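(* For every constant $d\in\mathbb{N}_{\ge 1}$, the parameterized problem \textsc{Vertex Cover}[mod to $\mathrm{td}\le d$] admits a polynomial kernelization whose output graph has $\mathcal{O}(k^{2^{d-1}})$ vertices. That is, there is a polynomial-time algorithm that, given an instance $(G,\ell,X,k)$ where $G$ is a graph, $\ell\in\mathbb{N}$, $X\subseteq V(G)$ with $\mathrm{td}(G-X)\le d$ and $|X|\le k$, outputs an instance $(G',\ell',X',k')$ of the same kind (so $\mathrm{td}(G'-X')\le d$ and $|X'|\le k'$) with $|V(G')|\in\mathcal{O}(k^{2^{d-1}})$ and encoding size and $k'$ bounded by a polynomial in $k$, such that $G$ has a vertex cover of size at most $\ell$ if and only if $G'$ has a vertex cover of size at most $\ell'$.
   Context: A vertex cover of $G$ is a set $S\subseteq V(G)$ such that every edge has an endpoint in $S$. The treedepth $\mathrm{td}(G)$ of a graph $G$ is the minimum height of a rooted forest $F$ on vertex set $V(G)$ such that for every edge $\{u,v\}$ of $G$, $u$ is an ancestor of $v$ in $F$ or vice versa (height counted in number of vertices on a root-to-leaf path, so edgeless graphs have treedepth 1). The parameterized problem \textsc{Vertex Cover}[mod to $\mathrm{td}\le d$] has instances $(G,\ell,X,k)$ with $X\subseteq V(G)$, $\mathrm{td}(G-X)\le d$, $|X|\le k$; $k$ is the parameter, and the instance is a YES-instance iff $G$ has a vertex cover of size at most $\ell$. A kernelization is a polynomial-time algorithm mapping an instance to an equivalent instance whose size and parameter are bounded by a computable function of $k$; it is polynomial if this function is a polynomial. *)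

theory Defs
  imports Main
begin

text \<open>A graph is given by a vertex set V and a symmetric irreflexive edge predicate E.
  An elimination forest of height at most h is a parent map p (p v = None: v is a root)
  such that following parents stays inside V, every root-to-vertex chain has at most h
  vertices, and every edge joins an ancestor/descendant pair.\<close>

fun itr :: "(nat \<Rightarrow> nat option) \<Rightarrow> nat \<Rightarrow> nat \<Rightarrow> nat option" where
  "itr p 0 v = Some v"
| "itr p (Suc i) v = (case itr p i v of None \<Rightarrow> None | Some u \<Rightarrow> p u)"

definition ancestor :: "(nat \<Rightarrow> nat option) \<Rightarrow> nat \<Rightarrow> nat \<Rightarrow> bool" where
  "ancestor p u v \<longleftrightarrow> (\<exists>i. itr p i v = Some u)"

definition elim_forest :: "nat set \<Rightarrow> (nat \<Rightarrow> nat \<Rightarrow> bool) \<Rightarrow> (nat \<Rightarrow> nat option) \<Rightarrow> nat \<Rightarrow> bool" where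
  "elim_forest V E p h \<longleftrightarrow>
     (\<forall>v\<in>V. \<forall>i u. itr p i v = Some u \<longrightarrow> u \<in> V) \<and>
     (\<forall>v\<in>V. itr p h v = None) \<and>
     (\<forall>u\<in>V. \<forall>v\<in>V. E u v \<longrightarrow> ancestor p u v \<or> ancestor p v u)"

definition treedepth :: "nat set \<Rightarrow> (nat \<Rightarrow> nat \<Rightarrow> bool) \<Rightarrow> nat" where
  "treedepth V E = (LEAST h. \<exists>p. elim_forest V E p h)"

text \<open>The graph has vertex set {0..<nv}, adjacency relation adj.\<close>
record vc_inst =
  nv :: nat
  adj :: "nat \<Rightarrow> nat \<Rightarrow> bool"
  ell :: nat
  modx :: "nat set"
  kpar :: nat

definition is_graph :: "vc_inst \<Rightarrow> bool" where
  "is_graph I \<longleftrightarrow> (\<forall>i j. adj I i j \<longrightarrow> i < nv I \<and> j < nv I \<and> i \<noteq> j \<and> adj I j i)"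

definition valid_inst :: "nat \<Rightarrow> vc_inst \<Rightarrow> bool" where
  "valid_inst d I \<longleftrightarrow> is_graph I \<and> modx I \<subseteq> {..<nv I} \<and> card (modx I) \<le> kpar I \<and>
     treedepth ({..<nv I} - modx I) (\<lambda>i j. adj I i j \<and> i \<notin> modx I \<and> j \<notin> modx I) \<le> d"

definition is_vertex_cover :: "vc_inst \<Rightarrow> nat set \<Rightarrow> bool" where
  "is_vertex_cover I S \<longleftrightarrow> S \<subseteq> {..<nv I} \<and> (\<forall>i j. adj I i j \<longrightarrow> i \<in> S \<or> j \<in> S)"

definition yes_inst :: "vc_inst \<Rightarrow> bool" where
  "yes_inst I \<longleftrightarrow> (\<exists>S. is_vertex_cover I S \<and> card S \<le> ell I)"

section \<open>Encoding of instances as strings over symbols 1 ('0'), 2 ('1'), 3 ('#')\<close>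

fun enc_nat :: "nat \<Rightarrow> nat list" where
  "enc_nat n = (if n = 0 then [] else (n mod 2 + 1) # enc_nat (n div 2))"

definition bitsym :: "bool \<Rightarrow> nat" where
  "bitsym b = (if b then 2 else 1)"

definition enc_inst :: "vc_inst \<Rightarrow> nat list" where
  "enc_inst I =
     enc_nat (nv I) @ [3] @ enc_nat (ell I) @ [3] @ enc_nat (kpar I) @ [3] @
     concat (map (\<lambda>i. map (\<lambda>j. bitsym (adj I i j)) [0..<nv I]) [0..<nv I]) @ [3] @
     map (\<lambda>i. bitsym (i \<in> modx I)) [0..<nv I] @ [3]"

datatype move = Lm | Rm | Sm

text \<open>States {0..<nstates}, start state 0, halting state 1; tape symbols {0..<nsyms},
  0 is the blank.\<close>
record tm =
  nstates :: nat
  nsyms :: nat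
  delta :: "nat \<Rightarrow> nat \<Rightarrow> nat \<times> nat \<times> move"

definition wf_tm :: "tm \<Rightarrow> bool" where
  "wf_tm M \<longleftrightarrow> 2 \<le> nstates M \<and> 4 \<le> nsyms M \<and>
     (\<forall>q < nstates M. \<forall>s < nsyms M.
        fst (delta M q s) < nstates M \<and> fst (snd (delta M q s)) < nsyms M)"

text \<open>Configuration: (state, cells left of head in reverse order, cells from the head on).\<close>
type_synonym config = "nat \<times> nat list \<times> nat list"

definition step :: "tm \<Rightarrow> config \<Rightarrow> config" where
  "step M c = (case c of (q, l, r) \<Rightarrow>
     if q = 1 then c else
     (let s = (case r of [] \<Rightarrow> 0 | x # _ \<Rightarrow> x);
          (q', s', m) = delta M q s;
          r' = s' # tl r
      in case m of
           Lm \<Rightarrow> (case l of [] \<Rightarrow> (q', [], 0 # r') | y # l' \<Rightarrow> (q', l', y # r'))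
         | Rm \<Rightarrow> (q', s' # l, tl r')
         | Sm \<Rightarrow> (q', l, r')))"

definition run :: "tm \<Rightarrow> nat \<Rightarrow> nat list \<Rightarrow> config" where
  "run M t x = (step M ^^ t) (0, [], x)"

definition halted :: "config \<Rightarrow> bool" where
  "halted c \<longleftrightarrow> fst c = 1"

definition tape_output :: "config \<Rightarrow> nat list" where
  "tape_output c = takeWhile (\<lambda>s. s \<noteq> 0) (snd (snd c))"

end

theory Submission
  imports Defs "HOL-Library.Nat_Bijection"
begin

text \<open>
  Combinatorics. Write $\<alpha>$ for the independence number and fix an elimination forest of $G - X$ of
  height $d$. In a graph of treedepth $h$, a set whose deletion lowers $\<alpha>$ contains a set of
  at most $\<beta>_h$ vertices that already does so, where $\<beta>_1 = 1$ and $\<beta>_{h+2} = 2^h + 1$.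
  The forest is pruned from the roots downwards. At depth $i$ let $M_i$ be $X$ together with the surviving
  vertices of smaller depth. A chunk is a set of at most $\<beta>_{d-i}$ vertices of $M_i$, all in $X$
  except for vertices on the path from a root to one vertex of $M_i$; only such sets can occur
  among the neighbours of a piece, the subtree of a depth-$i$ vertex. A chunk conflicts with a piece when
  deleting its neighbourhood lowers $\<alpha>$ of the piece. An auction in which pieces bid for conflicting
  chunks yields a crown: pieces left without a chunk can be deleted, each lowering $\<alpha>(G)$ by
  exactly its own $\<alpha>$, and the others are at most as many as the chunks. Hence
  $|M_{i+1}| \<le> 2 (k+d)^{\<beta>_{d-i} - 1} |M_i|$, and the exponents add up to $2^{d-1}$.

  Computability. A Turing machine simulates a language of counters and bit arrays, into which expressions
  with bounded sums are compiled. Every quantity above is given by such an expression, in terms of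
  polynomially many bits that are computed earlier by course-of-values recursion.
\<close>

section \<open>A counter and bit-array language on Turing machines\<close>

text \<open>The exponent depends on the shape of the chunks. If all sets of at most
  \<open>block_size\<close> vertices of M_i had to be counted, the exponents would multiply from
  level to level. But a neighbour in M_i of a piece, if it is outside X, is an ancestor of that
  piece. So a chunk is given by its deepest forest vertex and, for every further vertex, one of at
  most k + d choices. The excess \<open>block_size h - 1\<close> runs through 0, 1, 2, 4, ... and
  sums to 2^(d-1) - 1; the missing unit is the initial factor |X|.

  A crown is usually read off a maximum matching, found with augmenting paths. Here every step must
  be an expression over bits computed earlier, so an auction replaces the matching: the bid at time
  t is determined by the bids before t, and a gap between the final prices separates the crown. For
  the same reason the elimination forest, which is only known to exist, is replaced by a canonical
  one built from least roots, and the budget, which is written in binary, is capped at the number of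
  vertices.\<close>

type_synonym mem = "(nat \<Rightarrow> nat) \<times> (nat \<Rightarrow> nat \<Rightarrow> bool)"

text \<open>The tape symbol of a cell encodes the set of its flags: a counter is a pebble lying on the cell
  of its value, an array is a bit track, and the remaining flag marks the leftmost cell. Arrays 0 and 1
  get the flags 0 and 1 so that they are the two bits of an input symbol.\<close>

definition rflag :: "nat \<Rightarrow> nat" where
  "rflag r = 2 * r + 3"

definition aflag :: "nat \<Rightarrow> nat" where
  "aflag a = (if a < 2 then a else 2 * a)"

definition eflag :: nat where
  "eflag = 2"

definition has :: "mem \<Rightarrow> nat \<Rightarrow> nat \<Rightarrow> bool" where
  "has \<sigma> c p = (if c = 2 then p = 0
     else if odd c \<and> 3 \<le> c then fst \<sigma> ((c - 3) div 2) = p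
     else snd \<sigma> (if c < 2 then c else c div 2) p)"

lemma has_simps [simp]:
  "has \<sigma> (rflag r) p \<longleftrightarrow> fst \<sigma> r = p"
  "has \<sigma> (aflag a) p \<longleftrightarrow> snd \<sigma> a p"
  "has \<sigma> eflag p \<longleftrightarrow> p = 0"
  by (auto simp: has_def rflag_def aflag_def eflag_def)

lemma has_reg_upd:
  "has (g(r := x), A) c p \<longleftrightarrow> (if c = rflag r then x = p else has (g, A) c p)"
  by (auto simp: has_def rflag_def elim!: oddE)

lemma has_arr_upd:
  "has (g, A(a := (A a)(x := True))) c p \<longleftrightarrow> (c = aflag a \<and> p = x) \<or> has (g, A) c p"
  by (auto simp: has_def aflag_def elim!: oddE evenE)

text \<open>The condition (b, r, fs) asks whether some flag of fs is present under the pebble r, so comparing two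
  counters or reading an array bit takes a single look at the tape.\<close>

type_synonym cond = "bool \<times> nat \<times> nat list"

datatype com =
    Skip
  | Inc nat
  | Dec nat
  | Set nat nat
  | Seq com com
  | If cond com com
  | While cond com

fun test :: "cond \<Rightarrow> mem \<Rightarrow> bool" where
  "test (b, r, fs) \<sigma> \<longleftrightarrow> b = (\<exists>f\<in>set fs. has \<sigma> f (fst \<sigma> r))"

text \<open>The number counts executed commands and tests. Each unit costs the machine at most one
  sweep of the tape to a pebble and back, whose length depends on the counters; machine time is
  recovered in \<open>reach_bigstep\<close>.\<close>

inductive bigstep :: "com \<Rightarrow> mem \<Rightarrow> nat \<Rightarrow> mem \<Rightarrow> bool" where
  bigstep_Skip: "bigstep Skip \<sigma> 1 \<sigma>"
| bigstep_Inc: "bigstep (Inc r) (g, A) 1 (g(r := Suc (g r)), A)"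
| bigstep_Dec: "bigstep (Dec r) (g, A) 1 (g(r := g r - 1), A)"
| bigstep_Set: "bigstep (Set a r) (g, A) 1 (g, A(a := (A a)(g r := True)))"
| bigstep_Seq: "bigstep c1 \<sigma> m \<sigma>' \<Longrightarrow> bigstep c2 \<sigma>' n \<sigma>'' \<Longrightarrow> bigstep (Seq c1 c2) \<sigma> (Suc (m + n)) \<sigma>''"
| bigstep_IfT: "test b \<sigma> \<Longrightarrow> bigstep c1 \<sigma> n \<sigma>' \<Longrightarrow> bigstep (If b c1 c2) \<sigma> (Suc n) \<sigma>'"
| bigstep_IfF: "\<not> test b \<sigma> \<Longrightarrow> bigstep c2 \<sigma> n \<sigma>' \<Longrightarrow> bigstep (If b c1 c2) \<sigma> (Suc n) \<sigma>'"
| bigstep_WhileF: "\<not> test b \<sigma> \<Longrightarrow> bigstep (While b c) \<sigma> 1 \<sigma>"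
| bigstep_WhileT: "test b \<sigma> \<Longrightarrow> bigstep c \<sigma> m \<sigma>' \<Longrightarrow> bigstep (While b c) \<sigma>' n \<sigma>'' \<Longrightarrow>
    bigstep (While b c) \<sigma> (Suc (m + n)) \<sigma>''"

text \<open>A tape with \<open>2 ^ L\<close> symbols has room for the flags below \<open>L\<close>;
  a program can run once \<open>L\<close> exceeds every flag it mentions.\<close>

primrec okc :: "nat \<Rightarrow> com \<Rightarrow> bool" where
  "okc L Skip \<longleftrightarrow> True"
| "okc L (Inc r) \<longleftrightarrow> rflag r < L"
| "okc L (Dec r) \<longleftrightarrow> rflag r < L"
| "okc L (Set a r) \<longleftrightarrow> rflag r < L \<and> aflag a < L"
| "okc L (Seq a b) \<longleftrightarrow> okc L a \<and> okc L b"
| "okc L (If c a b) \<longleftrightarrow> rflag (fst (snd c)) < L \<and> (\<forall>f\<in>set (snd (snd c)). f < L) \<and> okc L a \<and> okc L b"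
| "okc L (While c a) \<longleftrightarrow> rflag (fst (snd c)) < L \<and> (\<forall>f\<in>set (snd (snd c)). f < L) \<and> okc L a"

lemma okc_mono: "okc L c \<Longrightarrow> L \<le> L' \<Longrightarrow> okc L' c"
  by (induction c) auto

lemma ex_okc: "\<exists>L. okc L c"
proof (induction c)
  case (Seq c1 c2)
  then obtain L1 L2 where "okc L1 c1" "okc L2 c2" by auto
  then have "okc (max L1 L2) (Seq c1 c2)" by (auto intro: okc_mono)
  then show ?case by blast
next
  case (If c c1 c2)
  then obtain L1 L2 where *: "okc L1 c1" "okc L2 c2" by auto
  obtain L3 where L3: "\<forall>f\<in>set (rflag (fst (snd c)) # snd (snd c)). f < L3"
    by (metis List.finite_set finite_nat_set_iff_bounded)
  from * L3 have "okc (max L1 (max L2 L3)) (If c c1 c2)"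
    by (auto intro: okc_mono simp: less_max_iff_disj)
  then show ?case by blast
next
  case (While c c1)
  then obtain L1 where *: "okc L1 c1" by auto
  obtain L3 where L3: "\<forall>f\<in>set (rflag (fst (snd c)) # snd (snd c)). f < L3"
    by (metis List.finite_set finite_nat_set_iff_bounded)
  from * L3 have "okc (max L1 L3) (While c c1)"
    by (auto intro: okc_mono simp: less_max_iff_disj)
  then show ?case by blast
next
  case (Set a r)
  have "okc (Suc (max (rflag r) (aflag a))) (Set a r)" by (simp add: less_Suc_eq_le)
  then show ?case by blast
qed (auto intro: lessI)

text \<open>A running machine keeps in its state the list of commands still to be executed; only finitely many
  such lists arise from a program.\<close>

datatype st = Start | Init | Halt | Emit | Fin | Run "com list" | Put nat "com list" | Back "com list"

text \<open>A loop is pushed below its own body as the same command instead of being unfolded, so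
  the lists of pending commands stay finite in number although runs are unbounded.\<close>

primrec conts :: "com \<Rightarrow> com list \<Rightarrow> com list set" where
  "conts Skip k = {Skip # k}"
| "conts (Inc r) k = {Inc r # k}"
| "conts (Dec r) k = {Dec r # k}"
| "conts (Set a r) k = {Set a r # k}"
| "conts (Seq a b) k = insert (Seq a b # k) (conts a (b # k) \<union> conts b k)"
| "conts (If c a b) k = insert (If c a b # k) (conts a k \<union> conts b k)"
| "conts (While c a) k = insert (While c a # k) (conts a (While c a # k))"

lemma finite_conts: "finite (conts c k)"
  by (induction c arbitrary: k) auto

lemma conts_self: "c # k \<in> conts c k"
  by (cases c) auto

fun testS :: "cond \<Rightarrow> nat set \<Rightarrow> bool" where
  "testS (b, r, fs) s \<longleftrightarrow> b = (\<exists>f\<in>set fs. f \<in> s)"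

text \<open>Every command begins with the head on the leftmost cell and scans right for the flag
  given here; commands that touch no counter act at the left end at once.\<close>

fun seek :: "com \<Rightarrow> nat" where
  "seek (Inc r) = rflag r"
| "seek (Dec r) = rflag r"
| "seek (Set a r) = rflag r"
| "seek (If c a b) = rflag (fst (snd c))"
| "seek (While c a) = rflag (fst (snd c))"
| "seek _ = eflag"

text \<open>Moving a pebble involves two cells, hence the intermediate state \<open>Put\<close>. The
  end marker realizes truncated decrement: a pebble on cell 0 stays there.\<close>

fun act :: "com \<Rightarrow> com list \<Rightarrow> nat set \<Rightarrow> st \<times> nat set \<times> move" where
  "act Skip k s = (Run k, s, Sm)"
| "act (Seq a b) k s = (Run (a # b # k), s, Sm)"
| "act (Inc r) k s = (Put (rflag r) k, s - {rflag r}, Rm)"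
| "act (Dec r) k s = (if eflag \<in> s then (Back k, s, Sm) else (Put (rflag r) k, s - {rflag r}, Lm))"
| "act (Set a r) k s = (Back k, insert (aflag a) s, Sm)"
| "act (If c a b) k s = (Back ((if testS c s then a else b) # k), s, Sm)"
| "act (While c a) k s = (Back (if testS c s then a # While c a # k else k), s, Sm)"

section \<open>The Turing machine of a program\<close>

locale machine =
  fixes L o0 o1 :: nat and prog :: com
  assumes okp: "okc L prog" and L3: "3 \<le> L" and oL: "aflag o0 < L" "aflag o1 < L"
begin

text \<open>Moving left off the tape inserts a fresh cell, so \<open>Start\<close> shifts the input
  to the cells from 1 on. Cell 0 then receives the end marker and all pebbles, that is, all counters
  are 0. \<open>Emit\<close> overwrites the cells from 1 on by pairs of output bits until both are
  absent and blanks that cell; \<open>Fin\<close> parks the head on cell 1, from where the output is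
  read.\<close>

fun transit :: "st \<Rightarrow> nat set \<Rightarrow> st \<times> nat set \<times> move" where
  "transit Start s = (Init, s, Lm)"
| "transit Init s = (Run [prog], {c. c < L \<and> (c = eflag \<or> (\<exists>r. c = rflag r))}, Sm)"
| "transit Halt s = (Halt, s, Sm)"
| "transit (Run []) s = (Emit, s, Rm)"
| "transit Emit s = (if aflag o0 \<in> s \<or> aflag o1 \<in> s
      then (Emit, {i. i = 0 \<and> aflag o0 \<in> s \<or> i = 1 \<and> aflag o1 \<in> s}, Rm) else (Fin, {}, Lm))"
| "transit Fin s = (if eflag \<in> s then (Halt, s, Rm) else (Fin, s, Lm))"
| "transit (Run (c # k)) s = (if seek c \<in> s then act c k s else (Run (c # k), s, Rm))"
| "transit (Put f k) s = (Back k, insert f s, Sm)"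
| "transit (Back k) s = (if eflag \<in> s then (Run k, s, Sm) else (Back k, s, Lm))"

definition CK :: "com list set" where
  "CK = insert [] (conts prog [])"

definition SS :: "st set" where
  "SS = {Start, Init, Halt, Emit, Fin} \<union> Run ` CK \<union> Back ` CK \<union> case_prod Put ` ({..<L} \<times> CK)"

lemma finite_SS: "finite SS"
  by (simp add: SS_def CK_def finite_conts)

lemma ex_phi: "\<exists>\<phi>. inj_on \<phi> SS \<and> \<phi> Start = 0 \<and> \<phi> Halt = 1 \<and> (\<forall>x\<in>SS. \<phi> x < card SS + 2)"
proof -
  have "finite (SS - {Start, Halt})" using finite_SS by simp
  then obtain g where g: "bij_betw g (SS - {Start, Halt}) {0..<card (SS - {Start, Halt})}"
    using ex_bij_betw_finite_nat by blast
  let ?\<phi> = "\<lambda>x. if x = Start then 0 else if x = Halt then 1 else g x + (2::nat)"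
  have "inj_on ?\<phi> SS"
  proof (rule inj_onI)
    fix x y assume "x \<in> SS" "y \<in> SS" "?\<phi> x = ?\<phi> y"
    then show "x = y"
      using inj_onD[OF bij_betw_imp_inj_on[OF g], of x y] by (simp split: if_splits)
  qed
  moreover have "?\<phi> x < card SS + 2" if "x \<in> SS" for x
  proof -
    have "x \<notin> {Start, Halt} \<Longrightarrow> g x < card (SS - {Start, Halt})"
      using bij_betwE[OF g] that by auto
    moreover have "card (SS - {Start, Halt}) \<le> card SS"
      using finite_SS by (simp add: card_mono)
    ultimately show ?thesis by auto
  qed
  ultimately show ?thesis by (intro exI[of _ ?\<phi>]) auto
qed

definition \<phi> :: "st \<Rightarrow> nat" where
  "\<phi> = (SOME \<phi>. inj_on \<phi> SS \<and> \<phi> Start = 0 \<and> \<phi> Halt = 1 \<and> (\<forall>x\<in>SS. \<phi> x < card SS + 2))"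

lemma \<phi>: "inj_on \<phi> SS" "\<phi> Start = 0" "\<phi> Halt = 1" "x \<in> SS \<Longrightarrow> \<phi> x < card SS + 2"
  using someI_ex[OF ex_phi] unfolding \<phi>_def[symmetric] by auto

text \<open>Tape symbols are decoded as flag sets. A number that codes no state decodes to something
  arbitrary, so the guard replaces every transition that leaves the permitted range; this makes the
  machine well-formed.\<close>

definition M :: tm where
  "M = \<lparr>nstates = card SS + 2, nsyms = 2 ^ L,
     delta = (\<lambda>q s. case transit (inv_into SS \<phi> q) (set_decode s) of (q', s', m) \<Rightarrow>
        if q' \<in> SS \<and> s' \<subseteq> {..<L} then (\<phi> q', set_encode s', m) else (0, 0, Sm))\<rparr>"

lemma set_encode_less: "s \<subseteq> {..<n} \<Longrightarrow> set_encode s < 2 ^ n"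
proof -
  assume "s \<subseteq> {..<n}"
  then have "set_encode s \<le> (\<Sum>i<n. 2 ^ i)"
    unfolding set_encode_def by (intro sum_mono2) auto
  also have "\<dots> < 2 ^ n" by (induction n) auto
  finally show ?thesis .
qed

lemma wf_M: "wf_tm M"
proof -
  have "(2::nat) ^ 2 \<le> 2 ^ L" using L3 by (intro power_increasing) auto
  then show ?thesis
    using \<phi>(4) set_encode_less by (auto simp: wf_tm_def M_def split: prod.splits)
qed

text \<open>\<open>T\<close> describes a one-way infinite tape. Cells beyond the list are blank,
  which is the empty flag set with code 0; finiteness makes \<open>set_encode\<close> invertible on
  the contents.\<close>

definition rep :: "(nat \<Rightarrow> nat set) \<Rightarrow> nat \<Rightarrow> nat list \<Rightarrow> nat list \<Rightarrow> bool" where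
  "rep T p l r \<longleftrightarrow> (\<forall>q. finite (T q)) \<and> l = rev (map (set_encode \<circ> T) [0..<p]) \<and>
     (\<forall>i. (if i < length r then r ! i else 0) = set_encode (T (p + i)))"

definition mv :: "move \<Rightarrow> nat \<Rightarrow> nat" where
  "mv m p = (case m of Lm \<Rightarrow> p - 1 | Rm \<Rightarrow> Suc p | Sm \<Rightarrow> p)"

text \<open>Excluding a left move from cell 0 keeps the numbering of the cells fixed, since that
  move would insert a cell. It happens only in the very first step, which \<open>start_step\<close>
  treats.\<close>

lemma rep_step:
  assumes r: "rep T p l r" and d: "transit q (T p) = (q', s', m)"
    and q: "q \<in> SS" "q \<noteq> Halt" "q' \<in> SS" "s' \<subseteq> {..<L}" and m: "m = Lm \<Longrightarrow> 0 < p"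
  shows "\<exists>l' r'. step M (\<phi> q, l, r) = (\<phi> q', l', r') \<and> rep (T(p := s')) (mv m p) l' r'"
proof -
  have q1: "\<phi> q \<noteq> 1"
    using \<phi> q by (metis Un_iff inj_onD insert_iff SS_def)
  have s: "(case r of [] \<Rightarrow> 0 | x # _ \<Rightarrow> x) = set_encode (T p)"
    using r unfolding rep_def by (cases r) (auto dest: spec[of _ 0])
  have dM: "delta M (\<phi> q) (set_encode (T p)) = (\<phi> q', set_encode s', m)"
    using r d q \<phi>(1) by (simp add: M_def rep_def)
  have fs: "finite s'" using q(4) finite_subset by blast
  have tl: "(if i < length (tl r) then tl r ! i else 0) = set_encode (T (Suc p + i))" for i
    using r unfolding rep_def by (cases r) (auto dest: spec[of _ "Suc i"])
  have r': "(if i < length (set_encode s' # tl r) then (set_encode s' # tl r) ! i else 0)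
      = set_encode ((T(p := s')) (p + i))" for i
    using tl[of "i - 1"] by (cases i) auto
  have l: "l = rev (map (set_encode \<circ> T) [0..<p])" using r by (simp add: rep_def)
  have same: "map (set_encode \<circ> (T(p := s'))) [0..<p] = map (set_encode \<circ> T) [0..<p]"
    "map (set_encode \<circ> (T(p := s'))) [0..<p - 1] = map (set_encode \<circ> T) [0..<p - 1]"
    by auto
  have fin: "\<forall>q. finite ((T(p := s')) q)" using r fs by (simp add: rep_def)
  show ?thesis
  proof (cases m)
    case Sm
    then show ?thesis using q1 s dM r' l fin
      by (auto simp: step_def rep_def mv_def same simp del: comp_apply)
  next
    case Rm
    have "rep (T(p := s')) (Suc p) (set_encode s' # l) (tl r)"
      using tl l fin by (auto simp: rep_def simp del: comp_apply) auto
    then show ?thesis using Rm q1 s dM by (auto simp: step_def mv_def)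
  next
    case Lm
    then obtain p' where p': "p = Suc p'" using m by (metis gr0_implies_Suc)
    have l': "l = set_encode (T p') # rev (map (set_encode \<circ> T) [0..<p'])"
      using l p' by simp
    have "(if i < length (set_encode (T p') # set_encode s' # tl r)
           then (set_encode (T p') # set_encode s' # tl r) ! i else 0)
         = set_encode ((T(p := s')) (p' + i))" for i
      using r'[of "i - 1"] p' by (cases i) auto
    then have "rep (T(p := s')) p' (rev (map (set_encode \<circ> T) [0..<p'])) (set_encode (T p') # set_encode s' # tl r)"
      using fin p' same(2) by (auto simp: rep_def simp del: comp_apply)
    then show ?thesis using Lm q1 s dM l' p' by (auto simp: step_def mv_def)
  qed
qed

text \<open>One number of steps serves all list representations of the same tape, which may differ
  in trailing blanks; this is what makes runs composable.\<close>

definition reach :: "nat \<Rightarrow> st \<times> nat \<times> (nat \<Rightarrow> nat set) \<Rightarrow> st \<times> nat \<times> (nat \<Rightarrow> nat set) \<Rightarrow> bool" where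
  "reach n a b \<longleftrightarrow> (\<exists>m\<le>n. \<forall>l r. rep (snd (snd a)) (fst (snd a)) l r \<longrightarrow>
     (\<exists>l' r'. (step M ^^ m) (\<phi> (fst a), l, r) = (\<phi> (fst b), l', r') \<and> rep (snd (snd b)) (fst (snd b)) l' r'))"

lemma reach_refl: "reach n a a"
  unfolding reach_def by (intro exI[of _ 0]) auto

lemma reach_trans: "reach n a b \<Longrightarrow> reach m b c \<Longrightarrow> n + m \<le> k \<Longrightarrow> reach k a c"
proof -
  assume a: "reach n a b" and b: "reach m b c" and k: "n + m \<le> k"
  obtain n' where n': "n' \<le> n" "\<forall>l r. rep (snd (snd a)) (fst (snd a)) l r \<longrightarrow>
     (\<exists>l' r'. (step M ^^ n') (\<phi> (fst a), l, r) = (\<phi> (fst b), l', r') \<and> rep (snd (snd b)) (fst (snd b)) l' r')"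
    using a unfolding reach_def by blast
  obtain m' where m': "m' \<le> m" "\<forall>l r. rep (snd (snd b)) (fst (snd b)) l r \<longrightarrow>
     (\<exists>l' r'. (step M ^^ m') (\<phi> (fst b), l, r) = (\<phi> (fst c), l', r') \<and> rep (snd (snd c)) (fst (snd c)) l' r')"
    using b unfolding reach_def by blast
  show ?thesis unfolding reach_def
  proof (intro exI[of _ "m' + n'"] conjI allI impI)
    show "m' + n' \<le> k" using n' m' k by simp
    fix l r assume "rep (snd (snd a)) (fst (snd a)) l r"
    then obtain l1 r1 where 1: "(step M ^^ n') (\<phi> (fst a), l, r) = (\<phi> (fst b), l1, r1)"
      "rep (snd (snd b)) (fst (snd b)) l1 r1" using n' by blast
    then obtain l2 r2 where "(step M ^^ m') (\<phi> (fst b), l1, r1) = (\<phi> (fst c), l2, r2)"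
      "rep (snd (snd c)) (fst (snd c)) l2 r2" using m' by blast
    then show "\<exists>l' r'. (step M ^^ (m' + n')) (\<phi> (fst a), l, r) = (\<phi> (fst c), l', r') \<and>
        rep (snd (snd c)) (fst (snd c)) l' r'"
      using 1 by (auto simp: funpow_add)
  qed
qed

lemma reach_step:
  assumes "transit q (T p) = (q', s', m)" "q \<in> SS" "q \<noteq> Halt" "q' \<in> SS" "s' \<subseteq> {..<L}" "m = Lm \<Longrightarrow> 0 < p"
    "p' = mv m p" "T' = T(p := s')"
  shows "reach 1 (q, p, T) (q', p', T')"
  unfolding reach_def using rep_step[of T p _ _ q q' s' m] assms by (intro exI[of _ 1]) auto

definition cell :: "mem \<Rightarrow> nat \<Rightarrow> nat set" where
  "cell \<sigma> p = {c. c < L \<and> has \<sigma> c p}"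

lemma cell_sub: "cell \<sigma> p \<subseteq> {..<L}"
  by (auto simp: cell_def)

lemma eL: "eflag < L"
  using L3 by (simp add: eflag_def)

lemma e_cell: "eflag \<in> cell \<sigma> p \<longleftrightarrow> p = 0"
  using eL by (simp add: cell_def)

lemma reach_scan:
  assumes "c # k \<in> CK" "\<And>q. p \<le> q \<Longrightarrow> q < x \<Longrightarrow> seek c \<notin> cell \<sigma> q" "p \<le> x"
  shows "reach (x - p) (Run (c # k), p, cell \<sigma>) (Run (c # k), x, cell \<sigma>)"
  using assms(3,2)
proof (induction p rule: inc_induct)
  case base
  show ?case by (rule reach_refl)
next
  case (step p)
  have "seek c \<notin> cell \<sigma> p" using step by auto
  then have "reach 1 (Run (c # k), p, cell \<sigma>) (Run (c # k), Suc p, cell \<sigma>)"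
    using assms(1) cell_sub[of \<sigma>] by (intro reach_step) (auto simp: SS_def mv_def)
  then show ?case
    by (rule reach_trans) (use step in auto)
qed

lemma reach_back:
  assumes "k \<in> CK"
  shows "reach (Suc p) (Back k, p, cell \<sigma>) (Run k, 0, cell \<sigma>)"
proof (induction p)
  case 0
  have "reach 1 (Back k, 0, cell \<sigma>) (Run k, 0, cell \<sigma>)"
    using assms eL cell_sub[of \<sigma>] by (intro reach_step) (auto simp: SS_def mv_def e_cell)
  then show ?case by simp
next
  case (Suc p)
  have "reach 1 (Back k, Suc p, cell \<sigma>) (Back k, p, cell \<sigma>)"
    using assms eL cell_sub[of \<sigma>] by (intro reach_step) (auto simp: SS_def mv_def e_cell)
  from reach_trans[OF this Suc] show ?case by simp
qed

lemma reach_scan0: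
  assumes "c # k \<in> CK" "rflag r < L" "seek c = rflag r"
  shows "reach (fst \<sigma> r) (Run (c # k), 0, cell \<sigma>) (Run (c # k), fst \<sigma> r, cell \<sigma>)"
  using reach_scan[of c k 0 "fst \<sigma> r" \<sigma>] assms by (auto simp: cell_def)

lemma at_reg: "rflag r < L \<Longrightarrow> rflag r \<in> cell \<sigma> (fst \<sigma> r)"
  by (auto simp: cell_def)

lemma testS_cell: "\<forall>f\<in>set (snd (snd b)). f < L \<Longrightarrow> testS b (cell \<sigma> (fst \<sigma> (fst (snd b)))) = test b \<sigma>"
  by (cases b) (auto simp: cell_def)

text \<open>A command raises a counter by at most one, so all counters stay below or at m + n. Each
  unit costs a scan to a pebble, a constant number of moves and the way back, at most
  \<open>2 * (m + n) + 4\<close> steps. The list \<open>k\<close> of pending commands varies in the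
  induction because subcommands run on top of longer lists.\<close>

lemma reach_bigstep:
  assumes "bigstep c \<sigma> n \<sigma>'" "\<forall>r. fst \<sigma> r \<le> m" "conts c k \<subseteq> CK" "k \<in> CK" "okc L c"
  shows "(\<forall>r. fst \<sigma>' r \<le> m + n) \<and> reach (n * (2 * (m + n) + 4)) (Run (c # k), 0, cell \<sigma>) (Run k, 0, cell \<sigma>')"
  using assms
proof (induction c \<sigma> n \<sigma>' arbitrary: m k rule: bigstep.induct)
  case (bigstep_Skip \<sigma>)
  have "reach 1 (Run (Skip # k), 0, cell \<sigma>) (Run k, 0, cell \<sigma>)"
    using bigstep_Skip eL cell_sub[of \<sigma>] by (intro reach_step) (auto simp: SS_def mv_def e_cell)
  then have "reach (1 * (2 * (m + 1) + 4)) (Run (Skip # k), 0, cell \<sigma>) (Run k, 0, cell \<sigma>)"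
    by (rule reach_trans[OF _ reach_refl[of 0]]) simp
  then show ?case using bigstep_Skip by (auto simp: le_SucI)
next
  case (bigstep_Inc r g A)
  have ck: "Inc r # k \<in> CK" using bigstep_Inc by simp
  let ?T = "(cell (g, A))(g r := cell (g, A) (g r) - {rflag r})"
  have 1: "reach (g r) (Run (Inc r # k), 0, cell (g, A)) (Run (Inc r # k), g r, cell (g, A))"
    using reach_scan0[OF ck, of r "(g, A)"] bigstep_Inc by simp
  have 2: "reach 1 (Run (Inc r # k), g r, cell (g, A)) (Put (rflag r) k, Suc (g r), ?T)"
    using bigstep_Inc ck at_reg[of r "(g, A)"] cell_sub[of "(g, A)"] by (intro reach_step) (auto simp: SS_def mv_def)
  have 3: "reach 1 (Put (rflag r) k, Suc (g r), ?T) (Back k, Suc (g r), cell (g(r := Suc (g r)), A))"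
  proof (rule reach_step)
    show "cell (g(r := Suc (g r)), A) = ?T(Suc (g r) := insert (rflag r) (?T (Suc (g r))))"
      using bigstep_Inc by (auto simp: cell_def fun_eq_iff has_reg_upd)
  qed (use bigstep_Inc ck cell_sub[of "(g, A)"] in \<open>auto simp: SS_def mv_def\<close>)
  have 4: "reach (Suc (Suc (g r))) (Back k, Suc (g r), cell (g(r := Suc (g r)), A)) (Run k, 0, cell (g(r := Suc (g r)), A))"
    using reach_back bigstep_Inc by blast
  have "g r \<le> m" using bigstep_Inc by auto
  then have "reach (2 * (m + 1) + 4) (Run (Inc r # k), 0, cell (g, A)) (Run k, 0, cell (g(r := Suc (g r)), A))"
    by (intro reach_trans[OF reach_trans[OF reach_trans[OF 1 2 order_refl] 3 order_refl] 4]) simp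
  then show ?case using bigstep_Inc by (auto simp: le_SucI)
next
  case (bigstep_Dec r g A)
  have ck: "Dec r # k \<in> CK" using bigstep_Dec by simp
  have gm: "g r \<le> m" using bigstep_Dec by auto
  have 1: "reach (g r) (Run (Dec r # k), 0, cell (g, A)) (Run (Dec r # k), g r, cell (g, A))"
    using reach_scan0[OF ck, of r "(g, A)"] bigstep_Dec by simp
  have m: "\<forall>ra. fst (g(r := g r - 1), A) ra \<le> m + 1" using bigstep_Dec by (auto simp: le_SucI) (metis diff_le_self le_trans le_SucI diff_Suc_1' One_nat_def)
  show ?case
  proof (cases "g r = 0")
    case True
    then have "g(r := g r - 1) = g" by auto
    have 2: "reach 1 (Run (Dec r # k), g r, cell (g, A)) (Back k, g r, cell (g, A))"
      using bigstep_Dec ck at_reg[of r "(g, A)"] cell_sub[of "(g, A)"] True by (intro reach_step) (auto simp: SS_def mv_def e_cell)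
    have "reach (2 * (m + 1) + 4) (Run (Dec r # k), 0, cell (g, A)) (Run k, 0, cell (g, A))"
      by (intro reach_trans[OF reach_trans[OF 1 2 order_refl] reach_back]) (use bigstep_Dec True in auto)
    then show ?thesis using m unfolding \<open>g(r := g r - 1) = g\<close> by simp
  next
    case False
    let ?T = "(cell (g, A))(g r := cell (g, A) (g r) - {rflag r})"
    have 2: "reach 1 (Run (Dec r # k), g r, cell (g, A)) (Put (rflag r) k, g r - 1, ?T)"
      using bigstep_Dec ck at_reg[of r "(g, A)"] cell_sub[of "(g, A)"] False
      by (intro reach_step) (auto simp: SS_def mv_def, auto simp: cell_def)
    have 3: "reach 1 (Put (rflag r) k, g r - 1, ?T) (Back k, g r - 1, cell (g(r := g r - 1), A))"
    proof (rule reach_step)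
      show "cell (g(r := g r - 1), A) = ?T(g r - 1 := insert (rflag r) (?T (g r - 1)))"
        using bigstep_Dec False by (auto simp: cell_def fun_eq_iff has_reg_upd)
    qed (use bigstep_Dec ck cell_sub[of "(g, A)"] in \<open>auto simp: SS_def mv_def\<close>)
    have 4: "reach (Suc (g r - 1)) (Back k, g r - 1, cell (g(r := g r - 1), A)) (Run k, 0, cell (g(r := g r - 1), A))"
      using reach_back bigstep_Dec by blast
    have "reach (2 * (m + 1) + 4) (Run (Dec r # k), 0, cell (g, A)) (Run k, 0, cell (g(r := g r - 1), A))"
      by (intro reach_trans[OF reach_trans[OF reach_trans[OF 1 2 order_refl] 3 order_refl] 4]) (use gm in simp)
    then show ?thesis using m by simp
  qed
next
  case (bigstep_Set a r g A)
  have ck: "Set a r # k \<in> CK" using bigstep_Set by simp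
  have gm: "g r \<le> m" using bigstep_Set by auto
  have 1: "reach (g r) (Run (Set a r # k), 0, cell (g, A)) (Run (Set a r # k), g r, cell (g, A))"
    using reach_scan0[OF ck, of r "(g, A)"] bigstep_Set by simp
  have 2: "reach 1 (Run (Set a r # k), g r, cell (g, A)) (Back k, g r, cell (g, A(a := (A a)(g r := True))))"
  proof (rule reach_step)
    show "cell (g, A(a := (A a)(g r := True))) = (cell (g, A))(g r := insert (aflag a) (cell (g, A) (g r)))"
      using bigstep_Set by (auto simp: cell_def fun_eq_iff has_arr_upd)
  qed (use bigstep_Set ck at_reg[of r "(g, A)"] cell_sub[of "(g, A)"] in \<open>auto simp: SS_def mv_def\<close>)
  have "reach (2 * (m + 1) + 4) (Run (Set a r # k), 0, cell (g, A)) (Run k, 0, cell (g, A(a := (A a)(g r := True))))"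
    by (intro reach_trans[OF reach_trans[OF 1 2 order_refl] reach_back]) (use bigstep_Set.prems(3) gm in auto)
  then show ?case using bigstep_Set by (auto simp: le_SucI)
next
  case (bigstep_Seq c1 \<sigma> n1 \<sigma>1 c2 n2 \<sigma>2)
  have c: "c1 # c2 # k \<in> CK" "c2 # k \<in> CK" "Seq c1 c2 # k \<in> CK"
    using bigstep_Seq.prems conts_self[of c1 "c2 # k"] conts_self[of c2 k] by auto
  have 1: "(\<forall>r. fst \<sigma>1 r \<le> m + n1) \<and> reach (n1 * (2 * (m + n1) + 4)) (Run (c1 # c2 # k), 0, cell \<sigma>) (Run (c2 # k), 0, cell \<sigma>1)"
    using bigstep_Seq.prems c by (intro bigstep_Seq.IH(1)) auto
  have 2: "(\<forall>r. fst \<sigma>2 r \<le> (m + n1) + n2) \<and> reach (n2 * (2 * ((m + n1) + n2) + 4)) (Run (c2 # k), 0, cell \<sigma>1) (Run k, 0, cell \<sigma>2)"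
    using bigstep_Seq.prems c 1 by (intro bigstep_Seq.IH(2)) auto
  have 0: "reach 1 (Run (Seq c1 c2 # k), 0, cell \<sigma>) (Run (c1 # c2 # k), 0, cell \<sigma>)"
    using c eL cell_sub[of \<sigma>] by (intro reach_step) (auto simp: SS_def mv_def e_cell)
  have le: "1 + n1 * (2 * (m + n1) + 4) + n2 * (2 * ((m + n1) + n2) + 4) \<le> Suc (n1 + n2) * (2 * (m + Suc (n1 + n2)) + 4)"
    by (simp add: algebra_simps)
  show ?case
    using reach_trans[OF reach_trans[OF 0 conjunct2[OF 1] order_refl] conjunct2[OF 2] le] 2 by (auto simp: le_SucI add.assoc)
next
  case (bigstep_IfT b \<sigma> c1 n \<sigma>' c2)
  have c: "If b c1 c2 # k \<in> CK" "c1 # k \<in> CK" using bigstep_IfT.prems conts_self[of c1 k] by auto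
  let ?r = "fst (snd b)"
  have gm: "fst \<sigma> ?r \<le> m" using bigstep_IfT by auto
  have 1: "reach (fst \<sigma> ?r) (Run (If b c1 c2 # k), 0, cell \<sigma>) (Run (If b c1 c2 # k), fst \<sigma> ?r, cell \<sigma>)"
    using reach_scan0[OF c(1), of ?r \<sigma>] bigstep_IfT by simp
  have 2: "reach 1 (Run (If b c1 c2 # k), fst \<sigma> ?r, cell \<sigma>) (Back (c1 # k), fst \<sigma> ?r, cell \<sigma>)"
    using bigstep_IfT.prems bigstep_IfT.hyps c at_reg[of ?r \<sigma>] cell_sub[of \<sigma>] testS_cell[of b \<sigma>] by (intro reach_step) (auto simp: SS_def mv_def)
  have 3: "(\<forall>r. fst \<sigma>' r \<le> m + n) \<and> reach (n * (2 * (m + n) + 4)) (Run (c1 # k), 0, cell \<sigma>) (Run k, 0, cell \<sigma>')"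
    using bigstep_IfT.prems by (intro bigstep_IfT.IH) auto
  have "reach (Suc n * (2 * (m + Suc n) + 4)) (Run (If b c1 c2 # k), 0, cell \<sigma>) (Run k, 0, cell \<sigma>')"
    by (intro reach_trans[OF reach_trans[OF reach_trans[OF 1 2 order_refl] reach_back order_refl] conjunct2[OF 3]])
       (use gm c in \<open>auto simp: algebra_simps\<close>)
  then show ?case using 3 by (auto simp: le_SucI)
next
  case (bigstep_IfF b \<sigma> c2 n \<sigma>' c1)
  have c: "If b c1 c2 # k \<in> CK" "c2 # k \<in> CK" using bigstep_IfF.prems conts_self[of c2 k] by auto
  let ?r = "fst (snd b)"
  have gm: "fst \<sigma> ?r \<le> m" using bigstep_IfF by auto
  have 1: "reach (fst \<sigma> ?r) (Run (If b c1 c2 # k), 0, cell \<sigma>) (Run (If b c1 c2 # k), fst \<sigma> ?r, cell \<sigma>)"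
    using reach_scan0[OF c(1), of ?r \<sigma>] bigstep_IfF by simp
  have 2: "reach 1 (Run (If b c1 c2 # k), fst \<sigma> ?r, cell \<sigma>) (Back (c2 # k), fst \<sigma> ?r, cell \<sigma>)"
    using bigstep_IfF.prems bigstep_IfF.hyps c at_reg[of ?r \<sigma>] cell_sub[of \<sigma>] testS_cell[of b \<sigma>] by (intro reach_step) (auto simp: SS_def mv_def)
  have 3: "(\<forall>r. fst \<sigma>' r \<le> m + n) \<and> reach (n * (2 * (m + n) + 4)) (Run (c2 # k), 0, cell \<sigma>) (Run k, 0, cell \<sigma>')"
    using bigstep_IfF.prems by (intro bigstep_IfF.IH) auto
  have "reach (Suc n * (2 * (m + Suc n) + 4)) (Run (If b c1 c2 # k), 0, cell \<sigma>) (Run k, 0, cell \<sigma>')"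
    by (intro reach_trans[OF reach_trans[OF reach_trans[OF 1 2 order_refl] reach_back order_refl] conjunct2[OF 3]])
       (use gm c in \<open>auto simp: algebra_simps\<close>)
  then show ?case using 3 by (auto simp: le_SucI)
next
  case (bigstep_WhileF b \<sigma> c)
  have c: "While b c # k \<in> CK" using bigstep_WhileF.prems by auto
  let ?r = "fst (snd b)"
  have gm: "fst \<sigma> ?r \<le> m" using bigstep_WhileF by auto
  have 1: "reach (fst \<sigma> ?r) (Run (While b c # k), 0, cell \<sigma>) (Run (While b c # k), fst \<sigma> ?r, cell \<sigma>)"
    using reach_scan0[OF c(1), of ?r \<sigma>] bigstep_WhileF by simp
  have 2: "reach 1 (Run (While b c # k), fst \<sigma> ?r, cell \<sigma>) (Back k, fst \<sigma> ?r, cell \<sigma>)"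
    using bigstep_WhileF.prems bigstep_WhileF.hyps c at_reg[of ?r \<sigma>] cell_sub[of \<sigma>] testS_cell[of b \<sigma>] by (intro reach_step) (auto simp: SS_def mv_def)
  have "reach (1 * (2 * (m + 1) + 4)) (Run (While b c # k), 0, cell \<sigma>) (Run k, 0, cell \<sigma>)"
    by (intro reach_trans[OF reach_trans[OF 1 2 order_refl] reach_back]) (use gm bigstep_WhileF.prems(3) in auto)
  then show ?case using bigstep_WhileF by (auto simp: le_SucI)
next
  case (bigstep_WhileT b \<sigma> c n1 \<sigma>1 n2 \<sigma>2)
  have c: "While b c # k \<in> CK" "c # While b c # k \<in> CK" using bigstep_WhileT.prems conts_self[of c "While b c # k"] by auto
  let ?r = "fst (snd b)"
  have gm: "fst \<sigma> ?r \<le> m" using bigstep_WhileT by auto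
  have 1: "reach (fst \<sigma> ?r) (Run (While b c # k), 0, cell \<sigma>) (Run (While b c # k), fst \<sigma> ?r, cell \<sigma>)"
    using reach_scan0[OF c(1), of ?r \<sigma>] bigstep_WhileT by simp
  have 2: "reach 1 (Run (While b c # k), fst \<sigma> ?r, cell \<sigma>) (Back (c # While b c # k), fst \<sigma> ?r, cell \<sigma>)"
    using bigstep_WhileT.prems bigstep_WhileT.hyps c at_reg[of ?r \<sigma>] cell_sub[of \<sigma>] testS_cell[of b \<sigma>] by (intro reach_step) (auto simp: SS_def mv_def)
  have 3: "(\<forall>r. fst \<sigma>1 r \<le> m + n1) \<and> reach (n1 * (2 * (m + n1) + 4)) (Run (c # While b c # k), 0, cell \<sigma>) (Run (While b c # k), 0, cell \<sigma>1)"
    using bigstep_WhileT.prems c by (intro bigstep_WhileT.IH(1)) auto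
  have 4: "(\<forall>r. fst \<sigma>2 r \<le> (m + n1) + n2) \<and> reach (n2 * (2 * ((m + n1) + n2) + 4)) (Run (While b c # k), 0, cell \<sigma>1) (Run k, 0, cell \<sigma>2)"
    using bigstep_WhileT.prems c 3 by (intro bigstep_WhileT.IH(2)) auto
  have "reach (Suc (n1 + n2) * (2 * (m + Suc (n1 + n2)) + 4)) (Run (While b c # k), 0, cell \<sigma>) (Run k, 0, cell \<sigma>2)"
    by (intro reach_trans[OF reach_trans[OF reach_trans[OF reach_trans[OF 1 2 order_refl] reach_back order_refl] conjunct2[OF 3] order_refl] conjunct2[OF 4]])
       (use gm c in \<open>auto simp: algebra_simps\<close>)
  then show ?case using 4 by (auto simp: le_SucI add.assoc)
qed

end

text \<open>The shift by one is due to the marker cell 0. The symbols 1, 2, 3 are read as two binary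
  digits: array 0 holds the low one and array 1 the high one.\<close>

definition inp :: "nat list \<Rightarrow> nat \<Rightarrow> nat \<Rightarrow> bool" where
  "inp x a p \<longleftrightarrow> 1 \<le> p \<and> p \<le> length x \<and> (a = 0 \<and> odd (x ! (p - 1)) \<or> a = 1 \<and> 2 \<le> x ! (p - 1))"

definition outsym :: "nat \<Rightarrow> nat \<Rightarrow> mem \<Rightarrow> nat \<Rightarrow> nat" where
  "outsym o0 o1 \<sigma> p = of_bool (snd \<sigma> o0 p) + 2 * of_bool (snd \<sigma> o1 p)"

lemma set_decode_less_4:
  assumes "s < 4" shows "set_decode s = {i. i = 0 \<and> odd s \<or> i = 1 \<and> 2 \<le> s}"
proof -
  have "i \<in> set_decode s \<longleftrightarrow> i = 0 \<and> odd s \<or> i = 1 \<and> 2 \<le> s" for i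
  proof (cases i)
    case (Suc j)
    have "s div 2 < 2" using assms by simp
    then have "s div 2 = 0 \<or> s div 2 = 1" by linarith
    moreover have "s div 2 = 1 \<longleftrightarrow> 2 \<le> s" using assms by linarith
    ultimately show ?thesis using Suc by (cases j) auto
  qed simp
  then show ?thesis by blast
qed

context machine
begin

definition emitset :: "mem \<Rightarrow> nat \<Rightarrow> nat set" where
  "emitset \<sigma> p = {i. i = 0 \<and> aflag o0 \<in> cell \<sigma> p \<or> i = 1 \<and> aflag o1 \<in> cell \<sigma> p}"

lemma encode_emitset: "set_encode (emitset \<sigma> p) = outsym o0 o1 \<sigma> p"
proof -
  have "emitset \<sigma> p = (if snd \<sigma> o0 p then {0} else {}) \<union> (if snd \<sigma> o1 p then {1} else {})"
    using oL by (auto simp: emitset_def cell_def)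
  then show ?thesis by (simp add: outsym_def set_encode_def)
qed

lemma reach_emit:
  assumes "\<And>i. i < n \<Longrightarrow> outsym o0 o1 \<sigma> (Suc i) \<noteq> 0"
  shows "reach (Suc n) (Run [], 0, cell \<sigma>)
     (Emit, Suc n, \<lambda>p. if 1 \<le> p \<and> p \<le> n then emitset \<sigma> p else cell \<sigma> p)"
  using assms
proof (induction n)
  case 0
  have "reach 1 (Run [], 0, cell \<sigma>) (Emit, 1, cell \<sigma>)"
    using cell_sub[of \<sigma>] by (intro reach_step) (auto simp: SS_def CK_def mv_def)
  moreover have "(\<lambda>p. if 1 \<le> p \<and> p \<le> 0 then emitset \<sigma> p else cell \<sigma> p) = cell \<sigma>"
    by (auto simp: fun_eq_iff)
  ultimately show ?case by simp
next
  case (Suc n)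
  let ?T = "\<lambda>n p. if 1 \<le> p \<and> p \<le> n then emitset \<sigma> p else cell \<sigma> p"
  have "aflag o0 \<in> cell \<sigma> (Suc n) \<or> aflag o1 \<in> cell \<sigma> (Suc n)"
    using Suc.prems[of n] oL by (auto simp: outsym_def cell_def split: if_splits)
  then have 1: "reach 1 (Emit, Suc n, ?T n) (Emit, Suc (Suc n), ?T (Suc n))"
    using L3 by (intro reach_step[where s' = "emitset \<sigma> (Suc n)"])
      (auto simp: SS_def mv_def emitset_def fun_eq_iff le_Suc_eq)
  have "reach (Suc n) (Run [], 0, cell \<sigma>) (Emit, Suc n, ?T n)"
    by (rule Suc.IH) (rule Suc.prems, simp)
  from reach_trans[OF this 1] show ?case by simp
qed

lemma reach_fin:
  assumes "\<And>q. 1 \<le> q \<Longrightarrow> q \<le> p \<Longrightarrow> eflag \<notin> T q \<and> T q \<subseteq> {..<L}" "eflag \<in> T 0" "T 0 \<subseteq> {..<L}"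
  shows "reach (Suc p) (Fin, p, T) (Halt, 1, T)"
  using assms
proof (induction p)
  case 0
  then have "reach 1 (Fin, 0, T) (Halt, 1, T)"
    by (intro reach_step) (auto simp: SS_def mv_def)
  then show ?case by simp
next
  case (Suc p)
  have "eflag \<notin> T (Suc p)" "T (Suc p) \<subseteq> {..<L}" using Suc.prems(1)[of "Suc p"] by auto
  then have "reach 1 (Fin, Suc p, T) (Fin, p, T)"
    by (intro reach_step) (auto simp: SS_def mv_def)
  from reach_trans[OF this Suc.IH] Suc.prems show ?case by auto
qed

lemma reach_output:
  assumes "\<And>i. i < n \<Longrightarrow> outsym o0 o1 \<sigma> (Suc i) \<noteq> 0" "outsym o0 o1 \<sigma> (Suc n) = 0"
  shows "reach (2 * n + 3) (Run [], 0, cell \<sigma>)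
     (Halt, 1, (\<lambda>p. if 1 \<le> p \<and> p \<le> n then emitset \<sigma> p else cell \<sigma> p)(Suc n := {}))"
proof -
  let ?T = "\<lambda>p. if 1 \<le> p \<and> p \<le> n then emitset \<sigma> p else cell \<sigma> p"
  have "\<not> (aflag o0 \<in> cell \<sigma> (Suc n) \<or> aflag o1 \<in> cell \<sigma> (Suc n))"
    using assms(2) oL by (auto simp: outsym_def cell_def)
  then have 2: "reach 1 (Emit, Suc n, ?T) (Fin, n, ?T(Suc n := {}))"
    by (intro reach_step) (auto simp: SS_def mv_def)
  have 3: "reach (Suc n) (Fin, n, ?T(Suc n := {})) (Halt, 1, ?T(Suc n := {}))"
    using L3 cell_sub[of \<sigma>] by (intro reach_fin) (auto simp: e_cell emitset_def eflag_def[symmetric], auto simp: eflag_def)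
  show ?thesis
    by (rule reach_trans[OF reach_trans[OF reach_emit 2 order_refl] 3]) (use assms in auto)
qed

lemma cell_inp:
  assumes "\<forall>s\<in>set x. s < 4"
  shows "cell (\<lambda>_. 0, inp x) p = (if p = 0 then {c. c < L \<and> (c = eflag \<or> (\<exists>r. c = rflag r))}
    else if p \<le> length x then set_decode (x ! (p - 1)) else {})"
proof (cases "p = 0")
  case True
  have "has (\<lambda>_. 0, inp x) c 0 \<longleftrightarrow> c = eflag \<or> (\<exists>r. c = rflag r)" for c
    by (auto simp: has_def eflag_def rflag_def inp_def elim!: oddE) presburger
  with True show ?thesis by (auto simp: cell_def)
next
  case False
  have h: "has (\<lambda>_. 0, inp x) c p \<longleftrightarrow> p \<le> length x \<and> (c = 0 \<and> odd (x ! (p - 1)) \<or> c = 1 \<and> 2 \<le> x ! (p - 1))" for c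
    using False by (auto simp: has_def inp_def Suc_le_eq elim!: evenE)
  show ?thesis
  proof (cases "p \<le> length x")
    case True
    then have "x ! (p - 1) < 4" using False assms by simp
    have "cell (\<lambda>_. 0, inp x) p = set_decode (x ! (p - 1))"
      unfolding cell_def h set_decode_less_4[OF \<open>x ! (p - 1) < 4\<close>] using L3 True
      by (intro Collect_cong) (metis less_le_trans zero_less_numeral one_less_numeral_iff numeral_less_iff semiring_norm(77) less_trans)
    then show ?thesis using False True by simp
  next
    case False
    then show ?thesis using h \<open>p \<noteq> 0\<close> by (auto simp: cell_def)
  qed
qed

text \<open>This is the one step in which the tape grows to the left. The new cell 0 is still blank,
  hence the update at 0 in the description of the tape.\<close>

lemma start_step:
  assumes "\<forall>s\<in>set x. s < 4"
  shows "\<exists>l r. step M (0, [], x) = (\<phi> Init, l, r) \<and> rep ((cell (\<lambda>_. 0, inp x))(0 := {})) 0 l r"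
proof -
  let ?s = "case x of [] \<Rightarrow> 0 | y # _ \<Rightarrow> y"
  have s4: "?s < 4" using assms by (cases x) auto
  have sub: "set_decode ?s \<subseteq> {..<L}" unfolding set_decode_less_4[OF s4] using L3 by (intro subsetI) (elim CollectE disjE conjE, simp_all)
  have "Start \<in> SS" "Init \<in> SS" by (auto simp: SS_def)
  then have i: "inv_into SS \<phi> 0 = Start" using inv_into_f_f[OF \<phi>(1), of Start] \<phi>(2) by simp
  have "step M (0, [], x) = (\<phi> Init, [], 0 # ?s # tl x)"
    using i sub \<open>Init \<in> SS\<close> by (simp add: step_def M_def)
  moreover have "rep ((cell (\<lambda>_. 0, inp x))(0 := {})) 0 [] (0 # ?s # tl x)"
  proof -
    have "(if i < length (0 # ?s # tl x) then (0 # ?s # tl x) ! i else 0) =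
      set_encode (((cell (\<lambda>_. 0, inp x))(0 := {})) (0 + i))" for i
      unfolding fun_upd_def cell_inp[OF assms]
      by (cases i; cases x) (auto simp: nth_Cons')
    moreover have "finite (cell (\<lambda>_. 0, inp x) q)" for q using cell_sub finite_subset by blast
    ultimately show ?thesis unfolding rep_def by auto
  qed
  ultimately show ?thesis by blast
qed

theorem run_prog:
  assumes x: "\<forall>s\<in>set x. s < 4" and b: "bigstep prog (\<lambda>_. 0, inp x) n \<sigma>"
    and y: "\<And>i. i < length y \<Longrightarrow> y ! i = outsym o0 o1 \<sigma> (Suc i) \<and> y ! i \<noteq> 0"
      "outsym o0 o1 \<sigma> (Suc (length y)) = 0"
  shows "\<exists>t \<le> n * (2 * n + 4) + 2 * length y + 5. halted (run M t x) \<and> tape_output (run M t x) = y"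
proof -
  let ?T = "(\<lambda>p. if 1 \<le> p \<and> p \<le> length y then emitset \<sigma> p else cell \<sigma> p)(Suc (length y) := {})"
  have ck: "conts prog [] \<subseteq> CK" "[] \<in> CK" "[prog] \<in> CK" using conts_self by (auto simp: CK_def)
  have 1: "reach 1 (Init, 0, (cell (\<lambda>_. 0, inp x))(0 := {})) (Run [prog], 0, cell (\<lambda>_. 0, inp x))"
    by (rule reach_step) (use ck cell_inp[OF x] in \<open>auto simp: SS_def mv_def fun_eq_iff\<close>)
  have 2: "reach (n * (2 * n + 4)) (Run [prog], 0, cell (\<lambda>_. 0, inp x)) (Run [], 0, cell \<sigma>)"
    using reach_bigstep[OF b, of 0 "[]"] ck okp by simp
  have 3: "reach (2 * length y + 3) (Run [], 0, cell \<sigma>) (Halt, 1, ?T)"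
    using y by (intro reach_output) fastforce+
  have "reach (n * (2 * n + 4) + 2 * length y + 4) (Init, 0, (cell (\<lambda>_. 0, inp x))(0 := {})) (Halt, 1, ?T)"
    by (rule reach_trans[OF reach_trans[OF 1 2 order_refl] 3]) simp
  then obtain m where m: "m \<le> n * (2 * n + 4) + 2 * length y + 4"
    and r: "\<And>l r. rep ((cell (\<lambda>_. 0, inp x))(0 := {})) 0 l r \<Longrightarrow>
     \<exists>l' r'. (step M ^^ m) (\<phi> Init, l, r) = (\<phi> Halt, l', r') \<and> rep ?T 1 l' r'"
    unfolding reach_def by auto
  obtain l r where s: "step M (0, [], x) = (\<phi> Init, l, r)" "rep ((cell (\<lambda>_. 0, inp x))(0 := {})) 0 l r"
    using start_step[OF x] by blast
  obtain l' r' where f: "(step M ^^ m) (\<phi> Init, l, r) = (\<phi> Halt, l', r')" "rep ?T 1 l' r'"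
    using r[OF s(2)] by blast
  have run: "run M (Suc m) x = (1, l', r')"
    using f(1) s(1) \<phi>(3) by (simp only: run_def funpow_Suc_right comp_apply)
  have nth: "(if i < length r' then r' ! i else 0) = set_encode (?T (1 + i))" for i
    using f(2) by (simp add: rep_def)
  have nth1: "(if i < length r' then r' ! i else 0) = y ! i" if "i < length y" for i
    using nth[of i] that y(1)[OF that] by (simp add: encode_emitset)
  have len: "i < length r'" if "i < length y" for i
    using nth1[OF that] y(1)[OF that] by (auto split: if_splits)
  then have len: "length y \<le> length r'" by (meson leI less_irrefl)
  have "takeWhile (\<lambda>s. s \<noteq> 0) r' = take (length y) r'"
  proof (rule takeWhile_eq_take_P_nth)
    show "r' ! i \<noteq> 0" if "i < length y" "i < length r'" for i using nth1[of i] y(1)[of i] that by simp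
    show "\<not> r' ! length y \<noteq> 0" if "length y < length r'" using nth[of "length y"] that by simp
  qed
  also have "\<dots> = y" using len nth1 by (intro nth_equalityI) auto
  finally show ?thesis using m run by (intro exI[of _ "Suc m"]) (auto simp: halted_def tape_output_def)
qed

end

theorem ex_machine:
  "\<exists>M. wf_tm M \<and> (\<forall>x n \<sigma> y. (\<forall>s\<in>set x. s < 4) \<longrightarrow> bigstep prog (\<lambda>_. 0, inp x) n \<sigma> \<longrightarrow>
     (\<forall>i < length y. y ! i = outsym o0 o1 \<sigma> (Suc i) \<and> y ! i \<noteq> 0) \<longrightarrow>
     outsym o0 o1 \<sigma> (Suc (length y)) = 0 \<longrightarrow>
     (\<exists>t \<le> n * (2 * n + 4) + 2 * length y + 5. halted (run M t x) \<and> tape_output (run M t x) = y))"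
proof -
  obtain L0 where "okc L0 prog" using ex_okc by blast
  \<comment> \<open>Large enough for the program, for the two input bits and the end marker, and for
    both output arrays.\<close>
  then interpret machine "L0 + 3 + Suc (aflag o0) + Suc (aflag o1)" o0 o1 prog
    by unfold_locales (auto intro: okc_mono)
  show ?thesis
  proof (intro exI[of _ M] conjI wf_M allI impI)
    fix x n \<sigma> y
    assume "\<forall>s\<in>set x. s < 4" "bigstep prog (\<lambda>_. 0, inp x) n \<sigma>"
      "\<forall>i < length y. y ! i = outsym o0 o1 \<sigma> (Suc i) \<and> y ! i \<noteq> 0" "outsym o0 o1 \<sigma> (Suc (length y)) = 0"
    then show "\<exists>t \<le> n * (2 * n + 4) + 2 * length y + 5. halted (run M t x) \<and> tape_output (run M t x) = y"
      by (intro run_prog[of x n \<sigma> y]) blast+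
  qed
qed

section \<open>Expressions with bounded sums\<close>

text \<open>The base n + 2 is at least 2 for every n, so constants, sums and products are absorbed
  into the exponent alone.\<close>

definition poly_bounded :: "(nat \<Rightarrow> nat) \<Rightarrow> bool" where
  "poly_bounded f \<longleftrightarrow> (\<exists>c. \<forall>n. f n \<le> (n + 2) ^ c)"

lemma two_pow_le: "2 ^ c \<le> (n + 2 :: nat) ^ c"
  by (intro power_mono) auto

lemma poly_bounded_const: "poly_bounded (\<lambda>_. c)"
  unfolding poly_bounded_def
proof (intro exI[of _ c] allI)
  fix n :: nat
  have "c \<le> 2 ^ c" by (rule less_imp_le[OF less_exp])
  then show "c \<le> (n + 2) ^ c" using two_pow_le le_trans by blast
qed

lemma poly_bounded_id: "poly_bounded (\<lambda>n. n)"
  unfolding poly_bounded_def by (intro exI[of _ 1]) auto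

lemma poly_bounded_mult: "poly_bounded f \<Longrightarrow> poly_bounded g \<Longrightarrow> poly_bounded (\<lambda>n. f n * g n)"
proof -
  assume "poly_bounded f" "poly_bounded g"
  then obtain a b where "\<And>n. f n \<le> (n + 2) ^ a" "\<And>n. g n \<le> (n + 2) ^ b"
    unfolding poly_bounded_def by blast
  then have "f n * g n \<le> (n + 2) ^ (a + b)" for n
    unfolding power_add by (rule mult_le_mono)
  then show ?thesis unfolding poly_bounded_def by blast
qed

lemma poly_bounded_add: "poly_bounded f \<Longrightarrow> poly_bounded g \<Longrightarrow> poly_bounded (\<lambda>n. f n + g n)"
proof -
  assume "poly_bounded f" "poly_bounded g"
  then obtain a b where a: "\<And>n. f n \<le> (n + 2) ^ a" and b: "\<And>n. g n \<le> (n + 2) ^ b"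
    unfolding poly_bounded_def by blast
  have "f n + g n \<le> (n + 2) ^ (a + b + 1)" for n
  proof -
    have "(n + 2) ^ a \<le> (n + 2) ^ (a + b)" "(n + 2) ^ b \<le> (n + 2) ^ (a + b)"
      by (auto intro: power_increasing)
    then have "f n + g n \<le> 2 * (n + 2) ^ (a + b)" using a[of n] b[of n] by linarith
    also have "\<dots> \<le> (n + 2) ^ (a + b + 1)" by simp
    finally show ?thesis .
  qed
  then show ?thesis unfolding poly_bounded_def by blast
qed

lemma poly_bounded_comp: "poly_bounded f \<Longrightarrow> poly_bounded g \<Longrightarrow> poly_bounded (\<lambda>n. f (g n))"
proof -
  assume f: "poly_bounded f" and g: "poly_bounded g"
  obtain c where c: "\<And>n. f n \<le> (n + 2) ^ c" using f unfolding poly_bounded_def by blast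
  obtain a where a: "\<And>n. g n + 2 \<le> (n + 2) ^ a"
    using poly_bounded_add[OF g poly_bounded_const[of 2]] unfolding poly_bounded_def by blast
  have "f (g n) \<le> (n + 2) ^ (a * c)" for n
    using le_trans[OF c[of "g n"] power_mono[OF a[of n]]] by (simp add: power_mult)
  then show ?thesis unfolding poly_bounded_def by blast
qed

lemmas poly_bounded_intros = poly_bounded_const poly_bounded_id poly_bounded_add poly_bounded_mult

section \<open>Counter programs and their running times\<close>

definition exec :: "com \<Rightarrow> mem \<Rightarrow> mem \<Rightarrow> nat \<Rightarrow> bool" where
  "exec c \<sigma> \<sigma>' n \<longleftrightarrow> (\<exists>m\<le>n. bigstep c \<sigma> m \<sigma>')"

lemma exec_mono: "exec c \<sigma> \<sigma>' n \<Longrightarrow> n \<le> m \<Longrightarrow> exec c \<sigma> \<sigma>' m"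
  unfolding exec_def using le_trans by blast

lemma exec_Seq: "exec a \<sigma> \<sigma>1 m \<Longrightarrow> exec b \<sigma>1 \<sigma>2 n \<Longrightarrow> Suc (m + n) \<le> k \<Longrightarrow> exec (Seq a b) \<sigma> \<sigma>2 k"
  unfolding exec_def by (elim exE conjE) (rule exI, rule conjI[rotated], erule (1) bigstep_Seq, simp)

lemma exec_Inc: "exec (Inc r) (g, A) (g(r := Suc (g r)), A) 1"
  unfolding exec_def using bigstep_Inc by blast

lemma exec_Dec: "exec (Dec r) (g, A) (g(r := g r - 1), A) 1"
  unfolding exec_def using bigstep_Dec by blast

lemma exec_WhileF: "\<not> test b \<sigma> \<Longrightarrow> exec (While b c) \<sigma> \<sigma> 1"
  unfolding exec_def using bigstep_WhileF by blast

lemma exec_WhileT: "test b \<sigma> \<Longrightarrow> exec c \<sigma> \<sigma>1 m \<Longrightarrow> exec (While b c) \<sigma>1 \<sigma>2 n \<Longrightarrow> Suc (m + n) \<le> k \<Longrightarrow> exec (While b c) \<sigma> \<sigma>2 k"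
  unfolding exec_def by (elim exE conjE) (rule exI, rule conjI[rotated], erule (2) bigstep_WhileT, simp)

lemma exec_IfT: "test b \<sigma> \<Longrightarrow> exec c1 \<sigma> \<sigma>' n \<Longrightarrow> Suc n \<le> k \<Longrightarrow> exec (If b c1 c2) \<sigma> \<sigma>' k"
  unfolding exec_def by (elim exE conjE) (rule exI, rule conjI[rotated], erule (1) bigstep_IfT, simp)

lemma exec_IfF: "\<not> test b \<sigma> \<Longrightarrow> exec c2 \<sigma> \<sigma>' n \<Longrightarrow> Suc n \<le> k \<Longrightarrow> exec (If b c1 c2) \<sigma> \<sigma>' k"
  unfolding exec_def by (elim exE conjE) (rule exI, rule conjI[rotated], erule (1) bigstep_IfF, simp)

definition clr :: "nat \<Rightarrow> com" where
  "clr u = While (False, u, [eflag]) (Dec u)"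

text \<open>Equality of two counters is a single test, two pebbles on one cell, so \<open>x\<close>
  is copied without being consumed. This works when \<open>t\<close> starts at or below the value of
  \<open>x\<close>.\<close>

definition copyc :: "nat \<Rightarrow> nat \<Rightarrow> com" where
  "copyc t x = While (False, t, [rflag x]) (Inc t)"

definition drain :: "nat \<Rightarrow> nat \<Rightarrow> com" where
  "drain t u = While (False, u, [eflag]) (Seq (Dec u) (Inc t))"

definition drainsub :: "nat \<Rightarrow> nat \<Rightarrow> com" where
  "drainsub t u = While (False, u, [eflag]) (Seq (Dec u) (Dec t))"

lemma exec_clr: "exec (clr u) (g, A) (g(u := 0), A) (2 * g u + 1)"
proof (induction "g u" arbitrary: g)
  case 0
  then have "g(u := 0) = g" by auto
  then show ?case using 0 unfolding clr_def by (auto intro!: exec_WhileF exec_mono[OF exec_WhileF])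
next
  case (Suc n)
  have ih: "exec (clr u) (g(u := g u - 1), A) (g(u := 0), A) (2 * n + 1)"
    using Suc(1)[of "g(u := g u - 1)"] Suc(2)[symmetric] by simp
  show ?case unfolding clr_def
    by (rule exec_WhileT[OF _ exec_Dec[of u g A] ih[unfolded clr_def]]) (use Suc(2)[symmetric] in auto)
qed

lemma exec_copyc: "t \<noteq> x \<Longrightarrow> g t \<le> g x \<Longrightarrow> exec (copyc t x) (g, A) (g(t := g x), A) (2 * (g x - g t) + 1)"
proof (induction "g x - g t" arbitrary: g)
  case 0
  then have "g(t := g x) = g" by auto
  then show ?case using 0 unfolding copyc_def by (auto intro!: exec_WhileF exec_mono[OF exec_WhileF])
next
  case (Suc n)
  have ih: "exec (copyc t x) (g(t := Suc (g t)), A) (g(t := g x), A) (2 * n + 1)"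
  proof -
    have "n = g x - Suc (g t)" "Suc (g t) \<le> g x" using Suc(2) by linarith+
    then show ?thesis using Suc(1)[of "g(t := Suc (g t))"] Suc(3) by simp
  qed
  show ?case unfolding copyc_def
    by (rule exec_WhileT[OF _ exec_Inc[of t g A] ih[unfolded copyc_def]]) (use Suc(2-) in auto)
qed

lemma exec_drain: "t \<noteq> u \<Longrightarrow> exec (drain t u) (g, A) (g(t := g t + g u, u := 0), A) (4 * g u + 1)"
proof (induction "g u" arbitrary: g)
  case 0
  then have "g(t := g t + g u, u := 0) = g" by auto
  then show ?case using 0 unfolding drain_def by (auto intro!: exec_WhileF exec_mono[OF exec_WhileF])
next
  case (Suc n)
  let ?g = "(g(u := g u - 1))(t := Suc (g t))"
  have 1: "exec (Seq (Dec u) (Inc t)) (g, A) (?g, A) 3"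
    using exec_Seq[OF exec_Dec[of u g A] exec_Inc[of t "g(u := g u - 1)" A]] Suc(3) by simp
  have eq: "?g(t := ?g t + ?g u, u := 0) = g(t := g t + g u, u := 0)"
    using Suc(2)[symmetric] Suc(3) by (auto simp: fun_eq_iff)
  have ih: "exec (drain t u) (?g, A) (?g(t := ?g t + ?g u, u := 0), A) (4 * ?g u + 1)"
    using Suc(1)[of ?g] Suc(2)[symmetric] Suc(3) by simp
  show ?case unfolding drain_def
    by (rule exec_WhileT[OF _ 1 ih[unfolded drain_def eq]]) (use Suc(2)[symmetric] Suc(3) in auto)
qed

lemma exec_drainsub: "t \<noteq> u \<Longrightarrow> exec (drainsub t u) (g, A) (g(t := g t - g u, u := 0), A) (4 * g u + 1)"
proof (induction "g u" arbitrary: g)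
  case 0
  then have "g(t := g t - g u, u := 0) = g" by auto
  then show ?case using 0 unfolding drainsub_def by (auto intro!: exec_WhileF exec_mono[OF exec_WhileF])
next
  case (Suc n)
  let ?g = "(g(u := g u - 1))(t := g t - 1)"
  have 1: "exec (Seq (Dec u) (Dec t)) (g, A) (?g, A) 3"
    using exec_Seq[OF exec_Dec[of u g A] exec_Dec[of t "g(u := g u - 1)" A]] Suc(3) by simp
  have eq: "?g(t := ?g t - ?g u, u := 0) = g(t := g t - g u, u := 0)"
    using Suc(2)[symmetric] Suc(3) by (auto simp: fun_eq_iff)
  have ih: "exec (drainsub t u) (?g, A) (?g(t := ?g t - ?g u, u := 0), A) (4 * ?g u + 1)"
    using Suc(1)[of ?g] Suc(2)[symmetric] Suc(3) by simp
  show ?case unfolding drainsub_def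
    by (rule exec_WhileT[OF _ 1 ih[unfolded drainsub_def eq]]) (use Suc(2)[symmetric] Suc(3) in auto)
qed

text \<open>Truncated subtraction and bounded sums already yield comparisons, connectives, bounded
  quantifiers, division and maxima. The nesting of sums is fixed by the expression, so evaluation
  stays polynomial.\<close>

datatype exp =
    Var nat
  | Cst nat
  | Len
  | Add exp exp
  | Sub exp exp
  | Sum exp exp
  | Arr nat exp

text \<open>Variables are de Bruijn indices, and the summation variable of Sum is index 0.\<close>

primrec ev :: "(nat \<Rightarrow> nat \<Rightarrow> bool) \<Rightarrow> nat \<Rightarrow> exp \<Rightarrow> (nat \<Rightarrow> nat) \<Rightarrow> nat" where
  "ev A N (Var i) s = s i"
| "ev A N (Cst c) s = c"
| "ev A N Len s = N"
| "ev A N (Add e1 e2) s = ev A N e1 s + ev A N e2 s"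
| "ev A N (Sub e1 e2) s = ev A N e1 s - ev A N e2 s"
| "ev A N (Sum e1 e2) s = (\<Sum>v<ev A N e1 s. ev A N e2 (case_nat v s))"
| "ev A N (Arr a e) s = of_bool (A a (ev A N e s))"

text \<open>A summation variable stays below the value of the range of its sum, so the bound for the
  summand is taken at an argument enlarged by that value; composition keeps it polynomial.\<close>

lemma ev_bound: "\<exists>V. poly_bounded V \<and> (\<forall>A N s M. (\<forall>k. s k \<le> M) \<longrightarrow> N \<le> M \<longrightarrow> ev A N e s \<le> V M)"
proof (induction e)
  case (Cst c)
  then show ?case by (intro exI[of _ "\<lambda>_. c"]) (auto intro: poly_bounded_intros)
next
  case (Add e1 e2)
  then obtain V1 V2 where "poly_bounded V1" "\<forall>A N s M. (\<forall>k. s k \<le> M) \<longrightarrow> N \<le> M \<longrightarrow> ev A N e1 s \<le> V1 M"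
    "poly_bounded V2" "\<forall>A N s M. (\<forall>k. s k \<le> M) \<longrightarrow> N \<le> M \<longrightarrow> ev A N e2 s \<le> V2 M" by blast
  then show ?case by (intro exI[of _ "\<lambda>M. V1 M + V2 M"]) (auto intro: poly_bounded_intros add_mono)
next
  case (Sub e1 e2)
  then obtain V1 where "poly_bounded V1" "\<forall>A N s M. (\<forall>k. s k \<le> M) \<longrightarrow> N \<le> M \<longrightarrow> ev A N e1 s \<le> V1 M" by blast
  then show ?case by (intro exI[of _ V1]) (auto intro: le_trans[OF diff_le_self])
next
  case (Sum e1 e2)
  then obtain V1 V2 where V: "poly_bounded V1" "\<forall>A N s M. (\<forall>k. s k \<le> M) \<longrightarrow> N \<le> M \<longrightarrow> ev A N e1 s \<le> V1 M"
    "poly_bounded V2" "\<forall>A N s M. (\<forall>k. s k \<le> M) \<longrightarrow> N \<le> M \<longrightarrow> ev A N e2 s \<le> V2 M" by blast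
  show ?case
  proof (intro exI[of _ "\<lambda>M. V1 M * V2 (V1 M + M)"] conjI allI impI)
    show "poly_bounded (\<lambda>M. V1 M * V2 (V1 M + M))" by (intro poly_bounded_intros poly_bounded_comp[OF V(3)] V(1))
    fix A :: "nat \<Rightarrow> nat \<Rightarrow> bool" and N M :: nat and s :: "nat \<Rightarrow> nat"
    assume s: "\<forall>k. s k \<le> M" "N \<le> M"
    have "ev A N e1 s \<le> V1 M" using V s by blast
    moreover have "ev A N e2 (case_nat v s) \<le> V2 (V1 M + M)" if "v < ev A N e1 s" for v
    proof -
      have "\<forall>k. case_nat v s k \<le> V1 M + M" using calculation that s
        by (auto split: nat.splits intro: trans_le_add2)
      then show ?thesis using V s by (simp add: trans_le_add2)
    qed
    ultimately show "ev A N (Sum e1 e2) s \<le> V1 M * V2 (V1 M + M)"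
      using sum_bounded_above[of "{..<ev A N e1 s}" "\<lambda>v. ev A N e2 (case_nat v s)" "V2 (V1 M + M)"]
      by (simp del: sum_bounded_above) (meson le_trans lessThan_iff mult_le_mono1)
  qed
next
  case (Arr a e)
  show ?case by (intro exI[of _ "\<lambda>_. 1"]) (auto intro: poly_bounded_intros)
next
  case (Var x)
  show ?case by (rule exI[of _ "\<lambda>M. M"]) (simp add: poly_bounded_id)
next
  case Len
  show ?case by (rule exI[of _ "\<lambda>M. M"]) (simp add: poly_bounded_id)
qed

text \<open>The value is left in counter t. All counters from t on are 0 before and, except for t, after the
  computation; counter 1 holds the input length.\<close>

primrec compile :: "exp \<Rightarrow> (nat \<Rightarrow> nat) \<Rightarrow> nat \<Rightarrow> com" where
  "compile (Var i) \<rho> t = copyc t (\<rho> i)"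
| "compile (Cst c) \<rho> t = (Seq (Inc t) ^^ c) Skip"
| "compile Len \<rho> t = copyc t 1"
| "compile (Add e1 e2) \<rho> t = Seq (compile e1 \<rho> t) (Seq (compile e2 \<rho> (Suc t)) (drain t (Suc t)))"
| "compile (Sub e1 e2) \<rho> t = Seq (compile e1 \<rho> t) (Seq (compile e2 \<rho> (Suc t)) (drainsub t (Suc t)))"
| "compile (Sum e1 e2) \<rho> t = Seq (compile e1 \<rho> t) (Seq
     (While (False, t + 2, [rflag t])
        (Seq (compile e2 (case_nat (t + 2) \<rho>) (t + 3)) (Seq (drain (t + 1) (t + 3)) (Inc (t + 2)))))
     (Seq (clr t) (Seq (clr (t + 2)) (drain t (t + 1)))))"
| "compile (Arr a e) \<rho> t = Seq (compile e \<rho> t) (If (True, t, [aflag a]) (Seq (clr t) (Inc t)) (clr t))"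

lemma exec_Cst: "exec ((Seq (Inc t) ^^ c) Skip) (g, A) (g(t := g t + c), A) (2 * c + 1)"
proof (induction c arbitrary: g)
  case 0
  then show ?case by (auto simp: exec_def intro: bigstep_Skip exI[of _ 1])
next
  case (Suc c)
  have "exec (Seq (Inc t) ((Seq (Inc t) ^^ c) Skip)) (g, A) (g(t := g t + Suc c), A) (2 * Suc c + 1)"
  proof (rule exec_Seq[OF exec_Inc[of t g A]])
    have "(g(t := Suc (g t)))(t := (g(t := Suc (g t))) t + c) = g(t := g t + Suc c)"
      by (auto simp: fun_eq_iff)
    then show "exec ((Seq (Inc t) ^^ c) Skip) (g(t := Suc (g t)), A) (g(t := g t + Suc c), A) (2 * c + 1)"
      using Suc[of "g(t := Suc (g t))"] by (simp only:)
  qed simp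
  then show ?case by (simp add: fun_upd_def)
qed

definition good :: "nat \<Rightarrow> nat \<Rightarrow> nat \<Rightarrow> (nat \<Rightarrow> nat) \<Rightarrow> bool" where
  "good t N M g \<longleftrightarrow> 1 < t \<and> g 1 = N \<and> (\<forall>x<t. g x \<le> M) \<and> (\<forall>x\<ge>t. g x = 0)"

text \<open>The time bound is chosen before the memory: one polynomial in \<open>M\<close> serves
  all arrays and all counter values up to \<open>M\<close>. This uniformity is what loops need,
  since their body runs in ever new memories.\<close>

lemma exec_compile:
  "\<exists>C. poly_bounded C \<and> (\<forall>\<rho> t g A N M. (\<forall>k. \<rho> k < t) \<longrightarrow> good t N M g \<longrightarrow>
     exec (compile e \<rho> t) (g, A) (g(t := ev A N e (g \<circ> \<rho>)), A) (C M))"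
proof (induction e)
  case (Var i)
  have "exec (copyc t (\<rho> i)) (g, A) (g(t := g (\<rho> i)), A) (2 * M + 1)" if "\<forall>k. \<rho> k < t" "good t N M g" for t \<rho> g A N M
    using exec_copyc[of t "\<rho> i" g A] that by (auto simp: good_def less_imp_neq[THEN not_sym] elim!: exec_mono)
  moreover have "poly_bounded (\<lambda>M. 2 * M + 1)" by (intro poly_bounded_intros)
  ultimately show ?case by (intro exI[of _ "\<lambda>M. 2 * M + 1"] conjI allI impI) (simp_all add: fun_upd_def)
next
  case Len
  have "exec (copyc t 1) (g, A) (g(t := N), A) (2 * M + 1)" if "\<forall>k. \<rho> k < t" "good t N M g" for t \<rho> g A N M
    using exec_copyc[of t 1 g A] that by (auto simp: good_def elim!: exec_mono)
  moreover have "poly_bounded (\<lambda>M. 2 * M + 1)" by (intro poly_bounded_intros)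
  ultimately show ?case by (intro exI[of _ "\<lambda>M. 2 * M + 1"] conjI allI impI) (simp_all add: fun_upd_def)
next
  case (Cst c)
  have "exec ((Seq (Inc t) ^^ c) Skip) (g, A) (g(t := c), A) (2 * c + 1)" if "good t N M g" for t g A N M
    using exec_Cst[of c t g A] that by (simp add: good_def)
  moreover have "poly_bounded (\<lambda>M. 2 * c + 1)" by (intro poly_bounded_intros)
  ultimately show ?case by (intro exI[of _ "\<lambda>M. 2 * c + 1"] conjI) (auto simp: fun_upd_def)
next
  case (Add e1 e2)
  then obtain C1 C2 where C: "poly_bounded C1" "poly_bounded C2"
    "\<And>\<rho> t g A N M. (\<forall>k. \<rho> k < t) \<Longrightarrow> good t N M g \<Longrightarrow> exec (compile e1 \<rho> t) (g, A) (g(t := ev A N e1 (g \<circ> \<rho>)), A) (C1 M)"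
    "\<And>\<rho> t g A N M. (\<forall>k. \<rho> k < t) \<Longrightarrow> good t N M g \<Longrightarrow> exec (compile e2 \<rho> t) (g, A) (g(t := ev A N e2 (g \<circ> \<rho>)), A) (C2 M)"
    by blast
  obtain V1 where V1: "poly_bounded V1" "\<And>A N s M. (\<forall>k. s k \<le> M) \<Longrightarrow> N \<le> M \<Longrightarrow> ev A N e1 s \<le> V1 M"
    using ev_bound by blast
  obtain V2 where V2: "poly_bounded V2" "\<And>A N s M. (\<forall>k. s k \<le> M) \<Longrightarrow> N \<le> M \<Longrightarrow> ev A N e2 s \<le> V2 M"
    using ev_bound by blast
  show ?case
  proof (intro exI[of _ "\<lambda>M. C1 M + C2 (V1 M + M) + (4 * V2 M + 1) + 2"] conjI allI impI)
    show "poly_bounded (\<lambda>M. C1 M + C2 (V1 M + M) + (4 * V2 M + 1) + 2)"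
      by (intro poly_bounded_intros poly_bounded_comp[OF C(2)] C(1) V1(1) V2(1))
    fix \<rho> :: "nat \<Rightarrow> nat" and t g A N M assume \<rho>: "\<forall>k. \<rho> k < t" and g: "good t N M g"
    let ?v = "ev A N e1 (g \<circ> \<rho>)" and ?w = "ev A N e2 (g \<circ> \<rho>)"
    have s: "\<forall>k. (g \<circ> \<rho>) k \<le> M" "N \<le> M" using \<rho> g by (auto simp: good_def)
    have v: "?v \<le> V1 M" and w: "?w \<le> V2 M" using V1 V2 s by blast+
    have g': "good (Suc t) N (V1 M + M) (g(t := ?v))"
      using g v by (auto simp: good_def less_Suc_eq trans_le_add2 trans_le_add1)
    have eq: "g(t := ?v) \<circ> \<rho> = g \<circ> \<rho>" using \<rho> by (auto simp: fun_eq_iff dest: less_imp_neq)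
    have 2: "exec (compile e2 \<rho> (Suc t)) (g(t := ?v), A) (g(t := ?v, Suc t := ?w), A) (C2 (V1 M + M))"
      using C(4)[OF _ g', of \<rho> A] \<rho> by (simp add: eq less_SucI)
    have 3: "exec (drain t (Suc t)) (g(t := ?v, Suc t := ?w), A) (g(t := ?v + ?w), A) (4 * V2 M + 1)"
    proof -
      have "g(t := ?v, Suc t := ?w, t := ?v + ?w, Suc t := 0) = g(t := ?v + ?w)"
        using g by (auto simp: good_def fun_eq_iff)
      then show ?thesis using exec_drain[of t "Suc t" "g(t := ?v, Suc t := ?w)" A] w by (auto intro: exec_mono)
    qed
    show "exec (compile (Add e1 e2) \<rho> t) (g, A) (g(t := ev A N (Add e1 e2) (g \<circ> \<rho>)), A)
      (C1 M + C2 (V1 M + M) + (4 * V2 M + 1) + 2)"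
      unfolding compile.simps ev.simps
      by (rule exec_Seq[OF C(3)[OF \<rho> g] exec_Seq[OF 2 3 order_refl]]) simp
  qed
next
  case (Sub e1 e2)
  then obtain C1 C2 where C: "poly_bounded C1" "poly_bounded C2"
    "\<And>\<rho> t g A N M. (\<forall>k. \<rho> k < t) \<Longrightarrow> good t N M g \<Longrightarrow> exec (compile e1 \<rho> t) (g, A) (g(t := ev A N e1 (g \<circ> \<rho>)), A) (C1 M)"
    "\<And>\<rho> t g A N M. (\<forall>k. \<rho> k < t) \<Longrightarrow> good t N M g \<Longrightarrow> exec (compile e2 \<rho> t) (g, A) (g(t := ev A N e2 (g \<circ> \<rho>)), A) (C2 M)"
    by blast
  obtain V1 where V1: "poly_bounded V1" "\<And>A N s M. (\<forall>k. s k \<le> M) \<Longrightarrow> N \<le> M \<Longrightarrow> ev A N e1 s \<le> V1 M"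
    using ev_bound by blast
  obtain V2 where V2: "poly_bounded V2" "\<And>A N s M. (\<forall>k. s k \<le> M) \<Longrightarrow> N \<le> M \<Longrightarrow> ev A N e2 s \<le> V2 M"
    using ev_bound by blast
  show ?case
  proof (intro exI[of _ "\<lambda>M. C1 M + C2 (V1 M + M) + (4 * V2 M + 1) + 2"] conjI allI impI)
    show "poly_bounded (\<lambda>M. C1 M + C2 (V1 M + M) + (4 * V2 M + 1) + 2)"
      by (intro poly_bounded_intros poly_bounded_comp[OF C(2)] C(1) V1(1) V2(1))
    fix \<rho> :: "nat \<Rightarrow> nat" and t g A N M assume \<rho>: "\<forall>k. \<rho> k < t" and g: "good t N M g"
    let ?v = "ev A N e1 (g \<circ> \<rho>)" and ?w = "ev A N e2 (g \<circ> \<rho>)"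
    have s: "\<forall>k. (g \<circ> \<rho>) k \<le> M" "N \<le> M" using \<rho> g by (auto simp: good_def)
    have v: "?v \<le> V1 M" and w: "?w \<le> V2 M" using V1 V2 s by blast+
    have g': "good (Suc t) N (V1 M + M) (g(t := ?v))"
      using g v by (auto simp: good_def less_Suc_eq trans_le_add2 trans_le_add1)
    have eq: "g(t := ?v) \<circ> \<rho> = g \<circ> \<rho>" using \<rho> by (auto simp: fun_eq_iff dest: less_imp_neq)
    have 2: "exec (compile e2 \<rho> (Suc t)) (g(t := ?v), A) (g(t := ?v, Suc t := ?w), A) (C2 (V1 M + M))"
      using C(4)[OF _ g', of \<rho> A] \<rho> by (simp add: eq less_SucI)
    have 3: "exec (drainsub t (Suc t)) (g(t := ?v, Suc t := ?w), A) (g(t := ?v - ?w), A) (4 * V2 M + 1)"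
    proof -
      have "g(t := ?v, Suc t := ?w, t := ?v - ?w, Suc t := 0) = g(t := ?v - ?w)"
        using g by (auto simp: good_def fun_eq_iff)
      then show ?thesis using exec_drainsub[of t "Suc t" "g(t := ?v, Suc t := ?w)" A] w by (auto intro: exec_mono)
    qed
    show "exec (compile (Sub e1 e2) \<rho> t) (g, A) (g(t := ev A N (Sub e1 e2) (g \<circ> \<rho>)), A)
      (C1 M + C2 (V1 M + M) + (4 * V2 M + 1) + 2)"
      unfolding compile.simps ev.simps
      by (rule exec_Seq[OF C(3)[OF \<rho> g] exec_Seq[OF 2 3 order_refl]]) simp
  qed
next
  case (Arr a e)
  then obtain C1 where C: "poly_bounded C1"
    "\<And>\<rho> t g A N M. (\<forall>k. \<rho> k < t) \<Longrightarrow> good t N M g \<Longrightarrow> exec (compile e \<rho> t) (g, A) (g(t := ev A N e (g \<circ> \<rho>)), A) (C1 M)"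
    by blast
  obtain V1 where V1: "poly_bounded V1" "\<And>A N s M. (\<forall>k. s k \<le> M) \<Longrightarrow> N \<le> M \<Longrightarrow> ev A N e s \<le> V1 M"
    using ev_bound by blast
  show ?case
  proof (intro exI[of _ "\<lambda>M. C1 M + 2 * V1 M + 5"] conjI allI impI)
    show "poly_bounded (\<lambda>M. C1 M + 2 * V1 M + 5)" by (intro poly_bounded_intros C(1) V1(1))
    fix \<rho> :: "nat \<Rightarrow> nat" and t g A N M assume \<rho>: "\<forall>k. \<rho> k < t" and g: "good t N M g"
    let ?v = "ev A N e (g \<circ> \<rho>)"
    have "?v \<le> V1 M" using V1 \<rho> g by (auto simp: good_def)
    then have c: "exec (clr t) (g(t := ?v), A) (g(t := 0), A) (2 * V1 M + 1)"
      using exec_clr[of t "g(t := ?v)" A] by (auto intro: exec_mono)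
    have i: "exec (Seq (clr t) (Inc t)) (g(t := ?v), A) (g(t := 1), A) (2 * V1 M + 3)"
      by (rule exec_Seq[OF c]) (use exec_Inc[of t "g(t := 0)" A] in auto)
    have "exec (If (True, t, [aflag a]) (Seq (clr t) (Inc t)) (clr t)) (g(t := ?v), A) (g(t := of_bool (A a ?v)), A) (2 * V1 M + 4)"
    proof (cases "A a ?v")
      case True
      show ?thesis by (rule exec_IfT) (use True i in auto)
    next
      case False
      show ?thesis by (rule exec_IfF) (use False c in auto)
    qed
    then show "exec (compile (Arr a e) \<rho> t) (g, A) (g(t := ev A N (Arr a e) (g \<circ> \<rho>)), A) (C1 M + 2 * V1 M + 5)"
      unfolding compile.simps ev.simps by (rule exec_Seq[OF C(2)[OF \<rho> g]]) simp
  qed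
next
  case (Sum e1 e2)
  then obtain C1 C2 where C: "poly_bounded C1" "poly_bounded C2"
    "\<And>\<rho> t g A N M. (\<forall>k. \<rho> k < t) \<Longrightarrow> good t N M g \<Longrightarrow> exec (compile e1 \<rho> t) (g, A) (g(t := ev A N e1 (g \<circ> \<rho>)), A) (C1 M)"
    "\<And>\<rho> t g A N M. (\<forall>k. \<rho> k < t) \<Longrightarrow> good t N M g \<Longrightarrow> exec (compile e2 \<rho> t) (g, A) (g(t := ev A N e2 (g \<circ> \<rho>)), A) (C2 M)"
    by blast
  obtain V1 where V1: "poly_bounded V1" "\<And>A N s M. (\<forall>k. s k \<le> M) \<Longrightarrow> N \<le> M \<Longrightarrow> ev A N e1 s \<le> V1 M"
    using ev_bound by blast
  obtain V2 where V2: "poly_bounded V2" "\<And>A N s M. (\<forall>k. s k \<le> M) \<Longrightarrow> N \<le> M \<Longrightarrow> ev A N e2 s \<le> V2 M"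
    using ev_bound by blast
  obtain V where V: "poly_bounded V" "\<And>A N s M. (\<forall>k. s k \<le> M) \<Longrightarrow> N \<le> M \<Longrightarrow> ev A N (Sum e1 e2) s \<le> V M"
    using ev_bound by blast
  let ?B = "\<lambda>M. C2 (M + V1 M + V M) + (4 * V2 (M + V1 M) + 1) + 5"
  show ?case
  proof (intro exI[of _ "\<lambda>M. C1 M + (V1 M * ?B M + 1) + (2 * V1 M + 1) + (2 * V1 M + 1) + (4 * V M + 1) + 4"] conjI allI impI)
    show "poly_bounded (\<lambda>M. C1 M + (V1 M * ?B M + 1) + (2 * V1 M + 1) + (2 * V1 M + 1) + (4 * V M + 1) + 4)"
      by (intro poly_bounded_intros poly_bounded_comp[OF C(2)] poly_bounded_comp[OF V2(1)] C(1) V1(1) V(1))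
    fix \<rho> :: "nat \<Rightarrow> nat" and t g A N M assume \<rho>: "\<forall>k. \<rho> k < t" and g: "good t N M g"
    let ?m = "ev A N e1 (g \<circ> \<rho>)" and ?f = "\<lambda>v. ev A N e2 (case_nat v (g \<circ> \<rho>))"
    \<comment> \<open>The memory before round j: counter t keeps the number of summands, t + 1 the
      partial sum and t + 2 the summation variable. Counter t + 3 is free for the summand.\<close>
    let ?G = "\<lambda>j. g(t := ?m, t + 1 := \<Sum>v<j. ?f v, t + 2 := j)"
    have s: "\<forall>k. (g \<circ> \<rho>) k \<le> M" "N \<le> M" using \<rho> g by (auto simp: good_def)
    have m: "?m \<le> V1 M" using V1 s by blast
    have S: "(\<Sum>v<?m. ?f v) \<le> V M" using V(2)[of "g \<circ> \<rho>" M N A] s by simp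
    have f: "?f v \<le> V2 (M + V1 M)" if "v < ?m" for v
    proof -
      have "\<forall>k. case_nat v (g \<circ> \<rho>) k \<le> M + V1 M"
        using m that s by (auto split: nat.splits intro: trans_le_add1)
      then show ?thesis using V2 s by (simp add: trans_le_add1)
    qed
    have body: "exec (Seq (compile e2 (case_nat (t + 2) \<rho>) (t + 3)) (Seq (drain (t + 1) (t + 3)) (Inc (t + 2))))
        (?G j, A) (?G (Suc j), A) (C2 (M + V1 M + V M) + (4 * V2 (M + V1 M) + 1) + 3)" if j: "j < ?m" for j
    proof -
      have "(\<Sum>v<j. ?f v) \<le> (\<Sum>v<?m. ?f v)" using j by (intro sum_mono2) auto
      then have gG: "good (t + 3) N (M + V1 M + V M) (?G j)"
        using g S m j by (auto simp: good_def less_Suc_eq numeral_3_eq_3 intro: trans_le_add1 trans_le_add2)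
      have \<rho>': "\<forall>k. case_nat (t + 2) \<rho> k < t + 3" using \<rho> by (auto split: nat.splits intro: trans_less_add1)
      have eq: "?G j \<circ> case_nat (t + 2) \<rho> = case_nat j (g \<circ> \<rho>)"
      proof
        fix k
        have "\<rho> i < t" for i using \<rho> by blast
        then have "\<rho> i \<noteq> t" "\<rho> i \<noteq> t + 1" "\<rho> i \<noteq> t + 2" for i
          by (metis less_irrefl, metis less_add_one less_asym, metis less_add_eq_less not_add_less1)
        then show "(?G j \<circ> case_nat (t + 2) \<rho>) k = case_nat j (g \<circ> \<rho>) k"
          by (cases k) auto
      qed
      have 1: "exec (compile e2 (case_nat (t + 2) \<rho>) (t + 3)) (?G j, A) ((?G j)(t + 3 := ?f j), A) (C2 (M + V1 M + V M))"
        using C(4)[OF \<rho>' gG, of A] unfolding eq .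
      have 2: "exec (drain (t + 1) (t + 3)) ((?G j)(t + 3 := ?f j), A) (g(t := ?m, t + 1 := \<Sum>v<Suc j. ?f v, t + 2 := j), A) (4 * V2 (M + V1 M) + 1)"
      proof -
        have "((?G j)(t + 3 := ?f j))(t + 1 := (\<Sum>v<j. ?f v) + ?f j, t + 3 := 0) = g(t := ?m, t + 1 := \<Sum>v<Suc j. ?f v, t + 2 := j)"
          using g by (auto simp: good_def fun_eq_iff)
        then show ?thesis using exec_drain[of "t + 1" "t + 3" "(?G j)(t + 3 := ?f j)" A] f[OF j] by (auto intro: exec_mono)
      qed
      have 3: "exec (Inc (t + 2)) (g(t := ?m, t + 1 := \<Sum>v<Suc j. ?f v, t + 2 := j), A) (?G (Suc j), A) 1"
        using exec_Inc[of "t + 2" "g(t := ?m, t + 1 := \<Sum>v<Suc j. ?f v, t + 2 := j)" A] by simp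
      show ?thesis by (rule exec_Seq[OF 1 exec_Seq[OF 2 3 order_refl]]) simp
    qed
    have loop: "exec (While (False, t + 2, [rflag t]) (Seq (compile e2 (case_nat (t + 2) \<rho>) (t + 3)) (Seq (drain (t + 1) (t + 3)) (Inc (t + 2)))))
        (?G j, A) (?G ?m, A) ((?m - j) * ?B M + 1)" if "j \<le> ?m" for j
      using that
    proof (induction j rule: inc_induct)
      case base
      show ?case by (intro exec_mono[OF exec_WhileF]) (simp_all add: comp_def)
    next
      case (step j)
      have "?m - j = Suc (?m - Suc j)" using step by simp
      then show ?case
        by (intro exec_WhileT[OF _ body[OF step(2)] step(3)]) (use step in \<open>auto simp: fun_upd_def comp_def\<close>)
    qed
    have G0: "?G 0 = g(t := ?m)" using g by (auto simp: good_def fun_eq_iff)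
    have 2: "exec (While (False, t + 2, [rflag t]) (Seq (compile e2 (case_nat (t + 2) \<rho>) (t + 3)) (Seq (drain (t + 1) (t + 3)) (Inc (t + 2)))))
        (g(t := ?m), A) (?G ?m, A) (V1 M * ?B M + 1)"
      using loop[of 0] unfolding G0 by (rule exec_mono) (use m in simp_all)
    let ?S = "\<Sum>v<?m. ?f v"
    have 3: "exec (clr t) (?G ?m, A) (g(t := 0, t + 1 := ?S, t + 2 := ?m), A) (2 * V1 M + 1)"
    proof -
      have "(?G ?m)(t := 0) = g(t := 0, t + 1 := ?S, t + 2 := ?m)" by (auto simp: fun_eq_iff)
      then show ?thesis using exec_clr[of t "?G ?m" A] m by (auto intro: exec_mono)
    qed
    have 4: "exec (clr (t + 2)) (g(t := 0, t + 1 := ?S, t + 2 := ?m), A) (g(t := 0, t + 1 := ?S), A) (2 * V1 M + 1)"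
    proof -
      have "(g(t := 0, t + 1 := ?S, t + 2 := ?m))(t + 2 := 0) = g(t := 0, t + 1 := ?S)"
        using g by (auto simp: good_def fun_eq_iff)
      then show ?thesis using exec_clr[of "t + 2" "g(t := 0, t + 1 := ?S, t + 2 := ?m)" A] m by (auto intro: exec_mono)
    qed
    have 5: "exec (drain t (t + 1)) (g(t := 0, t + 1 := ?S), A) (g(t := ?S), A) (4 * V M + 1)"
    proof -
      have "(g(t := 0, t + 1 := ?S))(t := ?S, t + 1 := 0) = g(t := ?S)"
        using g by (auto simp: good_def fun_eq_iff)
      then show ?thesis using exec_drain[of t "t + 1" "g(t := 0, t + 1 := ?S)" A] S by (auto intro: exec_mono)
    qed
    show "exec (compile (Sum e1 e2) \<rho> t) (g, A) (g(t := ev A N (Sum e1 e2) (g \<circ> \<rho>)), A)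
      (C1 M + (V1 M * ?B M + 1) + (2 * V1 M + 1) + (2 * V1 M + 1) + (4 * V M + 1) + 4)"
      unfolding compile.simps ev.simps
      by (rule exec_Seq[OF C(3)[OF \<rho> g] exec_Seq[OF 2 exec_Seq[OF 3 exec_Seq[OF 4 5 order_refl] order_refl] order_refl]]) simp
  qed
qed

text \<open>The test for entry k is evaluated in the memory that already contains the entries below
  k, with k as variable 0 and the input length as all other variables. This is how recursion enters
  although expressions have none.\<close>

primrec fillA :: "nat \<Rightarrow> exp \<Rightarrow> nat \<Rightarrow> nat \<Rightarrow> (nat \<Rightarrow> nat \<Rightarrow> bool) \<Rightarrow> nat \<Rightarrow> nat \<Rightarrow> bool" where
  "fillA a e N 0 A = A"
| "fillA a e N (Suc k) A = (let A' = fillA a e N k A in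
     if ev A' N e (case_nat k (\<lambda>_. N)) \<noteq> 0 then A'(a := (A' a)(k := True)) else A')"

definition fill_prog :: "nat \<Rightarrow> exp \<Rightarrow> exp \<Rightarrow> com" where
  "fill_prog a b e = Seq (compile b (\<lambda>_. 1) 3) (Seq
     (While (False, 2, [rflag 3])
        (Seq (compile e (case_nat 2 (\<lambda>_. 1)) 4) (Seq (If (True, 4, [eflag]) Skip (Set a 2)) (Seq (clr 4) (Inc 2)))))
     (Seq (clr 2) (clr 3)))"

lemma exec_fill_prog:
  "\<exists>C. poly_bounded C \<and> (\<forall>A N. exec (fill_prog a b e) ((\<lambda>_. 0)(1 := N), A)
     ((\<lambda>_. 0)(1 := N), fillA a e N (ev A N b (\<lambda>_. N)) A) (C N))"
proof -
  obtain C1 where C1: "poly_bounded C1" "\<And>\<rho> t g A N M. (\<forall>k. \<rho> k < t) \<Longrightarrow> good t N M g \<Longrightarrow>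
     exec (compile b \<rho> t) (g, A) (g(t := ev A N b (g \<circ> \<rho>)), A) (C1 M)" using exec_compile by metis
  obtain C2 where C2: "poly_bounded C2" "\<And>\<rho> t g A N M. (\<forall>k. \<rho> k < t) \<Longrightarrow> good t N M g \<Longrightarrow>
     exec (compile e \<rho> t) (g, A) (g(t := ev A N e (g \<circ> \<rho>)), A) (C2 M)" using exec_compile by metis
  obtain V1 where V1: "poly_bounded V1" "\<And>A N s M. (\<forall>k. s k \<le> M) \<Longrightarrow> N \<le> M \<Longrightarrow> ev A N b s \<le> V1 M"
    using ev_bound by blast
  obtain V2 where V2: "poly_bounded V2" "\<And>A N s M. (\<forall>k. s k \<le> M) \<Longrightarrow> N \<le> M \<Longrightarrow> ev A N e s \<le> V2 M"
    using ev_bound by blast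
  let ?B = "\<lambda>M. C2 (M + V1 M) + 2 + (2 * V2 (M + V1 M) + 1) + 5"
  show ?thesis
  proof (intro exI[of _ "\<lambda>M. C1 M + (V1 M * ?B M + 1) + (2 * V1 M + 1) + (2 * V1 M + 1) + 3"] conjI allI)
    show "poly_bounded (\<lambda>M. C1 M + (V1 M * ?B M + 1) + (2 * V1 M + 1) + (2 * V1 M + 1) + 3)"
      by (intro poly_bounded_intros poly_bounded_comp[OF C2(1)] poly_bounded_comp[OF V2(1)] C1(1) V1(1))
    fix A :: "nat \<Rightarrow> nat \<Rightarrow> bool" and N
    let ?m = "ev A N b (\<lambda>_. N)" and ?g = "(\<lambda>_. 0)(1 := N) :: nat \<Rightarrow> nat"
    let ?F = "\<lambda>j. fillA a e N j A"
    have m: "?m \<le> V1 N" by (intro V1(2)) auto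
    have "good 3 N N ?g" by (auto simp: good_def)
    from C1(2)[OF _ this, of "\<lambda>_. 1" A]
    have 1: "exec (compile b (\<lambda>_. 1) 3) (?g, A) (?g(3 := ?m), A) (C1 N)" by (simp add: comp_def)
    let ?body = "Seq (compile e (case_nat 2 (\<lambda>_. 1)) 4) (Seq (If (True, 4, [eflag]) Skip (Set a 2)) (Seq (clr 4) (Inc 2)))"
    have body: "exec ?body (?g(3 := ?m, 2 := j), ?F j) (?g(3 := ?m, 2 := Suc j), ?F (Suc j))
       (C2 (N + V1 N) + 2 + (2 * V2 (N + V1 N) + 1) + 4)" if j: "j < ?m" for j
    proof -
      let ?v = "ev (?F j) N e (case_nat j (\<lambda>_. N))"
      have "good 4 N (N + V1 N) (?g(3 := ?m, 2 := j))" using m j by (auto simp: good_def)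
      moreover have "?g(3 := ?m, 2 := j) \<circ> case_nat 2 (\<lambda>_. 1) = case_nat j (\<lambda>_. N)"
        by (auto simp: fun_eq_iff split: nat.splits)
      ultimately have b1: "exec (compile e (case_nat 2 (\<lambda>_. 1)) 4) (?g(3 := ?m, 2 := j), ?F j) (?g(3 := ?m, 2 := j, 4 := ?v), ?F j) (C2 (N + V1 N))"
        using C2(2)[of "case_nat 2 (\<lambda>_. 1)" 4 N "N + V1 N" "?g(3 := ?m, 2 := j)" "?F j"] by (auto split: nat.splits)
      have b2: "exec (If (True, 4, [eflag]) Skip (Set a 2)) (?g(3 := ?m, 2 := j, 4 := ?v), ?F j) (?g(3 := ?m, 2 := j, 4 := ?v), ?F (Suc j)) 2"
      proof (cases "?v = 0")
        case True
        then show ?thesis unfolding exec_def by (intro exI[of _ "Suc 1"]) (auto intro!: bigstep_IfT bigstep_Skip[unfolded One_nat_def])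
      next
        case False
        have "bigstep (If (True, 4, [eflag]) Skip (Set a 2)) (?g(3 := ?m, 2 := j, 4 := ?v), ?F j) (Suc 1)
          (?g(3 := ?m, 2 := j, 4 := ?v), (?F j)(a := (?F j a)((?g(3 := ?m, 2 := j, 4 := ?v)) 2 := True)))"
          using False by (intro bigstep_IfF bigstep_Set) auto
        then show ?thesis using False unfolding exec_def by (intro exI[of _ "Suc 1"]) (auto simp: Let_def)
      qed
      have v: "?v \<le> V2 (N + V1 N)"
        using m j by (intro V2(2)) (auto split: nat.splits)
      have b3: "exec (clr 4) (?g(3 := ?m, 2 := j, 4 := ?v), ?F (Suc j)) (?g(3 := ?m, 2 := j), ?F (Suc j)) (2 * V2 (N + V1 N) + 1)"
      proof -
        have "(?g(3 := ?m, 2 := j, 4 := ?v))(4 := 0) = ?g(3 := ?m, 2 := j)" by (auto simp: fun_eq_iff)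
        then show ?thesis using exec_clr[of 4 "?g(3 := ?m, 2 := j, 4 := ?v)" "?F (Suc j)"] v by (auto intro: exec_mono)
      qed
      have b4: "exec (Inc 2) (?g(3 := ?m, 2 := j), ?F (Suc j)) (?g(3 := ?m, 2 := Suc j), ?F (Suc j)) 1"
        using exec_Inc[of 2 "?g(3 := ?m, 2 := j)" "?F (Suc j)"] by simp
      show ?thesis by (rule exec_Seq[OF b1 exec_Seq[OF b2 exec_Seq[OF b3 b4 order_refl] order_refl]]) simp
    qed
    have loop: "exec (While (False, 2, [rflag 3]) ?body) (?g(3 := ?m, 2 := j), ?F j) (?g(3 := ?m, 2 := ?m), ?F ?m) ((?m - j) * ?B N + 1)"
      if "j \<le> ?m" for j
      using that
    proof (induction j rule: inc_induct)
      case base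
      show ?case by (intro exec_mono[OF exec_WhileF]) (simp_all add: comp_def)
    next
      case (step j)
      have "?m - j = Suc (?m - Suc j)" using step by simp
      then show ?case
        by (intro exec_WhileT[OF _ body[OF step(2)] step(3)]) (use step in \<open>auto simp: fun_upd_def comp_def\<close>)
    qed
    have g0: "?g(3 := ?m, 2 := 0) = ?g(3 := ?m)" by (auto simp: fun_eq_iff)
    have 2: "exec (While (False, 2, [rflag 3]) ?body) (?g(3 := ?m), A) (?g(3 := ?m, 2 := ?m), ?F ?m) (V1 N * ?B N + 1)"
      using loop[of 0] unfolding g0 fillA.simps by (rule exec_mono) (use m in simp_all)
    have 3: "exec (clr 2) (?g(3 := ?m, 2 := ?m), ?F ?m) (?g(3 := ?m), ?F ?m) (2 * V1 N + 1)"
      using exec_clr[of 2 "?g(3 := ?m, 2 := ?m)" "?F ?m"] m g0 by (auto intro: exec_mono)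
    have 4: "exec (clr 3) (?g(3 := ?m), ?F ?m) (?g, ?F ?m) (2 * V1 N + 1)"
    proof -
      have "(?g(3 := ?m))(3 := 0) = ?g" by (auto simp: fun_eq_iff)
      then show ?thesis using exec_clr[of 3 "?g(3 := ?m)" "?F ?m"] m by (auto intro: exec_mono)
    qed
    show "exec (fill_prog a b e) (?g, A) (?g, ?F ?m) (C1 N + (V1 N * ?B N + 1) + (2 * V1 N + 1) + (2 * V1 N + 1) + 3)"
      unfolding fill_prog_def
      by (rule exec_Seq[OF 1 exec_Seq[OF 2 exec_Seq[OF 3 4 order_refl] order_refl]]) simp
  qed
qed

text \<open>No input symbol is 0, so the input ends before the first cell from 1 on with both bits
  clear. The scan starts at cell 1, and the final decrement turns the number of that cell into the
  length.\<close>

definition length_prog :: com where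
  "length_prog = Seq (Inc 1) (Seq (While (True, 1, [aflag 0, aflag 1]) (Inc 1)) (Dec 1))"

lemma exec_length_prog:
  assumes "\<forall>s\<in>set x. s \<noteq> 0"
  shows "exec length_prog (\<lambda>_. 0, inp x) ((\<lambda>_. 0)(1 := length x), inp x) (2 * length x + 5)"
proof -
  let ?g = "\<lambda>j. (\<lambda>_. 0)(1 := j) :: nat \<Rightarrow> nat"
  have t: "inp x 0 (Suc j) \<or> inp x 1 (Suc j) \<longleftrightarrow> j < length x" for j
  proof -
    have "odd (x ! j) \<or> 2 \<le> x ! j" if "j < length x"
    proof -
      have "x ! j \<noteq> 0" using assms that by auto
      then show ?thesis by (cases "x ! j = 1") auto
    qed
    then show ?thesis by (auto simp: inp_def)
  qed
  have loop: "exec (While (True, 1, [aflag 0, aflag 1]) (Inc 1)) (?g (Suc j), inp x) (?g (Suc (length x)), inp x) (2 * (length x - j) + 1)"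
    if "j \<le> length x" for j
    using that
  proof (induction j rule: inc_induct)
    case base
    show ?case using t[of "length x"] by (intro exec_mono[OF exec_WhileF]) simp_all
  next
    case (step j)
    have "length x - j = Suc (length x - Suc j)" using step by simp
    moreover have "exec (Inc 1) (?g (Suc j), inp x) (?g (Suc (Suc j)), inp x) 1"
      using exec_Inc[of 1 "?g (Suc j)" "inp x"] by simp
    ultimately show ?case
      using t[of j] step by (intro exec_WhileT[OF _ _ step(3)]) (auto simp: fun_upd_def)
  qed
  have 1: "exec (Inc 1) (\<lambda>_. 0, inp x) (?g (Suc 0), inp x) 1" using exec_Inc[of 1 "\<lambda>_. 0" "inp x"] by simp
  have 3: "exec (Dec 1) (?g (Suc (length x)), inp x) (?g (length x), inp x) 1"
    using exec_Dec[of 1 "?g (Suc (length x))" "inp x"] by simp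
  show ?thesis unfolding length_prog_def
    by (rule exec_Seq[OF 1 exec_Seq[OF loop[of 0] 3 order_refl]]) auto
qed

section \<open>Renaming and substitution in expressions\<close>

primrec arrs :: "exp \<Rightarrow> nat set" where
  "arrs (Var i) = {}"
| "arrs (Cst c) = {}"
| "arrs Len = {}"
| "arrs (Add e1 e2) = arrs e1 \<union> arrs e2"
| "arrs (Sub e1 e2) = arrs e1 \<union> arrs e2"
| "arrs (Sum e1 e2) = arrs e1 \<union> arrs e2"
| "arrs (Arr a e) = insert a (arrs e)"

lemma ev_cong: "(\<And>a. a \<in> arrs e \<Longrightarrow> A a = A' a) \<Longrightarrow> ev A N e s = ev A' N e s"
  by (induction e arbitrary: s) auto

primrec ren :: "(nat \<Rightarrow> nat) \<Rightarrow> exp \<Rightarrow> exp" where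
  "ren \<rho> (Var i) = Var (\<rho> i)"
| "ren \<rho> (Cst c) = Cst c"
| "ren \<rho> Len = Len"
| "ren \<rho> (Add e1 e2) = Add (ren \<rho> e1) (ren \<rho> e2)"
| "ren \<rho> (Sub e1 e2) = Sub (ren \<rho> e1) (ren \<rho> e2)"
| "ren \<rho> (Sum e1 e2) = Sum (ren \<rho> e1) (ren (case_nat 0 (Suc \<circ> \<rho>)) e2)"
| "ren \<rho> (Arr a e) = Arr a (ren \<rho> e)"

lemma ev_ren: "ev A N (ren \<rho> e) s = ev A N e (\<lambda>i. s (\<rho> i))"
proof (induction e arbitrary: \<rho> s)
  case (Sum e1 e2)
  have "(\<lambda>i. case_nat v s (case_nat 0 (Suc \<circ> \<rho>) i)) = case_nat v (\<lambda>i. s (\<rho> i))" for v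
    by (auto simp: fun_eq_iff split: nat.splits)
  then show ?case by (simp only: ren.simps ev.simps Sum)
qed simp_all

lemma arrs_ren [simp]: "arrs (ren \<rho> e) = arrs e"
  by (induction e arbitrary: \<rho>) auto

text \<open>Composition of definable functions becomes substitution. Under a sum the substituted
  expressions are shifted past the new summation variable.\<close>

primrec sub :: "(nat \<Rightarrow> exp) \<Rightarrow> exp \<Rightarrow> exp" where
  "sub \<sigma> (Var i) = \<sigma> i"
| "sub \<sigma> (Cst c) = Cst c"
| "sub \<sigma> Len = Len"
| "sub \<sigma> (Add e1 e2) = Add (sub \<sigma> e1) (sub \<sigma> e2)"
| "sub \<sigma> (Sub e1 e2) = Sub (sub \<sigma> e1) (sub \<sigma> e2)"
| "sub \<sigma> (Sum e1 e2) = Sum (sub \<sigma> e1) (sub (case_nat (Var 0) (ren Suc \<circ> \<sigma>)) e2)"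
| "sub \<sigma> (Arr a e) = Arr a (sub \<sigma> e)"

lemma ev_sub: "ev A N (sub \<sigma> e) s = ev A N e (\<lambda>i. ev A N (\<sigma> i) s)"
proof (induction e arbitrary: \<sigma> s)
  case (Sum e1 e2)
  have "(\<lambda>i. ev A N ((case_nat (Var 0) (ren Suc \<circ> \<sigma>)) i) (case_nat v s)) = case_nat v (\<lambda>i. ev A N (\<sigma> i) s)" for v
    by (auto simp: fun_eq_iff ev_ren split: nat.splits)
  then show ?case by (simp only: sub.simps ev.simps Sum)
qed simp_all

lemma arrs_sub: "arrs (sub \<sigma> e) \<subseteq> arrs e \<union> (\<Union>i. arrs (\<sigma> i))"
proof (induction e arbitrary: \<sigma>)
  case (Sum e1 e2)
  let ?\<sigma> = "case_nat (Var 0) (ren Suc \<circ> \<sigma>)"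
  have "arrs (?\<sigma> i) \<subseteq> (\<Union>i. arrs (\<sigma> i))" for i by (cases i) auto
  then have "(\<Union>i. arrs (?\<sigma> i)) \<subseteq> (\<Union>i. arrs (\<sigma> i))" by blast
  then have "arrs (sub ?\<sigma> e2) \<subseteq> arrs e2 \<union> (\<Union>i. arrs (\<sigma> i))"
    by (intro order_trans[OF Sum(2)[of ?\<sigma>]] Un_mono order_refl)
  with Sum(1)[of \<sigma>] show ?case unfolding sub.simps arrs.simps by blast
next
  case (Add e1 e2)
  with Add(1)[of \<sigma>] Add(2)[of \<sigma>] show ?case unfolding sub.simps arrs.simps by blast
next
  case (Sub e1 e2)
  with Sub(1)[of \<sigma>] Sub(2)[of \<sigma>] show ?case unfolding sub.simps arrs.simps by blast
next
  case (Arr a e)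
  with Arr[of \<sigma>] show ?case unfolding sub.simps arrs.simps by blast
qed auto

section \<open>Definable functions\<close>

type_synonym 'c ctx = "('c \<Rightarrow> nat \<Rightarrow> nat \<Rightarrow> bool) \<times> ('c \<Rightarrow> nat) \<times> nat \<times> 'c set"

text \<open>One expression must compute f for all instances c in V, from the first n arrays and the input length.\<close>

fun dfn :: "'c ctx \<Rightarrow> ('c \<Rightarrow> (nat \<Rightarrow> nat) \<Rightarrow> nat) \<Rightarrow> bool" where
  "dfn (\<Gamma>, len, n, V) f \<longleftrightarrow> (\<exists>e. arrs e \<subseteq> {..<n} \<and> (\<forall>c\<in>V. \<forall>s. ev (\<Gamma> c) (len c) e s = f c s))"

abbreviation dfp :: "'c ctx \<Rightarrow> ('c \<Rightarrow> (nat \<Rightarrow> nat) \<Rightarrow> bool) \<Rightarrow> bool" where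
  "dfp \<kappa> P \<equiv> dfn \<kappa> (\<lambda>c s. of_bool (P c s))"

definition valid :: "'c ctx \<Rightarrow> 'c set" where
  "valid \<kappa> = snd (snd (snd \<kappa>))"

lemma dfn_cong: "dfn \<kappa> f \<Longrightarrow> (\<And>c s. c \<in> valid \<kappa> \<Longrightarrow> f c s = g c s) \<Longrightarrow> dfn \<kappa> g"
  by (cases \<kappa>) (auto simp: valid_def)

lemma dfp_cong: "dfp \<kappa> P \<Longrightarrow> (\<And>c s. c \<in> valid \<kappa> \<Longrightarrow> P c s = Q c s) \<Longrightarrow> dfp \<kappa> Q"
  by (erule dfn_cong) simp

lemma dfn_var: "dfn \<kappa> (\<lambda>c s. s i)"
  by (cases \<kappa>) (auto intro: exI[of _ "Var i"])

lemma dfn_cst: "dfn \<kappa> (\<lambda>c s. k)"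
  by (cases \<kappa>) (auto intro: exI[of _ "Cst k"])

lemma dfn_len: "dfn (\<Gamma>, len, n, V) (\<lambda>c s. len c)"
  by (auto intro: exI[of _ "Len"])

lemma dfn_arr: "a < n \<Longrightarrow> dfn (\<Gamma>, len, n, V) f \<Longrightarrow> dfp (\<Gamma>, len, n, V) (\<lambda>c s. \<Gamma> c a (f c s))"
proof -
  assume "a < n" "dfn (\<Gamma>, len, n, V) f"
  then obtain e where "arrs e \<subseteq> {..<n}" "\<forall>c\<in>V. \<forall>s. ev (\<Gamma> c) (len c) e s = f c s" by auto
  then show ?thesis using \<open>a < n\<close> by (auto intro!: exI[of _ "Arr a e"])
qed

lemma dfn_add: "dfn \<kappa> f \<Longrightarrow> dfn \<kappa> g \<Longrightarrow> dfn \<kappa> (\<lambda>c s. f c s + g c s)"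
proof -
  assume f: "dfn \<kappa> f" and g: "dfn \<kappa> g"
  obtain \<Gamma> len n V where k: "\<kappa> = (\<Gamma>, len, n, V)" by (cases \<kappa>)
  from f g obtain e1 e2 where "arrs e1 \<subseteq> {..<n}" "\<forall>c\<in>V. \<forall>s. ev (\<Gamma> c) (len c) e1 s = f c s"
    "arrs e2 \<subseteq> {..<n}" "\<forall>c\<in>V. \<forall>s. ev (\<Gamma> c) (len c) e2 s = g c s" unfolding k by auto
  then show ?thesis unfolding k by (auto intro!: exI[of _ "Add e1 e2"])
qed

lemma dfn_sub: "dfn \<kappa> f \<Longrightarrow> dfn \<kappa> g \<Longrightarrow> dfn \<kappa> (\<lambda>c s. f c s - g c s)"
proof -
  assume f: "dfn \<kappa> f" and g: "dfn \<kappa> g"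
  obtain \<Gamma> len n V where k: "\<kappa> = (\<Gamma>, len, n, V)" by (cases \<kappa>)
  from f g obtain e1 e2 where "arrs e1 \<subseteq> {..<n}" "\<forall>c\<in>V. \<forall>s. ev (\<Gamma> c) (len c) e1 s = f c s"
    "arrs e2 \<subseteq> {..<n}" "\<forall>c\<in>V. \<forall>s. ev (\<Gamma> c) (len c) e2 s = g c s" unfolding k by auto
  then show ?thesis unfolding k by (auto intro!: exI[of _ "Sub e1 e2"])
qed

lemma dfn_sum:
  assumes f: "dfn \<kappa> f" and g: "dfn \<kappa> (\<lambda>c s. g c (s 0) (\<lambda>k. s (Suc k)))"
  shows "dfn \<kappa> (\<lambda>c s. \<Sum>i<f c s. g c i s)"
proof -
  obtain \<Gamma> len n V where k: "\<kappa> = (\<Gamma>, len, n, V)" by (cases \<kappa>)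
  from f g obtain e1 e2 where "arrs e1 \<subseteq> {..<n}" "\<forall>c\<in>V. \<forall>s. ev (\<Gamma> c) (len c) e1 s = f c s"
    "arrs e2 \<subseteq> {..<n}" "\<forall>c\<in>V. \<forall>s. ev (\<Gamma> c) (len c) e2 s = g c (s 0) (\<lambda>k. s (Suc k))" unfolding k by auto
  then show ?thesis unfolding k by (auto intro!: exI[of _ "Sum e1 e2"])
qed

lemma dfn_subst:
  assumes f: "dfn \<kappa> f" and g: "\<And>i. dfn \<kappa> (g i)"
  shows "dfn \<kappa> (\<lambda>c s. f c (\<lambda>i. g i c s))"
proof -
  obtain \<Gamma> len n V where k: "\<kappa> = (\<Gamma>, len, n, V)" by (cases \<kappa>)
  from f obtain e where e: "arrs e \<subseteq> {..<n}" "\<forall>c\<in>V. \<forall>s. ev (\<Gamma> c) (len c) e s = f c s"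
    unfolding k by auto
  have "\<forall>i. \<exists>e. arrs e \<subseteq> {..<n} \<and> (\<forall>c\<in>V. \<forall>s. ev (\<Gamma> c) (len c) e s = g i c s)"
    using g unfolding k by auto
  then obtain \<sigma> where s: "\<And>i. arrs (\<sigma> i) \<subseteq> {..<n}" "\<And>i c s. c \<in> V \<Longrightarrow> ev (\<Gamma> c) (len c) (\<sigma> i) s = g i c s"
    by metis
  have "arrs (sub \<sigma> e) \<subseteq> {..<n}" using arrs_sub[of \<sigma> e] e(1) s(1) by blast
  moreover have "\<forall>c\<in>V. \<forall>t. ev (\<Gamma> c) (len c) (sub \<sigma> e) t = f c (\<lambda>i. g i c t)"
    using e(2) s(2) by (simp add: ev_sub)
  ultimately show ?thesis unfolding k by (auto intro: exI[of _ "sub \<sigma> e"])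
qed

text \<open>Definability facts are stated with the variables \<open>s 0\<close>, \<open>s 1\<close>,
  \<open>s 2\<close> as arguments; this rule and its companions allow arbitrary definable arguments
  in their place.\<close>

lemma dfn_comp1: "dfn \<kappa> (\<lambda>c s. f c (s 0)) \<Longrightarrow> dfn \<kappa> a \<Longrightarrow> dfn \<kappa> (\<lambda>c s. f c (a c s))"
  using dfn_subst[of \<kappa> "\<lambda>c s. f c (s 0)" "\<lambda>i. a"] by simp

lemma dfn_comp2: "dfn \<kappa> (\<lambda>c s. f c (s 0) (s 1)) \<Longrightarrow> dfn \<kappa> a \<Longrightarrow> dfn \<kappa> b \<Longrightarrow> dfn \<kappa> (\<lambda>c s. f c (a c s) (b c s))"
  using dfn_subst[of \<kappa> "\<lambda>c s. f c (s 0) (s 1)" "\<lambda>i. if i = 0 then a else b"] by simp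

lemma dfn_comp3: "dfn \<kappa> (\<lambda>c s. f c (s 0) (s 1) (s 2)) \<Longrightarrow> dfn \<kappa> a \<Longrightarrow> dfn \<kappa> b \<Longrightarrow> dfn \<kappa> d \<Longrightarrow>
    dfn \<kappa> (\<lambda>c s. f c (a c s) (b c s) (d c s))"
  using dfn_subst[of \<kappa> "\<lambda>c s. f c (s 0) (s 1) (s 2)" "\<lambda>i. if i = 0 then a else if i = 1 then b else d"] by simp

lemma dfn_shift: "dfn \<kappa> f \<Longrightarrow> dfn \<kappa> (\<lambda>c s. f c (\<lambda>k. s (Suc k)))"
  using dfn_subst[of \<kappa> f "\<lambda>i c s. s (Suc i)"] dfn_var by blast

lemma dfn_mult:
  assumes "dfn \<kappa> f" "dfn \<kappa> g" shows "dfn \<kappa> (\<lambda>c s. f c s * g c s)"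
  using dfn_sum[OF assms(1) dfn_shift[OF assms(2)]] by simp

text \<open>With truncated subtraction, \<open>1 - (1 - x)\<close> is 1 for positive x and 0 for x =
  0.\<close>

lemma dfp_less:
  assumes "dfn \<kappa> f" "dfn \<kappa> g" shows "dfp \<kappa> (\<lambda>c s. f c s < g c s)"
  by (rule dfn_cong[OF dfn_sub[OF dfn_cst[of _ 1] dfn_sub[OF dfn_cst[of _ 1] dfn_sub[OF assms(2,1)]]]]) auto

lemma dfp_not: "dfp \<kappa> P \<Longrightarrow> dfp \<kappa> (\<lambda>c s. \<not> P c s)"
  by (rule dfn_cong[OF dfn_sub[OF dfn_cst[of _ 1]], of \<kappa> "\<lambda>c s. of_bool (P c s)"]) auto

lemma dfp_conj: "dfp \<kappa> P \<Longrightarrow> dfp \<kappa> Q \<Longrightarrow> dfp \<kappa> (\<lambda>c s. P c s \<and> Q c s)"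
  by (rule dfn_cong[OF dfn_mult[of \<kappa> "\<lambda>c s. of_bool (P c s)" "\<lambda>c s. of_bool (Q c s)"]]) auto

lemma dfp_disj: "dfp \<kappa> P \<Longrightarrow> dfp \<kappa> Q \<Longrightarrow> dfp \<kappa> (\<lambda>c s. P c s \<or> Q c s)"
  by (rule dfn_cong[OF dfp_not[OF dfp_conj[OF dfp_not dfp_not], of \<kappa> P Q]]) auto

lemma dfp_imp: "dfp \<kappa> P \<Longrightarrow> dfp \<kappa> Q \<Longrightarrow> dfp \<kappa> (\<lambda>c s. P c s \<longrightarrow> Q c s)"
  by (rule dfn_cong[OF dfp_disj[OF dfp_not, of \<kappa> P Q]]) auto

lemma dfp_le: "dfn \<kappa> f \<Longrightarrow> dfn \<kappa> g \<Longrightarrow> dfp \<kappa> (\<lambda>c s. f c s \<le> g c s)"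
  by (rule dfn_cong[OF dfp_not[OF dfp_less, of \<kappa> g f]]) auto

lemma dfp_eq: "dfn \<kappa> f \<Longrightarrow> dfn \<kappa> g \<Longrightarrow> dfp \<kappa> (\<lambda>c s. f c s = g c s)"
  by (rule dfn_cong[OF dfp_conj[OF dfp_le[of \<kappa> f g] dfp_le[of \<kappa> g f]]]) auto

lemma dfp_ex:
  assumes "dfn \<kappa> f" "dfp \<kappa> (\<lambda>c s. P c (s 0) (\<lambda>k. s (Suc k)))"
  shows "dfp \<kappa> (\<lambda>c s. \<exists>i<f c s. P c i s)"
proof -
  have "dfp \<kappa> (\<lambda>c s. 0 < (\<Sum>i<f c s. of_bool (P c i s) :: nat))"
    by (intro dfp_less dfn_cst dfn_sum[where g = "\<lambda>c i s. of_bool (P c i s)"] assms)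
  then show ?thesis by (rule dfn_cong) (auto simp: neq0_conv[symmetric] simp del: neq0_conv)
qed

lemma dfp_all:
  assumes "dfn \<kappa> f" "dfp \<kappa> (\<lambda>c s. P c (s 0) (\<lambda>k. s (Suc k)))"
  shows "dfp \<kappa> (\<lambda>c s. \<forall>i<f c s. P c i s)"
  by (rule dfn_cong[OF dfp_not[OF dfp_ex[where P = "\<lambda>c i s. \<not> P c i s", OF assms(1) dfp_not[OF assms(2)]]]]) auto

lemma dfn_if:
  assumes "dfp \<kappa> P" "dfn \<kappa> f" "dfn \<kappa> g"
  shows "dfn \<kappa> (\<lambda>c s. if P c s then f c s else g c s)"
  by (rule dfn_cong[OF dfn_add[OF dfn_mult[OF assms(1,2)] dfn_mult[OF dfp_not[OF assms(1)] assms(3)]]]) auto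

lemma dfn_card:
  assumes "dfn \<kappa> f" "dfp \<kappa> (\<lambda>c s. P c (s 0) (\<lambda>k. s (Suc k)))"
  shows "dfn \<kappa> (\<lambda>c s. card {i. i < f c s \<and> P c i s})"
proof (rule dfn_cong[OF dfn_sum[where g = "\<lambda>c i s. of_bool (P c i s)", OF assms]])
  fix c s
  have "{..<f c s} \<inter> {i. P c i s} = {i. i < f c s \<and> P c i s}" by auto
  then show "(\<Sum>i<f c s. of_bool (P c i s)) = card {i. i < f c s \<and> P c i s}"
    by (simp add: sum.If_cases of_bool_def)
qed

lemma dfn_sum_filter:
  assumes "dfn \<kappa> f" "dfp \<kappa> (\<lambda>c s. P c (s 0) (\<lambda>k. s (Suc k)))" "dfn \<kappa> (\<lambda>c s. g c (s 0) (\<lambda>k. s (Suc k)))"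
  shows "dfn \<kappa> (\<lambda>c s. \<Sum>i\<in>{i. i < f c s \<and> P c i s}. g c i s)"
proof (rule dfn_cong[OF dfn_sum[where g = "\<lambda>c i s. of_bool (P c i s) * g c i s", OF assms(1) dfn_mult[OF assms(2,3)]]])
  fix c s
  show "(\<Sum>i<f c s. of_bool (P c i s) * g c i s) = (\<Sum>i\<in>{i. i < f c s \<and> P c i s}. g c i s)"
    by (rule sum.mono_neutral_cong_right) auto
qed

text \<open>The quotient counts the q with (q + 1) b \<le> a. The guard yields the value 0 for
  division by 0.\<close>

lemma div_sum: "(a::nat) div b = (\<Sum>q<a. of_bool (0 < b \<and> (q + 1) * b \<le> a))"
proof (cases "b = 0")
  case False
  have "{..<a} \<inter> {q. 0 < b \<and> (q + 1) * b \<le> a} = {..<a div b}"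
  proof (intro set_eqI iffI)
    fix q assume "q \<in> {..<a} \<inter> {q. 0 < b \<and> (q + 1) * b \<le> a}"
    then have "Suc q * b \<le> a" by simp
    then have "Suc q \<le> a div b" using False by (simp add: less_eq_div_iff_mult_less_eq)
    then show "q \<in> {..<a div b}" by simp
  next
    fix q assume "q \<in> {..<a div b}"
    then have "Suc q \<le> a div b" by simp
    then have 1: "Suc q * b \<le> a" using False by (simp add: less_eq_div_iff_mult_less_eq)
    moreover have "Suc q * 1 \<le> Suc q * b" using False by (intro mult_le_mono) auto
    ultimately show "q \<in> {..<a} \<inter> {q. 0 < b \<and> (q + 1) * b \<le> a}" using False by auto
  qed
  then show ?thesis by (simp add: sum.If_cases of_bool_def)
qed simp

lemma dfn_div: "dfn \<kappa> f \<Longrightarrow> dfn \<kappa> g \<Longrightarrow> dfn \<kappa> (\<lambda>c s. f c s div g c s)"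
proof -
  assume f: "dfn \<kappa> f" and g: "dfn \<kappa> g"
  have "dfn \<kappa> (\<lambda>c s. \<Sum>q<f c s. of_bool (0 < g c s \<and> (q + 1) * g c s \<le> f c s))"
    by (intro dfn_sum dfp_conj dfp_less dfp_le dfn_mult dfn_add dfn_cst dfn_var f dfn_shift[OF f] dfn_shift[OF g])
  then show ?thesis by (simp add: div_sum)
qed

lemma dfn_mod: "dfn \<kappa> f \<Longrightarrow> dfn \<kappa> g \<Longrightarrow> dfn \<kappa> (\<lambda>c s. f c s mod g c s)"
  by (rule dfn_cong[OF dfn_sub[OF _ dfn_mult[OF dfn_div], of \<kappa> f f g g]]) (auto simp: minus_div_mult_eq_mod)

lemma dfn_power: "dfn \<kappa> f \<Longrightarrow> dfn \<kappa> (\<lambda>c s. f c s ^ b)"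
  by (induction b) (auto intro: dfn_cst dfn_mult simp: dfn_cst)

lemma dfp_odd: "dfn \<kappa> f \<Longrightarrow> dfp \<kappa> (\<lambda>c s. odd (f c s))"
  by (rule dfn_cong[OF dfp_eq[OF dfn_mod[OF _ dfn_cst[of _ 2]] dfn_cst[of _ 1]], of \<kappa> f]) (auto simp: odd_iff_mod_2_eq_one)

lemma dfp_even: "dfn \<kappa> f \<Longrightarrow> dfp \<kappa> (\<lambda>c s. even (f c s))"
  by (rule dfn_cong[OF dfp_not[OF dfp_odd, of \<kappa> f]]) auto

lemma dfn_min: "dfn \<kappa> f \<Longrightarrow> dfn \<kappa> g \<Longrightarrow> dfn \<kappa> (\<lambda>c s. min (f c s) (g c s))"
  unfolding min_def by (intro dfn_if dfp_le)

lemma dfn_max: "dfn \<kappa> f \<Longrightarrow> dfn \<kappa> g \<Longrightarrow> dfn \<kappa> (\<lambda>c s. max (f c s) (g c s))"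
  unfolding max_def by (intro dfn_if dfp_le)

lemmas dfn_intros = dfn_var dfn_cst dfn_add dfn_sub dfn_sum dfn_mult dfp_less dfp_not dfp_conj dfp_disj
  dfp_imp dfp_le dfp_eq dfp_ex dfp_all dfn_if dfn_div dfn_mod dfn_power dfp_odd dfp_even dfn_min dfn_max

section \<open>Adding computed arrays to a context\<close>

lemma dfn_extend: "dfn (\<Gamma>, len, n, V) f \<Longrightarrow> dfn (\<lambda>c. (\<Gamma> c)(n := T c), len, Suc n, V) f"
proof -
  assume "dfn (\<Gamma>, len, n, V) f"
  then obtain e where e: "arrs e \<subseteq> {..<n}" "\<forall>c\<in>V. \<forall>s. ev (\<Gamma> c) (len c) e s = f c s" by auto
  have "ev ((\<Gamma> c)(n := T c)) (len c) e s = ev (\<Gamma> c) (len c) e s" for c s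
    by (rule ev_cong) (use e in auto)
  then show ?thesis using e by (auto intro!: exI[of _ e])
qed

lemma dfp_extend: "dfp (\<lambda>c. (\<Gamma> c)(n := T c), len, Suc n, V) (\<lambda>c s. T c (s 0))"
  using dfn_arr[OF lessI dfn_var, of "\<lambda>c. (\<Gamma> c)(n := T c)" len n V 0] by simp

text \<open>Adds an array whose contents are a parameter: the part of a table that has been filled so far.\<close>

definition tabctx :: "'c ctx \<Rightarrow> ('c \<times> (nat \<Rightarrow> bool)) ctx" where
  "tabctx \<kappa> = (case \<kappa> of (\<Gamma>, len, n, V) \<Rightarrow>
     (\<lambda>x. (\<Gamma> (fst x))(n := snd x), \<lambda>x. len (fst x), Suc n, V \<times> UNIV))"

lemma dfn_tabctx: "dfn \<kappa> f \<Longrightarrow> dfn (tabctx \<kappa>) (\<lambda>x s. f (fst x) s)"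
proof -
  assume f: "dfn \<kappa> f"
  obtain \<Gamma> len n V where k: "\<kappa> = (\<Gamma>, len, n, V)" by (cases \<kappa>)
  from f obtain e where e: "arrs e \<subseteq> {..<n}" "\<forall>c\<in>V. \<forall>s. ev (\<Gamma> c) (len c) e s = f c s" unfolding k by auto
  have "ev ((\<Gamma> c)(n := T)) (len c) e s = ev (\<Gamma> c) (len c) e s" for c s T
    by (rule ev_cong) (use e in auto)
  then show ?thesis using e unfolding tabctx_def k by (auto intro!: exI[of _ e])
qed

lemma dfp_tab: "dfn (tabctx \<kappa>) f \<Longrightarrow> dfp (tabctx \<kappa>) (\<lambda>x s. snd x (f x s))"
proof -
  assume f: "dfn (tabctx \<kappa>) f"
  obtain \<Gamma> len n V where k: "\<kappa> = (\<Gamma>, len, n, V)" by (cases \<kappa>)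
  show ?thesis using dfn_arr[OF lessI, of "\<lambda>x. (\<Gamma> (fst x))(n := snd x)" "\<lambda>x. len (fst x)" n "V \<times> UNIV" f] f
    unfolding k tabctx_def by simp
qed

text \<open>Entry j is written only in round j, so what round k sees is the final table cut off at
  k.\<close>

lemma fillA_eq:
  assumes "\<And>p. \<not> A a p"
  shows "fillA a e N k A = A(a := \<lambda>j. j < k \<and> fillA a e N (Suc j) A a j)"
proof (induction k)
  case 0
  show ?case using assms by (auto simp: fun_eq_iff)
next
  case (Suc k)
  have "\<not> fillA a e N k A a k" by (subst Suc) simp
  have "fillA a e N (Suc k) A = (fillA a e N k A)(a := (fillA a e N k A a)(k := fillA a e N (Suc k) A a k))"
    using \<open>\<not> fillA a e N k A a k\<close> by (auto simp: Let_def fun_eq_iff)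
  also have "\<dots> = A(a := \<lambda>j. j < Suc k \<and> fillA a e N (Suc j) A a j)"
    by (subst (1 2) Suc) (auto simp: fun_eq_iff less_Suc_eq simp del: fillA.simps)
  finally show ?case .
qed

text \<open>The first n arrays can be computed in polynomial time from the encoded instance.\<close>

definition stage :: "('c \<Rightarrow> nat list) \<Rightarrow> 'c ctx \<Rightarrow> bool" where
  "stage enc \<kappa> \<longleftrightarrow> (case \<kappa> of (\<Gamma>, len, n, V) \<Rightarrow> len = (\<lambda>c. length (enc c)) \<and> (\<exists>P C. poly_bounded C \<and>
     (\<forall>c\<in>V. exec P (\<lambda>_. 0, inp (enc c)) ((\<lambda>_. 0)(1 := length (enc c)), \<Gamma> c) (C (length (enc c))) \<and>
       (\<forall>a\<ge>n. \<forall>p. \<not> \<Gamma> c a p))))"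

lemma stage_init:
  assumes "\<And>c s. c \<in> V \<Longrightarrow> s \<in> set (enc c) \<Longrightarrow> s \<noteq> 0"
  shows "stage enc (\<lambda>c. inp (enc c), \<lambda>c. length (enc c), 2, V)"
  unfolding stage_def split
proof (intro conjI refl exI[of _ length_prog] exI[of _ "\<lambda>n. 2 * n + 5"] ballI)
  show "poly_bounded (\<lambda>n. 2 * n + 5)" by (intro poly_bounded_intros)
  fix c assume "c \<in> V"
  then show "exec length_prog (\<lambda>_. 0, inp (enc c)) ((\<lambda>_. 0)(1 := length (enc c)), inp (enc c)) (2 * length (enc c) + 5)"
    using assms by (intro exec_length_prog) blast
  show "\<forall>a\<ge>2. \<forall>p. \<not> inp (enc c) a p" by (auto simp: inp_def)
qed

text \<open>The new array is empty at first, so the partially filled array seen at index i is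
  \<open>T\<close> cut off at i. Any predicate definable relative to an arbitrary partial table thus
  defines a table by course-of-values recursion, at the cost of one more polynomial pass.\<close>

lemma stage_table:
  assumes st: "stage enc (\<Gamma>, len, n, V)" and b: "dfn (\<Gamma>, len, n, V) (\<lambda>c s. b c)"
    and P: "dfp (tabctx (\<Gamma>, len, n, V)) (\<lambda>x s. P (fst x) (snd x) (s 0))"
  obtains T where "stage enc (\<lambda>c. (\<Gamma> c)(n := T c), len, Suc n, V)"
    "\<And>c i. c \<in> V \<Longrightarrow> T c i \<longleftrightarrow> i < b c \<and> P c (\<lambda>j. j < i \<and> T c j) i"
proof -
  from st obtain Q C where len: "len = (\<lambda>c. length (enc c))" and C: "poly_bounded C"
    and Q: "\<And>c. c \<in> V \<Longrightarrow> exec Q (\<lambda>_. 0, inp (enc c)) ((\<lambda>_. 0)(1 := length (enc c)), \<Gamma> c) (C (length (enc c)))"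
    and z: "\<And>c a p. c \<in> V \<Longrightarrow> n \<le> a \<Longrightarrow> \<not> \<Gamma> c a p" unfolding stage_def split by blast
  from b obtain eb where eb: "\<And>c s. c \<in> V \<Longrightarrow> ev (\<Gamma> c) (len c) eb s = b c" by auto
  from P obtain e where "\<forall>c\<in>V. \<forall>T s. ev ((\<Gamma> c)(n := T)) (len c) e s = of_bool (P c T (s 0))"
    unfolding tabctx_def by auto
  note e = this[rule_format]
  define T where "T c = fillA n e (len c) (b c) (\<Gamma> c) n" for c
  obtain C' where C': "poly_bounded C'" "\<And>A N. exec (fill_prog n eb e) ((\<lambda>_. 0)(1 := N), A)
     ((\<lambda>_. 0)(1 := N), fillA n e N (ev A N eb (\<lambda>_. N)) A) (C' N)"
    using exec_fill_prog by blast
  have fe: "fillA n e (len c) k (\<Gamma> c) = (\<Gamma> c)(n := \<lambda>j. j < k \<and> fillA n e (len c) (Suc j) (\<Gamma> c) n j)" if "c \<in> V" for c k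
    by (rule fillA_eq) (use z that in auto)
  have Tb: "T c j \<longleftrightarrow> j < b c \<and> fillA n e (len c) (Suc j) (\<Gamma> c) n j" if "c \<in> V" for c j
    unfolding T_def by (subst fe[OF that]) simp
  have fT: "fillA n e (len c) k (\<Gamma> c) = (\<Gamma> c)(n := \<lambda>j. j < k \<and> T c j)" if "c \<in> V" "k \<le> b c" for c k
    by (subst fe[OF that(1)]) (use that in \<open>auto simp: fun_eq_iff Tb simp del: fillA.simps\<close>)
  have T: "T c i \<longleftrightarrow> i < b c \<and> P c (\<lambda>j. j < i \<and> T c j) i" if c: "c \<in> V" for c i
  proof (cases "i < b c")
    case True
    have "fillA n e (len c) (Suc i) (\<Gamma> c) n i \<longleftrightarrow> P c (\<lambda>j. j < i \<and> T c j) i"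
      using e[OF c, of "\<lambda>j. j < i \<and> T c j" "case_nat i (\<lambda>_. len c)"] True
      by (simp add: fT[OF c] Let_def)
    then show ?thesis using Tb[OF c] True by blast
  next
    case False
    then show ?thesis using Tb[OF c] by blast
  qed
  have "stage enc (\<lambda>c. (\<Gamma> c)(n := T c), len, Suc n, V)"
    unfolding stage_def split
  proof (intro conjI len exI[of _ "Seq Q (fill_prog n eb e)"] exI[of _ "\<lambda>n. C n + C' n + 1"] ballI)
    show "poly_bounded (\<lambda>n. C n + C' n + 1)" by (intro poly_bounded_intros C C')
    fix c assume c: "c \<in> V"
    have "(\<lambda>j. j < b c \<and> T c j) = T c" using Tb[OF c] by blast
    then have "fillA n e (len c) (ev (\<Gamma> c) (len c) eb (\<lambda>_. len c)) (\<Gamma> c) = (\<Gamma> c)(n := T c)"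
      using fT[OF c order_refl] eb[OF c] by simp
    then show "exec (Seq Q (fill_prog n eb e)) (\<lambda>_. 0, inp (enc c)) ((\<lambda>_. 0)(1 := length (enc c)), (\<Gamma> c)(n := T c))
        (C (length (enc c)) + C' (length (enc c)) + 1)"
      using C'(2)[of "len c" "\<Gamma> c"] by (intro exec_Seq[OF Q[OF c]]) (auto simp: len)
    show "\<forall>a\<ge>Suc n. \<forall>p. \<not> ((\<Gamma> c)(n := T c)) a p" using z[OF c] by auto
  qed
  with T that show thesis by blast
qed

definition dfl :: "'c ctx \<Rightarrow> ('c \<Rightarrow> nat list) \<Rightarrow> bool" where
  "dfl \<kappa> y \<longleftrightarrow> dfn \<kappa> (\<lambda>c s. length (y c)) \<and> dfn \<kappa> (\<lambda>c s. if s 0 < length (y c) then y c ! s 0 else 0)"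

text \<open>Two more tables store the binary digits of the output symbols, shifted by one cell as
  the emitting phase expects. As the symbols are nonzero, the output ends where both digits are 0
  for the first time.\<close>

theorem stage_output:
  assumes st: "stage enc \<kappa>" and y: "dfl \<kappa> y"
    and sym: "\<And>c s. c \<in> valid \<kappa> \<Longrightarrow> s \<in> set (y c) \<Longrightarrow> s \<noteq> 0 \<and> s < 4"
    and esym: "\<And>c s. c \<in> valid \<kappa> \<Longrightarrow> s \<in> set (enc c) \<Longrightarrow> s < 4"
  shows "\<exists>M C. wf_tm M \<and> poly_bounded C \<and> (\<forall>c\<in>valid \<kappa>. \<exists>t \<le> C (length (enc c)).
     halted (run M t (enc c)) \<and> tape_output (run M t (enc c)) = y c)"
proof -
  obtain \<Gamma> len n V where k: "\<kappa> = (\<Gamma>, len, n, V)" by (cases \<kappa>)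
  define sy where "sy c i = (if i < length (y c) then y c ! i else 0)" for c i
  have yl: "dfn (\<Gamma>, len, n, V) (\<lambda>c s. length (y c))" and ys: "dfn (\<Gamma>, len, n, V) (\<lambda>c s. sy c (s 0))"
    using y unfolding dfl_def k sy_def by auto
  have b: "dfn (\<Gamma>, len, n, V) (\<lambda>c s. length (y c) + 1)" by (intro dfn_intros yl)
  have "dfp (\<Gamma>, len, n, V) (\<lambda>c s. 1 \<le> s 0 \<and> odd (sy c (s 0 - 1)))"
    by (intro dfn_intros dfn_comp1[OF ys])
  from stage_table[where P = "\<lambda>c T i. 1 \<le> i \<and> odd (sy c (i - 1))", OF st[unfolded k] b dfn_tabctx[OF this]]
  obtain T0 where T0: "stage enc (\<lambda>c. (\<Gamma> c)(n := T0 c), len, Suc n, V)"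
    "\<And>c i. c \<in> V \<Longrightarrow> T0 c i \<longleftrightarrow> i < length (y c) + 1 \<and> 1 \<le> i \<and> odd (sy c (i - 1))"
    by blast
  have "dfp (\<Gamma>, len, n, V) (\<lambda>c s. 1 \<le> s 0 \<and> 2 \<le> sy c (s 0 - 1))"
    by (intro dfn_intros dfn_comp1[OF ys])
  from stage_table[where P = "\<lambda>c T i. 1 \<le> i \<and> 2 \<le> sy c (i - 1)", OF T0(1) dfn_extend[OF b] dfn_tabctx[OF dfn_extend[OF this]]]
  obtain T1 where
    T1: "stage enc (\<lambda>c. (\<Gamma> c)(n := T0 c, Suc n := T1 c), len, Suc (Suc n), V)"
    "\<And>c i. c \<in> V \<Longrightarrow> T1 c i \<longleftrightarrow> i < length (y c) + 1 \<and> 1 \<le> i \<and> 2 \<le> sy c (i - 1)"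
    by blast
  from T1(1) obtain P C where len: "len = (\<lambda>c. length (enc c))" and C: "poly_bounded C"
    and P: "\<And>c. c \<in> V \<Longrightarrow> exec P (\<lambda>_. 0, inp (enc c)) ((\<lambda>_. 0)(1 := length (enc c)), (\<Gamma> c)(n := T0 c, Suc n := T1 c)) (C (length (enc c)))"
    unfolding stage_def split by blast
  obtain M where M: "wf_tm M" "\<And>x n' \<sigma> y. (\<forall>s\<in>set x. s < 4) \<Longrightarrow> bigstep P (\<lambda>_. 0, inp x) n' \<sigma> \<Longrightarrow>
     (\<forall>i < length y. y ! i = outsym n (Suc n) \<sigma> (Suc i) \<and> y ! i \<noteq> 0) \<Longrightarrow>
     outsym n (Suc n) \<sigma> (Suc (length y)) = 0 \<Longrightarrow>
     (\<exists>t \<le> n' * (2 * n' + 4) + 2 * length y + 5. halted (run M t x) \<and> tape_output (run M t x) = y)"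
    using ex_machine[of P n "Suc n"] by blast
  from yl obtain e where e: "\<And>c s. c \<in> V \<Longrightarrow> ev (\<Gamma> c) (len c) e s = length (y c)" by auto
  obtain Y where Y: "poly_bounded Y" "\<And>A N s M. (\<forall>k. s k \<le> M) \<Longrightarrow> N \<le> M \<Longrightarrow> ev A N e s \<le> Y M"
    using ev_bound by metis
  have yb: "length (y c) \<le> Y (length (enc c))" if "c \<in> V" for c
    using Y(2)[of "\<lambda>_. 0" "length (enc c)" "len c" "\<Gamma> c"] e[OF that, of "\<lambda>_. 0"] by (simp add: len)
  show ?thesis
  proof (intro exI[of _ M] exI[of _ "\<lambda>n. C n * (2 * C n + 4) + 2 * Y n + 5"] conjI M(1) ballI)
    show "poly_bounded (\<lambda>n. C n * (2 * C n + 4) + 2 * Y n + 5)" by (intro poly_bounded_intros C Y(1))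
    fix c assume "c \<in> valid \<kappa>"
    then have c: "c \<in> V" by (simp add: valid_def k)
    obtain n' where n': "n' \<le> C (length (enc c))"
      "bigstep P (\<lambda>_. 0, inp (enc c)) n' ((\<lambda>_. 0)(1 := length (enc c)), (\<Gamma> c)(n := T0 c, Suc n := T1 c))"
      using P[OF c] unfolding exec_def by blast
    have "y c ! i = of_bool (odd (y c ! i)) + 2 * of_bool (2 \<le> y c ! i)" if "i < length (y c)" for i
    proof -
      have "y c ! i < 4" using sym[OF \<open>c \<in> valid \<kappa>\<close>, of "y c ! i"] that by auto
      then have "y c ! i = 0 \<or> y c ! i = 1 \<or> y c ! i = 2 \<or> y c ! i = 3" by linarith
      then show ?thesis by (elim disjE) simp_all
    qed
    then obtain t where t: "t \<le> n' * (2 * n' + 4) + 2 * length (y c) + 5" "halted (run M t (enc c))"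
      "tape_output (run M t (enc c)) = y c"
      using M(2)[OF _ n'(2), of "y c"] esym[OF \<open>c \<in> valid \<kappa>\<close>] sym[OF \<open>c \<in> valid \<kappa>\<close>] nth_mem[of _ "y c"]
      by (auto simp: outsym_def T0(2)[OF c] T1(2)[OF c] sy_def)
    have "n' * (2 * n' + 4) \<le> C (length (enc c)) * (2 * C (length (enc c)) + 4)"
      using n'(1) by (intro mult_le_mono) auto
    then show "\<exists>t\<le>C (length (enc c)) * (2 * C (length (enc c)) + 4) + 2 * Y (length (enc c)) + 5.
        halted (run M t (enc c)) \<and> tape_output (run M t (enc c)) = y c"
      using t yb[OF c] by (intro exI[of _ t]) auto
  qed
qed

section \<open>Tree orders and treedepth\<close>

text \<open>An elimination forest seen as its ancestor order. Unlike a parent map, the order can be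
  restricted to any set of vertices and pulled back along injections; the height becomes a bound on
  the number of elements below a vertex.\<close>

definition torder :: "nat set \<Rightarrow> (nat \<Rightarrow> nat \<Rightarrow> bool) \<Rightarrow> (nat \<Rightarrow> nat \<Rightarrow> bool) \<Rightarrow> nat \<Rightarrow> bool" where
  "torder U E le h \<longleftrightarrow>
     (\<forall>u\<in>U. le u u) \<and>
     (\<forall>u\<in>U. \<forall>v\<in>U. \<forall>w\<in>U. le u v \<longrightarrow> le v w \<longrightarrow> le u w) \<and>
     (\<forall>u\<in>U. \<forall>v\<in>U. le u v \<longrightarrow> le v u \<longrightarrow> u = v) \<and>
     (\<forall>u\<in>U. \<forall>v\<in>U. \<forall>w\<in>U. le u w \<longrightarrow> le v w \<longrightarrow> le u v \<or> le v u) \<and>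
     (\<forall>v\<in>U. card {u\<in>U. le u v} \<le> h) \<and>
     (\<forall>u\<in>U. \<forall>v\<in>U. E u v \<longrightarrow> le u v \<or> le v u)"

lemma torderD:
  assumes "torder U E le h"
  shows "u \<in> U \<Longrightarrow> le u u"
    "u \<in> U \<Longrightarrow> v \<in> U \<Longrightarrow> w \<in> U \<Longrightarrow> le u v \<Longrightarrow> le v w \<Longrightarrow> le u w"
    "u \<in> U \<Longrightarrow> v \<in> U \<Longrightarrow> le u v \<Longrightarrow> le v u \<Longrightarrow> u = v"
    "u \<in> U \<Longrightarrow> v \<in> U \<Longrightarrow> w \<in> U \<Longrightarrow> le u w \<Longrightarrow> le v w \<Longrightarrow> le u v \<or> le v u"
    "v \<in> U \<Longrightarrow> card {u\<in>U. le u v} \<le> h"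
    "u \<in> U \<Longrightarrow> v \<in> U \<Longrightarrow> E u v \<Longrightarrow> le u v \<or> le v u"
  using assms unfolding torder_def by blast+

lemma torder_subset:
  assumes "torder U E le h" "U' \<subseteq> U" "\<And>v. v \<in> U' \<Longrightarrow> card {u\<in>U'. le u v} \<le> h'"
  shows "torder U' E le h'"
proof -
  have i: "u \<in> U" if "u \<in> U'" for u using assms(2) that by blast
  note t = torderD[OF assms(1)]
  show ?thesis unfolding torder_def
  proof (intro conjI ballI impI, goal_cases)
    case 1 then show ?case by (rule t(1)[OF i])
  next
    case 2 show ?case by (rule t(2)[OF i[OF 2(1)] i[OF 2(2)] i[OF 2(3)] 2(4,5)])
  next
    case 3 show ?case by (rule t(3)[OF i[OF 3(1)] i[OF 3(2)] 3(3,4)])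
  next
    case 4 show ?case by (rule t(4)[OF i[OF 4(1)] i[OF 4(2)] i[OF 4(3)] 4(4,5)])
  next
    case 5 then show ?case by (rule assms(3))
  next
    case 6 show ?case by (rule t(6)[OF i[OF 6(1)] i[OF 6(2)] 6(3)])
  qed
qed

text \<open>Serves both to change the edge relation on the same vertices and to renumber the
  vertices of the output graph.\<close>

lemma torder_inj:
  assumes t: "torder U E le h" and f: "inj_on f S" "f ` S \<subseteq> U" and U: "finite U"
    and E: "\<And>i j. i \<in> S \<Longrightarrow> j \<in> S \<Longrightarrow> E' i j \<Longrightarrow> E (f i) (f j)"
  shows "torder S E' (\<lambda>i j. le (f i) (f j)) h"
proof -
  have i: "f u \<in> U" if "u \<in> S" for u using f(2) that by blast
  have c: "card {u\<in>S. le (f u) (f v)} \<le> h" if "v \<in> S" for v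
  proof -
    have "card {u\<in>S. le (f u) (f v)} = card (f ` {u\<in>S. le (f u) (f v)})"
      using f(1) by (subst card_image) (auto intro: inj_on_subset)
    also have "\<dots> \<le> card {u\<in>U. le u (f v)}" using i U by (intro card_mono) auto
    finally show ?thesis using torderD(5)[OF t] i[OF that] by (meson le_trans)
  qed
  note t = torderD[OF t]
  show ?thesis unfolding torder_def
  proof (intro conjI ballI impI, goal_cases)
    case 1 then show ?case by (rule t(1)[OF i])
  next
    case 2 show ?case by (rule t(2)[OF i[OF 2(1)] i[OF 2(2)] i[OF 2(3)] 2(4,5)])
  next
    case 3 show ?case by (rule inj_onD[OF f(1) t(3)[OF i[OF 3(1)] i[OF 3(2)] 3(3,4)] 3(1,2)])
  next
    case 4 show ?case by (rule t(4)[OF i[OF 4(1)] i[OF 4(2)] i[OF 4(3)] 4(4,5)])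
  next
    case 5 then show ?case by (rule c)
  next
    case 6 show ?case by (rule t(6)[OF i[OF 6(1)] i[OF 6(2)] E[OF 6]])
  qed
qed

lemma itr_add: "itr p (i + j) v = (case itr p j v of None \<Rightarrow> None | Some w \<Rightarrow> itr p i w)"
  by (induction i) (auto split: option.splits)

lemma torder_ancestor:
  assumes "elim_forest U E p h"
  shows "torder U E (ancestor p) h"
proof -
  note e = assms[unfolded elim_forest_def]
  have none: "itr p i v = None" if "v \<in> U" "h \<le> i" for i v
    using e that itr_add[of p "i - h" h v] by simp
  have anti: "u = v" if "u \<in> U" "v \<in> U" "itr p i v = Some u" "itr p j u = Some v" for u v i j
  proof (rule ccontr)
    assume "u \<noteq> v"
    then have i: "0 < i" using that by (cases i) auto
    have 1: "itr p (j + i) v = Some v" using that by (simp add: itr_add)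
    \<comment> \<open>A nontrivial cycle could be traversed h times, which leads beyond the height
      h.\<close>
    have "itr p (k * (j + i)) v = Some v" for k
      by (induction k) (simp_all add: itr_add[of p "j + i"] 1)
    moreover have "h \<le> h * (j + i)" using i by simp
    ultimately show False using none[OF \<open>v \<in> U\<close>] by (metis option.distinct(1))
  qed
  have lin: "(\<exists>k. itr p k v = Some u) \<or> (\<exists>k. itr p k u = Some v)"
    if "itr p i w = Some u" "itr p j w = Some v" for u v w i j
  proof (cases "i \<le> j")
    case True
    then show ?thesis using itr_add[of p "j - i" i w] that by auto
  next
    case False
    then show ?thesis using itr_add[of p "i - j" j w] that by auto
  qed
  have c: "card {u\<in>U. ancestor p u v} \<le> h" if v: "v \<in> U" for v
  proof -
    have "{u\<in>U. ancestor p u v} \<subseteq> (\<lambda>i. the (itr p i v)) ` {..<h}"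
    proof
      fix u assume "u \<in> {u\<in>U. ancestor p u v}"
      then obtain i where i: "itr p i v = Some u" unfolding ancestor_def by blast
      then have "i < h" using none[OF v, of i] by (metis not_le option.distinct(1))
      with i show "u \<in> (\<lambda>i. the (itr p i v)) ` {..<h}" by force
    qed
    from card_mono[OF _ this] show ?thesis using card_image_le[of "{..<h}" "\<lambda>i. the (itr p i v)"] by simp
  qed
  have r: "ancestor p u u" for u unfolding ancestor_def by (intro exI[of _ 0]) simp
  have tr: "ancestor p u w" if a: "ancestor p u v" "ancestor p v w" for u v w
  proof -
    obtain i j where "itr p i v = Some u" "itr p j w = Some v" using a unfolding ancestor_def by blast
    then have "itr p (i + j) w = Some u" by (simp add: itr_add)
    then show ?thesis unfolding ancestor_def by blast
  qed
  have an: "u = v" if "u \<in> U" "v \<in> U" "ancestor p u v" "ancestor p v u" for u v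
    using anti that unfolding ancestor_def by blast
  have li: "ancestor p u v \<or> ancestor p v u" if "ancestor p u w" "ancestor p v w" for u v w
    using lin that unfolding ancestor_def by blast
  show ?thesis unfolding torder_def
  proof (intro conjI ballI impI, goal_cases)
    case 1 show ?case by (rule r)
  next
    case 2 show ?case by (rule tr[OF 2(4,5)])
  next
    case 3 show ?case by (rule an[OF 3])
  next
    case 4 show ?case by (rule li[OF 4(4,5)])
  next
    case 5 then show ?case by (rule c)
  next
    case 6 then show ?case using e by blast
  qed
qed

text \<open>The elements below v form a chain, so among those different from v one has the largest
  down-set and lies above all others; it becomes the parent of v.\<close>

lemma elim_forest_torder:
  assumes U: "finite U" and t: "torder U E le h"
  shows "\<exists>p. elim_forest U E p h"
proof -
  define dn where "dn v = {u\<in>U. le u v}" for v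
  have fdn: "finite (dn v)" for v using U by (simp add: dn_def)
  have ex: "\<exists>u\<in>dn v - {v}. dn v = insert v (dn u) \<and> v \<notin> dn u" if v: "v \<in> U" and ne: "dn v - {v} \<noteq> {}" for v
  proof -
    have "finite (dn v - {v})" using fdn by simp
    then have "Max ((\<lambda>u. card (dn u)) ` (dn v - {v})) \<in> (\<lambda>u. card (dn u)) ` (dn v - {v})"
      using ne by (intro Max_in) auto
    then obtain u where u: "u \<in> dn v - {v}" "Max ((\<lambda>u. card (dn u)) ` (dn v - {v})) = card (dn u)" by blast
    have u2: "card (dn w) \<le> card (dn u)" if "w \<in> dn v - {v}" for w
      unfolding u(2)[symmetric] using that fdn by (intro Max_ge) auto
    have uU: "u \<in> U" "le u v" "u \<noteq> v" using u(1) by (auto simp: dn_def)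
    have "le w u" if w: "w \<in> dn v - {v}" for w
    proof (rule ccontr)
      have wU: "w \<in> U" "le w v" using w by (auto simp: dn_def)
      assume n: "\<not> le w u"
      then have uw: "le u w" using torderD(4)[OF t] uU wU v by blast
      then have "dn u \<subseteq> dn w" using torderD(2)[OF t] uU wU unfolding dn_def by blast
      then have "dn u = dn w" using card_seteq[OF fdn] u2[OF w] by blast
      then show False using n torderD(1)[OF t wU(1)] wU unfolding dn_def by blast
    qed
    then have "dn v \<subseteq> insert v (dn u)" by (auto simp: dn_def)
    moreover have "insert v (dn u) \<subseteq> dn v"
      using uU v torderD(1)[OF t v] torderD(2)[OF t _ uU(1) v _ uU(2)] by (auto simp: dn_def)
    ultimately have "dn v = insert v (dn u)" by blast
    moreover have "v \<notin> dn u" using torderD(3)[OF t] uU v unfolding dn_def by blast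
    ultimately show ?thesis using u(1) by blast
  qed
  define p where "p v = (if v \<in> U \<and> dn v - {v} \<noteq> {} then Some (SOME u. u \<in> dn v - {v} \<and> dn v = insert v (dn u) \<and> v \<notin> dn u) else None)" for v
  have p: "v \<in> U \<and> u \<in> U \<and> le u v \<and> dn v = insert v (dn u) \<and> v \<notin> dn u" if "p v = Some u" for u v
  proof -
    have v: "v \<in> U" "dn v - {v} \<noteq> {}" and u: "u = (SOME u. u \<in> dn v - {v} \<and> dn v = insert v (dn u) \<and> v \<notin> dn u)"
      using that by (auto simp: p_def split: if_splits)
    have "\<exists>u. u \<in> dn v - {v} \<and> dn v = insert v (dn u) \<and> v \<notin> dn u" using ex[OF v] by blast
    from someI_ex[OF this] show ?thesis unfolding u[symmetric] using v by (auto simp: dn_def)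
  qed
  have itr: "u \<in> U \<and> card (dn v) = card (dn u) + i" if "v \<in> U" "itr p i v = Some u" for u v i
    using that(2)
  proof (induction i arbitrary: u)
    case 0
    then show ?case using that by simp
  next
    case (Suc i)
    then obtain w where w: "itr p i v = Some w" "p w = Some u" by (auto split: option.splits)
    have "card (dn w) = Suc (card (dn u))" using p[OF w(2)] fdn by simp
    then show ?case using Suc.IH[OF w(1)] p[OF w(2)] by simp
  qed
  have anc: "ancestor p u v" if "u \<in> dn v" "v \<in> U" for u v
    using that
  proof (induction "card (dn v)" arbitrary: v rule: less_induct)
    case less
    show ?case
    proof (cases "u = v")
      case True
      then show ?thesis unfolding ancestor_def by (intro exI[of _ 0]) simp
    next
      case False
      then have "dn v - {v} \<noteq> {}" using less.prems by blast
      then obtain w where w: "p v = Some w" using less.prems by (simp add: p_def)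
      have "u \<in> dn w" "card (dn w) < card (dn v)" "w \<in> U" using p[OF w] less.prems False fdn by auto
      then obtain i where "itr p i w = Some u" using less.hyps unfolding ancestor_def by blast
      then have "itr p (i + 1) v = Some u" using w by (simp only: itr_add) simp
      then show ?thesis unfolding ancestor_def by blast
    qed
  qed
  have "itr p h v = None" if v: "v \<in> U" for v
  proof (rule ccontr)
    assume "itr p h v \<noteq> None"
    then obtain u where u: "itr p h v = Some u" by blast
    have "u \<in> dn u" using itr[OF v u] torderD(1)[OF t] unfolding dn_def by blast
    then have "0 < card (dn u)" using fdn by (auto simp: card_gt_0_iff)
    then show False using itr[OF v u] torderD(5)[OF t v] unfolding dn_def by simp
  qed
  moreover have "ancestor p u v \<or> ancestor p v u" if "u \<in> U" "v \<in> U" "E u v" for u v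
    using torderD(6)[OF t that] anc that unfolding dn_def by blast
  ultimately show ?thesis using itr unfolding elim_forest_def by (intro exI[of _ p]) blast
qed

text \<open>The usual order of the vertex numbers is a tree order of height \<open>card U\<close>,
  so the least height in the definition of \<open>treedepth\<close> is attained.\<close>

lemma treedepth_le_iff:
  assumes "finite U"
  shows "treedepth U E \<le> h \<longleftrightarrow> (\<exists>le. torder U E le h)"
proof
  have "torder U E (\<le>) (card U)"
    using assms unfolding torder_def by (auto intro: card_mono)
  then have "\<exists>h p. elim_forest U E p h" using elim_forest_torder[OF assms] by blast
  then have ex: "\<exists>p. elim_forest U E p (treedepth U E)"
    unfolding treedepth_def by (rule LeastI_ex)
  assume "treedepth U E \<le> h"
  from ex obtain p where "torder U E (ancestor p) (treedepth U E)" using torder_ancestor by blast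
  then have "torder U E (ancestor p) h"
    using \<open>treedepth U E \<le> h\<close> unfolding torder_def by (meson le_trans)
  then show "\<exists>le. torder U E le h" by blast
next
  assume "\<exists>le. torder U E le h"
  then show "treedepth U E \<le> h"
    unfolding treedepth_def using elim_forest_torder[OF assms] by (intro Least_le) blast
qed

section \<open>Connected components and a canonical decomposition\<close>

definition conn :: "(nat \<Rightarrow> nat \<Rightarrow> bool) \<Rightarrow> nat set \<Rightarrow> nat \<Rightarrow> nat set" where
  "conn E U v = {w. v \<in> U \<and> (\<lambda>x y. x \<in> U \<and> y \<in> U \<and> E x y)\<^sup>*\<^sup>* v w}"

lemma conn_sub: "conn E U v \<subseteq> U"
proof
  fix w assume "w \<in> conn E U v"
  then have "(\<lambda>x y. x \<in> U \<and> y \<in> U \<and> E x y)\<^sup>*\<^sup>* v w" "v \<in> U" unfolding conn_def by auto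
  then show "w \<in> U" by (induction rule: rtranclp_induct) auto
qed

lemma conn_self: "v \<in> U \<Longrightarrow> v \<in> conn E U v"
  by (simp add: conn_def)

lemma conn_step: "w \<in> conn E U v \<Longrightarrow> x \<in> U \<Longrightarrow> E w x \<Longrightarrow> x \<in> conn E U v"
  using conn_sub[of E U v] unfolding conn_def by (auto intro: rtranclp.rtrancl_into_rtrancl)

lemma conn_sym:
  assumes "\<And>x y. E x y \<Longrightarrow> E y x" "w \<in> conn E U v"
  shows "v \<in> conn E U w"
proof -
  let ?R = "\<lambda>x y. x \<in> U \<and> y \<in> U \<and> E x y"
  have "symp ?R" using assms(1) by (auto intro: sympI)
  then have "symp (?R\<^sup>*\<^sup>*)" by (rule symp_rtranclp)
  then show ?thesis using assms(2) conn_sub[of E U v] unfolding conn_def by (auto dest: sympD)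
qed

lemma conn_trans: "w \<in> conn E U v \<Longrightarrow> x \<in> conn E U w \<Longrightarrow> x \<in> conn E U v"
  unfolding conn_def by (auto intro: rtranclp_trans)

lemma conn_eq:
  assumes "\<And>x y. E x y \<Longrightarrow> E y x" "w \<in> conn E U v"
  shows "conn E U w = conn E U v"
  using conn_trans assms(2) conn_sym[OF assms] by blast

text \<open>A decomposition of treedepth h by recursion on h. Choosing the least admissible root of every component
  makes the resulting tree order definable.\<close>

primrec td_le :: "(nat \<Rightarrow> nat \<Rightarrow> bool) \<Rightarrow> nat \<Rightarrow> nat set \<Rightarrow> bool" where
  "td_le E 0 U \<longleftrightarrow> U = {}"
| "td_le E (Suc h) U \<longleftrightarrow> (\<forall>v\<in>U. \<exists>r\<in>conn E U v. td_le E h (conn E U v - {r}))"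

definition root :: "(nat \<Rightarrow> nat \<Rightarrow> bool) \<Rightarrow> nat \<Rightarrow> nat set \<Rightarrow> nat" where
  "root E h C = (LEAST r. r \<in> C \<and> td_le E h (C - {r}))"

primrec ord :: "(nat \<Rightarrow> nat \<Rightarrow> bool) \<Rightarrow> nat \<Rightarrow> nat set \<Rightarrow> nat \<Rightarrow> nat \<Rightarrow> bool" where
  "ord E 0 U u v \<longleftrightarrow> False"
| "ord E (Suc h) U u v \<longleftrightarrow> v \<in> U \<and> (u = root E h (conn E U v) \<or>
     v \<noteq> root E h (conn E U v) \<and> ord E h (conn E U v - {root E h (conn E U v)}) u v)"

text \<open>In a component, a vertex r of least depth lies below all others. On a walk from r, let y
  follow a vertex x that is above r: either y is above x, or y and r are both below x and hence
  comparable, and y below r contradicts the choice of r unless y = r. Deleting r therefore lowers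
  the height of the component.\<close>

lemma td_le_torder:
  assumes "finite U" "torder U E le h"
    and sym: "\<And>x y. E x y \<Longrightarrow> E y x"
  shows "td_le E h U"
  using assms(1,2)
proof (induction h arbitrary: U)
  case 0
  have "card {u\<in>U. le u v} \<noteq> 0" if "v \<in> U" for v
    using that 0 torderD(1)[OF 0(2) that] by auto
  then show ?case using torderD(5)[OF 0(2)] by auto
next
  case (Suc h)
  note t = Suc.prems(2)
  show ?case unfolding td_le.simps
  proof
    fix v assume v: "v \<in> U"
    let ?C = "conn E U v"
    have CU: "?C \<subseteq> U" by (rule conn_sub)
    define dn where "dn w = card {u\<in>U. le u w}" for w
    obtain r where r: "r \<in> ?C" "\<And>w. w \<in> ?C \<Longrightarrow> dn r \<le> dn w"
      using ex_has_least_nat[of "\<lambda>w. w \<in> ?C" v dn] conn_self[OF v] by blast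
    have rU: "r \<in> U" using r CU by blast
    have C: "?C = conn E U r" using conn_eq[OF sym r(1)] by simp
    have le: "le r w" if w: "w \<in> ?C" for w
    proof -
      have "w \<in> conn E U r" using w C by simp
      then have "(\<lambda>x y. x \<in> U \<and> y \<in> U \<and> E x y)\<^sup>*\<^sup>* r w" unfolding conn_def by blast
      then show ?thesis
      proof (induction rule: rtranclp_induct)
        case base
        show ?case using torderD(1)[OF t rU] .
      next
        case (step x y)
        then have xy: "x \<in> U" "y \<in> U" "E x y" by auto
        have "x \<in> conn E U r" using step.hyps(1) rU unfolding conn_def by blast
        then have "x \<in> ?C" using C by simp
        then have yC: "y \<in> ?C" using conn_step xy by blast
        from torderD(6)[OF t xy] show ?case
        proof
          assume "le x y" then show ?thesis using torderD(2)[OF t] step.IH rU xy by blast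
        next
          assume "le y x"
          then consider "le r y" | "le y r" using torderD(4)[OF t] step.IH rU xy by blast
          then show ?thesis
          proof cases
            case 2
            then have sub: "{u\<in>U. le u y} \<subseteq> {u\<in>U. le u r}" using torderD(2)[OF t] rU xy by blast
            have "{u\<in>U. le u y} = {u\<in>U. le u r}"
              by (rule card_seteq[OF _ sub]) (use Suc.prems(1) r(2)[OF yC] in \<open>auto simp: dn_def\<close>)
            then show ?thesis using torderD(1)[OF t rU] rU by blast
          qed
        qed
      qed
    qed
    have "torder (?C - {r}) E le h"
    proof (rule torder_subset[OF t])
      show "?C - {r} \<subseteq> U" using CU by blast
      fix w assume w: "w \<in> ?C - {r}"
      have "{u \<in> ?C - {r}. le u w} \<subseteq> {u\<in>U. le u w} - {r}" using CU by blast
      then have "card {u \<in> ?C - {r}. le u w} \<le> card ({u\<in>U. le u w} - {r})"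
        using Suc.prems(1) by (intro card_mono) auto
      also have "\<dots> = card {u\<in>U. le u w} - 1" using le[of w] w rU by (subst card_Diff_singleton) auto
      also have "\<dots> \<le> h" using torderD(5)[OF t, of w] w CU by auto
      finally show "card {u \<in> ?C - {r}. le u w} \<le> h" .
    qed
    then show "\<exists>r\<in>?C. td_le E h (?C - {r})" using Suc.IH[of "?C - {r}"] Suc.prems(1) CU r(1)
      by (meson finite_Diff finite_subset)
  qed
qed

lemma root_props:
  assumes "td_le E (Suc h) U" "v \<in> U"
  shows "root E h (conn E U v) \<in> conn E U v" "td_le E h (conn E U v - {root E h (conn E U v)})"
  using LeastI_ex[of "\<lambda>r. r \<in> conn E U v \<and> td_le E h (conn E U v - {r})"] assms unfolding root_def by auto

lemma ord_sub:
  assumes "td_le E h U" "ord E h U u v"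
  shows "u \<in> U \<and> v \<in> U"
  using assms
proof (induction h arbitrary: U)
  case (Suc h)
  then have v: "v \<in> U" by simp
  show ?case
  proof (cases "u = root E h (conn E U v)")
    case True
    then show ?thesis using root_props[OF Suc.prems(1) v] conn_sub v by blast
  next
    case False
    then have "ord E h (conn E U v - {root E h (conn E U v)}) u v" using Suc.prems by simp
    then show ?thesis using Suc.IH root_props[OF Suc.prems(1) v] conn_sub v by blast
  qed
qed simp

text \<open>Comparable vertices lie in one component and hence have the same root, so every order
  axiom reduces to the same axiom inside the component without its root.\<close>

lemma torder_ord:
  assumes U: "finite U" and td_le: "td_le E h U" and sym: "\<And>x y. E x y \<Longrightarrow> E y x"
  shows "torder U E (ord E h U) h"
  using U td_le
proof (induction h arbitrary: U)
  case 0
  then show ?case by (simp add: torder_def)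
next
  case (Suc h)
  define C where "C v = conn E U v" for v
  define r where "r v = root E h (C v)" for v
  have rC: "r v \<in> C v" and TDC: "td_le E h (C v - {r v})" if "v \<in> U" for v
    using root_props[OF Suc.prems(2) that] unfolding C_def r_def by auto
  have CU: "C v \<subseteq> U" for v unfolding C_def by (rule conn_sub)
  have IH: "torder (C v - {r v}) E (ord E h (C v - {r v})) h" if "v \<in> U" for v
    using Suc.IH[OF _ TDC[OF that]] CU Suc.prems(1) by (meson finite_Diff finite_subset)
  have o: "ord E (Suc h) U u v \<longleftrightarrow> v \<in> U \<and> (u = r v \<or> v \<noteq> r v \<and> ord E h (C v - {r v}) u v)" for u v
    by (simp add: C_def r_def)
  have Ceq: "C w = C v" if "w \<in> C v" for v w
    using conn_eq[of E w U v, OF sym] that unfolding C_def by blast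
  have req: "r w = r v" if "w \<in> C v" for v w using Ceq[OF that] unfolding r_def by simp
  have vC: "v \<in> C v" if "v \<in> U" for v using that conn_self unfolding C_def by blast
  have oC: "u \<in> C v" if uv: "ord E (Suc h) U u v" for u v
  proof -
    have v: "v \<in> U" and "u = r v \<or> ord E h (C v - {r v}) u v" using uv unfolding o by auto
    then show ?thesis using rC[OF v] ord_sub[OF TDC[OF v], of u v] by auto
  qed
  have osub: "u \<in> C v - {r v}" if "ord E h (C v - {r v}) u v" "v \<in> U" for u v
    using ord_sub[OF TDC[OF that(2)] that(1)] by blast
  show ?case unfolding torder_def
  proof (intro conjI ballI impI)
    fix u assume u: "u \<in> U"
    then show "ord E (Suc h) U u u" using o torderD(1)[OF IH[OF u]] vC[OF u] by blast
  next
    fix u v w assume U: "u \<in> U" "v \<in> U" "w \<in> U" and uv: "ord E (Suc h) U u v" and vw: "ord E (Suc h) U v w"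
    have vw': "v \<in> C w" using oC[OF vw] .
    have e: "C v = C w" "r v = r w" using Ceq[OF vw'] req[OF vw'] by (auto simp del: ord.simps)
    show "ord E (Suc h) U u w"
    proof (cases "u = r w")
      case True then show ?thesis using o U by blast
    next
      case False
      then have 1: "v \<noteq> r w" "ord E h (C w - {r w}) u v" using uv o e by (auto simp del: ord.simps)
      then have 2: "w \<noteq> r w" "ord E h (C w - {r w}) v w" using vw o by (auto simp del: ord.simps)
      have "u \<in> C w - {r w}" "v \<in> C w - {r w}" "w \<in> C w - {r w}"
        using ord_sub[OF TDC[OF U(3)]] 1 2 by blast+
      then show ?thesis using torderD(2)[OF IH[OF U(3)]] 1 2 o U by blast
    qed
  next
    fix u v assume U: "u \<in> U" "v \<in> U" and uv: "ord E (Suc h) U u v" and vu: "ord E (Suc h) U v u"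
    have u': "u \<in> C v" using oC[OF uv] .
    have e: "C u = C v" "r u = r v" using Ceq[OF u'] req[OF u'] by (auto simp del: ord.simps)
    show "u = v"
    proof (cases "u = r v \<or> v = r v")
      case True then show ?thesis using uv vu o e by (auto simp del: ord.simps)
    next
      case False
      then have "ord E h (C v - {r v}) u v" "ord E h (C v - {r v}) v u" using uv vu o e by (auto simp del: ord.simps)
      moreover have "u \<in> C v - {r v}" "v \<in> C v - {r v}" using False u' vC U by (auto simp del: ord.simps)
      ultimately show ?thesis using torderD(3)[OF IH[OF U(2)]] by blast
    qed
  next
    fix u v w assume U: "u \<in> U" "v \<in> U" "w \<in> U" and uw: "ord E (Suc h) U u w" and vw: "ord E (Suc h) U v w"
    have C: "u \<in> C w" "v \<in> C w" using oC uw vw by (auto simp del: ord.simps)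
    have e: "C u = C w" "r u = r w" "C v = C w" "r v = r w" using Ceq C req by (auto simp del: ord.simps)
    show "ord E (Suc h) U u v \<or> ord E (Suc h) U v u"
    proof (cases "u = r w \<or> v = r w")
      case True then show ?thesis using o U e by (auto simp del: ord.simps)
    next
      case False
      then have "ord E h (C w - {r w}) u w" "ord E h (C w - {r w}) v w" "w \<noteq> r w" using uw vw o by (auto simp del: ord.simps)
      moreover have "u \<in> C w - {r w}" "v \<in> C w - {r w}" "w \<in> C w - {r w}"
        using False C vC U calculation by (auto simp del: ord.simps)
      ultimately have "ord E h (C w - {r w}) u v \<or> ord E h (C w - {r w}) v u"
        using torderD(4)[OF IH[OF U(3)]] by blast
      then show ?thesis using o U e False by (auto simp del: ord.simps)
    qed
  next
    fix v assume v: "v \<in> U"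
    have fin: "finite {u \<in> C v - {r v}. ord E h (C v - {r v}) u v}"
      using Suc.prems(1) CU finite_subset[of _ U] by (auto intro: rev_finite_subset)
    have "card {u\<in>U. ord E (Suc h) U u v} \<le> card (insert (r v) {u \<in> C v - {r v}. v \<noteq> r v \<and> ord E h (C v - {r v}) u v})"
      using fin o osub v by (intro card_mono) (auto intro: rev_finite_subset)
    also have "\<dots> \<le> Suc (card {u \<in> C v - {r v}. v \<noteq> r v \<and> ord E h (C v - {r v}) u v})"
      by (rule card_insert_le_m1[THEN le_trans]) auto
    also have "card {u \<in> C v - {r v}. v \<noteq> r v \<and> ord E h (C v - {r v}) u v} \<le> h"
      using torderD(5)[OF IH[OF v], of v] vC[OF v] by (cases "v = r v") auto
    finally show "card {u\<in>U. ord E (Suc h) U u v} \<le> Suc h" by simp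
  next
    fix u v assume U: "u \<in> U" "v \<in> U" and E: "E u v"
    have u: "u \<in> C v" using conn_step[of v E U v u] conn_self[OF U(2)] U(1) sym[OF E] unfolding C_def by blast
    have e: "C u = C v" "r u = r v" using Ceq[OF u] req[OF u] by (auto simp del: ord.simps)
    show "ord E (Suc h) U u v \<or> ord E (Suc h) U v u"
    proof (cases "u = r v \<or> v = r v")
      case True then show ?thesis using o U e by (auto simp del: ord.simps)
    next
      case False
      then have "u \<in> C v - {r v}" "v \<in> C v - {r v}" using u vC U by (auto simp del: ord.simps)
      then show ?thesis using torderD(6)[OF IH[OF U(2)] _ _ E] o U e False by (auto simp del: ord.simps)
    qed
  qed
qed

section \<open>Blocking sets\<close>

definition indep :: "(nat \<Rightarrow> nat \<Rightarrow> bool) \<Rightarrow> nat set \<Rightarrow> bool" where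
  "indep E T \<longleftrightarrow> (\<forall>x\<in>T. \<forall>y\<in>T. \<not> E x y)"

definition alpha :: "(nat \<Rightarrow> nat \<Rightarrow> bool) \<Rightarrow> nat set \<Rightarrow> nat" where
  "alpha E S = Max (card ` {T. T \<subseteq> S \<and> indep E T})"

lemma indep_subset: "indep E T \<Longrightarrow> T' \<subseteq> T \<Longrightarrow> indep E T'"
  unfolding indep_def by blast

lemma finite_indep_subsets: "finite S \<Longrightarrow> finite {T. T \<subseteq> S \<and> indep E T}"
  by (rule finite_subset[of _ "Pow S"]) blast+

lemma alpha_ge: "finite S \<Longrightarrow> T \<subseteq> S \<Longrightarrow> indep E T \<Longrightarrow> card T \<le> alpha E S"
  unfolding alpha_def by (intro Max_ge finite_imageI finite_indep_subsets imageI CollectI conjI)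

lemma alpha_ex:
  assumes "finite S"
  shows "\<exists>T\<subseteq>S. indep E T \<and> card T = alpha E S"
proof -
  have "alpha E S \<in> card ` {T. T \<subseteq> S \<and> indep E T}"
    unfolding alpha_def
  proof (intro Max_in finite_imageI finite_indep_subsets assms)
    have "{} \<in> {T. T \<subseteq> S \<and> indep E T}" by (simp add: indep_def)
    then show "card ` {T. T \<subseteq> S \<and> indep E T} \<noteq> {}" by blast
  qed
  then obtain T where "alpha E S = card T" "T \<in> {T. T \<subseteq> S \<and> indep E T}" by (rule imageE)
  then show ?thesis by (intro exI[of _ T]) simp
qed

lemma alpha_le: "finite S \<Longrightarrow> (\<And>T. T \<subseteq> S \<Longrightarrow> indep E T \<Longrightarrow> card T \<le> n) \<Longrightarrow> alpha E S \<le> n"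
  by (metis alpha_ex)

lemma alpha_mono: "finite S \<Longrightarrow> S' \<subseteq> S \<Longrightarrow> alpha E S' \<le> alpha E S"
  by (rule alpha_le) (auto intro: alpha_ge finite_subset)

lemma alpha_card: "finite S \<Longrightarrow> alpha E S \<le> card S"
  by (rule alpha_le) (auto intro: card_mono)

lemma alpha_empty [simp]: "alpha E {} = 0"
  using alpha_card[of "{}" E] by simp

lemma alpha_insert_le: "finite S \<Longrightarrow> alpha E (insert v S) \<le> Suc (alpha E S)"
proof (rule alpha_le)
  fix T assume S: "finite S" and T: "T \<subseteq> insert v S" "indep E T"
  have "card (T - {v}) \<le> alpha E S"
    using S T by (intro alpha_ge) (auto simp: indep_def)
  moreover have "card T \<le> Suc (card (T - {v}))"
    using card_insert_le_m1[of "Suc (card (T - {v}))" "T - {v}" v] S finite_subset[OF T(1)]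
    by (cases "v \<in> T") (auto simp: insert_absorb)
  ultimately show "card T \<le> Suc (alpha E S)" by simp
qed simp

lemma alpha_vertex:
  assumes S: "finite S" "v \<in> S" and E: "\<And>x y. E x y \<Longrightarrow> E y x" "\<not> E v v"
  shows "alpha E S = max (alpha E (S - {v})) (Suc (alpha E (S - {v} - {w. E v w})))"
proof (rule antisym)
  show "alpha E S \<le> max (alpha E (S - {v})) (Suc (alpha E (S - {v} - {w. E v w})))"
  proof (rule alpha_le[OF S(1)])
    fix T assume T: "T \<subseteq> S" "indep E T"
    show "card T \<le> max (alpha E (S - {v})) (Suc (alpha E (S - {v} - {w. E v w})))"
    proof (cases "v \<in> T")
      case True
      have "card (T - {v}) \<le> alpha E (S - {v} - {w. E v w})"
        using S T True by (intro alpha_ge) (auto simp: indep_def)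
      moreover have "card T = Suc (card (T - {v}))"
        using True T S by (metis card_Suc_Diff1 finite_subset)
      ultimately show ?thesis by simp
    next
      case False
      then have "card T \<le> alpha E (S - {v})" using S T by (intro alpha_ge) auto
      then show ?thesis by simp
    qed
  qed
  obtain T where T: "T \<subseteq> S - {v} - {w. E v w}" "indep E T" "card T = alpha E (S - {v} - {w. E v w})"
    using alpha_ex[of "S - {v} - {w. E v w}" E] S by blast
  have "card (insert v T) \<le> alpha E S"
    using T S E by (intro alpha_ge) (auto simp: indep_def)
  moreover have "card (insert v T) = Suc (card T)"
    using T S by (intro card_insert_disjoint) (auto intro: finite_subset)
  ultimately show "max (alpha E (S - {v})) (Suc (alpha E (S - {v} - {w. E v w}))) \<le> alpha E S"
    using T alpha_mono[of S "S - {v}" E] S by auto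
qed

lemma alpha_partition:
  assumes S: "finite S" "finite L" "g ` S \<subseteq> L" and E: "\<And>x y. x \<in> S \<Longrightarrow> y \<in> S \<Longrightarrow> E x y \<Longrightarrow> g x = g y"
  shows "alpha E S = (\<Sum>l\<in>L. alpha E {x\<in>S. g x = l})"
proof (rule antisym)
  show "alpha E S \<le> (\<Sum>l\<in>L. alpha E {x\<in>S. g x = l})"
  proof (rule alpha_le[OF S(1)])
    fix T assume T: "T \<subseteq> S" "indep E T"
    have "T = (\<Union>l\<in>L. {x\<in>T. g x = l})" using T S by auto
    then have "card T = card (\<Union>l\<in>L. {x\<in>T. g x = l})" by simp
    also have "\<dots> = (\<Sum>l\<in>L. card {x\<in>T. g x = l})"
      using S finite_subset[OF T(1) S(1)] by (intro card_UN_disjoint) auto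
    also have "\<dots> \<le> (\<Sum>l\<in>L. alpha E {x\<in>S. g x = l})"
      using S T by (intro sum_mono alpha_ge) (auto intro: indep_subset)
    finally show "card T \<le> \<dots>" .
  qed
  have "\<exists>T. T \<subseteq> {x\<in>S. g x = l} \<and> indep E T \<and> card T = alpha E {x\<in>S. g x = l}" for l
  proof -
    have "finite {x\<in>S. g x = l}" using S(1) by simp
    from alpha_ex[OF this] show ?thesis .
  qed
  then obtain T where T: "\<And>l. T l \<subseteq> {x\<in>S. g x = l}" "\<And>l. indep E (T l)" "\<And>l. card (T l) = alpha E {x\<in>S. g x = l}"
    by metis
  have "(\<Sum>l\<in>L. alpha E {x\<in>S. g x = l}) = (\<Sum>l\<in>L. card (T l))" using T(3) by simp
  also have "\<dots> = card (\<Union>l\<in>L. T l)"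
  proof (rule card_UN_disjoint[symmetric])
    show "\<forall>i\<in>L. finite (T i)" using finite_subset[OF T(1)] S(1) by simp
    show "\<forall>i\<in>L. \<forall>j\<in>L. i \<noteq> j \<longrightarrow> T i \<inter> T j = {}" using T(1) by blast
  qed (rule S)
  also have "\<dots> \<le> alpha E S"
  proof (rule alpha_ge[OF S(1)])
    show "(\<Union>l\<in>L. T l) \<subseteq> S" using T(1) by blast
    show "indep E (\<Union>l\<in>L. T l)" unfolding indep_def
    proof (intro ballI notI)
      fix x y assume "x \<in> (\<Union>l\<in>L. T l)" "y \<in> (\<Union>l\<in>L. T l)" and e: "E x y"
      then obtain l l' where l: "x \<in> T l" "y \<in> T l'" by blast
      then have "x \<in> S" "y \<in> S" "g x = l" "g y = l'" using T(1) by blast+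
      then have "l = l'" using E e by blast
      then show False using l e T(2)[of l] unfolding indep_def by blast
    qed
  qed
  finally show "(\<Sum>l\<in>L. alpha E {x\<in>S. g x = l}) \<le> alpha E S" .
qed

text \<open>The subsets S' make the notion hereditary. The step for a new root needs this: it
  applies the bound to the graph without the root, without the neighbours of the root, and without a
  blocking set found earlier.\<close>

definition blocking :: "(nat \<Rightarrow> nat \<Rightarrow> bool) \<Rightarrow> nat \<Rightarrow> nat set \<Rightarrow> bool" where
  "blocking E b S \<longleftrightarrow> (\<forall>S'\<subseteq>S. \<forall>Y. alpha E (S' - Y) < alpha E S' \<longrightarrow>
     (\<exists>Y'\<subseteq>Y. finite Y' \<and> card Y' \<le> b \<and> alpha E (S' - Y') < alpha E S'))"

lemma blocking_D:
  assumes "blocking E b S" "S' \<subseteq> S" "alpha E (S' - Y) < alpha E S'"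
  shows "\<exists>Y'\<subseteq>Y. finite Y' \<and> card Y' \<le> b \<and> alpha E (S' - Y') < alpha E S'"
  using assms(1)[unfolded blocking_def, rule_format, OF assms(2,3)] .

text \<open>The independence number is a sum over the classes, so it drops exactly when it drops in
  some class, and blocking that class is enough.\<close>

lemma blocking_partition:
  assumes S: "finite S" and E: "\<And>x y. x \<in> S \<Longrightarrow> y \<in> S \<Longrightarrow> E x y \<Longrightarrow> g x = g y"
    and B: "\<And>v. v \<in> S \<Longrightarrow> blocking E b {x\<in>S. g x = g v}"
  shows "blocking E b S"
  unfolding blocking_def
proof (intro allI impI)
  fix S' Y assume S': "S' \<subseteq> S" and a: "alpha E (S' - Y) < alpha E S'"
  let ?L = "g ` S"
  have fin: "finite S'" "finite ?L" using S S' finite_subset by auto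
  have part: "alpha E (S' - Z) = (\<Sum>l\<in>?L. alpha E ({x\<in>S'. g x = l} - Z))" for Z
  proof -
    have "{x \<in> S' - Z. g x = l} = {x\<in>S'. g x = l} - Z" for l by blast
    moreover have "alpha E (S' - Z) = (\<Sum>l\<in>?L. alpha E {x \<in> S' - Z. g x = l})"
      using S' fin E by (intro alpha_partition) auto
    ultimately show ?thesis by simp
  qed
  have "\<exists>l\<in>?L. alpha E ({x\<in>S'. g x = l} - Y) < alpha E {x\<in>S'. g x = l}"
  proof (rule ccontr)
    assume "\<not> ?thesis"
    then have "(\<Sum>l\<in>?L. alpha E ({x\<in>S'. g x = l} - {})) \<le> (\<Sum>l\<in>?L. alpha E ({x\<in>S'. g x = l} - Y))"
      by (intro sum_mono) auto
    then show False using a part[of Y] part[of "{}"] by simp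
  qed
  then obtain v where v: "v \<in> S" "alpha E ({x\<in>S'. g x = g v} - Y) < alpha E {x\<in>S'. g x = g v}" by blast
  have "{x\<in>S'. g x = g v} \<subseteq> {x\<in>S. g x = g v}" using S' by blast
  from blocking_D[OF B[OF v(1)] this v(2)] obtain Y' where Y': "Y' \<subseteq> Y" "finite Y'" "card Y' \<le> b"
    "alpha E ({x\<in>S'. g x = g v} - Y') < alpha E {x\<in>S'. g x = g v}" by blast
  have "(\<Sum>l\<in>?L. alpha E ({x\<in>S'. g x = l} - Y')) < (\<Sum>l\<in>?L. alpha E ({x\<in>S'. g x = l} - {}))"
    using Y'(4) v(1) fin by (intro sum_strict_mono_ex1) (auto intro!: alpha_mono)
  then have "alpha E (S' - Y') < alpha E S'" using part[of Y'] part[of "{}"] by simp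
  then show "\<exists>Y'\<subseteq>Y. finite Y' \<and> card Y' \<le> b \<and> alpha E (S' - Y') < alpha E S'" using Y' by blast
qed

text \<open>With H the rest of S' and W the neighbours of r, a largest independent set has
  max(\<alpha>(H), 1 + \<alpha>(H - W)) vertices, according to whether it avoids r. If one
  alternative is strictly larger, lowering it alone is enough. On a tie both must drop. If r may be
  deleted, r and b further vertices do; otherwise two sets of size b do, and one of them can be
  taken to contain a neighbour of r, which need not be deleted. This is the origin of b + 1 and 2b -
  1.\<close>

lemma blocking_vertex:
  assumes S: "finite S" and E: "\<And>x y. E x y \<Longrightarrow> E y x" "\<And>x. \<not> E x x" and B: "blocking E b (S - {r})"
  shows "blocking E (max (2 * b - 1) (b + 1)) S"
  unfolding blocking_def
proof (intro allI impI)
  fix S' Y assume S': "S' \<subseteq> S" and Y: "alpha E (S' - Y) < alpha E S'"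
  let ?K = "max (2 * b - 1) (b + 1)"
  have fin: "finite S'" using S S' finite_subset by blast
  show "\<exists>Y'\<subseteq>Y. finite Y' \<and> card Y' \<le> ?K \<and> alpha E (S' - Y') < alpha E S'"
  proof (cases "r \<in> S'")
    case False
    then have "S' \<subseteq> S - {r}" using S' by blast
    from blocking_D[OF B this Y] obtain Y' where "Y' \<subseteq> Y" "finite Y'" "card Y' \<le> b" "alpha E (S' - Y') < alpha E S'"
      by blast
    then show ?thesis by (intro exI[of _ Y']) auto
  next
    case True
    have "S' - (Y \<inter> S') = S' - Y" by blast
    then have Y1: "Y \<inter> S' \<subseteq> Y \<inter> S' \<and> alpha E (S' - (Y \<inter> S')) < alpha E S'" using Y by simp
    \<comment> \<open>A blocking set of least size: any blocking subset of it with at most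
      \<open>?K\<close> elements bounds its own size.\<close>
    obtain Y0 where Y0: "Y0 \<subseteq> Y \<inter> S'" "alpha E (S' - Y0) < alpha E S'"
      and least: "\<forall>Z. Z \<subseteq> Y \<inter> S' \<and> alpha E (S' - Z) < alpha E S' \<longrightarrow> card Y0 \<le> card Z"
      using ex_has_least_nat[of "\<lambda>Z. Z \<subseteq> Y \<inter> S' \<and> alpha E (S' - Z) < alpha E S'", OF Y1, of card]
      by (elim exE conjE)
    have mini: "card Y0 \<le> card Z" if "Z \<subseteq> Y \<inter> S'" "alpha E (S' - Z) < alpha E S'" for Z
      using least[rule_format, OF conjI[OF that]] .
    have fY0: "finite Y0" using Y0 fin finite_subset by blast
    have enough: "card Y0 \<le> ?K" if "Z \<subseteq> Y0" "alpha E (S' - Z) < alpha E S'" "card Z \<le> ?K" for Z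
      using mini[of Z] that Y0 by (meson le_trans order_trans)
    define H where "H = S' - {r}"
    define W where "W = {w. E r w}"
    have fH: "finite H" and HS: "H \<subseteq> S - {r}" using fin S' by (auto simp: H_def)
    let ?A = "alpha E H" and ?B = "alpha E (H - W)"
    have aS: "alpha E S' = max ?A (Suc ?B)"
      unfolding H_def W_def using fin True E by (intro alpha_vertex) auto
    have aY: "alpha E (S' - Z) = max (alpha E (H - Z)) (Suc (alpha E (H - W - Z)))" if "r \<notin> Z" for Z
    proof -
      have "S' - Z - {r} = H - Z" "S' - Z - {r} - {w. E r w} = H - W - Z" by (auto simp: H_def W_def)
      then show ?thesis using alpha_vertex[of "S' - Z" r E] fin True E that by auto
    qed
    have aYr: "alpha E (S' - insert r Z) = alpha E (H - Z)" for Z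
    proof -
      have "S' - insert r Z = H - Z" by (auto simp: H_def)
      then show ?thesis by simp
    qed
    have HW: "H - W \<subseteq> S - {r}" using HS by blast
    have m: "alpha E T \<le> alpha E T'" if "T \<subseteq> T'" "T' \<subseteq> H" for T T'
      using that fH by (intro alpha_mono) (auto intro: finite_subset)
    have AB: "?B \<le> ?A" by (rule m) auto
    have HY0: "alpha E (H - Y0) \<le> alpha E (S' - Y0)" using fin by (intro alpha_mono) (auto simp: H_def)
    have "card Y0 \<le> ?K"
    proof (cases ?A "Suc ?B" rule: linorder_cases)
      case greater
      then have "alpha E (H - Y0) < ?A" using HY0 Y0(2) aS by simp
      from blocking_D[OF B HS this] obtain Z where Z: "Z \<subseteq> Y0" "finite Z" "card Z \<le> b" "alpha E (H - Z) < ?A" by blast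
      have "alpha E (S' - Z) < alpha E S'"
      proof (cases "r \<in> Z")
        case True
        then show ?thesis using aYr[of Z] Z aS by (simp add: insert_absorb)
      next
        case False
        have "alpha E (H - W - Z) \<le> ?B" by (rule m) auto
        then show ?thesis using aY[OF False] Z aS greater by simp
      qed
      then show ?thesis using enough[OF Z(1)] Z by simp
    next
      case less
      show ?thesis
      proof (cases "r \<in> Y0")
        case True
        have "alpha E (S' - {r}) < alpha E S'" using less aS aYr[of "{}"] by simp
        then show ?thesis using enough[of "{r}"] True by simp
      next
        case False
        then have "alpha E (H - W - Y0) < ?B" using aY[OF False] Y0(2) aS less by simp
        from blocking_D[OF B HW this] obtain Z where Z: "Z \<subseteq> Y0" "finite Z" "card Z \<le> b" "alpha E (H - W - Z) < ?B" by blast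
        have "r \<notin> Z" using False Z by blast
        moreover have "alpha E (H - Z) \<le> ?A" by (rule m) auto
        ultimately have "alpha E (S' - Z) < alpha E S'" using aY[of Z] Z aS less by simp
        then show ?thesis using enough[OF Z(1)] Z by simp
      qed
    next
      case equal
      then have aS': "alpha E S' = ?A" using aS by simp
      have "alpha E (H - Y0) < ?A" using HY0 Y0(2) aS' by simp
      from blocking_D[OF B HS this] obtain Z where Z: "Z \<subseteq> Y0" "finite Z" "card Z \<le> b" "alpha E (H - Z) < ?A" by blast
      show ?thesis
      proof (cases "r \<in> Y0")
        case True
        have "alpha E (S' - insert r Z) < alpha E S'" using aYr[of Z] Z aS' by simp
        moreover have "card (insert r Z) \<le> b + 1" using Z card_insert_le_m1[of "Suc b" Z r] by simp
        ultimately show ?thesis using enough[of "insert r Z"] True Z by simp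
      next
        case r: False
        have HWY: "alpha E (H - W - Y0) < ?B" using aY[OF r] Y0(2) aS' equal by simp
        show ?thesis
        proof (cases "alpha E (H - Y0) + 2 \<le> ?A")
          case True
          \<comment> \<open>Putting back one vertex raises the number for H by at most one, so H
            stays blocked. By minimality the other alternative must recover, whichever vertex is put
            back; hence no proper subset of \<open>Y0\<close> blocks \<open>H - W\<close>.\<close>
          have y: "?B \<le> alpha E (H - W - (Y0 - {y}))" if "y \<in> Y0" for y
          proof -
            have "alpha E (H - (Y0 - {y})) \<le> alpha E (insert y (H - Y0))"
              using fH by (intro alpha_mono) auto
            also have "\<dots> \<le> Suc (alpha E (H - Y0))" using fH by (intro alpha_insert_le) auto
            finally have 1: "alpha E (H - (Y0 - {y})) < ?A" using True by simp
            have "\<not> alpha E (S' - (Y0 - {y})) < alpha E S'"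
              using mini[of "Y0 - {y}"] Y0(1) card_Diff1_less[OF fY0 that] by auto
            then show ?thesis using aY[of "Y0 - {y}"] r 1 aS' equal by auto
          qed
          from blocking_D[OF B HW HWY] obtain D where D: "D \<subseteq> Y0" "finite D" "card D \<le> b" "alpha E (H - W - D) < ?B" by blast
          have "D = Y0"
          proof (rule ccontr)
            assume "D \<noteq> Y0"
            then obtain y where "y \<in> Y0" "y \<notin> D" using D by blast
            then have "H - W - (Y0 - {y}) \<subseteq> H - W - D" using D by blast
            then have "alpha E (H - W - (Y0 - {y})) \<le> alpha E (H - W - D)" by (rule m) auto
            then show False using y[OF \<open>y \<in> Y0\<close>] D by simp
          qed
          then show ?thesis using D by simp
        next
          case False
          \<comment> \<open>Here \<open>Y0\<close> and \<open>Z\<close> both lower H by exactly one,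
            down to \<alpha>(H - W). Deleting W and \<open>Y0\<close> lowers \<open>H - Z\<close>
            further, and so does some D of size b inside their union. D cannot lie within
            \<open>Y0\<close>, so at most b - 1 of its vertices have to be added to
            \<open>Z\<close>; the others are neighbours of r.\<close>
          have HZ: "alpha E (H - Y0) \<le> alpha E (H - Z)" using Z by (intro m) auto
          then have eq: "alpha E (H - Z) = ?B" "alpha E (H - Y0) = ?B" using False Z(4) equal by simp_all
          have "H - Z - (W \<union> Y0) = H - W - Y0" using Z by blast
          then have "alpha E (H - Z - (W \<union> Y0)) < alpha E (H - Z)" using HWY eq by simp
          moreover have "H - Z \<subseteq> S - {r}" using HS by blast
          ultimately obtain D where D: "D \<subseteq> W \<union> Y0" "finite D" "card D \<le> b" "alpha E (H - Z - D) < alpha E (H - Z)"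
            using blocking_D[OF B] by metis
          have "\<not> D \<subseteq> Y0"
          proof
            assume "D \<subseteq> Y0"
            then have "alpha E (H - Y0) \<le> alpha E (H - Z - D)" using Z by (intro m) auto
            then show False using D eq by simp
          qed
          then have "D \<inter> Y0 \<subset> D" by blast
          then have cD: "card (D \<inter> Y0) < b" using D psubset_card_mono[OF D(2)] by (metis le_trans less_le_trans)
          let ?Z = "Z \<union> (D \<inter> Y0)"
          have "card ?Z \<le> 2 * b - 1" using card_Un_le[of Z "D \<inter> Y0"] Z(3) cD by linarith
          moreover have "alpha E (S' - ?Z) < alpha E S'"
          proof -
            have "alpha E (H - ?Z) \<le> alpha E (H - Z)" by (rule m) auto
            moreover have "alpha E (H - W - ?Z) \<le> alpha E (H - Z - D)" using D by (intro m) auto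
            moreover have "r \<notin> ?Z" using r Z by blast
            ultimately show ?thesis using aY[of ?Z] D eq equal aS' by simp
          qed
          ultimately show ?thesis using enough[of ?Z] Z by simp
        qed
      qed
    qed
    then show ?thesis using Y0 fY0 by blast
  qed
qed

text \<open>The values are 0, 1, 2, 3, 5, 9, ...: from height 3 on the tie case of the vertex step
  dominates, up to the constant a doubling per level.\<close>

primrec block_size :: "nat \<Rightarrow> nat" where
  "block_size 0 = 0"
| "block_size (Suc h) = max (2 * block_size h - 1) (block_size h + 1)"

lemma block_size_eq: "block_size (Suc (Suc h)) = 2 ^ h + 1"
  by (induction h) auto

lemma blocking_td_le:
  assumes "finite S" "td_le E h S" and E: "\<And>x y. E x y \<Longrightarrow> E y x" "\<And>x. \<not> E x x"
  shows "blocking E (block_size h) S"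
  using assms(1,2)
proof (induction h arbitrary: S)
  case 0
  then show ?case by (auto simp: blocking_def)
next
  case (Suc h)
  show ?case
  proof (rule blocking_partition[where g = "conn E S"])
    fix x y assume "x \<in> S" "y \<in> S" "E x y"
    then show "conn E S x = conn E S y"
      using conn_eq[of E y S x, OF E(1)] conn_step[of x E S x y] conn_self[of x S E] by simp
  next
    fix v assume v: "v \<in> S"
    have eq: "{x\<in>S. conn E S x = conn E S v} = conn E S v"
    proof (intro set_eqI iffI)
      fix x assume "x \<in> conn E S v"
      then show "x \<in> {x\<in>S. conn E S x = conn E S v}"
        using conn_eq[of E x S v, OF E(1)] conn_sub[of E S v] by auto
    next
      fix x assume "x \<in> {x\<in>S. conn E S x = conn E S v}"
      then show "x \<in> conn E S v" using conn_self[of x S E] by simp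
    qed
    obtain r where "r \<in> conn E S v" "td_le E h (conn E S v - {r})" using Suc.prems v by auto
    moreover have fin: "finite (conn E S v)" by (rule finite_subset[OF conn_sub Suc.prems(1)])
    ultimately have "blocking E (block_size h) (conn E S v - {r})" by (intro Suc.IH) auto
    from blocking_vertex[OF fin E this] show "blocking E (block_size (Suc h)) {x\<in>S. conn E S x = conn E S v}"
      unfolding eq by simp
  qed (rule Suc.prems)
qed

lemma alpha_Un_le:
  assumes "finite A" "finite B" shows "alpha E (A \<union> B) \<le> alpha E A + alpha E B"
proof (rule alpha_le)
  fix T assume T: "T \<subseteq> A \<union> B" "indep E T"
  have "card T = card ((T \<inter> A) \<union> (T - A))" by (rule arg_cong[of _ _ card]) blast
  also have "\<dots> \<le> card (T \<inter> A) + card (T - A)" by (rule card_Un_le)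
  also have "\<dots> \<le> alpha E A + alpha E B"
    using assms T by (intro add_mono alpha_ge) (auto simp: indep_def)
  finally show "card T \<le> alpha E A + alpha E B" .
qed (use assms in simp)

lemma alpha_UN_le:
  assumes "finite P" "\<And>p. p \<in> P \<Longrightarrow> finite (C p)"
  shows "alpha E (\<Union>p\<in>P. C p) \<le> (\<Sum>p\<in>P. alpha E (C p))"
  using assms
proof (induction P rule: finite_induct)
  case (insert p P)
  have "alpha E (\<Union>q\<in>insert p P. C q) \<le> alpha E (C p) + alpha E (\<Union>p\<in>P. C p)"
    using insert.hyps insert.prems by (auto intro: alpha_Un_le)
  then show ?case using insert by auto
qed simp

section \<open>Crowns\<close>

definition nbrs :: "(nat \<Rightarrow> nat \<Rightarrow> bool) \<Rightarrow> nat set \<Rightarrow> nat set" where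
  "nbrs E Z = {w. \<exists>z\<in>Z. E z w}"

text \<open>Let S be a largest independent set of the graph without the pieces of Q. Dropping one
  vertex from every conflicting chunk contained in S allows all pieces of R, those of Q included, to
  be filled to their full independence number. The loss is paid for by \<open>f\<close>: each such
  chunk has a piece of its own in \<open>R - Q\<close>, on which S fell short by at least
  one.\<close>

lemma crown:
  fixes C :: "nat \<Rightarrow> nat set" and ch :: "nat \<Rightarrow> nat set" and E :: "nat \<Rightarrow> nat \<Rightarrow> bool"
  defines "conf \<equiv> \<lambda>y p. alpha E (C p - nbrs E (ch y)) < alpha E (C p)"
  assumes fin: "finite P" "finite M" "finite K" "\<And>p. p \<in> P \<Longrightarrow> finite (C p)"
    and disj: "\<And>p. p \<in> P \<Longrightarrow> M \<inter> C p = {}" "\<And>p q. p \<in> P \<Longrightarrow> q \<in> P \<Longrightarrow> p \<noteq> q \<Longrightarrow> C p \<inter> C q = {}"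
    and sep: "\<And>p q x y. p \<in> P \<Longrightarrow> q \<in> P \<Longrightarrow> p \<noteq> q \<Longrightarrow> x \<in> C p \<Longrightarrow> y \<in> C q \<Longrightarrow> \<not> E x y"
    and sym: "\<And>x y. E x y \<Longrightarrow> E y x"
    and compl: "\<And>p Z. p \<in> P \<Longrightarrow> Z \<subseteq> M \<Longrightarrow> alpha E (C p - nbrs E Z) < alpha E (C p) \<Longrightarrow>
      \<exists>y\<in>K. ch y \<subseteq> Z \<and> conf y p"
    and R: "R \<subseteq> P" "Q \<subseteq> R"
    and f: "\<And>y p. y \<in> K \<Longrightarrow> p \<in> R \<Longrightarrow> conf y p \<Longrightarrow> f y \<in> R - Q \<and> conf y (f y)"
      "inj_on f {y\<in>K. \<exists>p\<in>R. conf y p}"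
  shows "alpha E (M \<union> (\<Union>p\<in>P. C p)) = alpha E (M \<union> (\<Union>p\<in>P - Q. C p)) + (\<Sum>p\<in>Q. alpha E (C p))"
proof (rule antisym)
  have fR: "finite R" and fQ: "finite Q" using R fin(1) by (auto intro: finite_subset)
  have QP: "Q \<subseteq> P" using R by blast
  have "M \<union> (\<Union>p\<in>P. C p) = (M \<union> (\<Union>p\<in>P - Q. C p)) \<union> (\<Union>p\<in>Q. C p)" using QP by blast
  moreover have "finite (M \<union> (\<Union>p\<in>P - Q. C p))" "finite (\<Union>p\<in>Q. C p)" using fin fQ QP by auto
  ultimately have "alpha E (M \<union> (\<Union>p\<in>P. C p)) \<le> alpha E (M \<union> (\<Union>p\<in>P - Q. C p)) + alpha E (\<Union>p\<in>Q. C p)"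
    using alpha_Un_le by metis
  also have "alpha E (\<Union>p\<in>Q. C p) \<le> (\<Sum>p\<in>Q. alpha E (C p))" using fQ fin(4) QP by (intro alpha_UN_le) auto
  finally show "alpha E (M \<union> (\<Union>p\<in>P. C p)) \<le> alpha E (M \<union> (\<Union>p\<in>P - Q. C p)) + (\<Sum>p\<in>Q. alpha E (C p))" by simp

  obtain S where S: "S \<subseteq> M \<union> (\<Union>p\<in>P - Q. C p)" "indep E S" "card S = alpha E (M \<union> (\<Union>p\<in>P - Q. C p))"
    using alpha_ex[of "M \<union> (\<Union>p\<in>P - Q. C p)" E] fin by auto
  have fS: "finite S" using S(1) fin by (auto intro: finite_subset)
  define K1 where "K1 = {y\<in>K. ch y \<subseteq> S \<inter> M \<and> (\<exists>p\<in>R. conf y p)}"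
  have fK1: "finite K1" using fin by (simp add: K1_def)
  have "\<exists>x. x \<in> ch y" if y: "y \<in> K1" for y
  proof -
    obtain p where "conf y p" using y unfolding K1_def by blast
    then have "ch y \<noteq> {}" by (auto simp: conf_def nbrs_def)
    then show ?thesis by blast
  qed
  then obtain h where h: "\<And>y. y \<in> K1 \<Longrightarrow> h y \<in> ch y" by metis
  \<comment> \<open>One vertex of every harmful chunk is given up. By \<open>compl\<close>, a
    remaining conflict would come from a chunk inside \<open>S1\<close>, but that chunk has lost a
    vertex.\<close>
  define S1 where "S1 = S \<inter> M - h ` K1"
  have aR: "alpha E (C p - nbrs E S1) = alpha E (C p)" if p: "p \<in> R" for p
  proof (rule ccontr)
    assume "\<not> ?thesis"
    then have "alpha E (C p - nbrs E S1) < alpha E (C p)"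
      using alpha_mono[of "C p" "C p - nbrs E S1" E] fin(4) R p by (simp add: le_neq_implies_less subsetD)
    then obtain y where y: "y \<in> K" "ch y \<subseteq> S1" "conf y p"
      using compl[of p S1] R p unfolding S1_def by blast
    then have "y \<in> K1" using p unfolding K1_def S1_def by blast
    then have "h y \<in> S1" "h y \<notin> S1" using h y unfolding S1_def by auto
    then show False by blast
  qed
  have "\<exists>T. T \<subseteq> C p - nbrs E S1 \<and> indep E T \<and> card T = alpha E (C p)" if p: "p \<in> R" for p
    using alpha_ex[of "C p - nbrs E S1" E] aR[OF p] fin(4)[of p] p R by auto
  then obtain I where I: "\<And>p. p \<in> R \<Longrightarrow> I p \<subseteq> C p - nbrs E S1" "\<And>p. p \<in> R \<Longrightarrow> indep E (I p)"
    "\<And>p. p \<in> R \<Longrightarrow> card (I p) = alpha E (C p)" by metis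
  define J where "J p = (if p \<in> R then I p else S \<inter> C p)" for p
  have JC: "J p \<subseteq> C p" for p using I(1) unfolding J_def by auto
  have J1: "\<not> E x y" if "x \<in> S1" "y \<in> J p" "p \<in> P" for x y p
  proof (cases "p \<in> R")
    case True
    then have "y \<notin> nbrs E S1" using I(1)[OF True] that(2) unfolding J_def by auto
    then show ?thesis using that(1) unfolding nbrs_def by blast
  next
    case False
    then have "x \<in> S" "y \<in> S" using that unfolding J_def S1_def by auto
    then show ?thesis using S(2) unfolding indep_def by blast
  qed
  have JJ: "\<not> E x y" if "x \<in> J p" "y \<in> J q" "p \<in> P" "q \<in> P" for x y p q
  proof (cases "p = q")
    case True
    have "indep E (J p)" using I(2) S(2) unfolding J_def by (auto intro: indep_subset)
    then show ?thesis using that True unfolding indep_def by blast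
  next
    case False
    then show ?thesis using sep[of p q x y] that JC by blast
  qed
  have "indep E S1" using S(2) unfolding S1_def by (rule indep_subset) blast
  then have ind: "indep E (S1 \<union> (\<Union>p\<in>P. J p))"
    unfolding indep_def using J1 JJ sym by blast
  have fJ: "finite (J p)" if "p \<in> P" for p using JC fin(4)[OF that] by (rule finite_subset)
  have fS1: "finite S1" using fS by (simp add: S1_def)
  have "S1 \<union> (\<Union>p\<in>P. J p) \<subseteq> M \<union> (\<Union>p\<in>P. C p)" using JC unfolding S1_def by blast
  then have "card (S1 \<union> (\<Union>p\<in>P. J p)) \<le> alpha E (M \<union> (\<Union>p\<in>P. C p))"
    using ind fin by (intro alpha_ge) auto
  moreover have "card (S1 \<union> (\<Union>p\<in>P. J p)) = card S1 + (\<Sum>p\<in>P. card (J p))"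
  proof -
    have "S1 \<inter> (\<Union>p\<in>P. J p) = {}" using JC disj(1) unfolding S1_def by blast
    then have "card (S1 \<union> (\<Union>p\<in>P. J p)) = card S1 + card (\<Union>p\<in>P. J p)"
      using fS1 fJ fin(1) by (intro card_Un_disjoint) auto
    also have "card (\<Union>p\<in>P. J p) = (\<Sum>p\<in>P. card (J p))"
      using fJ fin(1) JC disj(2) by (intro card_UN_disjoint) blast+
    finally show ?thesis .
  qed
  moreover have "(\<Sum>p\<in>P. card (J p)) = (\<Sum>p\<in>P - R. card (S \<inter> C p)) + (\<Sum>p\<in>R - Q. alpha E (C p)) + (\<Sum>p\<in>Q. alpha E (C p))"
  proof -
    have "(\<Sum>p\<in>P. card (J p)) = (\<Sum>p\<in>P - R. card (J p)) + (\<Sum>p\<in>R. card (J p))"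
      by (rule sum.subset_diff[OF R(1) fin(1)])
    also have "(\<Sum>p\<in>P - R. card (J p)) = (\<Sum>p\<in>P - R. card (S \<inter> C p))" by (intro sum.cong) (auto simp: J_def)
    also have "(\<Sum>p\<in>R. card (J p)) = (\<Sum>p\<in>R. alpha E (C p))" using I(3) by (intro sum.cong) (auto simp: J_def)
    also have "\<dots> = (\<Sum>p\<in>R - Q. alpha E (C p)) + (\<Sum>p\<in>Q. alpha E (C p))" by (rule sum.subset_diff[OF R(2) fR])
    finally show ?thesis by simp
  qed
  moreover have "card S = card (S \<inter> M) + (\<Sum>p\<in>P - R. card (S \<inter> C p)) + (\<Sum>p\<in>R - Q. card (S \<inter> C p))"
  proof -
    have "card S = card ((S \<inter> M) \<union> (\<Union>p\<in>P - Q. S \<inter> C p))"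
      using S(1) by (intro arg_cong[of _ _ card]) blast
    also have "\<dots> = card (S \<inter> M) + card (\<Union>p\<in>P - Q. S \<inter> C p)"
      using fS fin(1) disj(1) by (intro card_Un_disjoint) auto
    also have "card (\<Union>p\<in>P - Q. S \<inter> C p) = (\<Sum>p\<in>P - Q. card (S \<inter> C p))"
      using fS fin(1) disj(2) by (intro card_UN_disjoint) blast+
    also have "\<dots> = (\<Sum>p\<in>P - Q - (R - Q). card (S \<inter> C p)) + (\<Sum>p\<in>R - Q. card (S \<inter> C p))"
      using R fin(1) by (intro sum.subset_diff) auto
    also have "P - Q - (R - Q) = P - R" using R by blast
    finally show ?thesis by simp
  qed
  moreover have "card (S \<inter> M) \<le> card S1 + card K1"
  proof -
    have "card (S \<inter> M) \<le> card (S1 \<union> h ` K1)" using fS1 fK1 unfolding S1_def by (intro card_mono) auto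
    also have "\<dots> \<le> card S1 + card (h ` K1)" by (rule card_Un_le)
    finally show ?thesis using card_image_le[OF fK1, of h] by linarith
  qed
  moreover have "(\<Sum>p\<in>R - Q. card (S \<inter> C p)) + card K1 \<le> (\<Sum>p\<in>R - Q. alpha E (C p))"
  proof -
    have fK: "f ` K1 \<subseteq> R - Q" using f(1) unfolding K1_def by blast
    have "inj_on f K1" using f(2) by (rule inj_on_subset) (auto simp: K1_def)
    then have "card K1 = card (f ` K1)" by (simp add: card_image)
    also have "\<dots> = card ((R - Q) \<inter> f ` K1)" using fK by (intro arg_cong[of _ _ card]) blast
    also have "\<dots> = (\<Sum>p\<in>R - Q. of_bool (p \<in> f ` K1))" using fR by (simp add: of_bool_def sum.If_cases)
    finally have "(\<Sum>p\<in>R - Q. card (S \<inter> C p)) + card K1 = (\<Sum>p\<in>R - Q. card (S \<inter> C p) + of_bool (p \<in> f ` K1))"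
      by (simp add: sum.distrib)
    also have "\<dots> \<le> (\<Sum>p\<in>R - Q. alpha E (C p))"
    proof (rule sum_mono)
      fix p assume p: "p \<in> R - Q"
      then have fC: "finite (C p)" using fin(4) R by blast
      show "card (S \<inter> C p) + of_bool (p \<in> f ` K1) \<le> alpha E (C p)"
      proof (cases "p \<in> f ` K1")
        case True
        then obtain y where y: "y \<in> K1" "p = f y" by blast
        then have c: "conf y p" "ch y \<subseteq> S" using f(1) unfolding K1_def by blast+
        have "S \<inter> C p \<subseteq> C p - nbrs E (ch y)" using c(2) S(2) unfolding nbrs_def indep_def by blast
        then have "card (S \<inter> C p) \<le> alpha E (C p - nbrs E (ch y))"
          using fC S(2) by (intro alpha_ge) (auto intro: indep_subset)
        then show ?thesis using c(1) True unfolding conf_def by simp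
      next
        case False
        have "card (S \<inter> C p) \<le> alpha E (C p)" using fC S(2) by (intro alpha_ge) (auto intro: indep_subset)
        then show ?thesis using False by simp
      qed
    qed
    finally show ?thesis .
  qed
  ultimately show "alpha E (M \<union> (\<Union>p\<in>P - Q. C p)) + (\<Sum>p\<in>Q. alpha E (C p)) \<le> alpha E (M \<union> (\<Union>p\<in>P. C p))"
    using S(3) by linarith
qed

text \<open>B t v y means that v bids for y at time t. The price of y is the number of bids made for it, and its
  owner is the last bidder. The first bidder without an object bids for its cheapest object, as long
  as this costs less than p. With p beyond the number of bidders some price is not attained, and the
  objects above this gap are those of the crown.\<close>

definition price :: "nat \<Rightarrow> (nat \<Rightarrow> nat \<Rightarrow> nat \<Rightarrow> bool) \<Rightarrow> nat \<Rightarrow> nat \<Rightarrow> nat" where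
  "price n B t y = (\<Sum>s<t. \<Sum>v<n. of_bool (B s v y))"

definition owns :: "nat \<Rightarrow> (nat \<Rightarrow> nat \<Rightarrow> nat \<Rightarrow> bool) \<Rightarrow> nat \<Rightarrow> nat \<Rightarrow> nat \<Rightarrow> bool" where
  "owns n B t v y \<longleftrightarrow> (\<exists>s<t. B s v y \<and> (\<forall>s'<t. s < s' \<longrightarrow> (\<forall>v'<n. \<not> B s' v' y)))"

definition active :: "nat \<Rightarrow> nat \<Rightarrow> nat \<Rightarrow> (nat \<Rightarrow> bool) \<Rightarrow> (nat \<Rightarrow> nat \<Rightarrow> bool) \<Rightarrow> (nat \<Rightarrow> nat \<Rightarrow> nat \<Rightarrow> bool) \<Rightarrow> nat \<Rightarrow> nat \<Rightarrow> bool" where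
  "active n m p P rel B t v \<longleftrightarrow> P v \<and> \<not> (\<exists>y<m. owns n B t v y) \<and> (\<exists>y<m. rel v y \<and> price n B t y < p)"

definition bid :: "nat \<Rightarrow> nat \<Rightarrow> nat \<Rightarrow> (nat \<Rightarrow> bool) \<Rightarrow> (nat \<Rightarrow> nat \<Rightarrow> bool) \<Rightarrow> (nat \<Rightarrow> nat \<Rightarrow> nat \<Rightarrow> bool) \<Rightarrow> nat \<Rightarrow> nat \<Rightarrow> nat \<Rightarrow> bool" where
  "bid n m p P rel B t v y \<longleftrightarrow> active n m p P rel B t v \<and> (\<forall>v'<v. \<not> active n m p P rel B t v') \<and> rel v y \<and>
     (\<forall>y'<m. rel v y' \<longrightarrow> price n B t y < price n B t y' \<or> price n B t y = price n B t y' \<and> y \<le> y')"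

text \<open>The bids are only assumed to satisfy an equation with \<open>B\<close> on both sides; it
  is a recursion because a bid at time t depends on earlier bids only. The condition
  \<open>m * p < T\<close> leaves time for every object to reach the price p.\<close>

locale auction =
  fixes n m p T :: nat and P :: "nat \<Rightarrow> bool" and rel :: "nat \<Rightarrow> nat \<Rightarrow> bool" and B :: "nat \<Rightarrow> nat \<Rightarrow> nat \<Rightarrow> bool"
  assumes B: "B t v y \<longleftrightarrow> t < T \<and> v < n \<and> y < m \<and> bid n m p P rel B t v y"
    and Pn: "\<And>v. P v \<Longrightarrow> v < n" and np: "n < p" and T: "m * p < T"
begin

abbreviation "pr \<equiv> price n B"
abbreviation "ow \<equiv> owns n B"
abbreviation "ac \<equiv> active n m p P rel B"

lemma BD: "B t v y \<Longrightarrow> v < n \<and> y < m \<and> bid n m p P rel B t v y"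
  by (drule B[THEN iffD1]) blast

lemma B_unique:
  assumes "B t v y" "B t v' y'" shows "v = v' \<and> y = y'"
proof -
  note a = assms[THEN BD, unfolded bid_def]
  have "v = v'" using a linorder_neqE_nat by blast
  then have "y \<le> y'" "y' \<le> y" using a by (metis less_asym order_refl less_imp_neq)+
  then show ?thesis using \<open>v = v'\<close> by simp
qed

lemma pr_Suc: "pr (Suc t) y = pr t y + of_bool (\<exists>v. B t v y)"
proof -
  have "(\<Sum>v<n. of_bool (B t v y)) = (of_bool (\<exists>v. B t v y) :: nat)"
  proof (cases "\<exists>v. B t v y")
    case True
    then obtain v where v: "B t v y" by blast
    then have "v < n" using BD by blast
    have "(\<Sum>v<n. of_bool (B t v y)) = (\<Sum>v\<in>{v}. of_bool (B t v y) :: nat)"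
      using \<open>v < n\<close> B_unique[OF v] by (intro sum.mono_neutral_right) auto
    then show ?thesis using v by auto
  qed auto
  then show ?thesis by (simp add: price_def)
qed

lemma ow_Suc: "ow (Suc t) v y \<longleftrightarrow> B t v y \<or> ow t v y \<and> (\<forall>v'. \<not> B t v' y)"
proof -
  have 1: "(\<forall>v'. \<not> B t v' y) \<longleftrightarrow> (\<forall>v'<n. \<not> B t v' y)" using BD by blast
  show ?thesis unfolding 1 owns_def by (auto simp: less_Suc_eq)
qed

lemma ow_props: "ow t v y \<Longrightarrow> P v \<and> y < m \<and> rel v y \<and> v < n"
  unfolding owns_def using BD by (fastforce simp: bid_def active_def)

lemma ow_fun: "ow t v y \<Longrightarrow> ow t v' y \<Longrightarrow> v = v'"
  by (induction t) (auto simp: ow_Suc owns_def[of _ _ 0] dest: B_unique)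

lemma not_ow_bidder: "B t v y \<Longrightarrow> \<not> ow t v y'"
  using ow_props[of t v y'] BD[of t v y] by (auto simp: bid_def active_def)

text \<open>Only bidders without an object bid, so nobody acquires a second one.\<close>

lemma ow_inj: "ow t v y \<Longrightarrow> ow t v y' \<Longrightarrow> y = y'"
proof (induction t)
  case (Suc t)
  then show ?case using B_unique not_ow_bidder unfolding ow_Suc by blast
qed (simp add: owns_def)

lemma ow_ex: "0 < pr t y \<Longrightarrow> \<exists>v. ow t v y"
proof (induction t)
  case (Suc t)
  then show ?case unfolding ow_Suc pr_Suc by (cases "\<exists>v. B t v y") auto
qed (simp add: price_def)

lemma pr_mono: "pr t y \<le> pr (Suc t) y"
  by (simp add: pr_Suc)

text \<open>When v made the bid that it still holds, the object was a cheapest one for v and rose by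
  one; its price has not changed since, and other prices never fall.\<close>

lemma ow_price: "ow t v y \<Longrightarrow> y' < m \<Longrightarrow> rel v y' \<Longrightarrow> pr t y \<le> Suc (pr t y')"
proof (induction t)
  case (Suc t)
  show ?case
  proof (cases "B t v y")
    case True
    then have "pr t y \<le> pr t y'" using Suc.prems BD[of t v y] by (auto simp: bid_def)
    then show ?thesis using pr_mono[of t y'] by (auto simp: pr_Suc)
  next
    case False
    then have o: "ow t v y" "\<forall>v'. \<not> B t v' y" using Suc.prems(1) unfolding ow_Suc by auto
    have "pr (Suc t) y = pr t y" using o(2) by (simp add: pr_Suc)
    then show ?thesis using Suc.IH[OF o(1) Suc.prems(2,3)] pr_mono[of t y'] by simp
  qed
qed (simp add: owns_def)

lemma pr_le: "pr t y \<le> p"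
proof (induction t)
  case (Suc t)
  show ?case
  proof (cases "\<exists>v. B t v y")
    case True
    then obtain v where v: "bid n m p P rel B t v y" using BD by blast
    then obtain y0 where "y0 < m" "rel v y0" "pr t y0 < p" unfolding bid_def active_def by blast
    then have "pr t y < p" using v unfolding bid_def by fastforce
    then show ?thesis using True by (simp add: pr_Suc)
  qed (use Suc in \<open>simp add: pr_Suc\<close>)
qed (simp add: price_def)

lemma bid_ex:
  assumes "ac t v" "t < T" shows "\<exists>v y. B t v y"
proof -
  obtain v where v: "ac t v" "\<And>v'. v' < v \<Longrightarrow> \<not> ac t v'"
    using LeastI[of "ac t" v, OF assms(1)] not_less_Least[of _ "ac t"] by blast
  then obtain y0 where y0: "y0 < m \<and> rel v y0" unfolding active_def by blast
  obtain y1 where y1: "y1 < m \<and> rel v y1" "\<And>y. y < m \<and> rel v y \<Longrightarrow> pr t y1 \<le> pr t y"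
    using ex_has_least_nat[of "\<lambda>y. y < m \<and> rel v y", OF y0, of "pr t"] by blast
  let ?Q = "\<lambda>y. y < m \<and> rel v y \<and> pr t y = pr t y1"
  have y: "?Q (Least ?Q)" using LeastI[of ?Q y1] y1(1) by blast
  have "pr t (Least ?Q) < pr t y' \<or> pr t (Least ?Q) = pr t y' \<and> Least ?Q \<le> y'" if "y' < m" "rel v y'" for y'
    using y1(2)[of y'] y that Least_le[of ?Q y'] by (cases "pr t y' = pr t y1") auto
  then have "bid n m p P rel B t v (Least ?Q)" using v y unfolding bid_def by blast
  moreover have "v < n" using v(1) Pn unfolding active_def by blast
  ultimately have "B t v (Least ?Q)" using y assms(2) by (intro B[THEN iffD2]) blast
  then show ?thesis by blast
qed

lemma inactive_Suc:
  assumes "\<And>v. \<not> ac t v" shows "\<not> ac (Suc t) v"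
proof -
  have nb: "\<not> B t v y" for v y using assms BD by (auto simp: bid_def)
  have "pr (Suc t) y = pr t y" for y using nb by (simp add: pr_Suc)
  moreover have "ow (Suc t) v y = ow t v y" for v y using nb by (simp add: ow_Suc)
  ultimately have "ac (Suc t) v = ac t v" by (simp add: active_def)
  then show ?thesis using assms by simp
qed

text \<open>Each bid raises the sum of the prices by one and no price exceeds p, so there are at
  most \<open>m * p\<close> bids. Once nobody is active, nobody becomes active again.\<close>

lemma inactive_T: "\<not> ac T v"
proof
  assume "ac T v"
  have act: "\<exists>v. ac t v" if "t \<le> T" for t
  proof (rule ccontr)
    assume n: "\<nexists>v. ac t v"
    have "\<forall>v. \<not> ac T v" using that
    proof (induction rule: dec_induct)
      case base show ?case using n by blast
    next
      case (step i) then show ?case using inactive_Suc by blast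
    qed
    then show False using \<open>ac T v\<close> by blast
  qed
  have "(\<Sum>y<m. pr t y) = t" if "t \<le> T" for t
    using that
  proof (induction t)
    case 0 show ?case by (simp add: price_def)
  next
    case (Suc t)
    then obtain v y where vy: "B t v y" using act[of t] bid_ex by (meson Suc_leD Suc_le_lessD)
    then have "y < m" using BD by blast
    have "{..<m} \<inter> {y. \<exists>v. B t v y} = {y}"
    proof (intro set_eqI iffI)
      fix y' assume "y' \<in> {..<m} \<inter> {y. \<exists>v. B t v y}"
      then obtain v' where "B t v' y'" by blast
      then show "y' \<in> {y}" using B_unique[OF vy] by simp
    next
      fix y' assume "y' \<in> {y}"
      then show "y' \<in> {..<m} \<inter> {y. \<exists>v. B t v y}" using \<open>y < m\<close> vy by blast
    qed
    then have "(\<Sum>y<m. of_bool (\<exists>v. B t v y)) = (1::nat)" by (simp add: of_bool_def sum.If_cases)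
    then show ?case using Suc by (simp add: pr_Suc sum.distrib)
  qed
  from this[of T] have "T = (\<Sum>y<m. pr T y)" by simp
  also have "\<dots> \<le> m * p" using sum_bounded_above[of "{..<m}" "pr T" p] pr_le by simp
  finally show False using T by simp
qed

definition Q :: "nat set" where
  "Q = {v. P v \<and> (\<forall>y<m. \<not> ow T v y)}"

text \<open>Let q be a price that is not attained. R consists of the unserved bidders and the owners
  of objects dearer than q. An unserved bidder is inactive and sees only prices of at least p; by
  \<open>ow_price\<close>, the owner of an object dearer than q sees only prices of at least q. In
  both cases the prices exceed q, so all objects wanted by R have owners, and these belong to
  R.\<close>

lemma crown_ex:
  "\<exists>R f. Q \<subseteq> R \<and> R \<subseteq> Collect P \<and> (\<forall>y<m. \<forall>v\<in>R. rel v y \<longrightarrow> f y \<in> R - Q \<and> rel (f y) y) \<and>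
     inj_on f {y. y < m \<and> (\<exists>v\<in>R. rel v y)}"
proof -
  let ?Y = "{y. y < m \<and> 0 < pr T y}"
  define ownr where "ownr y = (SOME v. ow T v y)" for y
  have o: "ow T (ownr y) y" if "0 < pr T y" for y
    using someI_ex[OF ow_ex[OF that]] unfolding ownr_def .
  have inj: "inj_on ownr ?Y" using o ow_inj unfolding inj_on_def by (metis (mono_tags, lifting) mem_Collect_eq)
  \<comment> \<open>Objects of positive price have distinct owners, so at most n positive prices
    occur, fewer than p.\<close>
  have "card ?Y = card (ownr ` ?Y)" by (simp add: card_image inj)
  also have "\<dots> \<le> card {..<n}" using o ow_props by (intro card_mono) auto
  finally have "card ?Y \<le> n" by simp
  then have "card (pr T ` ?Y) < card {1..p}" using card_image_le[of ?Y "pr T"] np by simp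
  then have "\<not> {1..p} \<subseteq> pr T ` ?Y" using card_mono[of "pr T ` ?Y" "{1..p}"] by auto
  then obtain q where "q \<in> {1..p}" and q3: "q \<notin> pr T ` ?Y" unfolding subset_iff by blast
  then have q: "1 \<le> q" "q \<le> p" by simp_all
  have gap: "pr T y \<noteq> q" if "y < m" for y
  proof
    assume e: "pr T y = q"
    then have "y \<in> ?Y" using that q by simp
    then show False using q3 e by blast
  qed
  let ?R = "Q \<union> {v. \<exists>y<m. ow T v y \<and> q < pr T y}"
  have high: "q < pr T y" if hyp: "v \<in> ?R" "y < m" "rel v y" for v y
  proof (cases "v \<in> Q")
    case True
    then have "\<not> (pr T y < p)" using inactive_T[of v] hyp unfolding active_def Q_def by blast
    then show ?thesis using q gap[OF hyp(2)] by linarith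
  next
    case False
    then obtain y0 where "ow T v y0" "q < pr T y0" using hyp by blast
    then show ?thesis using ow_price[of T v y0 y] hyp gap[OF hyp(2)] by linarith
  qed
  show ?thesis
  proof (intro exI[of _ ?R] exI[of _ ownr] conjI allI impI ballI)
    show "?R \<subseteq> Collect P" using ow_props unfolding Q_def by blast
    fix y v assume y: "y < m" "v \<in> ?R" "rel v y"
    have h: "q < pr T y" using high y by blast
    then have oy: "ow T (ownr y) y" using o by simp
    show "rel (ownr y) y" using ow_props[OF oy] by blast
    show "ownr y \<in> ?R - Q" using oy y(1) h unfolding Q_def by blast
  next
    show "inj_on ownr {y. y < m \<and> (\<exists>v\<in>?R. rel v y)}"
      using inj by (rule inj_on_subset) (use high in fastforce)
  qed simp
qed

text \<open>Served bidders own distinct objects. In the application this bounds the surviving pieces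
  by the number of chunks.\<close>

lemma card_matched: "card {v. P v \<and> v \<notin> Q} \<le> card {y. y < m \<and> (\<exists>v. P v \<and> rel v y)}"
proof -
  define g where "g v = (SOME y. ow T v y)" for v
  have g: "ow T v (g v)" if "P v" "v \<notin> Q" for v
  proof -
    have "\<exists>y. ow T v y" using that unfolding Q_def by blast
    from someI_ex[OF this] show ?thesis unfolding g_def .
  qed
  have "inj_on g {v. P v \<and> v \<notin> Q}" using g ow_fun unfolding inj_on_def by (metis (mono_tags, lifting) mem_Collect_eq)
  moreover have "g ` {v. P v \<and> v \<notin> Q} \<subseteq> {y. y < m \<and> (\<exists>v. P v \<and> rel v y)}" using g ow_props by blast
  ultimately show ?thesis by (intro card_inj_on_le) auto
qed

end

section \<open>One level of the forest\<close>

text \<open>Nonempty sets of at most b vertices are coded by b base-n digits, with repetitions.\<close>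

fun decode_set :: "nat \<Rightarrow> nat \<Rightarrow> nat \<Rightarrow> nat set" where
  "decode_set n 0 y = {}"
| "decode_set n (Suc b) y = insert (y mod n) (decode_set n b (y div n))"

text \<open>The vertex u fills the digits left over when Z has fewer than b elements, so it may
  enter the decoded set; for chunks u is a vertex that they contain anyway.\<close>

lemma decode_set_ex:
  assumes "u < n" "Z \<subseteq> {..<n}" "card Z \<le> b" "finite Z"
  shows "\<exists>y<n ^ b. Z \<subseteq> decode_set n b y \<and> decode_set n b y \<subseteq> insert u Z"
  using assms(2-)
proof (induction b arbitrary: Z)
  case 0
  then show ?case by auto
next
  case (Suc b)
  obtain z Z' where z: "z < n" "Z' \<subseteq> {..<n}" "card Z' \<le> b" "finite Z'" "Z \<subseteq> insert z Z'" "insert z Z' \<subseteq> insert u Z" "Z' \<subseteq> Z"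
  proof (cases "Z = {}")
    case True
    then show ?thesis using that[of u "{}"] assms(1) by auto
  next
    case False
    then obtain z where z: "z \<in> Z" by blast
    have "z < n" "Z - {z} \<subseteq> {..<n}" using z Suc.prems by blast+
    moreover have "card (Z - {z}) \<le> b" using z Suc.prems by simp
    ultimately show ?thesis using z Suc.prems(3) by (intro that[of z "Z - {z}"]) blast+
  qed
  from Suc.IH[OF z(2-4)] obtain y where y: "y < n ^ b" "Z' \<subseteq> decode_set n b y" "decode_set n b y \<subseteq> insert u Z'" by blast
  have "z + n * y < n ^ Suc b"
  proof -
    have "z + n * y < n + n * y" using z(1) by simp
    also have "\<dots> = n * Suc y" by simp
    also have "\<dots> \<le> n * n ^ b" using y(1) by (intro mult_le_mono2) simp
    finally show ?thesis by simp
  qed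
  moreover have "decode_set n (Suc b) (z + n * y) = insert z (decode_set n b y)" using z(1) by simp
  moreover have "Z \<subseteq> insert z (decode_set n b y)" by (rule order_trans[OF z(5) insert_mono[OF y(2)]])
  moreover have "insert z (decode_set n b y) \<subseteq> insert u Z"
  proof (rule insert_subsetI)
    show "z \<in> insert u Z" using z(6) by simp
    show "decode_set n b y \<subseteq> insert u Z" by (rule order_trans[OF y(3) insert_mono[OF z(7)]])
  qed
  ultimately show ?case by (intro exI[of _ "z + n * y"]) simp
qed

lemma digits_inj: "inj_on (\<lambda>y::nat. (y mod n, y div n)) S"
  by (rule inj_onI) (metis mod_div_decomp prod.inject)

lemma div_less_power: "y < n ^ Suc b \<Longrightarrow> y div n < (n::nat) ^ b"
  by (simp add: less_mult_imp_div_less mult.commute)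

lemma finite_Collect_conj_less: "finite {y. y < (k::nat) \<and> Q y}"
  by (rule finite_subset[of _ "{..<k}"]) auto

lemma card_decode_set: "finite A \<Longrightarrow> card {y. y < n ^ b \<and> decode_set n b y \<subseteq> A} \<le> card A ^ b"
proof (induction b)
  case 0
  have "{y::nat. y < 1} = {0}" by auto
  then show ?case by simp
next
  case (Suc b)
  let ?S = "{y. y < n ^ Suc b \<and> decode_set n (Suc b) y \<subseteq> A}"
  have "card ?S = card ((\<lambda>y. (y mod n, y div n)) ` ?S)" by (rule card_image[symmetric]) (rule digits_inj)
  also have "\<dots> \<le> card (A \<times> {y. y < n ^ b \<and> decode_set n b y \<subseteq> A})"
    using Suc.prems by (intro card_mono finite_cartesian_product finite_Collect_conj_less) (auto intro: div_less_power[simplified])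
  also have "\<dots> \<le> card A ^ Suc b" using Suc by (simp add: card_cartesian_product)
  finally show ?case .
qed

section \<open>Depths, subtrees and chunks in a tree order\<close>

definition dep :: "nat set \<Rightarrow> (nat \<Rightarrow> nat \<Rightarrow> bool) \<Rightarrow> nat \<Rightarrow> nat" where
  "dep U le v = card {u\<in>U. le u v \<and> u \<noteq> v}"

definition piece :: "(nat \<Rightarrow> nat \<Rightarrow> bool) \<Rightarrow> nat set \<Rightarrow> nat \<Rightarrow> nat set" where
  "piece le R v = {w\<in>R. le v w}"

definition level :: "nat set \<Rightarrow> (nat \<Rightarrow> nat \<Rightarrow> bool) \<Rightarrow> nat set \<Rightarrow> nat \<Rightarrow> nat set" where
  "level U le R i = {v\<in>R. dep U le v = i}"

definition low :: "nat set \<Rightarrow> (nat \<Rightarrow> nat \<Rightarrow> bool) \<Rightarrow> nat set \<Rightarrow> nat \<Rightarrow> nat set" where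
  "low U le R i = {v\<in>R. dep U le v < i}"

definition up :: "(nat \<Rightarrow> nat \<Rightarrow> bool) \<Rightarrow> nat set \<Rightarrow> nat \<Rightarrow> nat set" where
  "up le R u = {w\<in>R. u \<in> R \<and> le w u}"

text \<open>The lowest digit may be any vertex of M_i. Each of the other b digits is chosen from X
  and from the path ending in that vertex, at most k + d choices. This replaces a factor |M_i|^b by
  (k + d)^b.\<close>

definition chunk :: "nat \<Rightarrow> nat set \<Rightarrow> nat set \<Rightarrow> (nat \<Rightarrow> nat \<Rightarrow> bool) \<Rightarrow> nat set \<Rightarrow> nat \<Rightarrow> nat \<Rightarrow> nat \<Rightarrow> bool" where
  "chunk n X U le R i b y \<longleftrightarrow> y mod n \<in> X \<union> low U le R i \<and> decode_set n b (y div n) \<subseteq> X \<union> up le R (y mod n)"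

definition blocked_by :: "nat \<Rightarrow> (nat \<Rightarrow> nat \<Rightarrow> bool) \<Rightarrow> nat set \<Rightarrow> nat set \<Rightarrow> (nat \<Rightarrow> nat \<Rightarrow> bool) \<Rightarrow> nat set \<Rightarrow> nat \<Rightarrow> nat \<Rightarrow> nat \<Rightarrow> nat \<Rightarrow> bool" where
  "blocked_by n E X U le R i b v y \<longleftrightarrow> v \<in> level U le R i \<and> chunk n X U le R i b y \<and>
     alpha E (piece le R v - nbrs E (decode_set n (Suc b) y)) < alpha E (piece le R v)"

locale forest =
  fixes n d :: nat and E :: "nat \<Rightarrow> nat \<Rightarrow> bool" and X :: "nat set" and U :: "nat set" and le :: "nat \<Rightarrow> nat \<Rightarrow> bool"
  assumes E: "\<And>x y. E x y \<Longrightarrow> x < n \<and> y < n \<and> x \<noteq> y \<and> E y x"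
    and X: "X \<subseteq> {..<n}" and U: "U = {..<n} - X" and t: "torder U E le d"
begin

abbreviation "dp \<equiv> dep U le"

lemma finU: "finite U" and finX: "finite X"
  using X finite_subset by (auto simp: U)

lemma dep_card: "v \<in> U \<Longrightarrow> card {u\<in>U. le u v} = Suc (dp v)"
proof -
  assume v: "v \<in> U"
  have "{u\<in>U. le u v} = insert v {u\<in>U. le u v \<and> u \<noteq> v}" using v torderD(1)[OF t v] by auto
  then show ?thesis using finU by (simp add: dep_def)
qed

lemma dep_less: "v \<in> U \<Longrightarrow> dp v < d"
  using torderD(5)[OF t, of v] dep_card[of v] by simp

lemma dep_mono: "u \<in> U \<Longrightarrow> v \<in> U \<Longrightarrow> le u v \<Longrightarrow> u \<noteq> v \<Longrightarrow> dp u < dp v"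
proof -
  assume u: "u \<in> U" and v: "v \<in> U" and uv: "le u v" "u \<noteq> v"
  have "\<not> le v u" using torderD(3)[OF t u v] uv by blast
  then have "{w\<in>U. le w u} \<subset> {w\<in>U. le w v}"
    using torderD(2)[OF t _ u v _ uv(1)] torderD(1)[OF t v] v by blast
  then have "card {w\<in>U. le w u} < card {w\<in>U. le w v}" using finU by (intro psubset_card_mono) auto
  then show ?thesis using dep_card u v by simp
qed

lemma dep_mono_le: "u \<in> U \<Longrightarrow> v \<in> U \<Longrightarrow> le u v \<Longrightarrow> dp u \<le> dp v"
  using dep_mono[of u v] by (cases "u = v") auto

text \<open>Depth is strictly increasing along the chain below w, so its \<open>Suc (dp w)\<close>
  elements take every value up to \<open>dp w\<close>.\<close>

lemma anc_at:
  assumes w: "w \<in> U" and i: "i \<le> dp w"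
  shows "\<exists>v\<in>U. le v w \<and> dp v = i"
proof -
  let ?D = "{u\<in>U. le u w}"
  have "inj_on dp ?D"
  proof (rule inj_onI)
    fix u v assume u: "u \<in> ?D" and v: "v \<in> ?D" and e: "dp u = dp v"
    then have "le u v \<or> le v u" using torderD(4)[OF t] w by blast
    then show "u = v" using dep_mono[of u v] dep_mono[of v u] u v e by auto
  qed
  then have "card (dp ` ?D) = Suc (dp w)" using dep_card[OF w] by (simp add: card_image)
  moreover have "dp ` ?D \<subseteq> {..dp w}" using dep_mono_le w by auto
  ultimately have "dp ` ?D = {..dp w}" by (intro card_seteq) auto
  then have "i \<in> dp ` ?D" using i by simp
  then show ?thesis by blast
qed

text \<open>Closure towards the roots: pruning removes whole subtrees, so depths computed in
  \<open>U\<close> remain correct for the rest.\<close>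

definition down :: "nat set \<Rightarrow> bool" where
  "down R \<longleftrightarrow> R \<subseteq> U \<and> (\<forall>v\<in>R. \<forall>u\<in>U. le u v \<longrightarrow> u \<in> R)"

lemma down_U: "down U"
  by (simp add: down_def)

lemma down_fin: "down R \<Longrightarrow> finite R"
  using finU finite_subset unfolding down_def by blast

lemma piece_sub: "piece le R v \<subseteq> R"
  by (auto simp: piece_def)

text \<open>The \<open>dp v\<close> proper ancestors of v lie below every vertex of the piece but
  outside it; this lowers the height available inside the piece to \<open>d - dp v\<close>.\<close>

lemma blocking_piece:
  assumes R: "R \<subseteq> U" and v: "v \<in> U" shows "blocking E (block_size (d - dp v)) (piece le R v)"
proof -
  have sub: "piece le R v \<subseteq> U" using R piece_sub by blast
  have fin: "finite (piece le R v)" using sub finU finite_subset by blast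
  have "torder (piece le R v) E le (d - dp v)"
  proof (rule torder_subset[OF t sub])
    fix w assume w: "w \<in> piece le R v"
    then have wU: "w \<in> U" and vw: "le v w" using R by (auto simp: piece_def)
    have "card ({u \<in> piece le R v. le u w} \<union> {u\<in>U. le u v \<and> u \<noteq> v}) \<le> card {u\<in>U. le u w}"
      using torderD(2)[OF t _ v wU _ vw] sub finU by (intro card_mono) auto
    moreover have "card ({u \<in> piece le R v. le u w} \<union> {u\<in>U. le u v \<and> u \<noteq> v}) = card {u \<in> piece le R v. le u w} + dp v"
      unfolding dep_def
    proof (rule card_Un_disjoint)
      show "finite {u \<in> piece le R v. le u w}" using fin by simp
      show "finite {u\<in>U. le u v \<and> u \<noteq> v}" using finU by simp
      show "{u \<in> piece le R v. le u w} \<inter> {u\<in>U. le u v \<and> u \<noteq> v} = {}"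
        using torderD(3)[OF t _ v] by (auto simp: piece_def)
    qed
    ultimately show "card {u \<in> piece le R v. le u w} \<le> d - dp v" using torderD(5)[OF t wU] by linarith
  qed
  from td_le_torder[OF fin this] have "td_le E (d - dp v) (piece le R v)" using E by blast
  then show ?thesis using blocking_td_le[OF fin] E by blast
qed

text \<open>The bidders are the vertices of depth i and the objects are the codes of chunks; the
  unserved bidders are the roots of the pieces to delete. Chunks capture every conflict: if deleting
  the neighbours of Z lowers a piece, a small set of those neighbours already does, one vertex of Z
  is needed for each of them, and these vertices lie in X or on the path to the piece.\<close>

lemma level_step:
  fixes R :: "nat set" and i b p T :: nat and B
  defines "P \<equiv> \<lambda>v. v \<in> level U le R i"
  assumes R: "down R" and b: "block_size (d - i) = Suc b"
    and B: "\<And>t v y. B t v y \<longleftrightarrow> t < T \<and> v < n \<and> y < n ^ Suc b \<and> bid n (n ^ Suc b) p P (blocked_by n E X U le R i b) B t v y"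
    and p: "n < p" and T: "n ^ Suc b * p < T"
  defines "Q \<equiv> {v. P v \<and> (\<forall>y<n ^ Suc b. \<not> owns n B T v y)}"
  defines "R' \<equiv> R - (\<Union>v\<in>Q. piece le R v)"
  shows "down R'" "alpha E (X \<union> R) = alpha E (X \<union> R') + (\<Sum>v\<in>Q. alpha E (piece le R v))"
    "card (X \<union> R) = card (X \<union> R') + (\<Sum>v\<in>Q. card (piece le R v))"
    "card X + card (low U le R' (Suc i)) \<le> (card X + card (low U le R i)) * (1 + (card X + d) ^ b)"
proof -
  have RU: "R \<subseteq> U" and dR: "\<And>u v. v \<in> R \<Longrightarrow> u \<in> U \<Longrightarrow> le u v \<Longrightarrow> u \<in> R" using R unfolding down_def by auto
  have Un: "v < n" if "v \<in> U" for v using that U by simp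
  let ?m = "n ^ Suc b" and ?rel = "blocked_by n E X U le R i b"
  interpret a: auction n ?m p T P ?rel B
    using B p T RU Un by unfold_locales (auto simp: P_def level_def)
  have Q: "a.Q = Q" by (simp only: a.Q_def Q_def)
  have QP: "Q \<subseteq> level U le R i" unfolding Q_def P_def by blast
  have fR: "finite R" using down_fin[OF R] .
  have fP: "finite (level U le R i)" using fR by (simp add: level_def)
  have fC: "finite (piece le R v)" for v using fR by (simp add: piece_def)
  let ?M = "X \<union> low U le R i"
  have PU: "v \<in> U" if "v \<in> level U le R i" for v using that RU by (auto simp: level_def)
  have same: "v = v'" if h: "v \<in> level U le R i" "v' \<in> level U le R i" "w \<in> U" "le v w" "le v' w" for v v' w
  proof -
    have "le v v' \<or> le v' v" using torderD(4)[OF t PU[OF h(1)] PU[OF h(2)] h(3-5)] .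
    then show ?thesis using dep_mono[of v v'] dep_mono[of v' v] PU[OF h(1)] PU[OF h(2)] h(1,2) by (auto simp: level_def)
  qed
  have cover: "R = low U le R i \<union> (\<Union>v\<in>level U le R i. piece le R v)"
  proof (intro equalityI subsetI)
    fix w assume w: "w \<in> R"
    then have wU: "w \<in> U" using RU by blast
    show "w \<in> low U le R i \<union> (\<Union>v\<in>level U le R i. piece le R v)"
    proof (cases "dp w < i")
      case True
      then show ?thesis using w by (simp add: low_def)
    next
      case False
      then obtain v where "v \<in> U" "le v w" "dp v = i" using anc_at[OF wU] by (meson not_le)
      moreover from this have "v \<in> R" using dR w by blast
      ultimately show ?thesis using w by (auto simp: level_def piece_def)
    qed
  qed (auto simp: low_def piece_def)
  have disj1: "?M \<inter> piece le R v = {}" if v: "v \<in> level U le R i" for v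
  proof -
    have "i \<le> dp w" if w: "w \<in> piece le R v" for w
      using dep_mono_le[of v w] PU[OF v] v w RU by (auto simp: piece_def level_def)
    then show ?thesis using RU U by (fastforce simp: low_def piece_def)
  qed
  have disj2: "piece le R v \<inter> piece le R v' = {}" if "v \<in> level U le R i" "v' \<in> level U le R i" "v \<noteq> v'" for v v'
    using same[OF that(1,2)] that(3) RU by (auto simp: piece_def)
  have sep: "\<not> E x y" if h: "v \<in> level U le R i" "v' \<in> level U le R i" "v \<noteq> v'" "x \<in> piece le R v" "y \<in> piece le R v'" for v v' x y
  proof
    assume e: "E x y"
    have x: "x \<in> U" "le v x" and y: "y \<in> U" "le v' y" using h RU by (auto simp: piece_def)
    from torderD(6)[OF t x(1) y(1) e] show False
    proof
      assume "le x y"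
      then have "le v y" using torderD(2)[OF t PU[OF h(1)] x(1) y(1) x(2)] by blast
      then show False using same[OF h(1,2) y(1) _ y(2)] h(3) by blast
    next
      assume "le y x"
      then have "le v' x" using torderD(2)[OF t PU[OF h(2)] y(1) x(1) y(2)] by blast
      then show False using same[OF h(1,2) x(1) x(2)] h(3) by blast
    qed
  qed
  have compl: "\<exists>y\<in>{y. y < ?m \<and> chunk n X U le R i b y}. decode_set n (Suc b) y \<subseteq> Z \<and>
      alpha E (piece le R v - nbrs E (decode_set n (Suc b) y)) < alpha E (piece le R v)"
    if v: "v \<in> level U le R i" and Z: "Z \<subseteq> ?M" and a: "alpha E (piece le R v - nbrs E Z) < alpha E (piece le R v)" for v Z
  proof -
    have dv: "dp v = i" "v \<in> R" "v \<in> U" using v PU by (auto simp: level_def)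
    have "blocking E (Suc b) (piece le R v)" using blocking_piece[OF RU dv(3)] dv(1) b by simp
    from blocking_D[OF this subset_refl a] obtain Y where Y: "Y \<subseteq> nbrs E Z" "finite Y" "card Y \<le> Suc b"
      "alpha E (piece le R v - Y) < alpha E (piece le R v)" by blast
    let ?Y = "Y \<inter> piece le R v"
    have "\<exists>z\<in>Z. E z y" if "y \<in> ?Y" for y using that Y(1) unfolding nbrs_def by blast
    \<comment> \<open>One neighbour in Z for each vertex of the small blocking set; the chosen
      vertices alone already block the piece.\<close>
    then obtain z where z: "\<And>y. y \<in> ?Y \<Longrightarrow> z y \<in> Z \<and> E (z y) y" by metis
    let ?Z = "z ` ?Y"
    have "piece le R v - nbrs E ?Z \<subseteq> piece le R v - Y" using z unfolding nbrs_def by blast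
    then have a': "alpha E (piece le R v - nbrs E ?Z) < alpha E (piece le R v)"
      using alpha_mono[of "piece le R v - Y" "piece le R v - nbrs E ?Z" E] fC Y(4) by simp
    have ZZ: "?Z \<subseteq> Z" using z by blast
    have fZ: "finite ?Z" using Y(2) by simp
    have cZ: "card ?Z \<le> Suc b"
      using card_image_le[of ?Y z] card_mono[of Y ?Y] Y(2,3) by (meson finite_Int inf_le1 le_trans)
    have Zne: "?Z \<noteq> {}" using a' by (auto simp: nbrs_def)
    \<comment> \<open>The vertex z' is comparable with its neighbour y in the piece. Its depth is
      smaller than that of v, so it is not a descendant of v; hence it lies below y, and since the
      elements below y form a chain, below v.\<close>
    have zv: "z' \<in> R \<and> le z' v" if h: "z' \<in> ?Z" "z' \<notin> X" for z'
    proof -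
      obtain y where y: "y \<in> piece le R v" "E z' y" using h(1) z by blast
      have yU: "y \<in> U" "le v y" "y \<in> R" using y(1) RU by (auto simp: piece_def)
      have zl: "z' \<in> R" "dp z' < i" using h ZZ Z by (auto simp: low_def)
      then have zU: "z' \<in> U" using RU by blast
      have ne: "\<not> le v z'" using dep_mono_le[OF dv(3) zU] zl dv by auto
      have "le z' y"
        using torderD(6)[OF t zU yU(1) y(2)] torderD(2)[OF t dv(3) yU(1) zU yU(2)] ne by blast
      then have "le z' v" using torderD(4)[OF t zU dv(3) yU(1) _ yU(2)] ne by blast
      then show ?thesis using zl by blast
    qed
    have "\<exists>u\<in>?Z. ?Z \<subseteq> X \<union> up le R u"
    proof (cases "?Z \<subseteq> X")
      case True
      then show ?thesis using Zne by blast
    next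
      case False
      then obtain z0 where "z0 \<in> ?Z - X" by blast
      \<comment> \<open>The chosen vertices outside X are ancestors of v and form a chain. The
        deepest of them becomes the lowest digit, and its path contains the others.\<close>
      from ex_has_greatest_nat[of "\<lambda>x. x \<in> ?Z - X" z0 dp d, OF this] obtain u where
        u: "u \<in> ?Z - X" "\<And>x. x \<in> ?Z - X \<Longrightarrow> dp x \<le> dp u"
        using dep_less zv RU by (metis DiffD1 DiffD2 less_imp_le subsetD)
      have uR: "u \<in> R" "le u v" using zv u(1) by blast+
      have "x \<in> up le R u" if x: "x \<in> ?Z" "x \<notin> X" for x
      proof -
        have xR: "x \<in> R" "le x v" using zv x by blast+
        have "le x u \<or> le u x" using torderD(4)[OF t _ _ dv(3) xR(2) uR(2)] xR uR RU by blast
        moreover have "le x u" if "le u x"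
          using dep_mono[of u x] that u(2)[of x] x xR uR RU torderD(1)[OF t, of x] by (cases "u = x") auto
        ultimately show ?thesis using xR uR by (auto simp: up_def)
      qed
      then show ?thesis using u(1) by blast
    qed
    then obtain u where u: "u \<in> ?Z" "?Z \<subseteq> X \<union> up le R u" by blast
    have MX: "?M \<subseteq> {..<n}" using X RU U by (auto simp: low_def)
    then have un: "u < n" using u(1) ZZ Z by blast
    have "card (?Z - {u}) \<le> b" using u(1) cZ fZ by simp
    from decode_set_ex[OF un _ this] obtain y where y: "y < n ^ b" "?Z - {u} \<subseteq> decode_set n b y" "decode_set n b y \<subseteq> insert u (?Z - {u})"
      using ZZ Z MX fZ by blast
    let ?y = "u + n * y"
    have dm: "?y mod n = u" "?y div n = y" using un by auto
    have "u + n * y < n * Suc y" using un by simp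
    also have "\<dots> \<le> n * n ^ b" using y(1) by (intro mult_le_mono2) simp
    finally have yl: "?y < ?m" by simp
    have chy: "decode_set n (Suc b) ?y = ?Z" using y(2,3) u(1) dm by auto
    have "chunk n X U le R i b ?y" unfolding chunk_def dm using u y(3) ZZ Z by blast
    then show ?thesis using yl chy a' ZZ by (intro bexI[of _ ?y]) auto
  qed
  from a.crown_ex[unfolded Q] obtain R1 f where R1: "Q \<subseteq> R1" "R1 \<subseteq> Collect P"
    "\<forall>y<?m. \<forall>v\<in>R1. ?rel v y \<longrightarrow> f y \<in> R1 - Q \<and> ?rel (f y) y"
    "inj_on f {y. y < ?m \<and> (\<exists>v\<in>R1. ?rel v y)}"
    by (elim exE conjE)
  have R1P: "R1 \<subseteq> level U le R i" using R1(2) unfolding P_def by blast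
  have Xl: "finite ?M" using finX fR by (simp add: low_def)
  have fK: "finite {y. y < ?m \<and> chunk n X U le R i b y}" by (rule finite_Collect_conj_less)
  have "alpha E (?M \<union> (\<Union>v\<in>level U le R i. piece le R v)) =
      alpha E (?M \<union> (\<Union>v\<in>level U le R i - Q. piece le R v)) + (\<Sum>v\<in>Q. alpha E (piece le R v))"
  proof (rule crown[where ch = "decode_set n (Suc b)" and K = "{y. y < ?m \<and> chunk n X U le R i b y}" and R = R1 and f = f,
        OF fP Xl fK fC disj1 disj2 sep _ compl R1P R1(1)])
    show "E y x" if "E x y" for x y using E that by blast
    show "f y \<in> R1 - Q \<and> alpha E (piece le R (f y) - nbrs E (decode_set n (Suc b) y)) < alpha E (piece le R (f y))"
      if "y \<in> {y. y < ?m \<and> chunk n X U le R i b y}" "v \<in> R1"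
        "alpha E (piece le R v - nbrs E (decode_set n (Suc b) y)) < alpha E (piece le R v)" for y v
      using R1(3)[rule_format, of y v] that R1P unfolding blocked_by_def by blast
    show "inj_on f {y \<in> {y. y < ?m \<and> chunk n X U le R i b y}.
        \<exists>v\<in>R1. alpha E (piece le R v - nbrs E (decode_set n (Suc b) y)) < alpha E (piece le R v)}"
      by (rule inj_on_subset[OF R1(4)]) (use R1P in \<open>auto simp: blocked_by_def\<close>)
  qed
  moreover have "?M \<union> (\<Union>v\<in>level U le R i. piece le R v) = X \<union> R" using cover by blast
  moreover have R'eq: "R' = low U le R i \<union> (\<Union>v\<in>level U le R i - Q. piece le R v)"
  proof (intro set_eqI iffI)
    fix w assume w: "w \<in> R'"
    then have wR: "w \<in> R" and nq: "\<And>q. q \<in> Q \<Longrightarrow> w \<notin> piece le R q" unfolding R'_def by auto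
    from wR consider "w \<in> low U le R i" | v where "v \<in> level U le R i" "w \<in> piece le R v"
      by (subst (asm) cover) blast
    then show "w \<in> low U le R i \<union> (\<Union>v\<in>level U le R i - Q. piece le R v)"
      using nq by cases auto
  next
    fix w assume "w \<in> low U le R i \<union> (\<Union>v\<in>level U le R i - Q. piece le R v)"
    then consider "w \<in> low U le R i" | v where "v \<in> level U le R i" "v \<notin> Q" "w \<in> piece le R v" by blast
    then show "w \<in> R'"
    proof cases
      case 1
      then have "w \<notin> piece le R q" if "q \<in> Q" for q using disj1[of q] that QP by blast
      then show ?thesis using 1 unfolding R'_def by (auto simp: low_def)
    next
      case 2
      have "w \<notin> piece le R q" if "q \<in> Q" for q using disj2[of v q] that QP 2 by blast
      then show ?thesis using 2 piece_sub unfolding R'_def by blast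
    qed
  qed
  ultimately show "alpha E (X \<union> R) = alpha E (X \<union> R') + (\<Sum>v\<in>Q. alpha E (piece le R v))"
    by (simp add: Un_assoc)
  have fQ: "finite Q" using QP fP finite_subset by blast
  have UQ: "card (\<Union>v\<in>Q. piece le R v) = (\<Sum>v\<in>Q. card (piece le R v))"
    using fQ fC disj2 QP by (intro card_UN_disjoint) blast+
  have "X \<union> R = (X \<union> R') \<union> (\<Union>v\<in>Q. piece le R v)" unfolding R'_def using piece_sub by blast
  moreover have "(X \<union> R') \<inter> (\<Union>v\<in>Q. piece le R v) = {}"
    using disj1 QP unfolding R'_def by blast
  moreover have "finite (X \<union> R')" "finite (\<Union>v\<in>Q. piece le R v)" using finX fR fQ fC unfolding R'_def by auto
  ultimately show "card (X \<union> R) = card (X \<union> R') + (\<Sum>v\<in>Q. card (piece le R v))"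
    using card_Un_disjoint UQ by metis
  show "down R'"
    unfolding down_def
  proof (intro conjI ballI impI)
    show "R' \<subseteq> U" using RU unfolding R'_def by blast
    fix v u assume v: "v \<in> R'" and u: "u \<in> U" and uv: "le u v"
    have vR: "v \<in> R" "v \<in> U" using v RU unfolding R'_def by auto
    have "u \<in> R" using dR vR(1) u uv by blast
    moreover have "u \<notin> piece le R q" if q: "q \<in> Q" for q
    proof
      assume "u \<in> piece le R q"
      then have "le q u" by (simp add: piece_def)
      moreover have "q \<in> U" using q QP PU by blast
      ultimately have "v \<in> piece le R q" using torderD(2)[OF t _ u vR(2) _ uv] vR(1) by (auto simp: piece_def)
      then show False using v q unfolding R'_def by blast
    qed
    ultimately show "u \<in> R'" unfolding R'_def by blast
  qed
  \<comment> \<open>The survivors of depth at most i are old vertices of smaller depth and served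
    bidders, and the latter are bounded by the number of chunks.\<close>
  have "low U le R' (Suc i) \<subseteq> low U le R i \<union> (level U le R i - Q)"
  proof
    fix w assume w: "w \<in> low U le R' (Suc i)"
    then have wR: "w \<in> R" "w \<in> R'" "dp w \<le> i" unfolding low_def R'_def by auto
    show "w \<in> low U le R i \<union> (level U le R i - Q)"
    proof (cases "dp w < i")
      case True then show ?thesis using wR by (simp add: low_def)
    next
      case False
      then have "w \<in> level U le R i" using wR by (simp add: level_def)
      moreover have "w \<notin> Q" using wR torderD(1)[OF t, of w] RU unfolding R'_def piece_def by blast
      ultimately show ?thesis by blast
    qed
  qed
  then have "card (low U le R' (Suc i)) \<le> card (low U le R i \<union> (level U le R i - Q))"
    using fR by (intro card_mono) (auto simp: low_def level_def)
  also have "\<dots> \<le> card (low U le R i) + card (level U le R i - Q)" by (rule card_Un_le)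
  also have "card (level U le R i - Q) \<le> card ?M * (card X + d) ^ b"
  proof -
    have "{v. P v \<and> v \<notin> a.Q} = level U le R i - Q" unfolding Q by (auto simp: P_def)
    then have "card (level U le R i - Q) \<le> card {y. y < ?m \<and> (\<exists>v. P v \<and> ?rel v y)}" using a.card_matched by simp
    also have "\<dots> \<le> card {y. y < ?m \<and> chunk n X U le R i b y}"
      using fK by (intro card_mono) (auto simp: blocked_by_def)
    also have "\<dots> = card ((\<lambda>y. (y mod n, y div n)) ` {y. y < ?m \<and> chunk n X U le R i b y})"
      by (rule card_image[symmetric]) (rule digits_inj)
    also have "\<dots> \<le> card (SIGMA u:?M. {y. y < n ^ b \<and> decode_set n b y \<subseteq> X \<union> up le R u})"
      using Xl by (intro card_mono finite_SigmaI finite_Collect_conj_less)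
        (auto simp: chunk_def intro: div_less_power[simplified])
    also have "\<dots> = (\<Sum>u\<in>?M. card {y. y < n ^ b \<and> decode_set n b y \<subseteq> X \<union> up le R u})"
      using Xl by (intro card_SigmaI) (auto intro: finite_Collect_conj_less)
    also have "\<dots> \<le> (\<Sum>u\<in>?M. (card X + d) ^ b)"
    proof (rule sum_mono)
      fix u
      have fu: "finite (up le R u)" using fR by (simp add: up_def)
      have "card (up le R u) \<le> d"
      proof (cases "u \<in> R")
        case True
        then have "card (up le R u) \<le> card {w\<in>U. le w u}" using RU finU by (intro card_mono) (auto simp: up_def)
        then show ?thesis using torderD(5)[OF t, of u] True RU by (meson le_trans subsetD)
      qed (simp add: up_def)
      then have "card (X \<union> up le R u) \<le> card X + d" using card_Un_le[of X "up le R u"] by linarith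
      then have "card (X \<union> up le R u) ^ b \<le> (card X + d) ^ b" by (rule power_mono) simp
      then show "card {y. y < n ^ b \<and> decode_set n b y \<subseteq> X \<union> up le R u} \<le> (card X + d) ^ b"
        using card_decode_set[of "X \<union> up le R u" n b] finX fu by (meson finite_UnI le_trans)
    qed
    also have "\<dots> = card ?M * (card X + d) ^ b" by simp
    finally show ?thesis .
  qed
  also have "card ?M \<le> card X + card (low U le R i)" by (rule card_Un_le)
  finally show "card X + card (low U le R' (Suc i)) \<le> (card X + card (low U le R i)) * (1 + (card X + d) ^ b)"
    by (simp add: algebra_simps)
qed

lemma low_d: "R \<subseteq> U \<Longrightarrow> low U le R d = R"
  using dep_less by (auto simp: low_def)

end

text \<open>The summands are 0, 1, 2, 4, ...; the extra 1 is the exponent of the initial factor k.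
  For d = 0 truncated subtraction makes both sides equal to 1.\<close>

lemma block_size_sum: "(\<Sum>j<d. block_size (Suc j) - 1) + 1 = 2 ^ (d - 1)"
proof (induction d)
  case (Suc d)
  show ?case
  proof (cases d)
    case (Suc e)
    have "block_size (Suc d) - 1 = 2 ^ e" using Suc block_size_eq[of e] by simp
    then show ?thesis using Suc.IH Suc by (simp del: block_size.simps)
  qed simp
qed simp

lemma concat_map_blocks:
  "concat (map (\<lambda>i. map (f i) [0..<m]) [0..<n]) = map (\<lambda>q. f (q div m) (q mod m)) [0..<n * m]"
proof (induction n)
  case (Suc n)
  have "map (\<lambda>q. f (q div m) (q mod m)) [n * m..<n * m + m] = map (f n) [0..<m]"
  proof (rule nth_equalityI)
    fix j assume "j < length (map (\<lambda>q. f (q div m) (q mod m)) [n * m..<n * m + m])"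
    then have "j < m" by simp
    then show "map (\<lambda>q. f (q div m) (q mod m)) [n * m..<n * m + m] ! j = map (f n) [0..<m] ! j"
      by simp
  qed simp
  moreover have "[0..<Suc n * m] = [0..<n * m] @ [n * m..<n * m + m]"
    using upt_add_eq_append[of 0 "n * m" m] by (simp add: add.commute)
  ultimately show ?case using Suc by simp
qed simp

section \<open>Reading the instance\<close>

definition hashes :: "nat list \<Rightarrow> nat \<Rightarrow> nat" where
  "hashes w q = length (filter (\<lambda>x. x = 3) (take q w))"

text \<open>The position at which field k begins, every field being terminated by the symbol 3.\<close>

definition off :: "nat \<Rightarrow> nat list \<Rightarrow> nat" where
  "off k w = card {q. q < length w \<and> hashes w q < k}"

lemma off_0 [simp]: "off 0 w = 0"
  by (simp add: off_def)

text \<open>Peels off one terminated field, so that all offsets can be computed from the encoding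
  written as a concatenation.\<close>

lemma off_Suc:
  assumes "3 \<notin> set a" shows "off (Suc k) (a @ 3 # r) = length a + 1 + off k r"
proof -
  have c1: "hashes (a @ 3 # r) q = 0" if "q \<le> length a" for q
    using assms that by (auto simp: hashes_def filter_empty_conv dest: in_set_takeD)
  have c2: "hashes (a @ 3 # r) (q + (length a + 1)) = Suc (hashes r q)" for q
  proof -
    have "filter (\<lambda>x. x = 3) a = []" using assms by (auto simp: filter_empty_conv)
    then show ?thesis by (simp add: hashes_def)
  qed
  have "{q. q < length (a @ 3 # r) \<and> hashes (a @ 3 # r) q < Suc k} =
      {..<length a + 1} \<union> (\<lambda>q. q + (length a + 1)) ` {q. q < length r \<and> hashes r q < k}" (is "?L = ?R")
  proof (intro set_eqI iffI)
    fix q assume q: "q \<in> ?L"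
    show "q \<in> ?R"
    proof (cases "q \<le> length a")
      case False
      then obtain q' where "q = q' + (length a + 1)" by (metis add.commute le_add_diff_inverse2 not_less_eq_eq Suc_eq_plus1)
      then show ?thesis using q c2[of q'] by auto
    qed simp
  next
    fix q assume q: "q \<in> ?R"
    then consider "q \<le> length a" | q' where "q = q' + (length a + 1)" "q' < length r" "hashes r q' < k" by auto
    then show "q \<in> ?L" using c1[of q] c2 by cases auto
  qed
  moreover have "card ?R = length a + 1 + card {q. q < length r \<and> hashes r q < k}"
  proof -
    have "card ((\<lambda>q. q + (length a + 1)) ` {q. q < length r \<and> hashes r q < k}) = card {q. q < length r \<and> hashes r q < k}"
      by (intro card_image inj_onI) simp
    then show ?thesis
      by (subst card_Un_disjoint) (auto intro: finite_Collect_conj_less)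
  qed
  ultimately show ?thesis unfolding off_def by simp
qed

declare enc_nat.simps [simp del]

lemma enc_nat_eq: "enc_nat n = (if n = 0 then [] else (n mod 2 + 1) # enc_nat (n div 2))"
  by (rule enc_nat.simps)

lemma set_enc_nat: "x \<in> set (enc_nat n) \<Longrightarrow> x = 1 \<or> x = 2"
proof (induction n rule: less_induct)
  case (less n)
  show ?case
  proof (cases "n = 0")
    case True
    then show ?thesis using less.prems by (subst (asm) enc_nat_eq) simp
  next
    case False
    then have "x = n mod 2 + 1 \<or> x \<in> set (enc_nat (n div 2))"
      using less.prems by (subst (asm) enc_nat_eq) simp
    moreover have "n div 2 < n" using False by simp
    moreover have "n mod 2 = 0 \<or> n mod 2 = 1" by linarith
    ultimately show ?thesis using less.IH[of "n div 2"] by auto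
  qed
qed

definition adjseg :: "vc_inst \<Rightarrow> nat list" where
  "adjseg I = map (\<lambda>q. bitsym (adj I (q div nv I) (q mod nv I))) [0..<nv I * nv I]"

definition modseg :: "vc_inst \<Rightarrow> nat list" where
  "modseg I = map (\<lambda>i. bitsym (i \<in> modx I)) [0..<nv I]"

lemma enc_inst_eq: "enc_inst I = enc_nat (nv I) @ 3 # enc_nat (ell I) @ 3 # enc_nat (kpar I) @ 3 # adjseg I @ 3 # modseg I @ 3 # []"
  by (simp add: enc_inst_def adjseg_def modseg_def concat_map_blocks)

lemma enc_sym: "s \<in> set (enc_inst I) \<Longrightarrow> s = 1 \<or> s = 2 \<or> s = 3"
  unfolding enc_inst_eq by (auto simp: adjseg_def modseg_def bitsym_def dest: set_enc_nat)

lemma three_notin: "3 \<notin> set (enc_nat n)" "3 \<notin> set (adjseg I)" "3 \<notin> set (modseg I)"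
  using set_enc_nat[of 3] by (auto simp: adjseg_def modseg_def bitsym_def)

lemma offs:
  "off 1 (enc_inst I) = length (enc_nat (nv I)) + 1"
  "off 2 (enc_inst I) = off 1 (enc_inst I) + length (enc_nat (ell I)) + 1"
  "off 3 (enc_inst I) = off 2 (enc_inst I) + length (enc_nat (kpar I)) + 1"
  "off 4 (enc_inst I) = off 3 (enc_inst I) + nv I * nv I + 1"
  "off 5 (enc_inst I) = off 4 (enc_inst I) + nv I + 1"
proof -
  have n: "(1::nat) = Suc 0" "(2::nat) = Suc 1" "(4::nat) = Suc 3" "(5::nat) = Suc 4" by simp_all
  have n3: "off 3 w = off (Suc 2) w" for w by (simp add: numeral_3_eq_3 numeral_2_eq_2)
  have 1: "off 1 (a @ 3 # r) = length a + 1" if "3 \<notin> set a" for a r using off_Suc[OF that, of 0 r] by simp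
  have 2: "off 2 (a @ 3 # r) = length a + 1 + off 1 r" if "3 \<notin> set a" for a r using off_Suc[OF that, of 1 r] by (simp add: numeral_2_eq_2)
  have 3: "off 3 (a @ 3 # r) = length a + 1 + off 2 r" if "3 \<notin> set a" for a r using off_Suc[OF that, of 2 r] unfolding n3 .
  have 4: "off 4 (a @ 3 # r) = length a + 1 + off 3 r" if "3 \<notin> set a" for a r using off_Suc[OF that, of 3 r] unfolding n(3) .
  have 5: "off 5 (a @ 3 # r) = length a + 1 + off 4 r" if "3 \<notin> set a" for a r using off_Suc[OF that, of 4 r] unfolding n(4) .
  have l: "length (adjseg I) = nv I * nv I" "length (modseg I) = nv I" by (simp_all add: adjseg_def modseg_def)
  show "off 1 (enc_inst I) = length (enc_nat (nv I)) + 1"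
    "off 2 (enc_inst I) = off 1 (enc_inst I) + length (enc_nat (ell I)) + 1"
    "off 3 (enc_inst I) = off 2 (enc_inst I) + length (enc_nat (kpar I)) + 1"
    "off 4 (enc_inst I) = off 3 (enc_inst I) + nv I * nv I + 1"
    "off 5 (enc_inst I) = off 4 (enc_inst I) + nv I + 1"
    unfolding enc_inst_eq by (simp_all add: 1 2 3 4 5 l three_notin del: One_nat_def)
qed

definition symbol_at :: "vc_inst \<Rightarrow> nat \<Rightarrow> nat" where
  "symbol_at I q = (if q < length (enc_inst I) then enc_inst I ! q else 0)"

lemma len_enc: "length (enc_inst I) = off 5 (enc_inst I)"
  unfolding offs unfolding enc_inst_eq by (simp add: adjseg_def modseg_def)

lemma symbol_at_ell: "i < length (enc_nat (ell I)) \<Longrightarrow> symbol_at I (off 1 (enc_inst I) + i) = enc_nat (ell I) ! i"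
  unfolding symbol_at_def len_enc offs by (auto simp: enc_inst_eq nth_append)

lemma symbol_at_adj:
  assumes "i < nv I" "j < nv I"
  shows "symbol_at I (off 3 (enc_inst I) + (i * nv I + j)) = bitsym (adj I i j)"
proof -
  have l: "i * nv I + j < nv I * nv I"
  proof -
    have "i * nv I + j < Suc i * nv I" using assms by simp
    also have "\<dots> \<le> nv I * nv I" using assms by (intro mult_le_mono1) simp
    finally show ?thesis .
  qed
  have "symbol_at I (off 3 (enc_inst I) + (i * nv I + j)) = adjseg I ! (i * nv I + j)"
    using l unfolding symbol_at_def len_enc offs by (auto simp: enc_inst_eq nth_append adjseg_def)
  then show ?thesis using l assms by (simp add: adjseg_def)
qed

lemma symbol_at_modx: "i < nv I \<Longrightarrow> symbol_at I (off 4 (enc_inst I) + i) = bitsym (i \<in> modx I)"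
  unfolding symbol_at_def len_enc offs by (auto simp: enc_inst_eq nth_append adjseg_def modseg_def)

definition ispow :: "nat \<Rightarrow> bool" where
  "ispow v \<longleftrightarrow> (\<exists>i. v = 2 ^ i)"

text \<open>Powers of two are the positive numbers without an odd divisor other than 1. This form
  needs only bounded quantifiers and products, whereas the expressions have no exponentiation with a
  variable exponent.\<close>

lemma ispow_iff: "ispow v \<longleftrightarrow> 0 < v \<and> (\<forall>u<v + 1. (\<exists>q<v + 1. v = u * q) \<longrightarrow> u = 1 \<or> even u)"
proof
  assume "ispow v"
  then obtain i where v: "v = 2 ^ i" unfolding ispow_def by blast
  have "u = 1 \<or> even u" if "v = u * q" for u q
  proof -
    have "u dvd 2 ^ i" using that v by simp
    then show ?thesis
    proof (induction i)
      case (Suc i)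
      show ?case
      proof (cases "even u")
        case False
        then have "coprime u 2" by simp
        then have "u dvd 2 ^ i" using Suc.prems by (simp add: coprime_dvd_mult_right_iff)
        then show ?thesis by (rule Suc.IH)
      qed simp
    qed simp
  qed
  then show "0 < v \<and> (\<forall>u<v + 1. (\<exists>q<v + 1. v = u * q) \<longrightarrow> u = 1 \<or> even u)" using v by auto
next
  assume a: "0 < v \<and> (\<forall>u<v + 1. (\<exists>q<v + 1. v = u * q) \<longrightarrow> u = 1 \<or> even u)"
  have d: "u = 1 \<or> even u" if dvd: "u dvd v" for u
  proof -
    obtain q where q: "v = u * q" using dvd by blast
    have "q dvd v" using q by simp
    then have "u < v + 1" "q < v + 1" using dvd_imp_le[OF dvd] dvd_imp_le[of q v] a by (simp_all add: less_Suc_eq_le)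
    then show ?thesis using a q by blast
  qed
  have "0 < v \<Longrightarrow> (\<And>u. u dvd v \<Longrightarrow> u = 1 \<or> even u) \<Longrightarrow> ispow v"
  proof (induction v rule: less_induct)
    case (less v)
    show ?case
    proof (cases "v = 1")
      case True
      then show ?thesis unfolding ispow_def by (intro exI[of _ 0]) simp
    next
      case False
      then have "even v" using less.prems(2)[of v] by simp
      then obtain w where w: "v = 2 * w" by (rule evenE)
      have "ispow w" using less.prems w by (intro less.IH) auto
      then obtain i where "w = 2 ^ i" unfolding ispow_def by blast
      then show ?thesis unfolding ispow_def w by (intro exI[of _ "Suc i"]) simp
    qed
  qed
  then show "ispow v" using a d by blast
qed

lemma card_ispow: "card {u. u < 2 ^ i \<and> ispow u} = i"
proof -
  have "{u. u < 2 ^ i \<and> ispow u} = (\<lambda>j. 2 ^ j) ` {..<i}" by (auto simp: ispow_def)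
  then show ?thesis by (simp add: card_image inj_on_def)
qed

text \<open>The power with exponent i is recognized as the power of two that has exactly i smaller
  ones. The cap N keeps the value polynomial for large i.\<close>

definition p2 :: "nat \<Rightarrow> nat \<Rightarrow> nat" where
  "p2 N i = (\<Sum>v<N. if ispow v \<and> card {u. u < v \<and> ispow u} = i then v else 0) +
     (if \<exists>v<N. ispow v \<and> card {u. u < v \<and> ispow u} = i then 0 else N)"

lemma p2_eq: "p2 N i = min (2 ^ i) N"
proof -
  have e: "ispow v \<and> card {u. u < v \<and> ispow u} = i \<longleftrightarrow> v = 2 ^ i" for v
    using card_ispow by (auto simp: ispow_def)
  show ?thesis unfolding p2_def e by (cases "2 ^ i < N") (auto simp: min_def)
qed

lemma enc_nat_sum: "n = (\<Sum>i<length (enc_nat n). (enc_nat n ! i - 1) * 2 ^ i)"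
proof (induction n rule: enc_nat.induct)
  case (1 n)
  show ?case
  proof (cases "n = 0")
    case True
    have "enc_nat 0 = []" by (subst enc_nat_eq) simp
    then show ?thesis using True by simp
  next
    case False
    have e: "enc_nat n = (n mod 2 + 1) # enc_nat (n div 2)" using False by (subst enc_nat.simps) simp
    have "(\<Sum>i<length (enc_nat n). (enc_nat n ! i - 1) * 2 ^ i) = n mod 2 + 2 * (\<Sum>i<length (enc_nat (n div 2)). (enc_nat (n div 2) ! i - 1) * 2 ^ i)"
      unfolding e by (simp add: sum.lessThan_Suc_shift sum_distrib_left algebra_simps del: sum.lessThan_Suc)
    also have "\<dots> = n mod 2 + 2 * (n div 2)" using 1[OF False] by simp
    finally show ?thesis by simp
  qed
qed

text \<open>If some bit equal to 1 has weight at least N, both sums reach N; otherwise the cap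
  changes no weight that counts.\<close>

lemma min_sum_bits:
  fixes b :: "nat \<Rightarrow> nat"
  assumes "\<And>i. i < l \<Longrightarrow> b i \<le> 1"
  shows "min N (\<Sum>i<l. b i * min (2 ^ i) N) = min N (\<Sum>i<l. b i * 2 ^ i)"
proof (cases "\<exists>i<l. b i = 1 \<and> N \<le> 2 ^ i")
  case True
  then obtain i where i: "i < l" "b i = 1" "N \<le> 2 ^ i" by blast
  have "b i * min (2 ^ i) N \<le> (\<Sum>i<l. b i * min (2 ^ i) N)" by (rule member_le_sum) (use i in auto)
  moreover have "b i * 2 ^ i \<le> (\<Sum>i<l. b i * 2 ^ i)" by (rule member_le_sum) (use i in auto)
  ultimately show ?thesis using i by simp
next
  case False
  have "b i * min (2 ^ i) N = b i * 2 ^ i" if i: "i < l" for i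
  proof (cases "b i = 0")
    case nz: False
    then have "b i = 1" using assms[OF i] by linarith
    then have "\<not> N \<le> 2 ^ i" using False i by blast
    then show ?thesis by simp
  qed simp
  then have "(\<Sum>i<l. b i * min (2 ^ i) N) = (\<Sum>i<l. b i * 2 ^ i)" by (intro sum.cong) auto
  then show ?thesis by simp
qed

text \<open>The budget is capped because its value may be exponential in the input length.\<close>

definition ell_cap :: "vc_inst \<Rightarrow> nat" where
  "ell_cap I = min (nv I) (\<Sum>i<off 2 (enc_inst I) - off 1 (enc_inst I) - 1. (symbol_at I (off 1 (enc_inst I) + i) - 1) * p2 (nv I) i)"

lemma ell_cap_eq: "ell_cap I = min (nv I) (ell I)"
proof -
  have l: "off 2 (enc_inst I) - off 1 (enc_inst I) - 1 = length (enc_nat (ell I))" by (simp add: offs(2))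
  have "ell_cap I = min (nv I) (\<Sum>i<length (enc_nat (ell I)). (enc_nat (ell I) ! i - 1) * min (2 ^ i) (nv I))"
    unfolding ell_cap_def l p2_eq by (simp add: symbol_at_ell[unfolded One_nat_def])
  also have "\<dots> = min (nv I) (\<Sum>i<length (enc_nat (ell I)). (enc_nat (ell I) ! i - 1) * 2 ^ i)"
    using set_enc_nat[OF nth_mem] by (intro min_sum_bits) fastforce
  finally show ?thesis using enc_nat_sum[of "ell I"] by simp
qed

section \<open>Definability of the input data\<close>

definition ctx0 :: "nat \<Rightarrow> vc_inst ctx" where
  "ctx0 d = (\<lambda>I. inp (enc_inst I), \<lambda>I. length (enc_inst I), 2, {I. valid_inst d I})"

lemma valid_ctx0 [simp]: "valid (ctx0 d) = {I. valid_inst d I}"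
  by (simp add: valid_def ctx0_def)

lemma stage_ctx0: "stage enc_inst (ctx0 d)"
  unfolding ctx0_def using enc_sym by (intro stage_init) fastforce

lemma dfn_symbol_at: "dfn (ctx0 d) (\<lambda>I s. symbol_at I (s 0))"
proof -
  have "dfn (ctx0 d) (\<lambda>I s. of_bool (inp (enc_inst I) 0 (s 0 + 1)) + 2 * of_bool (inp (enc_inst I) 1 (s 0 + 1)))"
    unfolding ctx0_def by (intro dfn_add dfn_mult dfn_cst dfn_arr[where \<Gamma> = "\<lambda>I. inp (enc_inst I)"] dfn_var) simp_all
  then show ?thesis
  proof (rule dfn_cong)
    fix I and s :: "nat \<Rightarrow> nat"
    have "enc_inst I ! s 0 = 1 \<or> enc_inst I ! s 0 = 2 \<or> enc_inst I ! s 0 = 3" if "s 0 < length (enc_inst I)"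
      using enc_sym nth_mem[OF that] by blast
    then show "of_bool (inp (enc_inst I) 0 (s 0 + 1)) + 2 * of_bool (inp (enc_inst I) 1 (s 0 + 1)) = symbol_at I (s 0)"
      unfolding symbol_at_def inp_def by (cases "s 0 < length (enc_inst I)") (auto simp: Suc_le_eq)
  qed
qed

lemmas dfn_symbol_at' = dfn_comp1[OF dfn_symbol_at]

lemma dfn_length: "dfn (ctx0 d) (\<lambda>I s. length (enc_inst I))"
  unfolding ctx0_def by (rule dfn_len)

lemma dfn_off: "dfn (ctx0 d) (\<lambda>I s. off k (enc_inst I))"
proof -
  have "dfn (ctx0 d) (\<lambda>I s. card {q. q < length (enc_inst I) \<and> card {j. j < q \<and> symbol_at I j = 3} < k})"
    by (intro dfn_card dfn_length dfp_less dfp_eq dfn_var dfn_cst dfn_symbol_at')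
  then show ?thesis
  proof (rule dfn_cong)
    fix I and s :: "nat \<Rightarrow> nat"
    have "card {j. j < q \<and> symbol_at I j = 3} = hashes (enc_inst I) q" if "q < length (enc_inst I)" for q
      unfolding hashes_def length_filter_conv_card using that by (intro arg_cong[of _ _ card]) (auto simp: symbol_at_def)
    then show "card {q. q < length (enc_inst I) \<and> card {j. j < q \<and> symbol_at I j = 3} < k} = off k (enc_inst I)"
      unfolding off_def by (intro arg_cong[of _ _ card]) auto
  qed
qed

lemma dfn_nv: "dfn (ctx0 d) (\<lambda>I s. nv I)"
proof (rule dfn_cong)
  show "dfn (ctx0 d) (\<lambda>I s. off 5 (enc_inst I) - off 4 (enc_inst I) - 1)" by (intro dfn_sub dfn_off dfn_cst)
qed (simp add: offs(5))

lemma valid_graph: "valid_inst d I \<Longrightarrow> adj I i j \<Longrightarrow> i < nv I \<and> j < nv I \<and> i \<noteq> j \<and> adj I j i"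
  unfolding valid_inst_def is_graph_def by blast

lemma dfp_adj: "dfp (ctx0 d) (\<lambda>I s. adj I (s 0) (s 1))"
proof (rule dfp_cong)
  show "dfp (ctx0 d) (\<lambda>I s. s 0 < nv I \<and> s 1 < nv I \<and> symbol_at I (off 3 (enc_inst I) + (s 0 * nv I + s 1)) = 2)"
    by (intro dfp_conj dfp_less dfn_var dfn_nv dfp_eq dfn_symbol_at' dfn_add dfn_mult dfn_off dfn_cst)
  fix I and s :: "nat \<Rightarrow> nat" assume "I \<in> valid (ctx0 d)"
  then show "(s 0 < nv I \<and> s 1 < nv I \<and> symbol_at I (off 3 (enc_inst I) + (s 0 * nv I + s 1)) = 2) = adj I (s 0) (s 1)"
    using valid_graph[of d I "s 0" "s 1"] symbol_at_adj[of "s 0" I "s 1"] by (auto simp: bitsym_def split: if_splits)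
qed

lemma dfp_modx: "dfp (ctx0 d) (\<lambda>I s. s 0 \<in> modx I)"
proof (rule dfp_cong)
  show "dfp (ctx0 d) (\<lambda>I s. s 0 < nv I \<and> symbol_at I (off 4 (enc_inst I) + s 0) = 2)"
    by (intro dfp_conj dfp_less dfn_var dfn_nv dfp_eq dfn_symbol_at' dfn_add dfn_off dfn_cst)
  fix I and s :: "nat \<Rightarrow> nat" assume "I \<in> valid (ctx0 d)"
  then have "modx I \<subseteq> {..<nv I}" by (simp add: valid_inst_def)
  then show "(s 0 < nv I \<and> symbol_at I (off 4 (enc_inst I) + s 0) = 2) = (s 0 \<in> modx I)"
    using symbol_at_modx[of "s 0" I] by (auto simp: bitsym_def split: if_splits)
qed

lemma dfp_ispow: "dfp \<kappa> (\<lambda>c s. ispow (s 0))"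
  unfolding ispow_iff by (intro dfn_intros)

lemmas dfp_ispow' = dfn_comp1[where f = "\<lambda>c v. of_bool (ispow v)", OF dfp_ispow]

lemma dfn_p2: "dfn \<kappa> (\<lambda>c s. p2 (s 0) (s 1))"
  unfolding p2_def by (intro dfn_intros dfn_card dfp_ispow')

lemmas dfn_p2' = dfn_comp2[where f = "\<lambda>c. p2", OF dfn_p2]

lemma dfn_ell_cap: "dfn (ctx0 d) (\<lambda>I s. ell_cap I)"
  unfolding ell_cap_def by (intro dfn_intros dfn_p2' dfn_symbol_at' dfn_off dfn_nv)

text \<open>A definable set that depends on parameters: variable 0 is the tested element and the
  remaining variables are the parameters, which explains the shifts in the rules below.\<close>

definition DS :: "'c ctx \<Rightarrow> ('c \<Rightarrow> (nat \<Rightarrow> nat) \<Rightarrow> nat set) \<Rightarrow> bool" where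
  "DS \<kappa> S \<longleftrightarrow> dfp \<kappa> (\<lambda>c s. s 0 \<in> S c (\<lambda>k. s (Suc k)))"

lemma dfn_case: "dfn \<kappa> a \<Longrightarrow> (\<And>k. dfn \<kappa> (g k)) \<Longrightarrow> dfn \<kappa> (\<lambda>c s. case i of 0 \<Rightarrow> a c s | Suc k \<Rightarrow> g k c s)"
  by (cases i) simp_all

lemma DS_mem:
  assumes "DS \<kappa> S" "dfn \<kappa> a" shows "dfp \<kappa> (\<lambda>c s. a c s \<in> S c s)"
  using dfn_subst[OF assms(1)[unfolded DS_def], of "\<lambda>i c s. case i of 0 \<Rightarrow> a c s | Suc k \<Rightarrow> s k",
    OF dfn_case[OF assms(2) dfn_var]] by simp

lemma dfn_skip:
  assumes "dfn \<kappa> (\<lambda>c s. f c (s 0) (\<lambda>k. s (Suc k)))"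
  shows "dfn \<kappa> (\<lambda>c s. f c (s 0) (\<lambda>k. s (Suc (Suc k))))"
  using dfn_subst[OF assms, of "\<lambda>i c s. case i of 0 \<Rightarrow> s 0 | Suc k \<Rightarrow> s (Suc (Suc k))",
    OF dfn_case[OF dfn_var dfn_var]] by simp

lemma DS_shift:
  assumes "DS \<kappa> S" shows "DS \<kappa> (\<lambda>c s. S c (\<lambda>k. s (Suc k)))"
  using dfn_skip[where f = "\<lambda>c x s. of_bool (x \<in> S c s)"] assms unfolding DS_def by blast

lemma DS_shift2: "DS \<kappa> S \<Longrightarrow> DS \<kappa> (\<lambda>c s. S c (\<lambda>k. s (Suc (Suc k))))"
  using DS_shift[OF DS_shift] by blast

lemma DS_shift3: "DS \<kappa> S \<Longrightarrow> DS \<kappa> (\<lambda>c s. S c (\<lambda>k. s (Suc (Suc (Suc k)))))"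
  using DS_shift[OF DS_shift2] by blast

lemma DS_I: "dfp \<kappa> (\<lambda>c s. s 0 \<in> S c (\<lambda>k. s (Suc k))) \<Longrightarrow> DS \<kappa> S"
  by (simp add: DS_def)

lemma DS_union: "DS \<kappa> S \<Longrightarrow> DS \<kappa> S' \<Longrightarrow> DS \<kappa> (\<lambda>c s. S c s \<union> S' c s)"
  unfolding DS_def Un_iff by (intro dfp_disj)

lemma DS_diff: "DS \<kappa> S \<Longrightarrow> DS \<kappa> S' \<Longrightarrow> DS \<kappa> (\<lambda>c s. S c s - S' c s)"
  unfolding DS_def Diff_iff by (intro dfp_conj dfp_not)

lemma DS_single: "dfn \<kappa> a \<Longrightarrow> DS \<kappa> (\<lambda>c s. {a c s})"
  unfolding DS_def singleton_iff by (intro dfp_eq dfn_var dfn_shift)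

lemma DS_const: "dfp \<kappa> (\<lambda>c s. s 0 \<in> S c) \<Longrightarrow> DS \<kappa> (\<lambda>c s. S c)"
  by (rule DS_I)

section \<open>Definability of connectivity and of the tree order\<close>

definition near :: "(nat \<Rightarrow> nat \<Rightarrow> bool) \<Rightarrow> nat set \<Rightarrow> nat \<Rightarrow> nat \<Rightarrow> bool" where
  "near E U x y \<longleftrightarrow> x \<in> U \<and> y \<in> U \<and> (x = y \<or> E x y)"

text \<open>A definable form of connectivity: after deleting the root of a component of treedepth k + 1, every
  vertex is joined to a neighbour of the root inside a graph of treedepth k.\<close>

primrec linked :: "(nat \<Rightarrow> nat \<Rightarrow> bool) \<Rightarrow> nat \<Rightarrow> nat set \<Rightarrow> nat \<Rightarrow> nat \<Rightarrow> nat \<Rightarrow> bool" where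
  "linked E n U 0 x y \<longleftrightarrow> near E U x y"
| "linked E n U (Suc k) x y \<longleftrightarrow> (\<exists>a<n. \<exists>r<n. \<exists>b<n. linked E n U k x a \<and> near E U a r \<and> near E U r b \<and> linked E n U k b y)"

lemma linked_mono: "U \<subseteq> U' \<Longrightarrow> linked E n U k x y \<Longrightarrow> linked E n U' k x y"
proof (induction k arbitrary: x y)
  case (Suc k)
  have "near E U x y \<Longrightarrow> near E U' x y" for x y using Suc.prems(1) unfolding near_def by blast
  then show ?case using Suc unfolding linked.simps by blast
qed (auto simp: near_def)

lemma linked_sym:
  assumes "\<And>x y. E x y \<Longrightarrow> E y x"
  shows "linked E n U k x y \<Longrightarrow> linked E n U k y x"
proof (induction k arbitrary: x y)
  case (Suc k)
  have "near E U x y \<Longrightarrow> near E U y x" for x y using assms unfolding near_def by blast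
  then show ?case using Suc unfolding linked.simps by blast
qed (use assms in \<open>auto simp: near_def\<close>)

lemma near_conn: "near E U x y \<Longrightarrow> x \<in> conn E U z \<Longrightarrow> y \<in> conn E U z"
  using conn_step[of x E U z y] unfolding near_def by blast

lemma linked_conn: "linked E n U k x y \<Longrightarrow> y \<in> conn E U x"
proof (induction k arbitrary: x y)
  case 0
  then show ?case using near_conn[of E U x y x] conn_self[of x U E] by (simp add: near_def)
next
  case (Suc k)
  then obtain a r b where h: "linked E n U k x a" "near E U a r" "near E U r b" "linked E n U k b y" by auto
  show ?case using near_conn[OF h(3) near_conn[OF h(2) Suc.IH[OF h(1)]]] Suc.IH[OF h(4)] conn_trans by blast
qed

text \<open>Let r be the root of the component. Each of x and y is r or reaches a neighbour of r
  without using r, hence inside a graph of treedepth h; a detour through r joins the two walks.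
  Since \<open>near\<close> is reflexive, r may take the place of its own neighbour.\<close>

lemma conn_linked:
  assumes sym: "\<And>x y. E x y \<Longrightarrow> E y x"
  shows "U \<subseteq> {..<n} \<Longrightarrow> td_le E h U \<Longrightarrow> y \<in> conn E U x \<Longrightarrow> linked E n U h x y"
proof (induction h arbitrary: U x y)
  case 0
  then show ?case using conn_sub[of E U x] by auto
next
  case (Suc h)
  have xU: "x \<in> U" using Suc.prems(3) by (simp add: conn_def)
  let ?C = "conn E U x"
  have CU: "?C \<subseteq> U" by (rule conn_sub)
  obtain r where r: "r \<in> ?C" "td_le E h (?C - {r})" using Suc.prems(2) xU by auto
  have IH: "linked E n U h u v" if "v \<in> conn E (?C - {r}) u" for u v
  proof -
    have "linked E n (?C - {r}) h u v" using Suc.IH[of "?C - {r}" v u] r(2) CU Suc.prems(1) that by blast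
    then show ?thesis using linked_mono[of "?C - {r}" U] CU by blast
  qed
  have refl: "linked E n U h r r"
  proof -
    have rU: "near E U r r" "r < n" using r(1) CU Suc.prems(1) unfolding near_def by auto
    have "linked E n U k r r" for k
    proof (induction k)
      case 0 show ?case using rU by simp
    next
      case (Suc k) then show ?case using rU unfolding linked.simps by blast
    qed
    then show ?thesis .
  qed
  have Cr: "?C = conn E U r" using conn_eq[of E r U x, OF sym r(1)] by simp
  have reach: "\<exists>a<n. linked E n U h z a \<and> a \<in> U \<and> (a = r \<or> E a r)" if z: "z \<in> ?C" for z
  proof (cases "z = r")
    case True
    then show ?thesis using refl r CU Suc.prems(1) by (intro exI[of _ r]) auto
  next
    case False
    have "r \<in> conn E U z" using conn_eq[of E z U x, OF sym z] r(1) by simp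
    then have "(\<lambda>x y. x \<in> U \<and> y \<in> U \<and> E x y)\<^sup>*\<^sup>* z r" by (simp add: conn_def)
    then have "z \<in> ?C \<Longrightarrow> z \<noteq> r \<Longrightarrow> \<exists>a\<in>conn E (?C - {r}) z. E a r"
    proof (induction rule: converse_rtranclp_induct)
      case (step z z')
      have z'C: "z' \<in> ?C" using step conn_step by blast
      show ?case
      proof (cases "z' = r")
        case True
        then show ?thesis using step conn_self[of z "?C - {r}" E] by blast
      next
        case False
        then obtain a where a: "a \<in> conn E (?C - {r}) z'" "E a r" using step.IH z'C by blast
        have "z' \<in> conn E (?C - {r}) z"
          using conn_step[of z E "?C - {r}" z z'] conn_self[of z "?C - {r}" E] step z'C False by blast
        then show ?thesis using a conn_trans by blast
      qed
    qed simp
    then obtain a where a: "a \<in> conn E (?C - {r}) z" "E a r" using z False by blast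
    have "a \<in> U" using a(1) conn_sub[of E "?C - {r}" z] CU by blast
    then show ?thesis using IH[OF a(1)] a(2) Suc.prems(1) by blast
  qed
  obtain a where a: "a < n" "linked E n U h x a" "a \<in> U" "a = r \<or> E a r" using reach[of x] conn_self[OF xU] by blast
  obtain b where b: "b < n" "linked E n U h y b" "b \<in> U" "b = r \<or> E b r" using reach[OF Suc.prems(3)] by blast
  have "r \<in> U" "r < n" using r CU Suc.prems(1) by auto
  moreover have "linked E n U h b y" using linked_sym[of E n U h y b] sym b(2) by blast
  ultimately have "near E U a r" "near E U r b" using a b sym unfolding near_def by auto
  then show ?case unfolding linked.simps using a(1,2) b(1) \<open>r < n\<close> \<open>linked E n U h b y\<close> by blast
qed

text \<open>Every subset of \<open>U\<close> has treedepth at most d, so \<open>linked\<close> with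
  the constant d decides connectivity in all of them by a single expression.\<close>

locale gctx =
  fixes \<kappa> :: "'c ctx" and E :: "'c \<Rightarrow> nat \<Rightarrow> nat \<Rightarrow> bool" and n :: "'c \<Rightarrow> nat" and U :: "'c \<Rightarrow> nat set" and d :: nat
  assumes dE: "dfp \<kappa> (\<lambda>c s. E c (s 0) (s 1))" and dn: "dfn \<kappa> (\<lambda>c s. n c)" and dU: "dfp \<kappa> (\<lambda>c s. s 0 \<in> U c)"
    and symE: "\<And>c x y. c \<in> valid \<kappa> \<Longrightarrow> E c x y \<Longrightarrow> E c y x"
    and Un: "\<And>c. c \<in> valid \<kappa> \<Longrightarrow> U c \<subseteq> {..<n c}"
    and TDU: "\<And>c S. c \<in> valid \<kappa> \<Longrightarrow> S \<subseteq> U c \<Longrightarrow> td_le (E c) d S"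
begin

lemmas dE' = dfn_comp2[where f = "\<lambda>c x y. of_bool (E c x y)", OF dE]
lemma dfn_shift2: "dfn \<kappa> f \<Longrightarrow> dfn \<kappa> (\<lambda>c s. f c (\<lambda>k. s (Suc (Suc k))))"
  using dfn_shift[OF dfn_shift] by blast

lemma dfn_shift3: "dfn \<kappa> f \<Longrightarrow> dfn \<kappa> (\<lambda>c s. f c (\<lambda>k. s (Suc (Suc (Suc k)))))"
  using dfn_shift[OF dfn_shift2] by blast

lemma dfp_linked:
  "DS \<kappa> S \<Longrightarrow> dfn \<kappa> a \<Longrightarrow> dfn \<kappa> b \<Longrightarrow> dfp \<kappa> (\<lambda>c s. linked (E c) (n c) (S c s) k (a c s) (b c s))"
proof (induction k arbitrary: S a b)
  case 0
  then show ?case unfolding linked.simps near_def by (intro dfp_conj dfp_disj dfp_eq dE' DS_mem)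
next
  case (Suc k)
  note m = DS_mem[OF DS_shift3[OF Suc.prems(1)]]
  show ?case unfolding linked.simps near_def
    by (intro dfp_ex dfp_conj dfp_disj dfp_eq dE' dn m dfn_var
        Suc.IH[OF DS_shift3[OF Suc.prems(1)] dfn_shift3[OF Suc.prems(2)] dfn_var]
        Suc.IH[OF DS_shift3[OF Suc.prems(1)] dfn_var dfn_shift3[OF Suc.prems(3)]])
qed

lemma DS_conn:
  assumes S: "DS \<kappa> S" "\<And>c s. c \<in> valid \<kappa> \<Longrightarrow> S c s \<subseteq> U c" and a: "dfn \<kappa> a"
  shows "DS \<kappa> (\<lambda>c s. conn (E c) (S c s) (a c s))"
proof (rule DS_I, rule dfp_cong)
  show "dfp \<kappa> (\<lambda>c s. linked (E c) (n c) (S c (\<lambda>k. s (Suc k))) d (a c (\<lambda>k. s (Suc k))) (s 0))"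
    by (intro dfp_linked DS_shift[OF S(1)] dfn_shift[OF a] dfn_var)
  fix c and s :: "nat \<Rightarrow> nat" assume c: "c \<in> valid \<kappa>"
  let ?S = "S c (\<lambda>k. s (Suc k))"
  have "?S \<subseteq> U c" "?S \<subseteq> {..<n c}" using S(2)[OF c] Un[OF c] by blast+
  then show "linked (E c) (n c) ?S d (a c (\<lambda>k. s (Suc k))) (s 0) = (s 0 \<in> conn (E c) ?S (a c (\<lambda>k. s (Suc k))))"
    using conn_linked[of "E c" ?S "n c" d, OF symE[OF c]] TDU[OF c, of ?S] linked_conn by metis
qed

lemma DS_ball:
  assumes "DS \<kappa> S" "\<And>c s. c \<in> valid \<kappa> \<Longrightarrow> S c s \<subseteq> U c" "dfp \<kappa> (\<lambda>c s. P c (s 0) (\<lambda>k. s (Suc k)))"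
  shows "dfp \<kappa> (\<lambda>c s. \<forall>x\<in>S c s. P c x s)"
proof (rule dfp_cong)
  show "dfp \<kappa> (\<lambda>c s. \<forall>x<n c. x \<in> S c s \<longrightarrow> P c x s)"
    by (intro dfp_all dfp_imp dn assms(3) DS_mem[OF DS_shift[OF assms(1)]] dfn_var)
  fix c s assume "c \<in> valid \<kappa>"
  then show "(\<forall>x<n c. x \<in> S c s \<longrightarrow> P c x s) = (\<forall>x\<in>S c s. P c x s)" using assms(2)[of c s] Un by blast
qed

lemma DS_bex:
  assumes "DS \<kappa> S" "\<And>c s. c \<in> valid \<kappa> \<Longrightarrow> S c s \<subseteq> U c" "dfp \<kappa> (\<lambda>c s. P c (s 0) (\<lambda>k. s (Suc k)))"
  shows "dfp \<kappa> (\<lambda>c s. \<exists>x\<in>S c s. P c x s)"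
proof (rule dfp_cong)
  show "dfp \<kappa> (\<lambda>c s. \<exists>x<n c. x \<in> S c s \<and> P c x s)"
    by (intro dfp_ex dfp_conj dn assms(3) DS_mem[OF DS_shift[OF assms(1)]] dfn_var)
  fix c s assume "c \<in> valid \<kappa>"
  then show "(\<exists>x<n c. x \<in> S c s \<and> P c x s) = (\<exists>x\<in>S c s. P c x s)" using assms(2)[of c s] Un by blast
qed

lemma conn_U: "S \<subseteq> U c \<Longrightarrow> conn E' S v - A \<subseteq> U c"
  using conn_sub[of E' S v] by blast

lemma dfp_td_le:
  "DS \<kappa> S \<Longrightarrow> (\<And>c s. c \<in> valid \<kappa> \<Longrightarrow> S c s \<subseteq> U c) \<Longrightarrow> dfp \<kappa> (\<lambda>c s. td_le (E c) j (S c s))"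
proof (induction j arbitrary: S)
  case 0
  have "dfp \<kappa> (\<lambda>c s. \<forall>x\<in>S c s. False)" by (rule DS_ball[OF 0]) (auto intro: dfn_cst)
  then show ?case by (rule dfp_cong) auto
next
  case (Suc j)
  have C: "DS \<kappa> (\<lambda>c s. conn (E c) (S c (\<lambda>k. s (Suc k))) (s 0))"
    using Suc.prems by (intro DS_conn DS_shift dfn_var) auto
  have C2: "DS \<kappa> (\<lambda>c s. conn (E c) (S c (\<lambda>k. s (Suc (Suc k)))) (s 1) - {s 0})"
    using Suc.prems by (intro DS_diff DS_single DS_conn DS_shift2 dfn_var) auto
  have "dfp \<kappa> (\<lambda>c s. \<forall>v\<in>S c s. \<exists>r\<in>conn (E c) (S c s) v. td_le (E c) j (conn (E c) (S c s) v - {r}))"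
  proof (rule DS_ball[OF Suc.prems])
    show "dfp \<kappa> (\<lambda>c s. \<exists>r\<in>conn (E c) (S c (\<lambda>k. s (Suc k))) (s 0). td_le (E c) j (conn (E c) (S c (\<lambda>k. s (Suc k))) (s 0) - {r}))"
    proof (rule DS_bex[OF C])
      show "conn (E c) (S c (\<lambda>k. s (Suc k))) (s 0) \<subseteq> U c" if "c \<in> valid \<kappa>" for c s
        using conn_sub Suc.prems(2)[OF that] by blast
      have "dfp \<kappa> (\<lambda>c s. td_le (E c) j (conn (E c) (S c (\<lambda>k. s (Suc (Suc k)))) (s 1) - {s 0}))"
        by (rule Suc.IH[OF C2]) (intro conn_U Suc.prems(2))
      then show "dfp \<kappa> (\<lambda>c s. td_le (E c) j (conn (E c) (S c (\<lambda>k. s (Suc (Suc k)))) (s (Suc 0)) - {s 0}))" by simp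
    qed
  qed auto
  then show ?case unfolding td_le.simps .
qed

lemma dfn_least:
  assumes P: "dfp \<kappa> (\<lambda>c s. P c (s 0) (\<lambda>k. s (Suc k)))" and b: "\<And>c s x. c \<in> valid \<kappa> \<Longrightarrow> P c x s \<Longrightarrow> x < n c"
  shows "dfn \<kappa> (\<lambda>c s. LEAST x. P c x s)"
proof (rule dfn_cong)
  have P2: "dfp \<kappa> (\<lambda>c s. P c (s 0) (\<lambda>k. s (Suc (Suc k))))"
    using dfn_skip[where f = "\<lambda>c x s. of_bool (P c x s)"] P by blast
  \<comment> \<open>\<open>LEAST x. False\<close> is some fixed number, hence a definable constant;
    it is the value of the least-number operator when there is no witness.\<close>
  show "dfn \<kappa> (\<lambda>c s. if \<exists>x<n c. P c x s then \<Sum>x<n c. if P c x s \<and> (\<forall>y<x. \<not> P c y s) then x else 0 else (LEAST x. False))"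
    by (intro dfn_if dfp_ex dn P dfn_sum dfp_conj dfp_all dfn_var dfn_cst dfp_not P2)
  fix c s assume c: "c \<in> valid \<kappa>"
  show "(if \<exists>x<n c. P c x s then \<Sum>x<n c. if P c x s \<and> (\<forall>y<x. \<not> P c y s) then x else 0 else (LEAST x. False)) = (LEAST x. P c x s)"
  proof (cases "\<exists>x<n c. P c x s")
    case True
    let ?m = "LEAST x. P c x s"
    have m: "P c ?m s" "\<And>y. y < ?m \<Longrightarrow> \<not> P c y s"
      using LeastI_ex[of "\<lambda>x. P c x s"] not_less_Least[of _ "\<lambda>x. P c x s"] True by blast+
    have iff: "P c x s \<and> (\<forall>y<x. \<not> P c y s) \<longleftrightarrow> x = ?m" for x
      using m by (metis linorder_neqE_nat)
    have "(\<Sum>x<n c. if P c x s \<and> (\<forall>y<x. \<not> P c y s) then x else 0) = ?m"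
      unfolding iff using b[OF c m(1)] by simp
    then show ?thesis using True by simp
  next
    case False
    then have "P c x s = False" for x using b[OF c] by blast
    then show ?thesis using False by simp
  qed
qed

lemma dfn_root:
  assumes C: "DS \<kappa> C" "\<And>c s. c \<in> valid \<kappa> \<Longrightarrow> C c s \<subseteq> U c"
  shows "dfn \<kappa> (\<lambda>c s. root (E c) j (C c s))"
  unfolding root_def
proof (rule dfn_least)
  show "dfp \<kappa> (\<lambda>c s. s 0 \<in> C c (\<lambda>k. s (Suc k)) \<and> td_le (E c) j (C c (\<lambda>k. s (Suc k)) - {s 0}))"
    by (intro dfp_conj DS_mem[OF DS_shift[OF C(1)]] dfn_var dfp_td_le DS_diff DS_shift[OF C(1)] DS_single)
      (use C(2) in blast)
  show "x < n c" if "c \<in> valid \<kappa>" "x \<in> C c s \<and> td_le (E c) j (C c s - {x})" for c s x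
    using that C(2) Un by blast
qed

lemma dfp_ord:
  "DS \<kappa> S \<Longrightarrow> (\<And>c s. c \<in> valid \<kappa> \<Longrightarrow> S c s \<subseteq> U c) \<Longrightarrow> dfn \<kappa> a \<Longrightarrow> dfn \<kappa> b \<Longrightarrow>
    dfp \<kappa> (\<lambda>c s. ord (E c) j (S c s) (a c s) (b c s))"
proof (induction j arbitrary: S a b)
  case 0
  show ?case by (simp add: dfn_cst)
next
  case (Suc j)
  have C: "DS \<kappa> (\<lambda>c s. conn (E c) (S c s) (b c s))" by (rule DS_conn[OF Suc.prems(1,2,4)])
  have CU: "conn (E c) (S c s) (b c s) \<subseteq> U c" if "c \<in> valid \<kappa>" for c s
    using conn_sub Suc.prems(2)[OF that] by blast
  have r: "dfn \<kappa> (\<lambda>c s. root (E c) j (conn (E c) (S c s) (b c s)))" by (rule dfn_root[OF C CU])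
  show ?case unfolding ord.simps
    by (intro dfp_conj dfp_disj dfp_not dfp_eq DS_mem[OF Suc.prems(1)] Suc.prems(3,4) r
        Suc.IH[OF DS_diff[OF C DS_single[OF r]]] conn_U Suc.prems(2))
qed

end

section \<open>Independence numbers of subtrees\<close>

definition children :: "nat set \<Rightarrow> (nat \<Rightarrow> nat \<Rightarrow> bool) \<Rightarrow> nat set \<Rightarrow> nat \<Rightarrow> nat set" where
  "children U le R v = {w\<in>R. le v w \<and> dep U le w = Suc (dep U le v)}"

text \<open>The independence number of the part of the subtree of v avoiding B, by branching on v; a vertex above
  excludes its neighbours through B. The recursion depth is the constant d.\<close>

primrec alpha_rec :: "(nat \<Rightarrow> nat \<Rightarrow> bool) \<Rightarrow> nat set \<Rightarrow> (nat \<Rightarrow> nat \<Rightarrow> bool) \<Rightarrow> nat set \<Rightarrow> nat \<Rightarrow> nat \<Rightarrow> nat set \<Rightarrow> nat" where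
  "alpha_rec E U le R 0 v B = 0"
| "alpha_rec E U le R (Suc j) v B = max (\<Sum>w\<in>children U le R v. alpha_rec E U le R j w B)
     (if v \<in> B then 0 else Suc (\<Sum>w\<in>children U le R v. alpha_rec E U le R j w (B \<union> {w. E v w})))"

lemma alpha_UN_sep:
  assumes P: "finite P" "\<And>p. p \<in> P \<Longrightarrow> finite (C p)"
    and sep: "\<And>p q x y. p \<in> P \<Longrightarrow> q \<in> P \<Longrightarrow> p \<noteq> q \<Longrightarrow> x \<in> C p \<Longrightarrow> y \<in> C q \<Longrightarrow> x \<noteq> y \<and> \<not> E x y"
  shows "alpha E (\<Union>p\<in>P. C p) = (\<Sum>p\<in>P. alpha E (C p))"
proof -
  define g where "g x = (SOME p. p \<in> P \<and> x \<in> C p)" for x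
  have g: "g x = p" if "p \<in> P" "x \<in> C p" for x p
  proof -
    have "\<exists>p. p \<in> P \<and> x \<in> C p" using that by blast
    from someI_ex[OF this] have "g x \<in> P" "x \<in> C (g x)" unfolding g_def by blast+
    then show ?thesis using sep[of "g x" p x x] that by blast
  qed
  have "alpha E (\<Union>p\<in>P. C p) = (\<Sum>p\<in>P. alpha E {x \<in> (\<Union>p\<in>P. C p). g x = p})"
  proof (rule alpha_partition)
    show "g x = g y" if h: "x \<in> (\<Union>p\<in>P. C p)" "y \<in> (\<Union>p\<in>P. C p)" "E x y" for x y
    proof -
      obtain p q where "p \<in> P" "x \<in> C p" "q \<in> P" "y \<in> C q" using h by blast
      then show ?thesis using g sep h(3) by metis
    qed
    show "g ` (\<Union>p\<in>P. C p) \<subseteq> P" using g by auto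
  qed (use P in auto)
  also have "\<dots> = (\<Sum>p\<in>P. alpha E (C p))"
  proof (intro sum.cong refl)
    fix p assume p: "p \<in> P"
    have "{x \<in> (\<Union>p\<in>P. C p). g x = p} = C p" using g p by auto
    then show "alpha E {x \<in> (\<Union>p\<in>P. C p). g x = p} = alpha E (C p)" by simp
  qed
  finally show ?thesis .
qed

context forest
begin

text \<open>A piece is its root together with the pieces of the children, which are disjoint and
  have no edges between them; so both branches at the root are sums. Depths are below d, hence
  \<open>d \<le> dp v + j\<close> leaves enough recursion steps.\<close>

lemma alpha_rec_alpha:
  assumes R: "down R"
  shows "v \<in> R \<Longrightarrow> d \<le> dp v + j \<Longrightarrow> alpha_rec E U le R j v B = alpha E (piece le R v - B)"
proof (induction j arbitrary: v B)
  case 0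
  then show ?case using dep_less[of v] R unfolding down_def by auto
next
  case (Suc j)
  have RU: "R \<subseteq> U" using R unfolding down_def by blast
  have v: "v \<in> U" using Suc.prems RU by blast
  have fR: "finite R" using R by (rule down_fin)
  let ?C = "children U le R v"
  have Ch: "w \<in> R \<and> w \<in> U \<and> le v w \<and> dp w = Suc (dp v)" if "w \<in> ?C" for w using that RU by (auto simp: children_def)
  have fC: "finite ?C" using fR by (simp add: children_def)
  have pv: "piece le R v = insert v (\<Union>w\<in>?C. piece le R w)"
  proof (intro equalityI subsetI)
    fix x assume x: "x \<in> piece le R v"
    then have xU: "x \<in> U" "x \<in> R" "le v x" using RU by (auto simp: piece_def)
    show "x \<in> insert v (\<Union>w\<in>?C. piece le R w)"
    proof (cases "x = v")
      case False
      then have "Suc (dp v) \<le> dp x" using dep_mono[OF v xU(1) xU(3)] by simp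
      then obtain w where w: "w \<in> U" "le w x" "dp w = Suc (dp v)" using anc_at[OF xU(1)] by blast
      have "w \<in> R" using R xU(2) w unfolding down_def by blast
      moreover have "le v w" using torderD(4)[OF t v w(1) xU(1,3) w(2)] dep_mono_le[OF w(1) v] w(3) by auto
      ultimately have "w \<in> ?C" using w by (simp add: children_def)
      then show ?thesis using w(2) xU(2) by (auto simp: piece_def)
    qed simp
  next
    fix x assume "x \<in> insert v (\<Union>w\<in>?C. piece le R w)"
    then consider "x = v" | w where "w \<in> ?C" "x \<in> R" "le w x" by (auto simp: piece_def)
    then show "x \<in> piece le R v"
    proof cases
      case 1
      then show ?thesis using Suc.prems torderD(1)[OF t v] by (simp add: piece_def)
    next
      case 2
      then show ?thesis using torderD(2)[OF t v, of w x] Ch[of w] RU by (auto simp: piece_def)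
    qed
  qed
  have vn: "v \<notin> piece le R w" if "w \<in> ?C" for w
    using dep_mono_le[of w v] Ch[OF that] v by (auto simp: piece_def)
  have sep: "x \<noteq> y \<and> \<not> E x y" if h: "w \<in> ?C" "w' \<in> ?C" "w \<noteq> w'" "x \<in> piece le R w - A" "y \<in> piece le R w' - A'" for w w' x y A A'
  proof -
    have x: "x \<in> U" "le w x" and y: "y \<in> U" "le w' y" using h RU by (auto simp: piece_def)
    have no: False if "z \<in> U" "le w z" "le w' z" for z
      using torderD(4)[OF t, of w w' z] dep_mono[of w w'] dep_mono[of w' w] Ch[OF h(1)] Ch[OF h(2)] h(3) that by auto
    have "\<not> E x y"
    proof
      assume e: "E x y"
      from torderD(6)[OF t x(1) y(1) e] show False
        using no[of y] no[of x] torderD(2)[OF t, of w x y] torderD(2)[OF t, of w' y x] x y Ch[OF h(1)] Ch[OF h(2)] by blast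
    qed
    then show ?thesis using no[of x] x y by blast
  qed
  have sum: "(\<Sum>w\<in>?C. alpha_rec E U le R j w A) = alpha E ((\<Union>w\<in>?C. piece le R w) - A)" for A
  proof -
    have "(\<Sum>w\<in>?C. alpha_rec E U le R j w A) = (\<Sum>w\<in>?C. alpha E (piece le R w - A))"
      using Ch Suc.prems(2) by (intro sum.cong refl Suc.IH) auto
    also have "\<dots> = alpha E (\<Union>w\<in>?C. piece le R w - A)"
    proof (rule alpha_UN_sep[symmetric, OF fC])
      show "finite (piece le R w - A)" for w using fR by (simp add: piece_def)
      show "x \<noteq> y \<and> \<not> E x y" if "w \<in> ?C" "w' \<in> ?C" "w \<noteq> w'" "x \<in> piece le R w - A" "y \<in> piece le R w' - A" for w w' x y
        using sep[OF that] .
    qed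
    also have "(\<Union>w\<in>?C. piece le R w - A) = (\<Union>w\<in>?C. piece le R w) - A" by blast
    finally show ?thesis .
  qed
  define A where "A = (\<Union>w\<in>?C. piece le R w)"
  have vU: "v \<notin> A" using vn unfolding A_def by blast
  note pv = pv[folded A_def] and sum = sum[folded A_def]
  let ?S = "piece le R v - B"
  show ?case
  proof (cases "v \<in> B")
    case True
    then have "?S = A - B" unfolding pv by blast
    then show ?thesis using True sum by simp
  next
    case False
    have fS: "finite ?S" using fR by (simp add: piece_def)
    have "v \<in> ?S" using False unfolding pv by blast
    have s1: "?S - {v} = A - B" unfolding pv using vU by blast
    have s2: "?S - {v} - {w. E v w} = A - (B \<union> {w. E v w})" unfolding s1 by blast
    have "alpha E ?S = max (alpha E (?S - {v})) (Suc (alpha E (?S - {v} - {w. E v w})))"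
    proof (rule alpha_vertex[OF fS \<open>v \<in> ?S\<close>])
      show "E y x" if "E x y" for x y using E[OF that] by simp
      show "\<not> E v v" using E[of v v] by auto
    qed
    then show ?thesis unfolding s2 unfolding s1 using False sum by simp
  qed
qed

end

section \<open>Definability of chunks, conflicts and pruned pieces\<close>

locale fctx =
  fixes \<kappa> :: "'c ctx" and E :: "'c \<Rightarrow> nat \<Rightarrow> nat \<Rightarrow> bool" and n :: "'c \<Rightarrow> nat" and X U :: "'c \<Rightarrow> nat set"
    and le :: "'c \<Rightarrow> nat \<Rightarrow> nat \<Rightarrow> bool" and d :: nat and R :: "'c \<Rightarrow> nat set"
  assumes dE: "dfp \<kappa> (\<lambda>c s. E c (s 0) (s 1))" and dn: "dfn \<kappa> (\<lambda>c s. n c)" and dX: "dfp \<kappa> (\<lambda>c s. s 0 \<in> X c)"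
    and dU: "dfp \<kappa> (\<lambda>c s. s 0 \<in> U c)" and dle: "dfp \<kappa> (\<lambda>c s. le c (s 0) (s 1))" and dR: "dfp \<kappa> (\<lambda>c s. s 0 \<in> R c)"
    and fo: "\<And>c. c \<in> valid \<kappa> \<Longrightarrow> forest (n c) d (E c) (X c) (U c) (le c)"
    and dw: "\<And>c. c \<in> valid \<kappa> \<Longrightarrow> forest.down (U c) (le c) (R c)"
begin

lemmas dE' = dfn_comp2[where f = "\<lambda>c x y. of_bool (E c x y)", OF dE]
lemmas dle' = dfn_comp2[where f = "\<lambda>c x y. of_bool (le c x y)", OF dle]
lemmas dU' = dfn_comp1[where f = "\<lambda>c x. of_bool (x \<in> U c)", OF dU]
lemmas dX' = dfn_comp1[where f = "\<lambda>c x. of_bool (x \<in> X c)", OF dX]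
lemmas dR' = dfn_comp1[where f = "\<lambda>c x. of_bool (x \<in> R c)", OF dR]

lemma RU: "c \<in> valid \<kappa> \<Longrightarrow> R c \<subseteq> U c"
proof -
  assume c: "c \<in> valid \<kappa>"
  show "R c \<subseteq> U c" using dw[OF c] unfolding forest.down_def[OF fo[OF c]] by (rule conjunct1)
qed

lemma Rn: "c \<in> valid \<kappa> \<Longrightarrow> x \<in> R c \<Longrightarrow> x < n c"
proof -
  assume c: "c \<in> valid \<kappa>" and "x \<in> R c"
  then have "x \<in> U c" using RU by blast
  then show "x < n c" using forest.U[OF fo[OF c]] by simp
qed

lemma dfn_dep: "dfn \<kappa> (\<lambda>c s. dep (U c) (le c) (s 0))"
proof (rule dfn_cong)
  show "dfn \<kappa> (\<lambda>c s. card {u. u < n c \<and> u \<in> U c \<and> le c u (s 0) \<and> u \<noteq> s 0})"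
    by (intro dfn_card dn dfp_conj dfp_not dfp_eq dfn_var dU' dle')
  fix c and s :: "nat \<Rightarrow> nat" assume "c \<in> valid \<kappa>"
  then have "U c \<subseteq> {..<n c}" using forest.U[OF fo[of c]] by blast
  then show "card {u. u < n c \<and> u \<in> U c \<and> le c u (s 0) \<and> u \<noteq> s 0} = dep (U c) (le c) (s 0)"
    unfolding dep_def by (intro arg_cong[of _ _ card]) auto
qed

lemmas dfn_dep' = dfn_comp1[where f = "\<lambda>c x. dep (U c) (le c) x", OF dfn_dep]

lemma dfn_alpha_rec: "DS \<kappa> B \<Longrightarrow> dfn \<kappa> v \<Longrightarrow> dfn \<kappa> (\<lambda>c s. alpha_rec (E c) (U c) (le c) (R c) j (v c s) (B c s))"
proof (induction j arbitrary: B v)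
  case 0
  show ?case by (simp add: dfn_cst)
next
  case (Suc j)
  have sum: "dfn \<kappa> (\<lambda>c s. \<Sum>w\<in>children (U c) (le c) (R c) (v c s). alpha_rec (E c) (U c) (le c) (R c) j w (B' c s))"
    if B': "DS \<kappa> B'" for B'
  proof (rule dfn_cong)
    show "dfn \<kappa> (\<lambda>c s. \<Sum>w\<in>{w. w < n c \<and> w \<in> R c \<and> le c (v c s) w \<and> dep (U c) (le c) w = Suc (dep (U c) (le c) (v c s))}.
        alpha_rec (E c) (U c) (le c) (R c) j w (B' c s))"
      unfolding Suc_eq_plus1
      by (intro dfn_sum_filter dn dfp_conj dR' dle' dfp_eq dfn_dep' dfn_add dfn_cst dfn_var dfn_shift[OF Suc.prems(2)]
          Suc.IH[OF DS_shift[OF B'] dfn_var])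
    fix c s assume "c \<in> valid \<kappa>"
    then have "{w. w < n c \<and> w \<in> R c \<and> le c (v c s) w \<and> dep (U c) (le c) w = Suc (dep (U c) (le c) (v c s))}
        = children (U c) (le c) (R c) (v c s)"
      using Rn unfolding children_def by blast
    then show "(\<Sum>w\<in>{w. w < n c \<and> w \<in> R c \<and> le c (v c s) w \<and> dep (U c) (le c) w = Suc (dep (U c) (le c) (v c s))}.
        alpha_rec (E c) (U c) (le c) (R c) j w (B' c s)) = (\<Sum>w\<in>children (U c) (le c) (R c) (v c s). alpha_rec (E c) (U c) (le c) (R c) j w (B' c s))"
      by simp
  qed
  have "DS \<kappa> (\<lambda>c s. {w. E c (v c s) w})"
    unfolding DS_def mem_Collect_eq by (intro dE' dfn_shift[OF Suc.prems(2)] dfn_var)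
  then have B2: "DS \<kappa> (\<lambda>c s. B c s \<union> {w. E c (v c s) w})" by (rule DS_union[OF Suc.prems(1)])
  show ?case unfolding alpha_rec.simps unfolding Suc_eq_plus1
    by (intro dfn_max sum[OF Suc.prems(1)] dfn_if DS_mem[OF Suc.prems] dfn_cst dfn_add sum[OF B2])
qed

lemma dfp_level: "dfp \<kappa> (\<lambda>c s. s 0 \<in> level (U c) (le c) (R c) i)"
  unfolding level_def mem_Collect_eq by (intro dfp_conj dR' dfn_var dfp_eq dfn_dep' dfn_cst)

lemmas dfp_level' = dfn_comp1[where f = "\<lambda>c x. of_bool (x \<in> level (U c) (le c) (R c) i)" for i, OF dfp_level]

lemma dfp_decode_set_sub:
  assumes S: "DS \<kappa> S"
  shows "dfn \<kappa> y \<Longrightarrow> dfp \<kappa> (\<lambda>c s. decode_set (n c) b (y c s) \<subseteq> S c s)"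
proof (induction b arbitrary: y)
  case 0
  show ?case by (simp add: dfn_cst)
next
  case (Suc b)
  show ?case unfolding decode_set.simps insert_subset
    by (intro dfp_conj DS_mem[OF S] dfn_mod dn Suc.prems Suc.IH dfn_div)
qed

lemma dfp_nbrs_decode_set: "dfn \<kappa> y \<Longrightarrow> dfn \<kappa> w \<Longrightarrow> dfp \<kappa> (\<lambda>c s. w c s \<in> nbrs (E c) (decode_set (n c) b (y c s)))"
proof (induction b arbitrary: y)
  case 0
  show ?case by (simp add: nbrs_def dfn_cst)
next
  case (Suc b)
  have e: "w' \<in> nbrs E' (decode_set n' (Suc b) y') \<longleftrightarrow> E' (y' mod n') w' \<or> w' \<in> nbrs E' (decode_set n' b (y' div n'))" for w' E' n' y'
    by (auto simp: nbrs_def)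
  show ?case unfolding e by (intro dfp_disj dE' dfn_mod dn Suc.prems Suc.IH dfn_div)
qed

lemma dfp_chunk: "dfp \<kappa> (\<lambda>c s. chunk (n c) (X c) (U c) (le c) (R c) i b (s 0))"
proof -
  have "DS \<kappa> (\<lambda>c s. X c \<union> up (le c) (R c) (s 0 mod n c))"
    unfolding DS_def up_def Un_iff mem_Collect_eq by (intro dfp_disj dfp_conj dX' dR' dle' dfn_var dfn_mod dn)
  then show ?thesis unfolding chunk_def low_def Un_iff mem_Collect_eq
    by (intro dfp_conj dfp_disj dX' dR' dfn_mod dn dfn_var dfp_less dfn_dep' dfn_cst dfp_decode_set_sub dfn_div)
qed

lemmas dfp_chunk' = dfn_comp1[where f = "\<lambda>c y. of_bool (chunk (n c) (X c) (U c) (le c) (R c) i b y)" for i b, OF dfp_chunk]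

lemma DS_empty: "DS \<kappa> (\<lambda>c s. {})"
  unfolding DS_def by (simp add: dfn_cst)

lemma dfp_blocked_by: "dfp \<kappa> (\<lambda>c s. blocked_by (n c) (E c) (X c) (U c) (le c) (R c) i b (s 0) (s 1))"
proof (rule dfp_cong)
  have N: "DS \<kappa> (\<lambda>c s. nbrs (E c) (decode_set (n c) (Suc b) (s 1)))"
    unfolding DS_def by (intro dfp_nbrs_decode_set dfn_var)
  show "dfp \<kappa> (\<lambda>c s. s 0 \<in> level (U c) (le c) (R c) i \<and> chunk (n c) (X c) (U c) (le c) (R c) i b (s 1) \<and>
     alpha_rec (E c) (U c) (le c) (R c) d (s 0) (nbrs (E c) (decode_set (n c) (Suc b) (s 1))) < alpha_rec (E c) (U c) (le c) (R c) d (s 0) {})"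
    by (intro dfp_conj dfp_level' dfp_chunk' dfn_var dfp_less dfn_alpha_rec N DS_empty)
  fix c and s :: "nat \<Rightarrow> nat" assume c: "c \<in> valid \<kappa>"
  have "alpha_rec (E c) (U c) (le c) (R c) d v B = alpha (E c) (piece (le c) (R c) v - B)" if "v \<in> level (U c) (le c) (R c) i" for v B
    using forest.alpha_rec_alpha[OF fo[OF c] dw[OF c], of v d B] that by (auto simp: level_def)
  then show "(s 0 \<in> level (U c) (le c) (R c) i \<and> chunk (n c) (X c) (U c) (le c) (R c) i b (s 1) \<and>
     alpha_rec (E c) (U c) (le c) (R c) d (s 0) (nbrs (E c) (decode_set (n c) (Suc b) (s 1))) < alpha_rec (E c) (U c) (le c) (R c) d (s 0) {})
     = blocked_by (n c) (E c) (X c) (U c) (le c) (R c) i b (s 0) (s 1)"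
    unfolding blocked_by_def by auto
qed

text \<open>Supplies the two updates made at a level: the decrease of the cover number caused by the
  deleted pieces, and the surviving vertices.\<close>

lemma dfn_pieces:
  assumes Q: "dfp \<kappa> (\<lambda>c s. s 0 \<in> Q c)" and QR: "\<And>c. c \<in> valid \<kappa> \<Longrightarrow> Q c \<subseteq> R c"
  shows "dfn \<kappa> (\<lambda>c s. \<Sum>v\<in>Q c. card (piece (le c) (R c) v) - alpha (E c) (piece (le c) (R c) v))"
    "dfp \<kappa> (\<lambda>c s. s 0 \<in> R c - (\<Union>v\<in>Q c. piece (le c) (R c) v))"
proof -
  note Q' = dfn_comp1[where f = "\<lambda>c x. of_bool (x \<in> Q c)", OF Q]
  have Qn: "{v. v < n c \<and> v \<in> Q c} = Q c" if "c \<in> valid \<kappa>" for c using QR[OF that] Rn[OF that] by blast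
  show "dfn \<kappa> (\<lambda>c s. \<Sum>v\<in>Q c. card (piece (le c) (R c) v) - alpha (E c) (piece (le c) (R c) v))"
  proof (rule dfn_cong)
    show "dfn \<kappa> (\<lambda>c s. \<Sum>v\<in>{v. v < n c \<and> v \<in> Q c}. card {w. w < n c \<and> w \<in> R c \<and> le c v w} - alpha_rec (E c) (U c) (le c) (R c) d v {})"
      by (intro dfn_sum_filter dn Q' dfn_var dfn_sub dfn_card dfp_conj dR' dle' dfn_alpha_rec DS_empty)
    fix c and s :: "nat \<Rightarrow> nat" assume c: "c \<in> valid \<kappa>"
    have "card {w. w < n c \<and> w \<in> R c \<and> le c v w} - alpha_rec (E c) (U c) (le c) (R c) d v {}
        = card (piece (le c) (R c) v) - alpha (E c) (piece (le c) (R c) v)" if "v \<in> Q c" for v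
    proof -
      have "{w. w < n c \<and> w \<in> R c \<and> le c v w} = piece (le c) (R c) v" using Rn[OF c] by (auto simp: piece_def)
      moreover have "alpha_rec (E c) (U c) (le c) (R c) d v {} = alpha (E c) (piece (le c) (R c) v)"
        using forest.alpha_rec_alpha[OF fo[OF c] dw[OF c], of v d "{}"] QR[OF c] that by auto
      ultimately show ?thesis by simp
    qed
    then show "(\<Sum>v\<in>{v. v < n c \<and> v \<in> Q c}. card {w. w < n c \<and> w \<in> R c \<and> le c v w} - alpha_rec (E c) (U c) (le c) (R c) d v {})
        = (\<Sum>v\<in>Q c. card (piece (le c) (R c) v) - alpha (E c) (piece (le c) (R c) v))"
      unfolding Qn[OF c] by (intro sum.cong) auto
  qed
  show "dfp \<kappa> (\<lambda>c s. s 0 \<in> R c - (\<Union>v\<in>Q c. piece (le c) (R c) v))"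
  proof (rule dfp_cong)
    show "dfp \<kappa> (\<lambda>c s. s 0 \<in> R c \<and> \<not> (\<exists>v<n c. v \<in> Q c \<and> le c v (s 0)))"
      by (intro dfp_conj dfp_not dfp_ex dn Q' dR' dle' dfn_var)
    fix c and s :: "nat \<Rightarrow> nat" assume c: "c \<in> valid \<kappa>"
    show "(s 0 \<in> R c \<and> \<not> (\<exists>v<n c. v \<in> Q c \<and> le c v (s 0))) = (s 0 \<in> R c - (\<Union>v\<in>Q c. piece (le c) (R c) v))"
      using QR[OF c] Rn[OF c] unfolding piece_def by blast
  qed
qed

end

text \<open>A three-dimensional table of bids in one array. Time is the most significant digit, so
  earlier bids have smaller indices and the auction becomes a course-of-values recursion.\<close>

definition bt :: "nat \<Rightarrow> nat \<Rightarrow> (nat \<Rightarrow> bool) \<Rightarrow> nat \<Rightarrow> nat \<Rightarrow> nat \<Rightarrow> bool" where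
  "bt n m T t v y \<longleftrightarrow> T ((t * n + v) * m + y)"

section \<open>Definability of the auction\<close>

locale actx =
  fixes \<kappa> :: "'c ctx" and n m p :: "'c \<Rightarrow> nat" and T :: "'c \<Rightarrow> nat \<Rightarrow> bool"
    and P :: "'c \<Rightarrow> nat \<Rightarrow> bool" and rel :: "'c \<Rightarrow> nat \<Rightarrow> nat \<Rightarrow> bool"
  assumes dn: "dfn \<kappa> (\<lambda>c s. n c)" and dm: "dfn \<kappa> (\<lambda>c s. m c)" and dp: "dfn \<kappa> (\<lambda>c s. p c)"
    and dT: "dfp \<kappa> (\<lambda>c s. T c (s 0))" and dP: "dfp \<kappa> (\<lambda>c s. P c (s 0))" and drel: "dfp \<kappa> (\<lambda>c s. rel c (s 0) (s 1))"
begin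

lemmas dT' = dfn_comp1[where f = "\<lambda>c x. of_bool (T c x)", OF dT]
lemmas dP' = dfn_comp1[where f = "\<lambda>c x. of_bool (P c x)", OF dP]
lemmas drel' = dfn_comp2[where f = "\<lambda>c x y. of_bool (rel c x y)", OF drel]

lemma dfp_bt: "dfn \<kappa> t \<Longrightarrow> dfn \<kappa> v \<Longrightarrow> dfn \<kappa> y \<Longrightarrow> dfp \<kappa> (\<lambda>c s. bt (n c) (m c) (T c) (t c s) (v c s) (y c s))"
  unfolding bt_def by (intro dT' dfn_add dfn_mult dn dm)

lemma dfn_price: "dfn \<kappa> (\<lambda>c s. price (n c) (bt (n c) (m c) (T c)) (s 0) (s 1))"
  unfolding price_def by (intro dfn_sum dfn_var dn dfp_bt)

lemmas dfn_price' = dfn_comp2[where f = "\<lambda>c. price (n c) (bt (n c) (m c) (T c))", OF dfn_price]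

lemma dfp_owns: "dfp \<kappa> (\<lambda>c s. owns (n c) (bt (n c) (m c) (T c)) (s 0) (s 1) (s 2))"
  unfolding owns_def by (intro dfp_ex dfp_conj dfp_all dfp_imp dfp_less dfp_not dfn_var dn dfp_bt)

lemmas dfp_owns' = dfn_comp3[where f = "\<lambda>c t v y. of_bool (owns (n c) (bt (n c) (m c) (T c)) t v y)", OF dfp_owns]

lemma dfp_active: "dfp \<kappa> (\<lambda>c s. active (n c) (m c) (p c) (P c) (rel c) (bt (n c) (m c) (T c)) (s 0) (s 1))"
  unfolding active_def by (intro dfp_conj dP' dfp_not dfp_ex dm dfp_owns' dfn_var drel' dfp_less dfn_price' dp)

lemmas dfp_active' = dfn_comp2[where f = "\<lambda>c t v. of_bool (active (n c) (m c) (p c) (P c) (rel c) (bt (n c) (m c) (T c)) t v)", OF dfp_active]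

lemma dfp_bid: "dfn \<kappa> t \<Longrightarrow> dfn \<kappa> v \<Longrightarrow> dfn \<kappa> y \<Longrightarrow>
  dfp \<kappa> (\<lambda>c s. bid (n c) (m c) (p c) (P c) (rel c) (bt (n c) (m c) (T c)) (t c s) (v c s) (y c s))"
proof -
  have "dfp \<kappa> (\<lambda>c s. bid (n c) (m c) (p c) (P c) (rel c) (bt (n c) (m c) (T c)) (s 0) (s 1) (s 2))"
    unfolding bid_def
    by (intro dfp_conj dfp_all dfp_imp dfp_disj dfp_not dfp_active' dfn_var drel' dm dfp_less dfp_eq dfp_le dfn_price')
  from dfn_comp3[where f = "\<lambda>c t v y. of_bool (bid (n c) (m c) (p c) (P c) (rel c) (bt (n c) (m c) (T c)) t v y)", OF this]
  show "dfn \<kappa> t \<Longrightarrow> dfn \<kappa> v \<Longrightarrow> dfn \<kappa> y \<Longrightarrow>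
    dfp \<kappa> (\<lambda>c s. bid (n c) (m c) (p c) (P c) (rel c) (bt (n c) (m c) (T c)) (t c s) (v c s) (y c s))" .
qed

end

text \<open>Prices and owners at time t come from bids before t; so the partially filled table can
  stand in for the final one.\<close>

lemma bid_cong:
  assumes B: "\<And>s v y. s < t \<Longrightarrow> v < n \<Longrightarrow> y < m \<Longrightarrow> B s v y = B' s v y"
    and P: "\<And>v. P v \<Longrightarrow> v < n" and y: "y < m"
  shows "bid n m p P rel B t v y = bid n m p P rel B' t v y"
proof -
  have pr: "price n B t y = price n B' t y" if "y < m" for y
    unfolding price_def using B that by (intro sum.cong) auto
  have ow: "owns n B t v y = owns n B' t v y" if "v < n" "y < m" for v y
    unfolding owns_def using B that by (metis (no_types, lifting))
  have ac: "active n m p P rel B t v = active n m p P rel B' t v" for v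
    unfolding active_def using pr ow P by (metis (no_types, lifting))
  show ?thesis unfolding bid_def ac by (auto simp: pr y)
qed

lemma idx_less:
  assumes "s < t" "v' < n" "y' < (m::nat)" shows "(s * n + v') * m + y' < (t * n + v) * m + y"
proof -
  have "(s * n + v') * m + y' < Suc (s * n + v') * m" using assms(3) by simp
  also have "Suc (s * n + v') \<le> Suc s * n" using assms(2) by simp
  then have "Suc (s * n + v') * m \<le> Suc s * n * m" by (rule mult_le_mono1)
  also have "Suc s * n * m \<le> t * n * m" using assms(1) by (intro mult_le_mono1) simp
  also have "\<dots> \<le> (t * n + v) * m + y" by (simp add: algebra_simps)
  finally show ?thesis .
qed

lemma idx_decode:
  assumes "v < n" "y < (m::nat)"
  shows "((t * n + v) * m + y) mod m = y" "((t * n + v) * m + y) div m mod n = v" "((t * n + v) * m + y) div m div n = t"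
  using assms by simp_all

lemma owns_cong:
  assumes "\<And>s v y. s < t \<Longrightarrow> v < n \<Longrightarrow> y < m \<Longrightarrow> B s v y = B' s v y" "v < n" "y < m"
  shows "owns n B t v y = owns n B' t v y"
  unfolding owns_def using assms by (metis (no_types, lifting))

lemma level_table:
  assumes st: "stage enc (\<Gamma>, len, a, V)" and fc: "fctx (\<Gamma>, len, a, V) E n X U le d R"
  obtains T Q where "stage enc (\<lambda>c. (\<Gamma> c)(a := T c), len, Suc a, V)"
    "dfp (\<lambda>c. (\<Gamma> c)(a := T c), len, Suc a, V) (\<lambda>c s. s 0 \<in> Q c)"
    "\<And>c. c \<in> V \<Longrightarrow> \<exists>B p Tm. (\<forall>t v y. B t v y \<longleftrightarrow> t < Tm \<and> v < n c \<and> y < n c ^ Suc b \<and>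
        bid (n c) (n c ^ Suc b) p (\<lambda>v. v \<in> level (U c) (le c) (R c) i) (blocked_by (n c) (E c) (X c) (U c) (le c) (R c) i b) B t v y) \<and>
      n c < p \<and> n c ^ Suc b * p < Tm \<and>
      Q c = {v. v \<in> level (U c) (le c) (R c) i \<and> (\<forall>y<n c ^ Suc b. \<not> owns (n c) B Tm v y)}"
proof -
  let ?k = "(\<Gamma>, len, a, V)"
  interpret f: fctx ?k E n X U le d R by (rule fc)
  define m where "m c = n c ^ Suc b" for c
  \<comment> \<open>The least values that the auction admits: the price limit exceeds the number n
    of bidders, and the time bound below exceeds m times this limit.\<close>
  define p where "p c = n c + 1" for c
  define Tm where "Tm c = m c * (n c + 1) + 1" for c
  define P where "P c v = (v \<in> level (U c) (le c) (R c) i)" for c v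
  define rel where "rel c = blocked_by (n c) (E c) (X c) (U c) (le c) (R c) i b" for c
  have dm: "dfn ?k (\<lambda>c s. m c)" unfolding m_def by (intro dfn_power f.dn)
  have dp: "dfn ?k (\<lambda>c s. p c)" unfolding p_def by (intro dfn_add dfn_cst f.dn)
  have dTm: "dfn ?k (\<lambda>c s. Tm c)" unfolding Tm_def by (intro dfn_add dfn_mult dm dfn_cst f.dn)
  have dP: "dfp ?k (\<lambda>c s. P c (s 0))" unfolding P_def by (rule f.dfp_level)
  have drel: "dfp ?k (\<lambda>c s. rel c (s 0) (s 1))" unfolding rel_def by (rule f.dfp_blocked_by)
  have Pn: "v < n c" if "c \<in> V" "P c v" for c v
    using f.Rn[of c v] that unfolding P_def level_def valid_def by auto
  interpret t: actx "tabctx ?k" "\<lambda>x. n (fst x)" "\<lambda>x. m (fst x)" "\<lambda>x. p (fst x)" "\<lambda>x. snd x" "\<lambda>x. P (fst x)" "\<lambda>x. rel (fst x)"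
    using dfn_tabctx[OF f.dn] dfn_tabctx[OF dm] dfn_tabctx[OF dp] dfn_tabctx[OF dP] dfn_tabctx[OF drel] dfp_tab[OF dfn_var]
    by unfold_locales
  define body where "body c T j = bid (n c) (m c) (p c) (P c) (rel c) (bt (n c) (m c) T) (j div m c div n c) (j div m c mod n c) (j mod m c)" for c T j
  have dbody: "dfp (tabctx ?k) (\<lambda>x s. body (fst x) (snd x) (s 0))"
    unfolding body_def by (intro t.dfp_bid dfn_div dfn_mod dfn_var t.dn t.dm)
  have db: "dfn ?k (\<lambda>c s. Tm c * n c * m c)" by (intro dfn_mult dTm f.dn dm)
  obtain T where T: "stage enc (\<lambda>c. (\<Gamma> c)(a := T c), len, Suc a, V)"
    "\<And>c j. c \<in> V \<Longrightarrow> T c j \<longleftrightarrow> j < Tm c * n c * m c \<and> body c (\<lambda>j'. j' < j \<and> T c j') j"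
    by (rule stage_table[OF st db dbody]) blast
  let ?k1 = "(\<lambda>c. (\<Gamma> c)(a := T c), len, Suc a, V)"
  interpret u: actx ?k1 n m p T P rel
    using dfn_extend[OF f.dn] dfn_extend[OF dm] dfn_extend[OF dp] dfn_extend[OF dP] dfn_extend[OF drel] dfp_extend
    by unfold_locales
  \<comment> \<open>Restricted to the index ranges, inside which the code of a triple is
    unambiguous.\<close>
  define B where "B c t v y \<longleftrightarrow> t < Tm c \<and> v < n c \<and> y < m c \<and> bt (n c) (m c) (T c) t v y" for c t v y
  have B: "B c t v y \<longleftrightarrow> t < Tm c \<and> v < n c \<and> y < m c \<and> bid (n c) (m c) (p c) (P c) (rel c) (B c) t v y" if c: "c \<in> V" for c t v y
  proof (cases "t < Tm c \<and> v < n c \<and> y < m c")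
    case True
    let ?j = "(t * n c + v) * m c + y"
    have jb: "?j < Tm c * n c * m c" using idx_less[of t "Tm c" v "n c" y "m c" 0 0] True by simp
    have "B c t v y \<longleftrightarrow> T c ?j" using True by (simp add: B_def bt_def)
    also have "\<dots> \<longleftrightarrow> body c (\<lambda>j'. j' < ?j \<and> T c j') ?j" using T(2)[OF c, of ?j] jb by simp
    also have "\<dots> \<longleftrightarrow> bid (n c) (m c) (p c) (P c) (rel c) (bt (n c) (m c) (\<lambda>j'. j' < ?j \<and> T c j')) t v y"
      unfolding body_def using idx_decode[of v "n c" y "m c" t] True by simp
    also have "\<dots> \<longleftrightarrow> bid (n c) (m c) (p c) (P c) (rel c) (B c) t v y"
    proof (rule bid_cong)
      fix s v' y' assume "s < t" "v' < n c" "y' < m c"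
      then show "bt (n c) (m c) (\<lambda>j'. j' < ?j \<and> T c j') s v' y' = B c s v' y'"
        using idx_less[of s t v' "n c" y' "m c" v y] True by (simp add: B_def bt_def)
    qed (use True Pn[OF c] in auto)
    finally show ?thesis using True by simp
  qed (auto simp: B_def)
  define Q where "Q c = {v. P c v \<and> (\<forall>y<m c. \<not> owns (n c) (B c) (Tm c) v y)}" for c
  have dQ: "dfp ?k1 (\<lambda>c s. s 0 \<in> Q c)"
  proof (rule dfp_cong)
    show "dfp ?k1 (\<lambda>c s. P c (s 0) \<and> (\<forall>y<m c. \<not> owns (n c) (bt (n c) (m c) (T c)) (Tm c) (s 0) y))"
      by (intro dfp_conj u.dP' dfn_var dfp_all u.dm dfp_not u.dfp_owns' dfn_extend[OF dTm])
    fix c and s :: "nat \<Rightarrow> nat" assume "c \<in> valid ?k1"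
    then have c: "c \<in> V" by (simp add: valid_def)
    have "owns (n c) (bt (n c) (m c) (T c)) (Tm c) (s 0) y = owns (n c) (B c) (Tm c) (s 0) y" if "P c (s 0)" "y < m c" for y
      using that Pn[OF c] by (intro owns_cong) (auto simp: B_def)
    then show "(P c (s 0) \<and> (\<forall>y<m c. \<not> owns (n c) (bt (n c) (m c) (T c)) (Tm c) (s 0) y)) = (s 0 \<in> Q c)"
      unfolding Q_def by blast
  qed
  show thesis
  proof (rule that[OF T(1) dQ])
    fix c assume c: "c \<in> V"
    show "\<exists>B p Tm. (\<forall>t v y. B t v y \<longleftrightarrow> t < Tm \<and> v < n c \<and> y < n c ^ Suc b \<and>
        bid (n c) (n c ^ Suc b) p (\<lambda>v. v \<in> level (U c) (le c) (R c) i) (blocked_by (n c) (E c) (X c) (U c) (le c) (R c) i b) B t v y) \<and>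
      n c < p \<and> n c ^ Suc b * p < Tm \<and>
      Q c = {v. v \<in> level (U c) (le c) (R c) i \<and> (\<forall>y<n c ^ Suc b. \<not> owns (n c) B Tm v y)}"
    proof -
      have 1: "\<forall>t v y. B c t v y \<longleftrightarrow> t < Tm c \<and> v < n c \<and> y < n c ^ Suc b \<and>
        bid (n c) (n c ^ Suc b) (p c) (\<lambda>v. v \<in> level (U c) (le c) (R c) i) (blocked_by (n c) (E c) (X c) (U c) (le c) (R c) i b) (B c) t v y"
        using B[OF c] unfolding m_def P_def rel_def by blast
      have 2: "Q c = {v. v \<in> level (U c) (le c) (R c) i \<and> (\<forall>y<n c ^ Suc b. \<not> owns (n c) (B c) (Tm c) v y)}"
        unfolding Q_def m_def P_def ..
      have 3: "n c < p c" "n c ^ Suc b * p c < Tm c" by (simp_all add: p_def Tm_def m_def)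
      show ?thesis by (intro exI conjI) (rule 1, rule 3, rule 3, rule 2)
    qed
  qed
qed

section \<open>The kernel\<close>

definition forest_part :: "vc_inst \<Rightarrow> nat set" where
  "forest_part I = {..<nv I} - modx I"

text \<open>Validity only asserts that some tree order exists; this canonical one is given by an
  expression.\<close>

definition forest_le :: "nat \<Rightarrow> vc_inst \<Rightarrow> nat \<Rightarrow> nat \<Rightarrow> bool" where
  "forest_le d I = ord (adj I) d (forest_part I)"

lemma valid_torder:
  assumes "valid_inst d I" shows "\<exists>le. torder (forest_part I) (adj I) le d"
proof -
  have "treedepth (forest_part I) (\<lambda>i j. adj I i j \<and> i \<notin> modx I \<and> j \<notin> modx I) \<le> d"
    using assms unfolding valid_inst_def forest_part_def by blast
  then obtain le where "torder (forest_part I) (\<lambda>i j. adj I i j \<and> i \<notin> modx I \<and> j \<notin> modx I) le d"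
    using treedepth_le_iff[of "forest_part I"] by (auto simp: forest_part_def)
  from torder_inj[OF this inj_on_id, of "forest_part I" "adj I"] have "torder (forest_part I) (adj I) le d"
    by (simp add: forest_part_def)
  then show ?thesis by blast
qed

lemma valid_td_le:
  assumes v: "valid_inst d I" and S: "S \<subseteq> forest_part I" shows "td_le (adj I) d S"
proof -
  obtain le where t: "torder (forest_part I) (adj I) le d" using valid_torder[OF v] by blast
  have fU: "finite (forest_part I)" by (simp add: forest_part_def)
  have "torder S (adj I) le d"
  proof (rule torder_subset[OF t S])
    fix w assume "w \<in> S"
    have "card {u\<in>S. le u w} \<le> card {u\<in>forest_part I. le u w}" using S fU by (intro card_mono) auto
    then show "card {u\<in>S. le u w} \<le> d" using torderD(5)[OF t, of w] S \<open>w \<in> S\<close> by (meson le_trans subsetD)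
  qed
  then show ?thesis using td_le_torder[of S "adj I" le d] valid_graph[OF v] finite_subset[OF S fU] by blast
qed

lemma forest_valid:
  assumes v: "valid_inst d I" shows "forest (nv I) d (adj I) (modx I) (forest_part I) (forest_le d I)"
proof
  show "x < nv I \<and> y < nv I \<and> x \<noteq> y \<and> adj I y x" if "adj I x y" for x y using valid_graph[OF v that] .
  show "modx I \<subseteq> {..<nv I}" using v by (simp add: valid_inst_def)
  show "torder (forest_part I) (adj I) (forest_le d I) d"
    unfolding forest_le_def using valid_graph[OF v] by (intro torder_ord valid_td_le[OF v]) (auto simp: forest_part_def)
qed (simp add: forest_part_def)

lemma dfp_forest_part: "dfp (ctx0 d) (\<lambda>I s. s 0 \<in> forest_part I)"
  unfolding forest_part_def Diff_iff lessThan_iff by (intro dfp_conj dfp_less dfn_var dfn_nv dfp_not dfp_modx)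

lemma dfp_forest_le: "dfp (ctx0 d) (\<lambda>I s. forest_le d I (s 0) (s 1))"
proof -
  interpret gctx "ctx0 d" adj nv forest_part d
    using dfp_adj dfn_nv dfp_forest_part valid_graph valid_td_le by unfold_locales (auto simp: forest_part_def)
  show ?thesis unfolding forest_le_def by (intro dfp_ord DS_const dfp_forest_part dfn_var) simp
qed

text \<open>The size k of the modulator times one factor
  \<open>2 * (k + d) ^ (block_size (d - j) - 1)\<close> for each level j < i; d - j is the height of
  the pieces at depth j.\<close>

definition level_bound :: "nat \<Rightarrow> nat \<Rightarrow> nat \<Rightarrow> nat" where
  "level_bound d i k = k * (2 ^ i * (k + d) ^ (\<Sum>j<i. block_size (d - j) - 1))"

text \<open>D is the amount by which the deletions have lowered the vertex cover number.\<close>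

definition level_inv :: "nat \<Rightarrow> nat \<Rightarrow> vc_inst \<Rightarrow> nat set \<Rightarrow> nat \<Rightarrow> bool" where
  "level_inv d i I R D \<longleftrightarrow> forest.down (forest_part I) (forest_le d I) R \<and>
     nv I + alpha (adj I) (modx I \<union> R) = alpha (adj I) {..<nv I} + card (modx I \<union> R) + D \<and>
     card (modx I) + card (low (forest_part I) (forest_le d I) R i) \<le> level_bound d i (card (modx I))"

text \<open>Each level adds one array, the bids of its auction, so the context changes with i. As d
  is constant, a constant number of polynomial passes is composed.\<close>

lemma levels:
  assumes d: "1 \<le> d"
  shows "i \<le> d \<Longrightarrow> \<exists>\<Gamma> len a R D. stage enc_inst (\<Gamma>, len, a, {I. valid_inst d I}) \<and>
     (\<forall>f. dfn (ctx0 d) f \<longrightarrow> dfn (\<Gamma>, len, a, {I. valid_inst d I}) f) \<and>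
     dfp (\<Gamma>, len, a, {I. valid_inst d I}) (\<lambda>I s. s 0 \<in> R I) \<and> dfn (\<Gamma>, len, a, {I. valid_inst d I}) (\<lambda>I s. D I) \<and>
     (\<forall>I. valid_inst d I \<longrightarrow> level_inv d i I (R I) (D I))"
proof (induction i)
  case 0
  have "level_inv d 0 I (forest_part I) 0" if v: "valid_inst d I" for I
  proof -
    interpret forest "nv I" d "adj I" "modx I" "forest_part I" "forest_le d I" by (rule forest_valid[OF v])
    have "modx I \<union> forest_part I = {..<nv I}" using X by (auto simp: forest_part_def)
    moreover have "low (forest_part I) (forest_le d I) (forest_part I) 0 = {}" by (simp add: low_def)
    ultimately show ?thesis unfolding level_inv_def using down_U by (simp add: level_bound_def)
  qed
  moreover have "ctx0 d = (\<lambda>I. inp (enc_inst I), \<lambda>I. length (enc_inst I), 2, {I. valid_inst d I})" by (simp add: ctx0_def)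
  ultimately show ?case using stage_ctx0[of d] dfp_forest_part[of d] dfn_cst[of "ctx0 d" 0]
    by (intro exI[of _ "\<lambda>I. inp (enc_inst I)"] exI[of _ "\<lambda>I. length (enc_inst I)"] exI[of _ 2] exI[of _ forest_part] exI[of _ "\<lambda>_. 0"]) simp
next
  case (Suc i)
  let ?V = "{I. valid_inst d I}"
  obtain \<Gamma> len a R D where st: "stage enc_inst (\<Gamma>, len, a, ?V)"
    and ext: "\<And>f. dfn (ctx0 d) f \<Longrightarrow> dfn (\<Gamma>, len, a, ?V) f"
    and dR: "dfp (\<Gamma>, len, a, ?V) (\<lambda>I s. s 0 \<in> R I)" and dD: "dfn (\<Gamma>, len, a, ?V) (\<lambda>I s. D I)"
    and inv: "\<And>I. valid_inst d I \<Longrightarrow> level_inv d i I (R I) (D I)"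
    using Suc by (auto simp del: dfn.simps)
  interpret f: fctx "(\<Gamma>, len, a, ?V)" adj nv modx forest_part "forest_le d" d R
  proof (rule fctx.intro)
    show "forest.down (forest_part I) (forest_le d I) (R I)" if "I \<in> valid (\<Gamma>, len, a, ?V)" for I
      using inv that unfolding level_inv_def by (simp add: valid_def)
    show "forest (nv I) d (adj I) (modx I) (forest_part I) (forest_le d I)" if "I \<in> valid (\<Gamma>, len, a, ?V)" for I
      using that by (intro forest_valid) (simp add: valid_def)
  qed (intro ext dR dfp_adj dfn_nv dfp_modx dfp_forest_part dfp_forest_le)+
  obtain b where b: "block_size (d - i) = Suc b"
  proof -
    have "block_size (d - i) \<noteq> 0" using Suc.prems by (cases "d - i") auto
    then show ?thesis using that not0_implies_Suc by blast
  qed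
  obtain T Q where T: "stage enc_inst (\<lambda>I. (\<Gamma> I)(a := T I), len, Suc a, ?V)"
    and dQ: "dfp (\<lambda>I. (\<Gamma> I)(a := T I), len, Suc a, ?V) (\<lambda>I s. s 0 \<in> Q I)"
    and Q: "\<And>I. I \<in> ?V \<Longrightarrow> \<exists>B p Tm. (\<forall>t v y. B t v y \<longleftrightarrow> t < Tm \<and> v < nv I \<and> y < nv I ^ Suc b \<and>
        bid (nv I) (nv I ^ Suc b) p (\<lambda>v. v \<in> level (forest_part I) (forest_le d I) (R I) i) (blocked_by (nv I) (adj I) (modx I) (forest_part I) (forest_le d I) (R I) i b) B t v y) \<and>
      nv I < p \<and> nv I ^ Suc b * p < Tm \<and>
      Q I = {v. v \<in> level (forest_part I) (forest_le d I) (R I) i \<and> (\<forall>y<nv I ^ Suc b. \<not> owns (nv I) B Tm v y)}"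
    by (rule level_table[OF st f.fctx_axioms, of b i]) blast
  let ?k1 = "(\<lambda>I. (\<Gamma> I)(a := T I), len, Suc a, ?V)"
  interpret g: fctx ?k1 adj nv modx forest_part "forest_le d" d R
    using dfn_extend[OF f.dE] dfn_extend[OF f.dn] dfn_extend[OF f.dX] dfn_extend[OF f.dU] dfn_extend[OF f.dle] dfn_extend[OF f.dR] f.fo f.dw
    by (intro fctx.intro) (auto simp: valid_def simp del: dfn.simps)
  have QR: "Q I \<subseteq> R I" if "I \<in> valid ?k1" for I
    using Q[of I] that by (auto simp: valid_def level_def)
  define R' where "R' I = R I - (\<Union>v\<in>Q I. piece (forest_le d I) (R I) v)" for I
  define \<Delta> where "\<Delta> I = (\<Sum>v\<in>Q I. card (piece (forest_le d I) (R I) v) - alpha (adj I) (piece (forest_le d I) (R I) v))" for I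
  have dR': "dfp ?k1 (\<lambda>I s. s 0 \<in> R' I)" unfolding R'_def by (rule g.dfn_pieces(2)[OF dQ QR])
  have d\<Delta>: "dfn ?k1 (\<lambda>I s. D I + \<Delta> I)" unfolding \<Delta>_def
    by (intro dfn_add dfn_extend[OF dD] g.dfn_pieces(1)[OF dQ QR])
  have lv: "level_inv d (Suc i) I (R' I) (D I + \<Delta> I)" if v: "valid_inst d I" for I
  proof -
    interpret F: forest "nv I" d "adj I" "modx I" "forest_part I" "forest_le d I" by (rule forest_valid[OF v])
    from Q[of I] v obtain B p Tm where B: "\<And>t v y. B t v y \<longleftrightarrow> t < Tm \<and> v < nv I \<and> y < nv I ^ Suc b \<and>
        bid (nv I) (nv I ^ Suc b) p (\<lambda>v. v \<in> level (forest_part I) (forest_le d I) (R I) i) (blocked_by (nv I) (adj I) (modx I) (forest_part I) (forest_le d I) (R I) i b) B t v y"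
      "nv I < p" "nv I ^ Suc b * p < Tm"
      and QI: "Q I = {v. v \<in> level (forest_part I) (forest_le d I) (R I) i \<and> (\<forall>y<nv I ^ Suc b. \<not> owns (nv I) B Tm v y)}" by auto
    have inv': "F.down (R I)" "nv I + alpha (adj I) (modx I \<union> R I) = alpha (adj I) {..<nv I} + card (modx I \<union> R I) + D I"
      "card (modx I) + card (low (forest_part I) (forest_le d I) (R I) i) \<le> level_bound d i (card (modx I))"
      using inv[OF v] unfolding level_inv_def by auto
    note s = F.level_step[OF inv'(1) b B, folded QI, folded R'_def]
    have fR: "finite (R I)" using F.down_fin[OF inv'(1)] .
    \<comment> \<open>The cover number of the graph drops by the cover numbers of the deleted
      pieces. No subtraction is truncated, since \<alpha> is at most the cardinality.\<close>
    have "\<Delta> I + (\<Sum>v\<in>Q I. alpha (adj I) (piece (forest_le d I) (R I) v)) = (\<Sum>v\<in>Q I. card (piece (forest_le d I) (R I) v))"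
      unfolding \<Delta>_def sum.distrib[symmetric]
      using fR by (intro sum.cong refl le_add_diff_inverse2 alpha_card) (simp add: piece_def)
    then have eq: "nv I + alpha (adj I) (modx I \<union> R' I) = alpha (adj I) {..<nv I} + card (modx I \<union> R' I) + (D I + \<Delta> I)"
      using inv'(2) s(2,3) by linarith
    let ?k = "card (modx I)"
    \<comment> \<open>The base is positive because d \<ge> 1, so the 1 accounting for the older
      vertices is absorbed by a factor 2.\<close>
    have "1 + (?k + d) ^ b \<le> 2 * (?k + d) ^ b" using d by simp
    then have "(?k + card (low (forest_part I) (forest_le d I) (R I) i)) * (1 + (?k + d) ^ b) \<le> level_bound d i ?k * (2 * (?k + d) ^ b)"
      by (intro mult_le_mono inv'(3))
    also have "\<dots> = level_bound d (Suc i) ?k"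
      using b by (simp add: level_bound_def power_add algebra_simps)
    finally show ?thesis unfolding level_inv_def using s(1,4) eq by linarith
  qed
  have ext': "dfn ?k1 f" if "dfn (ctx0 d) f" for f by (rule dfn_extend[OF ext[OF that]])
  show ?case
  proof (intro exI conjI allI impI)
    show "stage enc_inst ?k1" by (rule T)
    show "dfn ?k1 f" if "dfn (ctx0 d) f" for f by (rule ext'[OF that])
    show "dfp ?k1 (\<lambda>I s. s 0 \<in> R' I)" by (rule dR')
    show "dfn ?k1 (\<lambda>I s. D I + \<Delta> I)" by (rule d\<Delta>)
    show "level_inv d (Suc i) I (R' I) (D I + \<Delta> I)" if "valid_inst d I" for I by (rule lv[OF that])
  qed
qed

section \<open>Renumbering and the output instance\<close>

definition rank :: "nat set \<Rightarrow> nat \<Rightarrow> nat" where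
  "rank W v = card {u. u < v \<and> u \<in> W}"

definition unrank :: "nat \<Rightarrow> nat set \<Rightarrow> nat \<Rightarrow> nat" where
  "unrank N W i = (\<Sum>v<N. if v \<in> W \<and> rank W v = i then v else 0)"

lemma rank_bij:
  assumes "finite W" shows "bij_betw (rank W) W {..<card W}"
proof -
  have less: "rank W u < rank W v" if "u \<in> W" "u < v" for u v
  proof -
    have "{w. w < u \<and> w \<in> W} \<subset> {w. w < v \<and> w \<in> W}" using that by auto
    then show ?thesis unfolding rank_def using assms by (intro psubset_card_mono) auto
  qed
  have inj: "inj_on (rank W) W"
    using less by (intro linorder_inj_onI') (metis less_irrefl)+
  moreover have "rank W ` W \<subseteq> {..<card W}"
  proof
    fix i assume "i \<in> rank W ` W"
    then obtain v where v: "v \<in> W" "i = rank W v" by blast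
    have "{w. w < v \<and> w \<in> W} \<subset> W" using v(1) by auto
    then show "i \<in> {..<card W}" unfolding v(2) rank_def using assms by (simp add: psubset_card_mono)
  qed
  ultimately have "rank W ` W = {..<card W}" using assms by (intro card_seteq) (auto simp: card_image)
  then show ?thesis using inj by (simp add: bij_betw_def)
qed

lemma unrank_rank:
  assumes W: "W \<subseteq> {..<N}" and v: "v \<in> W" shows "unrank N W (rank W v) = v"
proof -
  have fW: "finite W" using W finite_subset by blast
  have "u \<in> W \<and> rank W u = rank W v \<longleftrightarrow> u = v" for u
    using v inj_onD[OF bij_betw_imp_inj_on[OF rank_bij[OF fW]], of u v] by auto
  then have "unrank N W (rank W v) = (\<Sum>u<N. if u = v then u else 0)" unfolding unrank_def by simp
  then show ?thesis using v W by auto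
qed

lemma unrank_bij:
  assumes W: "W \<subseteq> {..<N}" shows "bij_betw (unrank N W) {..<card W} W"
proof (rule bij_betw_byWitness[where f' = "rank W"])
  have b: "bij_betw (rank W) W {..<card W}" using rank_bij W finite_subset by blast
  have im: "rank W ` W = {..<card W}" using b by (simp add: bij_betw_def)
  show "\<forall>i\<in>{..<card W}. rank W (unrank N W i) = i"
    unfolding im[symmetric] using unrank_rank[OF W] by auto
  show "\<forall>v\<in>W. unrank N W (rank W v) = v" using unrank_rank[OF W] by blast
  show "unrank N W ` {..<card W} \<subseteq> W"
    unfolding im[symmetric] using unrank_rank[OF W] by auto
  show "rank W ` W \<subseteq> {..<card W}" using b unfolding bij_betw_def by blast
qed

lemma alpha_image:
  assumes S: "finite S" and f: "inj_on f S" and E: "\<And>i j. i \<in> S \<Longrightarrow> j \<in> S \<Longrightarrow> E' i j = E (f i) (f j)"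
  shows "alpha E' S = alpha E (f ` S)"
proof (rule antisym)
  obtain T where T: "T \<subseteq> S" "indep E' T" "card T = alpha E' S" using alpha_ex[OF S, of E'] by blast
  have "indep E (f ` T)" using T E unfolding indep_def by blast
  then have "card (f ` T) \<le> alpha E (f ` S)" using S T by (intro alpha_ge) auto
  then show "alpha E' S \<le> alpha E (f ` S)" using T f by (metis card_image inj_on_subset)
  obtain T where T: "T \<subseteq> f ` S" "indep E T" "card T = alpha E (f ` S)" using alpha_ex[of "f ` S" E] S by blast
  obtain T' where T': "T' \<subseteq> S" "T = f ` T'" using T(1) by (meson subset_imageE)
  have "indep E' T'" using T(2) T' E unfolding indep_def by blast
  then have "card T' \<le> alpha E' S" using S T' by (intro alpha_ge) auto
  then show "alpha E (f ` S) \<le> alpha E' S" using T T' f by (metis card_image inj_on_subset)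
qed

text \<open>Complements of vertex covers are independent sets and conversely; written additively to
  avoid truncated subtraction.\<close>

lemma yes_alpha:
  assumes g: "is_graph I" shows "yes_inst I \<longleftrightarrow> nv I \<le> ell I + alpha (adj I) {..<nv I}"
proof
  assume "yes_inst I"
  then obtain S where S: "S \<subseteq> {..<nv I}" "\<forall>i j. adj I i j \<longrightarrow> i \<in> S \<or> j \<in> S" "card S \<le> ell I"
    unfolding yes_inst_def is_vertex_cover_def by blast
  have "card ({..<nv I} - S) \<le> alpha (adj I) {..<nv I}"
    using S(2) by (intro alpha_ge) (auto simp: indep_def)
  moreover have "card ({..<nv I} - S) = nv I - card S" using S(1) by (simp add: card_Diff_subset finite_subset)
  ultimately show "nv I \<le> ell I + alpha (adj I) {..<nv I}" using S(3) by linarith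
next
  assume a: "nv I \<le> ell I + alpha (adj I) {..<nv I}"
  obtain T where T: "T \<subseteq> {..<nv I}" "indep (adj I) T" "card T = alpha (adj I) {..<nv I}"
    using alpha_ex[of "{..<nv I}" "adj I"] by blast
  have "card ({..<nv I} - T) = nv I - card T" using T(1) by (simp add: card_Diff_subset finite_subset)
  then have "card ({..<nv I} - T) \<le> ell I" using a T(3) by linarith
  moreover have "is_vertex_cover I ({..<nv I} - T)"
    unfolding is_vertex_cover_def
  proof (intro conjI allI impI)
    fix i j assume a: "adj I i j"
    then have "i < nv I" "j < nv I" using g by (auto simp: is_graph_def)
    moreover have "\<not> (i \<in> T \<and> j \<in> T)" using T(2) a unfolding indep_def by blast
    ultimately show "i \<in> {..<nv I} - T \<or> j \<in> {..<nv I} - T" by blast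
  qed blast
  ultimately show "yes_inst I" unfolding yes_inst_def by blast
qed

text \<open>Cutting the budget at \<open>card W\<close> does not change the answer, since all
  vertices together form a cover, and the actual size of the modulator becomes the parameter. The
  original budget and parameter may be exponential in the length of their binary encodings.\<close>

definition sub_inst :: "vc_inst \<Rightarrow> nat set \<Rightarrow> nat \<Rightarrow> vc_inst" where
  "sub_inst I W D = \<lparr>nv = card W,
     adj = (\<lambda>i j. i < card W \<and> j < card W \<and> adj I (unrank (nv I) W i) (unrank (nv I) W j)),
     ell = min (ell_cap I - D) (card W),
     modx = {i. i < card W \<and> unrank (nv I) W i \<in> modx I},
     kpar = card (modx I)\<rparr>"

text \<open>A single edge with budget 0. One endpoint is put into the modulator, so that the rest
  has treedepth 1.\<close>

definition no_inst :: vc_inst where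
  "no_inst = \<lparr>nv = 2, adj = (\<lambda>i j. i = 0 \<and> j = 1 \<or> i = 1 \<and> j = 0), ell = 0, modx = {0}, kpar = 1\<rparr>"

text \<open>If the budget is smaller than \<open>D\<close>, truncated subtraction would turn it into
  0 and possibly create a yes-instance.\<close>

definition out_inst :: "vc_inst \<Rightarrow> nat set \<Rightarrow> nat \<Rightarrow> vc_inst" where
  "out_inst I W D = (if ell_cap I < D then no_inst else sub_inst I W D)"

lemma no_inst_valid: assumes "1 \<le> d" shows "valid_inst d no_inst" "\<not> yes_inst no_inst"
proof -
  have "{..<2} - {0} = {1::nat}" by auto
  moreover have "torder {1} (\<lambda>i j. adj no_inst i j \<and> i \<notin> modx no_inst \<and> j \<notin> modx no_inst) (=) d"
    using assms by (auto simp: torder_def no_inst_def)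
  ultimately have "treedepth ({..<nv no_inst} - modx no_inst) (\<lambda>i j. adj no_inst i j \<and> i \<notin> modx no_inst \<and> j \<notin> modx no_inst) \<le> d"
    using treedepth_le_iff[of "{1}"] by (auto simp: no_inst_def)
  then show "valid_inst d no_inst" unfolding valid_inst_def is_graph_def by (auto simp: no_inst_def)
  show "\<not> yes_inst no_inst"
  proof
    assume "yes_inst no_inst"
    then obtain S where S: "is_vertex_cover no_inst S" "card S \<le> ell no_inst" unfolding yes_inst_def by blast
    have "S \<subseteq> {..<2}" using S(1) by (simp add: is_vertex_cover_def no_inst_def)
    moreover have "0 \<in> S \<or> 1 \<in> S"
      using S(1) unfolding is_vertex_cover_def by (auto simp: no_inst_def dest: spec[of _ 0])
    moreover have "card S = 0" using S(2) by (simp add: no_inst_def)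
    ultimately have S: "S \<subseteq> {..<2}" "0 \<in> S \<or> 1 \<in> S" "card S = 0" .
    then have "finite S" using finite_subset by blast
    then show False using S by simp
  qed
qed

text \<open>The tree order is pulled back along the renumbering, which is injective and maps the
  vertices outside the new modulator into the forest part.\<close>

lemma sub_inst_valid:
  assumes v: "valid_inst d I" and R: "R \<subseteq> forest_part I" shows "valid_inst d (sub_inst I (modx I \<union> R) D)"
proof -
  let ?W = "modx I \<union> R" and ?J = "sub_inst I (modx I \<union> R) D"
  let ?f = "unrank (nv I) ?W"
  interpret F: forest "nv I" d "adj I" "modx I" "forest_part I" "forest_le d I" by (rule forest_valid[OF v])
  have W: "?W \<subseteq> {..<nv I}" using F.X R F.U by blast
  note b = unrank_bij[OF W]
  have inj: "inj_on ?f {..<card ?W}" and img: "?f ` {..<card ?W} = ?W" using b by (auto simp: bij_betw_def)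
  have "i \<noteq> j" if "adj I (?f i) (?f j)" for i j using valid_graph[OF v that] by auto
  then have g: "is_graph ?J" using valid_graph[OF v] unfolding is_graph_def sub_inst_def by auto
  have m: "modx ?J \<subseteq> {..<nv ?J}" by (auto simp: sub_inst_def)
  have "card (modx ?J) = card (?f ` modx ?J)"
    using inj by (intro card_image[symmetric]) (auto simp: sub_inst_def intro: inj_on_subset)
  also have "\<dots> \<le> card (modx I)" using F.finX by (intro card_mono) (auto simp: sub_inst_def)
  finally have k: "card (modx ?J) \<le> kpar ?J" by (simp add: sub_inst_def)
  let ?S = "{..<nv ?J} - modx ?J"
  have S: "?S \<subseteq> {..<card ?W}" by (auto simp: sub_inst_def)
  have "?f ` ?S \<subseteq> forest_part I"
  proof
    fix w assume "w \<in> ?f ` ?S"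
    then obtain i where i: "i < card ?W" "w = ?f i" "?f i \<notin> modx I" by (auto simp: sub_inst_def)
    then have "w \<in> ?W" using img by blast
    then show "w \<in> forest_part I" using i R by blast
  qed
  then have "torder ?S (\<lambda>i j. adj ?J i j \<and> i \<notin> modx ?J \<and> j \<notin> modx ?J) (\<lambda>i j. forest_le d I (?f i) (?f j)) d"
    by (intro torder_inj[OF F.t inj_on_subset[OF inj S]]) (auto simp: sub_inst_def F.finU)
  then have "treedepth ?S (\<lambda>i j. adj ?J i j \<and> i \<notin> modx ?J \<and> j \<notin> modx ?J) \<le> d"
    using treedepth_le_iff[of ?S] by blast
  then show ?thesis using g m k unfolding valid_inst_def by blast
qed

lemma out_inst_yes:
  assumes v: "valid_inst d I" and d: "1 \<le> d" and R: "R \<subseteq> forest_part I"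
    and eq: "nv I + alpha (adj I) (modx I \<union> R) = alpha (adj I) {..<nv I} + card (modx I \<union> R) + D"
  shows "yes_inst (out_inst I (modx I \<union> R) D) \<longleftrightarrow> yes_inst I"
proof -
  let ?W = "modx I \<union> R"
  interpret F: forest "nv I" d "adj I" "modx I" "forest_part I" "forest_le d I" by (rule forest_valid[OF v])
  have W: "?W \<subseteq> {..<nv I}" using F.X R F.U by blast
  then have fW: "finite ?W" using finite_subset by blast
  have aW: "alpha (adj I) ?W \<le> card ?W" using fW by (rule alpha_card)
  have aV: "alpha (adj I) {..<nv I} \<le> nv I" using alpha_card[of "{..<nv I}"] by simp
  have yI: "yes_inst I \<longleftrightarrow> nv I \<le> ell I + alpha (adj I) {..<nv I}"
    using v by (intro yes_alpha) (simp add: valid_inst_def)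
  show ?thesis
  proof (cases "ell_cap I < D")
    case True
    \<comment> \<open>The cover number is at least \<open>D\<close> and at most \<open>nv I\<close>,
      so the minimum can be below \<open>D\<close> only because of the budget itself.\<close>
    then have "min (nv I) (ell I) < D" by (simp add: ell_cap_eq)
    then have "\<not> yes_inst I" unfolding yI using eq aW aV by linarith
    then show ?thesis using True no_inst_valid(2)[OF d] by (simp add: out_inst_def)
  next
    case False
    have b: "bij_betw (unrank (nv I) ?W) {..<card ?W} ?W" by (rule unrank_bij[OF W])
    have "alpha (adj (sub_inst I ?W D)) {..<card ?W} = alpha (adj I) (unrank (nv I) ?W ` {..<card ?W})"
      using b by (intro alpha_image) (auto simp: sub_inst_def bij_betw_def)
    then have "alpha (adj (sub_inst I ?W D)) {..<card ?W} = alpha (adj I) ?W" using b by (simp add: bij_betw_def)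
    then have "yes_inst (sub_inst I ?W D) \<longleftrightarrow> card ?W \<le> min (ell_cap I - D) (card ?W) + alpha (adj I) ?W"
      using yes_alpha[of "sub_inst I ?W D"] sub_inst_valid[OF v R, of D] by (simp add: valid_inst_def sub_inst_def)
    also have "\<dots> \<longleftrightarrow> nv I \<le> ell I + alpha (adj I) {..<nv I}"
      using False eq aW aV unfolding ell_cap_eq by linarith
    finally show ?thesis using False yI by (simp add: out_inst_def)
  qed
qed

section \<open>Definability of the output string\<close>

lemma enc_nat_nth:
  "enc_nat n = map (\<lambda>i. n div 2 ^ i mod 2 + 1) [0..<card {i. 2 ^ i \<le> n}]"
proof (induction n rule: less_induct)
  case (less n)
  show ?case
  proof (cases "n = 0")
    case True
    then show ?thesis by (subst enc_nat_eq) simp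
  next
    case False
    have fin: "finite {i. 2 ^ i \<le> m}" for m :: nat
      by (rule finite_subset[of _ "{..m}"]) (auto intro: less_imp_le[OF less_le_trans[OF less_exp]])
    have "{i. 2 ^ i \<le> n} = insert 0 (Suc ` {i. 2 ^ i \<le> n div 2})"
    proof (intro set_eqI iffI)
      fix i assume "i \<in> {i. 2 ^ i \<le> n}"
      then show "i \<in> insert 0 (Suc ` {i. 2 ^ i \<le> n div 2})" by (cases i) auto
    qed (use False in auto)
    then have c: "card {i. 2 ^ i \<le> n} = Suc (card {i. 2 ^ i \<le> n div 2})"
      using fin by (simp add: card_image)
    have "n div 2 < n" using False by simp
    from less.IH[OF this] have "enc_nat n = (n mod 2 + 1) # map (\<lambda>i. n div 2 div 2 ^ i mod 2 + 1) [0..<card {i. 2 ^ i \<le> n div 2}]"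
      using False by (subst enc_nat_eq) simp
    also have "\<dots> = map (\<lambda>i. n div 2 ^ i mod 2 + 1) [0..<Suc (card {i. 2 ^ i \<le> n div 2})]"
      by (simp add: upt_conv_Cons map_Suc_upt[symmetric] div_mult2_eq comp_def del: upt_Suc)
    finally show ?thesis unfolding c .
  qed
qed

lemma length_enc_nat: "length (enc_nat n) = card {v. v < n + 1 \<and> ispow v}"
proof -
  have "{v. v < n + 1 \<and> ispow v} = (\<lambda>i. 2 ^ i) ` {i. 2 ^ i \<le> n}" by (auto simp: ispow_def less_Suc_eq_le)
  then have "card {v. v < n + 1 \<and> ispow v} = card {i. 2 ^ i \<le> n}" by (simp add: card_image inj_on_def)
  then show ?thesis by (subst enc_nat_nth) simp
qed

lemma length_enc_nat_le: "length (enc_nat n) \<le> n"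
proof -
  have "{v. v < n + 1 \<and> ispow v} \<subseteq> {1..n}" by (auto simp: ispow_def)
  from card_mono[OF _ this] show ?thesis unfolding length_enc_nat by simp
qed

text \<open>A digit at position i means 2^i \<le> n, so the cap n + 1 in \<open>p2\<close> is not
  reached.\<close>

lemma nth_enc_nat: "i < length (enc_nat n) \<Longrightarrow> enc_nat n ! i = n div p2 (n + 1) i mod 2 + 1"
proof -
  assume i: "i < length (enc_nat n)"
  have "\<not> n < 2 ^ i"
  proof
    assume n: "n < 2 ^ i"
    have "{v. v < n + 1 \<and> ispow v} \<subseteq> {u. u < 2 ^ i \<and> ispow u}" using n by auto
    then have "length (enc_nat n) \<le> i"
      unfolding length_enc_nat using card_mono[OF finite_Collect_conj_less] card_ispow by metis
    then show False using i by simp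
  qed
  then have "p2 (n + 1) i = 2 ^ i" by (simp add: p2_eq)
  then show ?thesis using i by (subst enc_nat_nth) (simp add: enc_nat_nth[of n, THEN arg_cong[of _ _ length]])
qed

lemma dfl_append: "dfl \<kappa> x \<Longrightarrow> dfl \<kappa> y \<Longrightarrow> dfl \<kappa> (\<lambda>c. x c @ y c)"
proof -
  assume x: "dfl \<kappa> x" and y: "dfl \<kappa> y"
  have lx: "dfn \<kappa> (\<lambda>c s. length (x c))" and ly: "dfn \<kappa> (\<lambda>c s. length (y c))"
    and nx: "dfn \<kappa> (\<lambda>c s. if s 0 < length (x c) then x c ! s 0 else 0)"
    and ny: "dfn \<kappa> (\<lambda>c s. if s 0 < length (y c) then y c ! s 0 else 0)"
    using x y by (auto simp: dfl_def)
  note ny' = dfn_comp1[where f = "\<lambda>c i. if i < length (y c) then y c ! i else 0", OF ny]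
  have "dfn \<kappa> (\<lambda>c s. if s 0 < length (x c) then (if s 0 < length (x c) then x c ! s 0 else 0)
      else (if s 0 - length (x c) < length (y c) then y c ! (s 0 - length (x c)) else 0))"
    by (intro dfn_if[where f = "\<lambda>c s. if s 0 < length (x c) then x c ! s 0 else 0"] dfp_less dfn_var lx nx ny' dfn_sub)
  then have "dfn \<kappa> (\<lambda>c s. if s 0 < length (x c @ y c) then (x c @ y c) ! s 0 else 0)"
    by (rule dfn_cong) (auto simp: nth_append)
  moreover have "dfn \<kappa> (\<lambda>c s. length (x c @ y c))" unfolding length_append by (intro dfn_add lx ly)
  ultimately show ?thesis unfolding dfl_def by blast
qed

lemma dfl_map:
  assumes "dfn \<kappa> (\<lambda>c s. n c)" "dfn \<kappa> (\<lambda>c s. f c (s 0))" shows "dfl \<kappa> (\<lambda>c. map (f c) [0..<n c])"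
proof -
  have "dfn \<kappa> (\<lambda>c s. if s 0 < n c then f c (s 0) else 0)"
    by (intro dfn_if dfp_less dfn_var assms dfn_cst)
  then have "dfn \<kappa> (\<lambda>c s. if s 0 < length (map (f c) [0..<n c]) then map (f c) [0..<n c] ! s 0 else 0)"
    by (rule dfn_cong) auto
  then show ?thesis using assms(1) by (simp add: dfl_def)
qed

lemma dfl_single: "dfl \<kappa> (\<lambda>c. [k])"
  using dfl_map[OF dfn_cst[of \<kappa> 1] dfn_cst[of \<kappa> k]] by simp

lemma dfl_cons: "dfl \<kappa> x \<Longrightarrow> dfl \<kappa> (\<lambda>c. k # x c)"
  using dfl_append[OF dfl_single, of \<kappa> x k] by simp

lemma dfl_const: "dfl \<kappa> (\<lambda>c. l)"
proof (induction l)
  case Nil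
  show ?case using dfl_map[OF dfn_cst[of \<kappa> 0] dfn_cst[of \<kappa> 0]] by simp
next
  case (Cons k l)
  then show ?case by (rule dfl_cons)
qed

lemma dfl_enc_nat:
  assumes "dfn \<kappa> (\<lambda>c s. n c)" shows "dfl \<kappa> (\<lambda>c. enc_nat (n c))"
proof -
  have "dfl \<kappa> (\<lambda>c. map (\<lambda>i. n c div p2 (n c + 1) i mod 2 + 1) [0..<card {v. v < n c + 1 \<and> ispow v}])"
    by (intro dfl_map dfn_card dfn_add assms dfn_cst dfp_ispow' dfn_var dfn_mod dfn_div dfn_p2')
  moreover have "map (\<lambda>i. m div p2 (m + 1) i mod 2 + 1) [0..<card {v. v < m + 1 \<and> ispow v}] = enc_nat m" for m
  proof (rule nth_equalityI)
    show l: "length (map (\<lambda>i. m div p2 (m + 1) i mod 2 + 1) [0..<card {v. v < m + 1 \<and> ispow v}]) = length (enc_nat m)"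
      by (simp only: length_map length_upt length_enc_nat minus_nat.diff_0)
    fix i assume "i < length (map (\<lambda>i. m div p2 (m + 1) i mod 2 + 1) [0..<card {v. v < m + 1 \<and> ispow v}])"
    then have i: "i < length (enc_nat m)" unfolding l .
    then have "i < card {v. v < m + 1 \<and> ispow v}" by (simp only: length_enc_nat)
    then have "map (\<lambda>i. m div p2 (m + 1) i mod 2 + 1) [0..<card {v. v < m + 1 \<and> ispow v}] ! i = m div p2 (m + 1) i mod 2 + 1"
      by (simp del: Suc_eq_plus1 One_nat_def add_Suc_right)
    then show "map (\<lambda>i. m div p2 (m + 1) i mod 2 + 1) [0..<card {v. v < m + 1 \<and> ispow v}] ! i = enc_nat m ! i"
      using nth_enc_nat[OF i] by simp
  qed
  ultimately show ?thesis by simp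
qed

lemma dfl_if:
  assumes P: "dfp \<kappa> (\<lambda>c s. P c)" and x: "dfl \<kappa> x" and y: "dfl \<kappa> y"
  shows "dfl \<kappa> (\<lambda>c. if P c then x c else y c)"
  unfolding dfl_def
proof
  show "dfn \<kappa> (\<lambda>c s. length (if P c then x c else y c))"
    by (rule dfn_cong[OF dfn_if[OF P x[unfolded dfl_def, THEN conjunct1] y[unfolded dfl_def, THEN conjunct1]]]) simp
  show "dfn \<kappa> (\<lambda>c s. if s 0 < length (if P c then x c else y c) then (if P c then x c else y c) ! s 0 else 0)"
    by (rule dfn_cong[OF dfn_if[OF P x[unfolded dfl_def, THEN conjunct2] y[unfolded dfl_def, THEN conjunct2]]]) simp
qed

lemma dfn_bitsym: "dfp \<kappa> P \<Longrightarrow> dfn \<kappa> (\<lambda>c s. bitsym (P c s))"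
  unfolding bitsym_def by (intro dfn_if dfn_cst)

lemma dfl_out_inst:
  assumes nv: "dfn \<kappa> (\<lambda>I s. nv I)" and ad: "dfp \<kappa> (\<lambda>I s. adj I (s 0) (s 1))" and mo: "dfp \<kappa> (\<lambda>I s. s 0 \<in> modx I)"
    and el: "dfn \<kappa> (\<lambda>I s. ell_cap I)" and R: "dfp \<kappa> (\<lambda>I s. s 0 \<in> R I)" and D: "dfn \<kappa> (\<lambda>I s. D I)"
    and sub: "\<And>I. I \<in> valid \<kappa> \<Longrightarrow> modx I \<union> R I \<subseteq> {..<nv I}"
  shows "dfl \<kappa> (\<lambda>I. enc_inst (out_inst I (modx I \<union> R I) (D I)))"
proof -
  note ad' = dfn_comp2[where f = "\<lambda>I x y. of_bool (adj I x y)", OF ad]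
  note mo' = dfn_comp1[where f = "\<lambda>I x. of_bool (x \<in> modx I)", OF mo]
  note R' = dfn_comp1[where f = "\<lambda>I x. of_bool (x \<in> R I)", OF R]
  let ?W = "\<lambda>I. modx I \<union> R I"
  have cW: "dfn \<kappa> (\<lambda>I s. card (?W I))"
  proof (rule dfn_cong)
    show "dfn \<kappa> (\<lambda>I s. card {x. x < nv I \<and> (x \<in> modx I \<or> x \<in> R I)})"
      by (intro dfn_card nv dfp_disj mo' R' dfn_var)
    fix I and s :: "nat \<Rightarrow> nat" assume "I \<in> valid \<kappa>"
    then have "{x. x < nv I \<and> (x \<in> modx I \<or> x \<in> R I)} = ?W I" using sub by blast
    then show "card {x. x < nv I \<and> (x \<in> modx I \<or> x \<in> R I)} = card (?W I)" by simp
  qed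
  have cX: "dfn \<kappa> (\<lambda>I s. card (modx I))"
  proof (rule dfn_cong)
    show "dfn \<kappa> (\<lambda>I s. card {x. x < nv I \<and> x \<in> modx I})" by (intro dfn_card nv mo' dfn_var)
    fix I and s :: "nat \<Rightarrow> nat" assume "I \<in> valid \<kappa>"
    then have "{x. x < nv I \<and> x \<in> modx I} = modx I" using sub by blast
    then show "card {x. x < nv I \<and> x \<in> modx I} = card (modx I)" by simp
  qed
  have "dfn \<kappa> (\<lambda>I s. unrank (nv I) (?W I) (s 0))"
    unfolding unrank_def rank_def Un_iff
    by (intro dfn_sum nv dfn_if dfp_conj dfp_disj mo' R' dfn_var dfp_eq dfn_card dfn_cst)
  note unrank' = dfn_comp1[where f = "\<lambda>I i. unrank (nv I) (?W I) i", OF this]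
  let ?J = "\<lambda>I. sub_inst I (?W I) (D I)"
  have n: "dfn \<kappa> (\<lambda>I s. nv (?J I))" using cW by (simp add: sub_inst_def)
  have J: "dfl \<kappa> (\<lambda>I. enc_inst (?J I))"
    unfolding enc_inst_eq adjseg_def modseg_def
  proof (intro dfl_append dfl_cons dfl_const dfl_enc_nat dfl_map dfn_mult n)
    show "dfn \<kappa> (\<lambda>I s. ell (?J I))" unfolding sub_inst_def vc_inst.simps by (intro dfn_min dfn_sub el D cW)
    show "dfn \<kappa> (\<lambda>I s. kpar (?J I))" using cX by (simp add: sub_inst_def)
    have "dfn \<kappa> (\<lambda>I s. bitsym (s 0 div card (?W I) < card (?W I) \<and> s 0 mod card (?W I) < card (?W I) \<and>
        adj I (unrank (nv I) (?W I) (s 0 div card (?W I))) (unrank (nv I) (?W I) (s 0 mod card (?W I)))))"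
      by (intro dfn_bitsym dfp_conj dfp_less dfn_div dfn_mod dfn_var cW ad' unrank')
    then show "dfn \<kappa> (\<lambda>I s. bitsym (adj (?J I) (s 0 div nv (?J I)) (s 0 mod nv (?J I))))" by (simp add: sub_inst_def)
    have "dfn \<kappa> (\<lambda>I s. bitsym (s 0 < card (?W I) \<and> unrank (nv I) (?W I) (s 0) \<in> modx I))"
      by (intro dfn_bitsym dfp_conj dfp_less dfn_var cW mo' unrank')
    then show "dfn \<kappa> (\<lambda>I s. bitsym (s 0 \<in> modx (?J I)))" by (simp add: sub_inst_def)
  qed
  have "dfl \<kappa> (\<lambda>I. if ell_cap I < D I then enc_inst no_inst else enc_inst (?J I))"
    by (intro dfl_if dfp_less el D dfl_const J)
  moreover have "(if ell_cap I < D I then enc_inst no_inst else enc_inst (?J I)) = enc_inst (out_inst I (?W I) (D I))" for I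
    by (simp add: out_inst_def)
  ultimately show ?thesis by simp
qed

lemma length_enc_le: "length (enc_inst I) \<le> nv I + ell I + kpar I + nv I * nv I + nv I + 5"
  unfolding enc_inst_eq using length_enc_nat_le[of "nv I"] length_enc_nat_le[of "ell I"] length_enc_nat_le[of "kpar I"]
  by (simp add: adjseg_def modseg_def)

text \<open>After reindexing, the exponents sum to 2^(d-1) - 1 and the leading k adds one more; k
  and k + d are both at most (d + 1)(K + 1).\<close>

lemma level_bound_le:
  assumes "1 \<le> d" "k \<le> K"
  shows "level_bound d d k \<le> 2 ^ d * (d + 1) ^ (2 ^ (d - 1)) * (K + 1) ^ (2 ^ (d - 1))"
proof -
  let ?e = "\<Sum>j<d. block_size (d - j) - 1"
  have "(\<Sum>j<d. block_size (d - j) - 1) = (\<Sum>j<d. block_size (Suc (d - Suc j)) - 1)"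
    by (intro sum.cong) (auto simp: Suc_diff_Suc)
  also have "\<dots> = (\<Sum>j<d. block_size (Suc j) - 1)" by (rule sum.nat_diff_reindex)
  finally have e: "?e + 1 = 2 ^ (d - 1)" using block_size_sum[of d] by simp
  have kd: "k + d \<le> (d + 1) * (K + 1)" using assms(2) by (simp add: algebra_simps)
  have "k \<le> (d + 1) * (K + 1)" using kd by simp
  moreover have "(k + d) ^ ?e \<le> ((d + 1) * (K + 1)) ^ ?e" by (rule power_mono[OF kd]) simp
  ultimately have "k * (k + d) ^ ?e \<le> ((d + 1) * (K + 1)) * ((d + 1) * (K + 1)) ^ ?e" by (rule mult_le_mono)
  also have "\<dots> = ((d + 1) * (K + 1)) ^ (2 ^ (d - 1))" unfolding e[symmetric] by simp
  finally have "2 ^ d * (k * (k + d) ^ ?e) \<le> 2 ^ d * ((d + 1) * (K + 1)) ^ (2 ^ (d - 1))" by (rule mult_le_mono2)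
  then show ?thesis by (simp only: level_bound_def power_mult_distrib mult.left_commute[of k] mult.assoc)
qed

theorem theorem3:
  fixes d :: nat
  assumes "1 \<le> d"
  shows "\<exists>(M::tm) (c::nat). wf_tm M \<and>
    (\<forall>I. valid_inst d I \<longrightarrow>
       (\<exists>t I'. t \<le> c * length (enc_inst I) ^ c + c \<and>
              halted (run M t (enc_inst I)) \<and>
              tape_output (run M t (enc_inst I)) = enc_inst I' \<and>
              valid_inst d I' \<and>
              nv I' \<le> c * (kpar I + 1) ^ (2 ^ (d - 1)) \<and>
              length (enc_inst I') \<le> c * (kpar I + 1) ^ c \<and>
              kpar I' \<le> c * (kpar I + 1) ^ c \<and>
              (yes_inst I \<longleftrightarrow> yes_inst I')))"
proof -
  let ?V = "{I. valid_inst d I}"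
  obtain \<Gamma> len a R D where st: "stage enc_inst (\<Gamma>, len, a, ?V)"
    and ext: "\<And>f. dfn (ctx0 d) f \<Longrightarrow> dfn (\<Gamma>, len, a, ?V) f"
    and dR: "dfp (\<Gamma>, len, a, ?V) (\<lambda>I s. s 0 \<in> R I)" and dD: "dfn (\<Gamma>, len, a, ?V) (\<lambda>I s. D I)"
    and inv: "\<And>I. valid_inst d I \<Longrightarrow> level_inv d d I (R I) (D I)"
    using levels[OF assms order_refl] by blast
  have RU: "R I \<subseteq> forest_part I" if v: "valid_inst d I" for I
  proof -
    interpret F: forest "nv I" d "adj I" "modx I" "forest_part I" "forest_le d I" by (rule forest_valid[OF v])
    show ?thesis using inv[OF v] unfolding level_inv_def F.down_def by blast
  qed
  have sub: "modx I \<union> R I \<subseteq> {..<nv I}" if v: "valid_inst d I" for I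
    using RU[OF v] v unfolding forest_part_def valid_inst_def by blast
  define J where "J I = out_inst I (modx I \<union> R I) (D I)" for I
  have "dfl (\<Gamma>, len, a, ?V) (\<lambda>I. enc_inst (J I))"
    unfolding J_def using sub
    by (intro dfl_out_inst ext dfn_nv dfp_adj dfp_modx dfn_ell_cap dR dD) (simp add: valid_def)
  from stage_output[OF st this] obtain M C where M: "wf_tm M" "poly_bounded C"
    "\<And>I. valid_inst d I \<Longrightarrow> \<exists>t\<le>C (length (enc_inst I)). halted (run M t (enc_inst I)) \<and> tape_output (run M t (enc_inst I)) = enc_inst (J I)"
    using enc_sym by (fastforce simp: valid_def)
  obtain e where e: "\<And>n. C n \<le> (n + 2) ^ e" using M(2) unfolding poly_bounded_def by blast
  let ?q = "2 ^ (d - 1) :: nat"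
  \<comment> \<open>The summand 2 covers the two vertices of the fixed no-instance.\<close>
  define c1 where "c1 = 2 ^ d * (d + 1) ^ ?q + (2::nat)"
  \<comment> \<open>One number dominates all factors and exponents: \<open>3 ^ e\<close> and
    \<open>e\<close> for the running time, the other summands for the encoding length, which is at
    most quadratic in the number of vertices up to lower terms.\<close>
  define c where "c = 3 ^ e + e + (c1 * c1 + 3 * c1 + 6) + (2 * ?q + 1)"
  show ?thesis
  proof (rule exI[of _ M], rule exI[of _ c], intro conjI M(1) allI impI)
    fix I assume v: "valid_inst d I"
    let ?n = "length (enc_inst I)" and ?K = "kpar I + 1" and ?J = "J I"
    interpret F: forest "nv I" d "adj I" "modx I" "forest_part I" "forest_le d I" by (rule forest_valid[OF v])
    obtain t where t: "t \<le> C ?n" "halted (run M t (enc_inst I))" "tape_output (run M t (enc_inst I)) = enc_inst ?J"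
      using M(3)[OF v] by blast
    have n1: "1 \<le> ?n" unfolding enc_inst_eq by simp
    have "t \<le> (?n + 2) ^ e" using t(1) e le_trans by blast
    also have "\<dots> \<le> (3 * ?n) ^ e" using n1 by (intro power_mono) auto
    also have "\<dots> = 3 ^ e * ?n ^ e" by (rule power_mult_distrib)
    also have "\<dots> \<le> c * ?n ^ c" using n1 by (intro mult_le_mono power_increasing) (auto simp: c_def)
    finally have tb: "t \<le> c * ?n ^ c + c" by simp
    have val: "valid_inst d ?J"
      unfolding J_def out_inst_def using no_inst_valid(1)[OF assms] sub_inst_valid[OF v RU[OF v]] by simp
    have yes: "yes_inst I \<longleftrightarrow> yes_inst ?J"
      unfolding J_def using out_inst_yes[OF v assms RU[OF v]] inv[OF v] unfolding level_inv_def by blast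
    have kX: "card (modx I) \<le> kpar I" using v by (simp add: valid_inst_def)
    have "card (modx I \<union> R I) \<le> card (modx I) + card (R I)" by (rule card_Un_le)
    also have "\<dots> \<le> level_bound d d (card (modx I))"
      using inv[OF v] F.low_d[OF RU[OF v]] unfolding level_inv_def by simp
    also have "\<dots> \<le> 2 ^ d * (d + 1) ^ ?q * ?K ^ ?q" by (rule level_bound_le[OF assms kX])
    finally have W: "card (modx I \<union> R I) \<le> 2 ^ d * (d + 1) ^ ?q * ?K ^ ?q" .
    have K1: "1 \<le> ?K ^ ?q" by simp
    have nJ: "nv ?J \<le> c1 * ?K ^ ?q"
    proof (cases "ell_cap I < D I")
      case True
      then have "nv ?J = 2" by (simp add: J_def out_inst_def no_inst_def)
      also have "\<dots> \<le> c1 * ?K ^ ?q" using K1 unfolding c1_def by (metis le_add2 mult_le_mono nat_mult_1_right)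
      finally show ?thesis .
    next
      case False
      then have "nv ?J = card (modx I \<union> R I)" by (simp add: J_def out_inst_def sub_inst_def)
      then show ?thesis using W unfolding c1_def by (simp add: algebra_simps)
    qed
    have eJ: "ell ?J \<le> nv ?J" by (simp add: J_def out_inst_def no_inst_def sub_inst_def)
    have kJ: "kpar ?J \<le> ?K" using kX by (auto simp: J_def out_inst_def no_inst_def sub_inst_def)
    have c1c: "c1 \<le> c" unfolding c_def by simp
    have "length (enc_inst ?J) \<le> nv ?J + ell ?J + kpar ?J + nv ?J * nv ?J + nv ?J + 5" by (rule length_enc_le)
    also have "\<dots> \<le> (c1 * ?K ^ ?q) * (c1 * ?K ^ ?q) + 3 * (c1 * ?K ^ ?q) + ?K + 5"
      using mult_le_mono[OF nJ nJ] nJ eJ kJ by linarith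
    also have "\<dots> \<le> (c1 * c1 + 3 * c1 + 6) * ?K ^ (2 * ?q + 1)"
    proof -
      have p: "?K ^ ?q * ?K ^ ?q \<le> ?K ^ (2 * ?q + 1)" "?K ^ ?q \<le> ?K ^ (2 * ?q + 1)" "?K \<le> ?K ^ (2 * ?q + 1)" "1 \<le> ?K ^ (2 * ?q + 1)"
      proof -
        have "?K ^ ?q * ?K ^ ?q = ?K ^ (2 * ?q)" by (simp add: power_add[symmetric] mult_2)
        also have "\<dots> \<le> ?K ^ (2 * ?q + 1)" by (rule power_increasing) auto
        finally show "?K ^ ?q * ?K ^ ?q \<le> ?K ^ (2 * ?q + 1)" .
        show "?K ^ ?q \<le> ?K ^ (2 * ?q + 1)" by (rule power_increasing) auto
        show "?K \<le> ?K ^ (2 * ?q + 1)" using power_increasing[of 1 "2 * ?q + 1" ?K] by simp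
        show "1 \<le> ?K ^ (2 * ?q + 1)" by (rule one_le_power) simp
      qed
      have "(c1 * ?K ^ ?q) * (c1 * ?K ^ ?q) = (c1 * c1) * (?K ^ ?q * ?K ^ ?q)" by (simp add: algebra_simps)
      also have "\<dots> \<le> (c1 * c1) * ?K ^ (2 * ?q + 1)" by (rule mult_le_mono2[OF p(1)])
      finally have a: "(c1 * ?K ^ ?q) * (c1 * ?K ^ ?q) \<le> (c1 * c1) * ?K ^ (2 * ?q + 1)" .
      have b: "3 * (c1 * ?K ^ ?q) \<le> 3 * c1 * ?K ^ (2 * ?q + 1)" using mult_le_mono2[OF p(2), of "3 * c1"] by (simp add: mult.assoc)
      have "(c1 * c1 + 3 * c1 + 6) * ?K ^ (2 * ?q + 1) = (c1 * c1) * ?K ^ (2 * ?q + 1) + 3 * c1 * ?K ^ (2 * ?q + 1) + 6 * ?K ^ (2 * ?q + 1)"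
        by (simp only: add_mult_distrib)
      then show ?thesis using a b p(3,4) by linarith
    qed
    also have "\<dots> \<le> c * ?K ^ c" by (intro mult_le_mono power_increasing) (auto simp: c_def)
    finally have lJ: "length (enc_inst ?J) \<le> c * ?K ^ c" .
    have "?K \<le> c * ?K ^ c"
    proof -
      have c: "1 \<le> c" by (simp add: c_def)
      then have "?K ^ 1 \<le> ?K ^ c" by (intro power_increasing) auto
      then show ?thesis using mult_le_mono[OF c, of "?K ^ 1" "?K ^ c"] by simp
    qed
    then have kJc: "kpar ?J \<le> c * ?K ^ c" using kJ by linarith
    have nJc: "nv ?J \<le> c * ?K ^ ?q" using nJ mult_le_mono1[OF c1c, of "?K ^ ?q"] by linarith
    show "\<exists>t I'. t \<le> c * length (enc_inst I) ^ c + c \<and> halted (run M t (enc_inst I)) \<and>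
        tape_output (run M t (enc_inst I)) = enc_inst I' \<and> valid_inst d I' \<and>
        nv I' \<le> c * (kpar I + 1) ^ (2 ^ (d - 1)) \<and> length (enc_inst I') \<le> c * (kpar I + 1) ^ c \<and>
        kpar I' \<le> c * (kpar I + 1) ^ c \<and> (yes_inst I \<longleftrightarrow> yes_inst I')"
      using t tb val yes nJc lJ kJc by blast
  qed
qed

end
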